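(* Let $N\ge 1$ and $q_c:=\frac{N+2}{N+1}$. For a non-positive function $u_0\in L^1(\mathbb{R}^N)\cap W^{1,\infty}(\mathbb{R}^N)$ with $u_0\not\equiv 0$ and $q>1$, let $u$ be the solution of $u_t-\Delta u+|\nabla u|^q=0$ in $\mathbb{R}^N\times(0,\infty)$, $u(\cdot,0)=u_0$, and put $$I_\infty:=\inf_{t\ge0}\int_{\mathbb{R}^N}u(x,t)\,dx=-\sup_{t\ge0}\|u(t)\|_1\in[-\infty,-\|u_0\|_1].$$ a) Assume that $q\ge2$. Then $I_\infty>-\infty$ and $|\nabla u|\in L^q(\mathbb{R}^N\times(0,\infty))$. In addition, $$I_\infty=\lim_{t\to\infty}\int_{\mathbb{R}^N}u(x,t)\,dx=\int_{\mathbb{R}^N}u_0(x)\,dx-\int_0^\infty\int_{\mathbb{R}^N}|\nabla u(x,s)|^q\,dx\,ds,$$ and for every $p\in[1,\infty]$, $$\lim_{t\to\infty}t^{(N/2)(1-1/p)}\,\|u(t)-I_\infty G(t)\|_p=0\quad\text{and}\quad\lim_{t\to\infty}t^{(N/2)(1-1/p)+1/2}\,\|\nabla u(t)-I_\infty\nabla G(t)\|_p=0,$$ where $G(x,t)=(4\pi t)^{-N/2}\exp(-|x|^2/(4t))$. b) Assume that $q\in(q_c,2)$. There exists $\varepsilon=\varepsilon(N,q)>0$ such that, if $$\|u_0\|_1\,\|\nabla u_0\|_\infty^{(N+1)q-(N+2)}<\varepsilon,$$ then all the conclusions of part a) are still valid.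
   Context: For $q>1$ and every $u_0\in W^{1,\infty}(\mathbb{R}^N)$, the Cauchy problem $u_t-\Delta u+|\nabla u|^q=0$, $u(\cdot,0)=u_0$, has a unique global-in-time classical solution $u\in\mathcal{C}(\mathbb{R}^N\times[0,\infty))\cap\mathcal{C}^{2,1}(\mathbb{R}^N\times(0,\infty))$; it satisfies $\|u(t)\|_\infty\le\|u_0\|_\infty$ and $\|\nabla u(t)\|_\infty\le\|\nabla u_0\|_\infty$ for all $t>0$. "The solution" means this one. If $u_0\le0$ then $u\le0$. For non-positive integrable $u_0$, $t\mapsto\|u(t)\|_1$ is non-decreasing. $\|\cdot\|_p$ is the $L^p(\mathbb{R}^N)$-norm, $u(t)=u(\cdot,t)$, and $1/p=0$ if $p=\infty$. *)

theory Defs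
  imports "HOL-Analysis.Analysis" "HOL-Probability.Essential_Supremum"
begin

section \<open>Lebesgue spaces\<close>

text \<open>The norm takes values in the extended non-negative reals, so that it equals the top element
  for functions that are not in the Lebesgue space.\<close>

definition Lp_norm :: "ennreal \<Rightarrow> 'a measure \<Rightarrow> ('a \<Rightarrow> 'b::real_normed_vector) \<Rightarrow> ennreal" where
  "Lp_norm p M f =
    (if p = \<infinity> then esssup M (\<lambda>x. ennreal (norm (f x)))
     else (let J = (\<integral>\<^sup>+ x. ennreal (norm (f x) powr enn2real p) \<partial>M)
           in if J = \<infinity> then \<infinity> else ennreal (enn2real J powr (1 / enn2real p))))"

definition in_Lp :: "ennreal \<Rightarrow> 'a measure \<Rightarrow> ('a \<Rightarrow> 'b::real_normed_vector) \<Rightarrow> bool" where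
  "in_Lp p M f \<longleftrightarrow> f \<in> borel_measurable M \<and> Lp_norm p M f < \<infinity>"

text \<open>The reciprocal \<open>1/p\<close> of an exponent, with \<open>1/\<infinity> = 0\<close>.\<close>

definition inv_exponent :: "ennreal \<Rightarrow> real" where
  "inv_exponent p = enn2real (inverse p)"


section \<open>Classical and weak derivatives\<close>

definition partially_differentiable :: "'n::finite \<Rightarrow> (real^'n \<Rightarrow> real) \<Rightarrow> real^'n \<Rightarrow> bool" where
  "partially_differentiable i f x \<longleftrightarrow> (\<lambda>h. f (x + h *\<^sub>R axis i 1)) differentiable (at 0)"

definition partial_deriv :: "'n::finite \<Rightarrow> (real^'n \<Rightarrow> real) \<Rightarrow> real^'n \<Rightarrow> real" where
  "partial_deriv i f x = deriv (\<lambda>h. f (x + h *\<^sub>R axis i 1)) 0"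

definition grad :: "(real^'n::finite \<Rightarrow> real) \<Rightarrow> real^'n \<Rightarrow> real^'n" where
  "grad f x = (\<chi> i. partial_deriv i f x)"

definition laplacian :: "(real^'n::finite \<Rightarrow> real) \<Rightarrow> real^'n \<Rightarrow> real" where
  "laplacian f x = (\<Sum>i\<in>UNIV. partial_deriv i (partial_deriv i f) x)"

text \<open>Infinitely differentiable functions: all iterated partial derivatives exist and are
  continuous.\<close>

definition smooth_function :: "(real^'n::finite \<Rightarrow> real) \<Rightarrow> bool" where
  "smooth_function f \<longleftrightarrow>
    (\<forall>is. continuous_on UNIV (foldr partial_deriv is f) \<and>
          (\<forall>i x. partially_differentiable i (foldr partial_deriv is f) x))"

definition test_function :: "(real^'n::finite \<Rightarrow> real) \<Rightarrow> bool" where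
  "test_function \<phi> \<longleftrightarrow> smooth_function \<phi> \<and> compact (closure {x. \<phi> x \<noteq> 0})"

definition locally_integrable :: "(real^'n::finite \<Rightarrow> 'b::{banach, second_countable_topology}) \<Rightarrow> bool" where
  "locally_integrable f \<longleftrightarrow> (\<forall>K. compact K \<longrightarrow> set_integrable lebesgue K f)"

definition is_weak_grad :: "(real^'n::finite \<Rightarrow> real) \<Rightarrow> (real^'n \<Rightarrow> real^'n) \<Rightarrow> bool" where
  "is_weak_grad f g \<longleftrightarrow> locally_integrable f \<and> locally_integrable g \<and>
    (\<forall>i \<phi>. test_function \<phi> \<longrightarrow>
      (LINT x|lebesgue. f x * partial_deriv i \<phi> x) = - (LINT x|lebesgue. g x $ i * \<phi> x))"

text \<open>Weak gradients are unique up to null sets; \<open>weak_grad f\<close> is a representative.\<close>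

definition weak_grad :: "(real^'n::finite \<Rightarrow> real) \<Rightarrow> real^'n \<Rightarrow> real^'n" where
  "weak_grad f = (SOME g. is_weak_grad f g)"

definition in_W1_infty :: "(real^'n::finite \<Rightarrow> real) \<Rightarrow> bool" where
  "in_W1_infty f \<longleftrightarrow> in_Lp \<infinity> lebesgue f \<and> (\<exists>g. is_weak_grad f g \<and> in_Lp \<infinity> lebesgue g)"


section \<open>The Cauchy problem\<close>

text \<open>The class $C^{2,1}$ on the open upper half space; \<open>u x t\<close> has space variable \<open>x\<close> and time
  variable \<open>t\<close>.\<close>

definition C21 :: "(real^'n::finite \<Rightarrow> real \<Rightarrow> real) \<Rightarrow> bool" where
  "C21 u \<longleftrightarrow>
    continuous_on (UNIV \<times> {0<..}) (\<lambda>(x, t). u x t) \<and>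
    (\<forall>x. \<forall>t>0. u x differentiable (at t)) \<and>
    continuous_on (UNIV \<times> {0<..}) (\<lambda>(x, t). deriv (u x) t) \<and>
    (\<forall>i x. \<forall>t>0. partially_differentiable i (\<lambda>y. u y t) x) \<and>
    (\<forall>i. continuous_on (UNIV \<times> {0<..}) (\<lambda>(x, t). partial_deriv i (\<lambda>y. u y t) x)) \<and>
    (\<forall>i j x. \<forall>t>0. partially_differentiable j (partial_deriv i (\<lambda>y. u y t)) x) \<and>
    (\<forall>i j. continuous_on (UNIV \<times> {0<..})
             (\<lambda>(x, t). partial_deriv j (partial_deriv i (\<lambda>y. u y t)) x))"

text \<open>The global classical solution with initial datum \<open>u0\<close>. The datum is an element of
  $W^{1,\infty}$, i.e.\ a class of functions modulo null sets, hence the initial condition holds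
  almost everywhere (everywhere for the continuous representative). The two maximum-principle
  bounds hold for the solution and single it out without appeal to a uniqueness theorem for
  classical solutions of unrestricted growth.\<close>

definition HJ_solution ::
    "real \<Rightarrow> (real^'n::finite \<Rightarrow> real) \<Rightarrow> (real^'n \<Rightarrow> real \<Rightarrow> real) \<Rightarrow> bool" where
  "HJ_solution q u0 u \<longleftrightarrow>
    continuous_on (UNIV \<times> {0..}) (\<lambda>(x, t). u x t) \<and>
    C21 u \<and>
    (\<forall>x. \<forall>t>0. deriv (u x) t - laplacian (\<lambda>y. u y t) x
                 + norm (grad (\<lambda>y. u y t) x) powr q = 0) \<and>
    (AE x in lebesgue. u x 0 = u0 x) \<and>
    (\<forall>t>0. Lp_norm \<infinity> lebesgue (\<lambda>x. u x t) \<le> Lp_norm \<infinity> lebesgue u0) \<and>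
    (\<forall>t>0. Lp_norm \<infinity> lebesgue (grad (\<lambda>x. u x t)) \<le> Lp_norm \<infinity> lebesgue (weak_grad u0))"

definition admissible_datum :: "(real^'n::finite \<Rightarrow> real) \<Rightarrow> bool" where
  "admissible_datum u0 \<longleftrightarrow>
    in_Lp 1 lebesgue u0 \<and> in_W1_infty u0 \<and>
    (AE x in lebesgue. u0 x \<le> 0) \<and> \<not> (AE x in lebesgue. u0 x = 0)"


section \<open>Mass and large time behaviour\<close>

text \<open>The integral as an extended real number. For functions of constant sign it is always
  meaningful, whereas the Bochner integral of a non-integrable function is 0 by convention.\<close>

definition ext_integral :: "'a measure \<Rightarrow> ('a \<Rightarrow> real) \<Rightarrow> ereal" where
  "ext_integral M f =
    enn2ereal (\<integral>\<^sup>+ x. ennreal (f x) \<partial>M) - enn2ereal (\<integral>\<^sup>+ x. ennreal (- f x) \<partial>M)"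

definition I_infty :: "(real^'n::finite \<Rightarrow> real \<Rightarrow> real) \<Rightarrow> ereal" where
  "I_infty u = (INF t\<in>{0..}. ext_integral lebesgue (\<lambda>x. u x t))"

definition heat_kernel :: "real^'n::finite \<Rightarrow> real \<Rightarrow> real" where
  "heat_kernel x t =
    (4 * pi * t) powr (- (real CARD('n) / 2)) * exp (- ((norm x)\<^sup>2 / (4 * t)))"

definition q_crit :: "nat \<Rightarrow> real" where
  "q_crit N = (real N + 2) / (real N + 1)"

definition diffusive_large_time_behaviour ::
    "real \<Rightarrow> (real^'n::finite \<Rightarrow> real) \<Rightarrow> (real^'n \<Rightarrow> real \<Rightarrow> real) \<Rightarrow> bool" where
  "diffusive_large_time_behaviour q u0 u \<longleftrightarrow>
    I_infty u > -\<infinity> \<and>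
    in_Lp (ennreal q) (lebesgue_on (UNIV \<times> {0<..})) (\<lambda>(x, t). norm (grad (\<lambda>y. u y t) x)) \<and>
    ((\<lambda>t. ext_integral lebesgue (\<lambda>x. u x t)) \<longlongrightarrow> I_infty u) at_top \<and>
    I_infty u = ext_integral lebesgue u0
      - enn2ereal (\<integral>\<^sup>+ s\<in>{0<..}.
          (\<integral>\<^sup>+ x. ennreal (norm (grad (\<lambda>y. u y s) x) powr q) \<partial>lebesgue) \<partial>lebesgue) \<and>
    (\<forall>p\<ge>1.
      ((\<lambda>t. ennreal (t powr (real CARD('n) / 2 * (1 - inv_exponent p)))
            * Lp_norm p lebesgue (\<lambda>x. u x t - real_of_ereal (I_infty u) * heat_kernel x t))
        \<longlongrightarrow> 0) at_top \<and>
      ((\<lambda>t. ennreal (t powr (real CARD('n) / 2 * (1 - inv_exponent p) + 1 / 2))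
            * Lp_norm p lebesgue (\<lambda>x. grad (\<lambda>y. u y t) x
                - real_of_ereal (I_infty u) *\<^sub>R grad (\<lambda>y. heat_kernel y t) x))
        \<longlongrightarrow> 0) at_top)"

end

(*
  Let v = -u >= 0 and f = |grad u|^q, so that v(t) = G(t) * v(0) + int_0^t G(t - s) * f(s) ds and
  m(t) := ||u(t)||_1 = m(0) + int_0^t ||f||_1. Duhamel's formula is obtained by differentiating the heat
  kernel against the solution localized by a cutoff; integration by parts reduces to the vanishing of
  the integral of a compactly supported partial derivative.

  Everything rests on the decay |grad u(t)| <= A t^(-(N+1)/2), ||grad u(t)||_1 <= A t^(-1/2). With k = (N+1)/2
  the bounds give |grad u|^(q-1) <= min(K, A s^(-k))^(q-1) <= eta s^(-1/2), where
  eta^(N+1) = A K^((N+1)q-(N+2)), and for k (q - 1) > 1/2, i.e. q > q_c, the integral of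
  min(K, A s^(-k))^(q-1) s^(-1/2) over (0, oo) is at most C eta. So the gradient form of Duhamel's
  formula reproduces the decay with A = C (m(0) + A eta), which closes when
  m(0) K^((N+1)q-(N+2)) is small.

  For q >= 2 the function exp(-l u) - 1 is a nonnegative subsolution of the heat equation (Hopf-Cole), which
  bounds m and hence the space-time integral of f. Then sup |grad u(t)| tends to 0, and after a large time
  the data are small in the above sense.

  For the asymptotics, restart at a time tau: u(tau) differs from I G(tau) by a function whose
  integral is the small number m(oo) - m(tau), mean-zero data are flattened by the heat flow faster than G,
  and the source after tau has small total mass. The cases p = 1 and p = oo interpolate.
*)

theory Submission
  imports Defs "HOL-Probability.Distributions" "HOL-Computational_Algebra.Polynomial"
begin

text \<open>Two obstacles shape the estimates. The bootstrap compares constants of quantities that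
  have to be finite, yet a bounded gradient gives no integrability in space. The L^1 norms are
  therefore first taken against weights exp(-\<open>\<delta>\<close>|x - a|), with constants
  independent of \<open>\<delta>\<close> and a, and \<open>\<delta>\<close> tends to 0 at the end.
  Instead of proving these norms continuous in time, the argument propagates the decay in short time
  steps of equal length.

  Spatial L^1 norms are integrals with values in [0, oo], so that exchanging integrals costs no
  integrability proof and an estimate may precede the finiteness of its right-hand side.

  The linear theory is set up once for a bounded solution w of w_t = Laplacian w + g, with the
  derivatives of w as parameters. It is applied to u, to its time shifts, to u minus a multiple of
  the heat kernel, and to exp(-l u) - 1.

  The datum enters through the norm of \<open>weak_grad u0\<close>, a chosen representative. That
  this norm is finite rests on the uniqueness of weak gradients, proved with test functions that
  approximate indicators of boxes.\<close>

section \<open>The heat kernel\<close>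

lemma heat_kernel_nonneg [simp]: "heat_kernel x t \<ge> 0"
  by (simp add: heat_kernel_def)

lemma heat_kernel_minus [simp]: "heat_kernel (- x) t = heat_kernel x t"
  by (simp add: heat_kernel_def)

lemma heat_kernel_measurable [measurable]:
  assumes "f \<in> borel_measurable M" "g \<in> borel_measurable M"
  shows "(\<lambda>x. heat_kernel (f x) (g x)) \<in> borel_measurable M"
  using assms unfolding heat_kernel_def by measurable

lemma heat_kernel_continuous:
  assumes "continuous_on S f" "continuous_on S g" "\<And>x. x \<in> S \<Longrightarrow> g x > 0"
  shows "continuous_on S (\<lambda>x. heat_kernel (f x) (g x))"
  unfolding heat_kernel_def using assms
  by (auto intro!: continuous_intros simp: less_imp_neq[symmetric])

text \<open>Parabolic self-similarity: integrals against the kernel at time t become integrals at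
  time 1, where total mass and continuity in t are easy to read off.\<close>

lemma heat_kernel_scale:
  fixes x :: "real^'n::finite"
  assumes "t > 0"
  shows "heat_kernel (sqrt t *\<^sub>R x) t = t powr (- (real CARD('n) / 2)) * heat_kernel x 1"
  using assms by (simp add: heat_kernel_def powr_mult power_mult_distrib)

lemma heat_kernel_le:
  fixes x :: "real^'n::finite"
  assumes "t > 0"
  shows "heat_kernel x t \<le> t powr (- (real CARD('n) / 2))"
proof -
  have "(4 * pi * t) powr (- (real CARD('n) / 2)) \<le> t powr (- (real CARD('n) / 2))"
    using assms pi_gt3 by (intro powr_mono2') auto
  moreover have "exp (- ((norm x)\<^sup>2 / (4 * t))) \<le> 1"
    using assms by simp
  ultimately show ?thesis
    unfolding heat_kernel_def using mult_mono[of _ _ _ 1] by fastforce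
qed

text \<open>At time 1 the kernel is the joint density of independent centred normal variables of
  variance 2, so its total mass follows from that of \<open>normal_density\<close>, one factor per
  coordinate.\<close>

lemma heat_kernel_1_prod:
  fixes x :: "real^'n::finite"
  shows "heat_kernel x 1 = (\<Prod>b\<in>Basis. normal_density 0 (sqrt 2) (x \<bullet> b))"
proof -
  have "(\<Prod>b\<in>(Basis::(real^'n) set). normal_density 0 (sqrt 2) (x \<bullet> b))
      = (\<Prod>b\<in>(Basis::(real^'n) set). (1 / sqrt (4 * pi))) * (\<Prod>b\<in>(Basis::(real^'n) set). exp (- (x \<bullet> b)\<^sup>2 / 4))"
    by (simp add: normal_density_def prod.distrib[symmetric] del: prod_constant)
  also have "(\<Prod>b\<in>(Basis::(real^'n) set). exp (- (x \<bullet> b)\<^sup>2 / 4)) = exp (- (norm x)\<^sup>2 / 4)"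
  proof -
    have "(norm x)\<^sup>2 = (\<Sum>b\<in>Basis. (x \<bullet> b)\<^sup>2)"
      unfolding power2_norm_eq_inner euclidean_inner[of x x] by (simp add: power2_eq_square)
    then show ?thesis
      by (subst exp_sum[symmetric]) (simp_all add: sum_divide_distrib[symmetric] sum_negf)
  qed
  also have "(\<Prod>b\<in>(Basis::(real^'n) set). (1 / sqrt (4 * pi))) = (4 * pi) powr (- (real CARD('n) / 2))"
    by (simp add: powr_half_sqrt[symmetric] powr_minus powr_powr powr_realpow[symmetric] divide_simps)
  finally show ?thesis
    by (simp add: heat_kernel_def)
qed

lemma nn_integral_heat_kernel_1: "(\<integral>\<^sup>+x. heat_kernel (x::real^'n::finite) 1 \<partial>lborel) = 1"
proof -
  have "(\<integral>\<^sup>+x. normal_density 0 (sqrt 2) x \<partial>lborel) = 1"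
    using prob_space.emeasure_space_1[OF prob_space_normal_density[of "sqrt 2" 0]]
    by (simp add: emeasure_density)
  then have "(\<integral>\<^sup>+x. (\<Prod>b\<in>Basis. ennreal (normal_density 0 (sqrt 2) ((x::real^'n) \<bullet> b))) \<partial>lborel) = 1"
    by (subst nn_integral_lborel_prod) auto
  then show ?thesis
    by (simp add: heat_kernel_1_prod prod_ennreal)
qed

lemma nn_integral_scale_lborel:
  fixes f :: "'a::euclidean_space \<Rightarrow> ennreal"
  assumes [measurable]: "f \<in> borel_measurable borel" and "c \<noteq> 0"
  shows "(\<integral>\<^sup>+x. f x \<partial>lborel) = ennreal (\<bar>c\<bar> ^ DIM('a)) * (\<integral>\<^sup>+x. f (a + c *\<^sub>R x) \<partial>lborel)"
  by (subst lborel_affine[OF assms(2), of a])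
    (simp add: nn_integral_density nn_integral_distr nn_integral_cmult)

lemma nn_integral_translate_lborel:
  fixes f :: "'a::euclidean_space \<Rightarrow> ennreal"
  assumes "f \<in> borel_measurable borel"
  shows "(\<integral>\<^sup>+x. f (a + x) \<partial>lborel) = (\<integral>\<^sup>+x. f x \<partial>lborel)"
    and "(\<integral>\<^sup>+x. f (a - x) \<partial>lborel) = (\<integral>\<^sup>+x. f x \<partial>lborel)"
    and "(\<integral>\<^sup>+x. f (x - a) \<partial>lborel) = (\<integral>\<^sup>+x. f x \<partial>lborel)"
  using nn_integral_scale_lborel[OF assms, of 1 a] nn_integral_scale_lborel[OF assms, of "-1" a]
    nn_integral_scale_lborel[OF assms, of 1 "-a"] by auto

lemma integral_translate_lborel:
  fixes f :: "'a::euclidean_space \<Rightarrow> real"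
  assumes [measurable]: "f \<in> borel_measurable borel"
  shows "(LINT x|lborel. f (a + x)) = (LINT x|lborel. f x)"
    and "(LINT x|lborel. f (a - x)) = (LINT x|lborel. f x)"
proof -
  show 1: "(LINT x|lborel. f (a + x)) = (LINT x|lborel. f x)"
    by (subst lborel_distr_plus[of a, symmetric], subst integral_distr) auto
  have "(LINT x|lborel. f (a - x)) = (LINT x|lborel. f (a + (-1) *\<^sub>R x)) "
    by simp
  also have "\<dots> = (LINT x|(density (distr lborel borel (\<lambda>x. a + (-1::real) *\<^sub>R x)) (\<lambda>_. \<bar>-1::real\<bar> ^ DIM('a))). f x)"
    by (subst integral_density, simp_all, subst integral_distr) auto
  also have "\<dots> = (LINT x|lborel. f x)"
    by (subst lborel_affine[of "-1" a, symmetric]) auto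
  finally show "(LINT x|lborel. f (a - x)) = (LINT x|lborel. f x)" .
qed


text \<open>Existence and value in one relation, so that the one-variable derivative rules transfer
  directly; \<open>partial_deriv\<close> rests on \<open>deriv\<close>, which has a value even where
  no derivative exists.\<close>

definition has_partial :: "'n::finite \<Rightarrow> (real^'n \<Rightarrow> real) \<Rightarrow> real \<Rightarrow> real^'n \<Rightarrow> bool" where
  "has_partial i f D x \<longleftrightarrow> ((\<lambda>h. f (x + h *\<^sub>R axis i 1)) has_real_derivative D) (at 0)"

lemma has_partial_partial_deriv: "has_partial i f D x \<Longrightarrow> partial_deriv i f x = D"
  by (simp add: has_partial_def partial_deriv_def DERIV_imp_deriv)

lemma has_partial_partially_differentiable: "has_partial i f D x \<Longrightarrow> partially_differentiable i f x"
  unfolding has_partial_def partially_differentiable_def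
  by (auto simp: real_differentiable_def)

lemma partially_differentiable_has_partial:
  "partially_differentiable i f x \<Longrightarrow> has_partial i f (partial_deriv i f x) x"
  unfolding has_partial_def partially_differentiable_def partial_deriv_def
  by (simp add: DERIV_deriv_iff_real_differentiable)

text \<open>The defining derivative is taken at 0 for every base point; translating along the axis
  gives the derivative at an arbitrary h, the form used by the mean value theorem.\<close>

lemma has_partial_line:
  assumes "has_partial i f D (x + h *\<^sub>R axis i 1)"
  shows "((\<lambda>h. f (x + h *\<^sub>R axis i 1)) has_real_derivative D) (at h)"
proof -
  have "((\<lambda>k. f ((x + h *\<^sub>R axis i 1) + k *\<^sub>R axis i 1)) has_real_derivative D) (at (h + (- h)))"
    using assms by (simp add: has_partial_def)
  then have "((\<lambda>k. f ((x + h *\<^sub>R axis i 1) + (k - h) *\<^sub>R axis i 1)) has_real_derivative D) (at h)"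
    by (subst (asm) DERIV_shift) simp
  then show ?thesis
    by (simp add: algebra_simps)
qed

lemma has_partial_const [intro]: "has_partial i (\<lambda>x. c) 0 x"
  by (simp add: has_partial_def)

lemma has_partial_add [intro]:
  "has_partial i f D x \<Longrightarrow> has_partial i g E x \<Longrightarrow> has_partial i (\<lambda>x. f x + g x) (D + E) x"
  unfolding has_partial_def by (rule DERIV_add)

lemma has_partial_diff [intro]:
  "has_partial i f D x \<Longrightarrow> has_partial i g E x \<Longrightarrow> has_partial i (\<lambda>x. f x - g x) (D - E) x"
  unfolding has_partial_def by (rule DERIV_diff)

lemma has_partial_cmult [intro]: "has_partial i f D x \<Longrightarrow> has_partial i (\<lambda>x. c * f x) (c * D) x"
  unfolding has_partial_def by (rule DERIV_cmult)

lemma has_partial_mult [intro]: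
  "has_partial i f D x \<Longrightarrow> has_partial i g E x \<Longrightarrow>
    has_partial i (\<lambda>x. f x * g x) (D * g x + E * f x) x"
  unfolding has_partial_def using DERIV_mult by fastforce

lemma has_partial_compose:
  "has_partial i f D x \<Longrightarrow> (\<phi> has_real_derivative E) (at (f x)) \<Longrightarrow>
    has_partial i (\<lambda>x. \<phi> (f x)) (E * D) x"
  unfolding has_partial_def by (rule DERIV_chain2) simp_all

lemma has_partial_translate:
  "has_partial i f D (a + x) \<Longrightarrow> has_partial i (\<lambda>x. f (a + x)) D x"
  unfolding has_partial_def by (simp add: add.assoc)

lemma has_partial_component: "has_partial i (\<lambda>x. x $ j) (if i = j then 1 else 0) x"
  unfolding has_partial_def
  by (auto simp: axis_def intro!: derivative_eq_intros)

lemma power2_norm_line: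
  fixes x :: "real^'n::finite"
  shows "(norm (x + h *\<^sub>R axis i 1))\<^sup>2 = (norm x)\<^sup>2 + 2 * h * x $ i + h\<^sup>2"
  unfolding power2_norm_eq_inner
  by (simp add: inner_add_left inner_add_right inner_commute[of "axis i 1"] cart_eq_inner_axis[symmetric]
      algebra_simps power2_eq_square inner_axis_axis)

lemma has_partial_norm_sq: "has_partial i (\<lambda>x. (norm x)\<^sup>2) (2 * x $ i) x"
  unfolding has_partial_def power2_norm_line
  by (auto intro!: derivative_eq_intros)

section \<open>Derivatives of the heat kernel and Gaussian bounds\<close>

definition heat_kernel_d :: "'n::finite \<Rightarrow> real^'n \<Rightarrow> real \<Rightarrow> real" where
  "heat_kernel_d i x t = - (x $ i) / (2 * t) * heat_kernel x t"

definition heat_kernel_dd :: "'n::finite \<Rightarrow> real^'n \<Rightarrow> real \<Rightarrow> real" where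
  "heat_kernel_dd i x t = ((x $ i)\<^sup>2 / (4 * t\<^sup>2) - 1 / (2 * t)) * heat_kernel x t"

definition heat_kernel_t :: "real^'n::finite \<Rightarrow> real \<Rightarrow> real" where
  "heat_kernel_t x t = ((norm x)\<^sup>2 / (4 * t\<^sup>2) - real CARD('n) / (2 * t)) * heat_kernel x t"

lemma has_partial_heat_kernel:
  assumes "t > 0"
  shows "has_partial i (\<lambda>x. heat_kernel x t) (heat_kernel_d i x t) x"
proof -
  have "has_partial i (\<lambda>x. (4 * pi * t) powr (- (real CARD('a) / 2)) * exp (- ((norm x)\<^sup>2 / (4 * t))))
     ((4 * pi * t) powr (- (real CARD('a) / 2)) * (exp (- ((norm x)\<^sup>2 / (4 * t))) * (- 1 / (4 * t)) * (2 * x $ i))) x"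
    by (intro has_partial_cmult has_partial_compose[OF has_partial_norm_sq])
      (use assms in \<open>auto intro!: derivative_eq_intros\<close>)
  then show ?thesis
    by (simp add: heat_kernel_def heat_kernel_d_def mult_ac divide_simps)
qed

lemma has_partial_heat_kernel_d:
  assumes "t > 0"
  shows "has_partial i (\<lambda>x. heat_kernel_d i x t) (heat_kernel_dd i x t) x"
proof -
  have "has_partial i (\<lambda>x. (- 1 / (2 * t)) * (x $ i * heat_kernel x t))
    ((- 1 / (2 * t)) * (1 * heat_kernel x t + heat_kernel_d i x t * x $ i)) x"
    using has_partial_component[of i i] has_partial_heat_kernel[OF assms]
    by (intro has_partial_cmult has_partial_mult) auto
  then show ?thesis using assms
    by (simp add: heat_kernel_d_def heat_kernel_dd_def algebra_simps power2_eq_square)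
qed

lemma heat_kernel_deriv_time:
  assumes "t > 0"
  shows "((\<lambda>t. heat_kernel x t) has_real_derivative heat_kernel_t x t) (at t)"
proof -
  have "((\<lambda>t. (4 * pi * t) powr (- (real CARD('a) / 2))) has_real_derivative
      (- (real CARD('a) / (2 * t)) * (4 * pi * t) powr (- (real CARD('a) / 2)))) (at t)"
    using assms powr_add[of "4 * pi * t" "- (real CARD('a) / 2) - 1" 1]
    by (auto intro!: derivative_eq_intros simp: field_simps)
  moreover have "((\<lambda>t. exp (- ((norm x)\<^sup>2 / (4 * t)))) has_real_derivative
      (norm x)\<^sup>2 / (4 * t\<^sup>2) * exp (- ((norm x)\<^sup>2 / (4 * t)))) (at t)"
    using assms by (auto intro!: derivative_eq_intros simp: divide_simps power2_eq_square)
  ultimately show ?thesis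
    unfolding heat_kernel_def heat_kernel_t_def
    by (rule DERIV_mult[THEN DERIV_cong]) (simp add: algebra_simps)
qed

lemma sum_component_sq: "(\<Sum>i\<in>UNIV. (x $ i)\<^sup>2) = (norm (x::real^'n::finite))\<^sup>2"
  by (simp add: norm_vec_def L2_set_def sum_nonneg)

lemma heat_equation_heat_kernel: "(\<Sum>i\<in>UNIV. heat_kernel_dd i x t) = heat_kernel_t x t"
  by (simp add: heat_kernel_dd_def heat_kernel_t_def sum_distrib_right[symmetric] sum_subtractf
      sum_divide_distrib[symmetric] sum_component_sq)

text \<open>A Gaussian with half the decay rate is a kernel at the doubled time. The half of the
  exponent that is given up absorbs linear factors, exponential weights and bounded shifts in the
  bounds below.\<close>

lemma heat_kernel_double:
  fixes x :: "real^'n::finite"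
  assumes "t > 0"
  shows "2 powr (real CARD('n) / 2) * heat_kernel x (2 * t) = (4 * pi * t) powr (- (real CARD('n) / 2))
    * exp (- ((norm x)\<^sup>2 / (8 * t)))"
proof -
  have "(4 * pi * (2 * t)) powr (- (real CARD('n) / 2)) = 2 powr (- (real CARD('n) / 2)) * (4 * pi * t) powr (- (real CARD('n) / 2))"
    using assms powr_mult[of 2 "4 * pi * t" "- (real CARD('n) / 2)"] by (simp add: mult_ac)
  then have "2 powr (real CARD('n) / 2) * (4 * pi * (2 * t)) powr (- (real CARD('n) / 2)) = (4 * pi * t) powr (- (real CARD('n) / 2))"
    by (simp add: powr_minus)
  then show ?thesis
    by (simp add: heat_kernel_def mult.assoc[symmetric])
qed

text \<open>Half of the Gaussian exponent pays for the factor r = |x| / sqrt t. Gradient estimates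
  thereby inherit every estimate of the heat semigroup, at the price of t^(-1/2).\<close>

lemma heat_kernel_d_bound:
  fixes x :: "real^'n::finite"
  assumes "t > 0"
  shows "\<bar>heat_kernel_d i x t\<bar> \<le> 2 powr (real CARD('n) / 2) * t powr (- (1/2)) * heat_kernel x (2 * t)"
proof -
  define r where "r = norm x / sqrt t"
  have r: "r \<ge> 0" "(norm x)\<^sup>2 = r\<^sup>2 * t" using assms by (auto simp: r_def power_divide)
  have "r / 2 \<le> 1 + r\<^sup>2 / 8"
    using zero_le_power2[of "r - 2"] by (simp add: power2_diff field_simps)
  also have "\<dots> \<le> exp (r\<^sup>2 / 8)" by (rule exp_ge_add_one_self)
  finally have "r / 2 * exp (- (r\<^sup>2 / 4)) \<le> exp (r\<^sup>2 / 8) * exp (- (r\<^sup>2 / 4))"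
    by (intro mult_right_mono) auto
  then have 1: "r / 2 * exp (- (r\<^sup>2 / 4)) \<le> exp (- (r\<^sup>2 / 8))"
    by (simp add: exp_add[symmetric])
  have "\<bar>x $ i\<bar> / (2 * t) \<le> norm x / (2 * t)"
    using assms component_le_norm_cart[of x i] by (simp add: divide_right_mono)
  also have "\<dots> = r / 2 * t powr (- (1/2))"
    using assms by (simp add: r_def powr_minus powr_half_sqrt divide_simps)
  finally have "\<bar>x $ i\<bar> / (2 * t) * exp (- ((norm x)\<^sup>2 / (4 * t))) \<le> r / 2 * t powr (- (1/2)) * exp (- (r\<^sup>2 / 4))"
    using assms r by (intro mult_mono) auto
  also have "\<dots> \<le> t powr (- (1/2)) * exp (- (r\<^sup>2 / 8))"
    using mult_left_mono[OF 1, of "t powr (- (1/2))"] by (simp add: mult_ac)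
  finally have "(4 * pi * t) powr (- (real CARD('n) / 2)) * (\<bar>x $ i\<bar> / (2 * t) * exp (- ((norm x)\<^sup>2 / (4 * t))))
     \<le> (4 * pi * t) powr (- (real CARD('n) / 2)) * (t powr (- (1/2)) * exp (- (r\<^sup>2 / 8)))"
    by (intro mult_left_mono) auto
  also have "\<dots> = t powr (- (1/2)) * (2 powr (real CARD('n) / 2) * heat_kernel x (2 * t))"
    unfolding heat_kernel_double[OF assms] using assms r by simp
  also have "(4 * pi * t) powr (- (real CARD('n) / 2)) * (\<bar>x $ i\<bar> / (2 * t) * exp (- ((norm x)\<^sup>2 / (4 * t)))) = \<bar>heat_kernel_d i x t\<bar>"
    using assms by (simp add: heat_kernel_d_def abs_mult heat_kernel_def mult_ac)
  finally show ?thesis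
    by (simp only: mult_ac)
qed

text \<open>The condition on \<open>\<delta>\<close> says \<open>\<delta>\<close> |x| <= |x| / sqrt
  t, which the Gaussian absorbs. The constant does not depend on \<open>\<delta>\<close>, and this
  is what later permits the limit \<open>\<delta>\<close> -> 0.\<close>

lemma heat_kernel_weight_bound:
  fixes x :: "real^'n::finite"
  assumes "t > 0" "\<delta> \<ge> 0" "\<delta>\<^sup>2 * t \<le> 1"
  shows "heat_kernel x t * exp (\<delta> * norm x) \<le> 2 powr (real CARD('n) / 2) * exp 2 * heat_kernel x (2 * t)"
proof -
  define r where "r = norm x / sqrt t"
  have r: "r \<ge> 0" "(norm x)\<^sup>2 = r\<^sup>2 * t" "norm x = r * sqrt t" using assms by (auto simp: r_def power_divide)
  have "(\<delta> * sqrt t)\<^sup>2 \<le> 1\<^sup>2" using assms by (simp add: power_mult_distrib)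
  then have "\<delta> * sqrt t \<le> 1" by (rule power2_le_imp_le) simp
  then have "\<delta> * norm x \<le> r" using r mult_right_mono[of "\<delta> * sqrt t" 1 r] by (simp add: mult_ac)
  also have "r \<le> 2 + r\<^sup>2 / 8"
    using zero_le_power2[of "r - 4"] by (simp add: power2_diff field_simps)
  finally have "exp (- (r\<^sup>2 / 4)) * exp (\<delta> * norm x) \<le> exp 2 * exp (- (r\<^sup>2 / 8))"
    by (simp add: exp_add[symmetric])
  then have "(4 * pi * t) powr (- (real CARD('n) / 2)) * (exp (- (r\<^sup>2 / 4)) * exp (\<delta> * norm x))
      \<le> (4 * pi * t) powr (- (real CARD('n) / 2)) * (exp 2 * exp (- (r\<^sup>2 / 8)))"
    by (intro mult_left_mono) auto
  also have "\<dots> = exp 2 * (2 powr (real CARD('n) / 2) * heat_kernel x (2 * t))"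
    unfolding heat_kernel_double[OF assms(1)] using assms r by simp
  also have "(4 * pi * t) powr (- (real CARD('n) / 2)) * (exp (- (r\<^sup>2 / 4)) * exp (\<delta> * norm x)) = heat_kernel x t * exp (\<delta> * norm x)"
    using assms(1) r(2) by (simp add: heat_kernel_def)
  finally show ?thesis
    by (simp only: mult_ac)
qed

section \<open>Conservation of mass and smoothing by the heat semigroup\<close>

lemma nn_integral_heat_kernel:
  assumes "t > 0"
  shows "(\<integral>\<^sup>+x. heat_kernel (x::real^'n::finite) t \<partial>lborel) = 1"
proof -
  have "(\<integral>\<^sup>+x. heat_kernel (x::real^'n) t \<partial>lborel)
     = ennreal (sqrt t ^ CARD('n)) * (\<integral>\<^sup>+x. heat_kernel (sqrt t *\<^sub>R x::real^'n) t \<partial>lborel)"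
    using assms by (subst nn_integral_scale_lborel[where c="sqrt t" and a=0]) auto
  also have "(\<integral>\<^sup>+x. heat_kernel (sqrt t *\<^sub>R x::real^'n) t \<partial>lborel)
      = ennreal (t powr (- (real CARD('n) / 2))) * (\<integral>\<^sup>+x. heat_kernel (x::real^'n) 1 \<partial>lborel)"
    using assms by (simp add: heat_kernel_scale ennreal_mult nn_integral_cmult)
  finally show ?thesis
    using assms by (simp add: nn_integral_heat_kernel_1 ennreal_mult[symmetric] powr_half_sqrt[symmetric]
        powr_realpow[symmetric] powr_powr powr_add[symmetric])
qed

lemma nn_integral_heat_kernel_diff [simp]:
  assumes "t > 0"
  shows "(\<integral>\<^sup>+x. heat_kernel (a - x::real^'n::finite) t \<partial>lborel) = 1"
    and "(\<integral>\<^sup>+x. heat_kernel (x - a::real^'n::finite) t \<partial>lborel) = 1"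
  using nn_integral_translate_lborel[of "\<lambda>x::real^'n. ennreal (heat_kernel x t)" a] nn_integral_heat_kernel[OF assms]
  by auto

lemma integrable_heat_kernel:
  assumes "t > 0"
  shows "integrable lborel (\<lambda>x. heat_kernel (x::real^'n::finite) t)"
    and "integrable lborel (\<lambda>x. heat_kernel (a - x::real^'n::finite) t)"
    and "(LINT x|lborel. heat_kernel (x::real^'n::finite) t) = 1"
  using assms
  by (auto intro!: integrableI_nonneg simp: integral_eq_nn_integral nn_integral_heat_kernel)

text \<open>The heat semigroup on functions with values in [0, oo]: Tonelli applies to it without
  integrability side conditions.\<close>

definition heat_nn :: "real \<Rightarrow> (real^'n::finite \<Rightarrow> ennreal) \<Rightarrow> real^'n \<Rightarrow> ennreal" where
  "heat_nn t h x = (\<integral>\<^sup>+y. ennreal (heat_kernel (x - y) t) * h y \<partial>lborel)"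

lemma heat_nn_measurable [measurable]:
  assumes [measurable]: "case_prod h \<in> borel_measurable (M \<Otimes>\<^sub>M lborel)" "g \<in> borel_measurable M" "r \<in> borel_measurable M"
  shows "(\<lambda>p. heat_nn (r p) (h p) (g p)) \<in> borel_measurable M"
  unfolding heat_nn_def by measurable

lemma heat_nn_L1:
  assumes "t > 0" and [measurable]: "h \<in> borel_measurable borel"
  shows "(\<integral>\<^sup>+x. heat_nn t h x \<partial>lborel) = (\<integral>\<^sup>+x. h x \<partial>lborel)"
proof -
  have "(\<integral>\<^sup>+x. heat_nn t h x \<partial>lborel) = (\<integral>\<^sup>+y. (\<integral>\<^sup>+x. ennreal (heat_kernel (x - y) t) * h y \<partial>lborel) \<partial>lborel)"
    unfolding heat_nn_def by (rule lborel_pair.Fubini') measurable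
  also have "\<dots> = (\<integral>\<^sup>+y. h y \<partial>lborel)"
    using assms by (simp add: nn_integral_multc)
  finally show ?thesis .
qed

lemma heat_nn_sup:
  assumes "t > 0" "\<And>y. h y \<le> c"
  shows "heat_nn t h x \<le> c"
proof -
  have "heat_nn t h x \<le> (\<integral>\<^sup>+y. ennreal (heat_kernel (x - y) t) * c \<partial>lborel)"
    unfolding heat_nn_def using assms by (intro nn_integral_mono mult_left_mono) auto
  also have "\<dots> = c"
    using assms by (simp add: nn_integral_multc)
  finally show ?thesis .
qed

lemma heat_nn_le_L1:
  fixes h :: "real^'n::finite \<Rightarrow> ennreal"
  assumes "t > 0" and [measurable]: "h \<in> borel_measurable borel"
  shows "heat_nn t h x \<le> ennreal (t powr (- (real CARD('n) / 2))) * (\<integral>\<^sup>+x. h x \<partial>lborel)"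
proof -
  have "heat_nn t h x \<le> (\<integral>\<^sup>+y. ennreal (t powr (- (real CARD('n) / 2))) * h y \<partial>lborel)"
    unfolding heat_nn_def using assms by (intro nn_integral_mono mult_right_mono ennreal_leI heat_kernel_le) auto
  then show ?thesis
    by (simp add: nn_integral_cmult)
qed

text \<open>By the triangle inequality the weight at x is at most the weight at y times
  exp(\<open>\<delta>\<close> |x - y|), and the kernel absorbs the second factor. Weighted L^1 norms
  are thus preserved up to a constant independent of \<open>\<delta>\<close> and a.\<close>

lemma heat_nn_weighted_L1:
  fixes h :: "real^'n::finite \<Rightarrow> ennreal"
  assumes "t > 0" "\<delta> \<ge> 0" "\<delta>\<^sup>2 * t \<le> 1" and [measurable]: "h \<in> borel_measurable borel"
  shows "(\<integral>\<^sup>+x. ennreal (exp (- \<delta> * norm (x - a))) * heat_nn t h x \<partial>lborel)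
    \<le> ennreal (2 powr (real CARD('n) / 2) * exp 2) * (\<integral>\<^sup>+y. ennreal (exp (- \<delta> * norm (y - a))) * h y \<partial>lborel)"
proof -
  let ?C = "2 powr (real CARD('n) / 2) * exp 2"
  have *: "exp (- \<delta> * norm (x - a)) * heat_kernel (x - y) t \<le> ?C * (exp (- \<delta> * norm (y - a)) * heat_kernel (x - y) (2 * t))" for x y :: "real^'n"
  proof -
    have "norm (y - a) \<le> norm (x - a) + norm (x - y)"
      using norm_triangle_ineq4[of "x - a" "x - y"] by simp
    then have "\<delta> * norm (y - a) \<le> \<delta> * norm (x - a) + \<delta> * norm (x - y)"
      using assms(2) by (simp add: distrib_left[symmetric] mult_left_mono)
    then have "exp (- \<delta> * norm (x - a)) \<le> exp (- \<delta> * norm (y - a)) * exp (\<delta> * norm (x - y))"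
      by (simp add: exp_add[symmetric])
    then have "exp (- \<delta> * norm (x - a)) * heat_kernel (x - y) t
      \<le> exp (- \<delta> * norm (y - a)) * exp (\<delta> * norm (x - y)) * heat_kernel (x - y) t"
      by (intro mult_right_mono) auto
    also have "\<dots> \<le> exp (- \<delta> * norm (y - a)) * (?C * heat_kernel (x - y) (2 * t))"
      using mult_left_mono[OF heat_kernel_weight_bound[OF assms(1-3), of "x - y"], of "exp (- \<delta> * norm (y - a))"]
      by (simp add: mult_ac)
    finally show ?thesis by (simp add: mult_ac)
  qed
  have "(\<integral>\<^sup>+x. ennreal (exp (- \<delta> * norm (x - a))) * heat_nn t h x \<partial>lborel)
     = (\<integral>\<^sup>+x. (\<integral>\<^sup>+y. ennreal (exp (- \<delta> * norm (x - a)) * heat_kernel (x - y) t) * h y \<partial>lborel) \<partial>lborel)"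
    unfolding heat_nn_def
    by (intro nn_integral_cong, subst nn_integral_cmult[symmetric]) (auto simp: ennreal_mult mult_ac)
  also have "\<dots> \<le> (\<integral>\<^sup>+x. (\<integral>\<^sup>+y. ennreal (?C * (exp (- \<delta> * norm (y - a)) * heat_kernel (x - y) (2 * t))) * h y \<partial>lborel) \<partial>lborel)"
    using * by (intro nn_integral_mono mult_right_mono ennreal_leI) auto
  also have "\<dots> = (\<integral>\<^sup>+x. (\<integral>\<^sup>+y. ennreal (heat_kernel (x - y) (2 * t)) * (ennreal ?C * (ennreal (exp (- \<delta> * norm (y - a))) * h y)) \<partial>lborel) \<partial>lborel)"
    by (intro nn_integral_cong) (auto simp: ennreal_mult mult_ac)
  also have "\<dots> = (\<integral>\<^sup>+x. heat_nn (2 * t) (\<lambda>y. ennreal ?C * (ennreal (exp (- \<delta> * norm (y - a))) * h y)) x \<partial>lborel)"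
    by (simp add: heat_nn_def)
  also have "\<dots> = ennreal ?C * (\<integral>\<^sup>+y. ennreal (exp (- \<delta> * norm (y - a))) * h y \<partial>lborel)"
    using assms by (subst heat_nn_L1) (auto simp: nn_integral_cmult)
  finally show ?thesis .
qed

text \<open>The same absorption pointwise: seen from a, the kernel decays at least like the weight
  centred at a. The smoothing estimate at a therefore asks only for the weighted L^1 norm with that
  centre.\<close>

lemma heat_nn_le_weighted:
  fixes h :: "real^'n::finite \<Rightarrow> ennreal"
  assumes "t > 0" "\<delta> \<ge> 0" "\<delta>\<^sup>2 * t \<le> 1" and [measurable]: "h \<in> borel_measurable borel"
  shows "heat_nn t h a
    \<le> ennreal (2 powr (real CARD('n) / 2) * exp 2 * t powr (- (real CARD('n) / 2))) * (\<integral>\<^sup>+y. ennreal (exp (- \<delta> * norm (y - a))) * h y \<partial>lborel)"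
proof -
  let ?C = "2 powr (real CARD('n) / 2) * exp 2 * t powr (- (real CARD('n) / 2))"
  have *: "heat_kernel (a - y) t \<le> ?C * exp (- \<delta> * norm (y - a))" for y
  proof -
    have "heat_kernel (a - y) t * exp (\<delta> * norm (a - y)) \<le> 2 powr (real CARD('n) / 2) * exp 2 * heat_kernel (a - y) (2 * t)"
      by (rule heat_kernel_weight_bound) fact+
    also have "\<dots> \<le> ?C"
      using assms heat_kernel_le[of "2 * t" "a - y"]
        powr_mono2'[of "- (real CARD('n) / 2)" t "2*t"]
      by (intro mult_left_mono) auto
    finally show ?thesis
      by (simp add: exp_minus divide_simps norm_minus_commute mult_ac)
  qed
  have "heat_nn t h a \<le> (\<integral>\<^sup>+y. ennreal (?C * exp (- \<delta> * norm (y - a))) * h y \<partial>lborel)"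
    unfolding heat_nn_def using * by (intro nn_integral_mono mult_right_mono ennreal_leI) auto
  also have "\<dots> = ennreal ?C * (\<integral>\<^sup>+y. ennreal (exp (- \<delta> * norm (y - a))) * h y \<partial>lborel)"
    by (subst nn_integral_cmult[symmetric]) (auto simp: ennreal_mult mult_ac)
  finally show ?thesis .
qed

section \<open>Duhamel's formula\<close>

lemma integrable_continuous_compact_support:
  fixes f :: "'a::euclidean_space \<Rightarrow> real"
  assumes "continuous_on UNIV f" "\<And>x. norm x > R \<Longrightarrow> f x = 0"
  shows "integrable lborel f"
proof -
  have "integrable lborel (\<lambda>x. indicator (cball 0 R) x *\<^sub>R f x)"
    by (intro borel_integrable_compact continuous_on_subset[OF assms(1)]) auto
  moreover have "(\<lambda>x. indicator (cball 0 R) x *\<^sub>R f x) = f"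
    using assms(2) by (force simp: indicator_def not_le)
  ultimately show ?thesis by simp
qed

text \<open>Bridge from the Lebesgue integral to the gauge integral over a box, the form in which
  the Leibniz rule for parameter integrals is applied below.\<close>

lemma integral_eq_cbox:
  fixes f :: "'a::euclidean_space \<Rightarrow> real"
  assumes "continuous_on UNIV f" "\<And>x. x \<notin> cbox a b \<Longrightarrow> f x = 0"
  shows "(LINT x|lborel. f x) = integral (cbox a b) f"
proof -
  have "integrable lborel (\<lambda>x. indicator (cbox a b) x *\<^sub>R f x)"
    by (intro borel_integrable_compact continuous_on_subset[OF assms(1)]) auto
  moreover have "(\<lambda>x. indicator (cbox a b) x *\<^sub>R f x) = f" "(\<lambda>x. if x \<in> cbox a b then f x else 0) = f"
    using assms(2) by (force simp: indicator_def)+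
  ultimately have "(f has_integral (LINT x|lborel. f x)) UNIV"
    by (intro has_integral_integral_lborel) simp
  then have "(f has_integral (LINT x|lborel. f x)) (cbox a b)"
    using has_integral_restrict_UNIV[of "cbox a b" f] \<open>(\<lambda>x. if x \<in> cbox a b then f x else 0) = f\<close> by simp
  then show ?thesis by (simp add: integral_unique)
qed

text \<open>The difference quotients of \<open>F\<close> have vanishing integral by translation invariance.\<close>

lemma integral_partial_eq_0:
  fixes F :: "real^'n::finite \<Rightarrow> real"
  assumes F: "\<And>x. has_partial i F (F' x) x"
    and cont: "continuous_on UNIV F" "continuous_on UNIV F'"
    and supp: "\<And>x. norm x > R \<Longrightarrow> F x = 0" and "R \<ge> 0"
  shows "(LINT x|lborel. F' x) = 0"
proof -
  let ?e = "axis i 1 :: real^'n"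
  \<comment> \<open>The steps 1/(k+1) are at most 1: the difference quotients vanish outside the
    ball of radius R + 1, and on it the mean value theorem evaluates \<open>F'\<close> within radius
    R + 2.\<close>
  have "compact (F' ` cball 0 (R + 2))"
    by (intro compact_continuous_image continuous_on_subset[OF cont(2)]) auto
  then have "bounded (F' ` cball 0 (R + 2))" by (rule compact_imp_bounded)
  then obtain C where C: "\<And>x. x \<in> cball 0 (R + 2) \<Longrightarrow> \<bar>F' x\<bar> \<le> C"
    unfolding bounded_iff real_norm_def by blast
  have "C \<ge> 0" using C[of 0] assms(5) by simp
  define s where "s k x = (F (x + (1 / real (Suc k)) *\<^sub>R ?e) - F x) / (1 / real (Suc k))" for k x
  have intF: "integrable lborel F" by (rule integrable_continuous_compact_support) fact+
  have [measurable]: "F \<in> borel_measurable borel" "F' \<in> borel_measurable borel"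
    using cont by (auto intro: borel_measurable_continuous_onI)
  have bd: "\<bar>s k x\<bar> \<le> C * indicator (cball 0 (R + 1)) x" for k x
  proof (cases "norm x \<le> R + 1")
    case True
    have k: "0 < 1 / real (Suc k)" "1 / real (Suc k) \<le> 1" by auto
    have "\<exists>z. 0 < z \<and> z < 1 / real (Suc k) \<and> F (x + (1 / real (Suc k)) *\<^sub>R ?e) - F (x + 0 *\<^sub>R ?e) = (1 / real (Suc k) - 0) * F' (x + z *\<^sub>R ?e)"
      by (rule MVT2[OF k(1)]) (rule has_partial_line[OF F])
    then obtain z where z: "0 < z" "z < 1 / real (Suc k)" "F (x + (1 / real (Suc k)) *\<^sub>R ?e) - F x = (1 / real (Suc k)) * F' (x + z *\<^sub>R ?e)"
      by auto
    have "norm (x + z *\<^sub>R ?e) \<le> norm x + z"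
      using norm_triangle_ineq[of x "z *\<^sub>R ?e"] z(1) by simp
    then have "norm (x + z *\<^sub>R ?e) \<le> R + 2" using z k True by linarith
    then have "\<bar>F' (x + z *\<^sub>R ?e)\<bar> \<le> C"
      by (intro C) auto
    then show ?thesis using True unfolding s_def z(3) by (simp add: indicator_def)
  next
    case False
    have "norm x \<le> norm (x + (1 / real (Suc k)) *\<^sub>R ?e) + 1 / real (Suc k)"
      using norm_triangle_ineq4[of "x + (1 / real (Suc k)) *\<^sub>R ?e" "(1 / real (Suc k)) *\<^sub>R ?e"] by simp
    moreover have "1 / real (Suc k) \<le> 1" by simp
    ultimately have "norm (x + (1 / real (Suc k)) *\<^sub>R ?e) > R" "norm x > R" using False by linarith+
    then show ?thesis using supp \<open>C \<ge> 0\<close> by (simp add: s_def)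
  qed
  have lim: "(\<lambda>k. s k x) \<longlonglongrightarrow> F' x" for x
  proof -
    have "((\<lambda>h. (F (x + h *\<^sub>R ?e) - F x) / h) \<longlongrightarrow> F' x) (at 0)"
      using F[of x] by (simp add: has_partial_def has_field_derivative_iff)
    moreover have "filterlim (\<lambda>k. 1 / real (Suc k)) (at 0) sequentially"
      unfolding filterlim_at using LIMSEQ_inverse_real_of_nat by (auto simp: inverse_eq_divide)
    ultimately show ?thesis
      unfolding s_def by (rule filterlim_compose)
  qed
  have "(\<lambda>k. LINT x|lborel. s k x) \<longlonglongrightarrow> (LINT x|lborel. F' x)"
  proof (rule integral_dominated_convergence[where w="\<lambda>x. C * indicator (cball 0 (R + 1)) x"])
    show "integrable lborel (\<lambda>x::real^'n. C * indicator (cball 0 (R + 1)) x)"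
      by (intro integrable_mult_right integrable_real_indicator emeasure_bounded_finite) auto
    show "s k \<in> borel_measurable lborel" for k unfolding s_def by measurable
  qed (use bd lim in auto)
  moreover have "(LINT x|lborel. s k x) = 0" for k
  proof -
    have "integrable lborel (\<lambda>x. F ((1 / real (Suc k)) *\<^sub>R ?e + x))"
    proof (rule integrable_continuous_compact_support)
      show "continuous_on UNIV (\<lambda>x. F ((1 / real (Suc k)) *\<^sub>R ?e + x))"
        by (intro continuous_on_compose2[OF cont(1)] continuous_intros) auto
      fix x :: "real^'n" assume "norm x > R + 1"
      moreover have "norm x \<le> norm ((1 / real (Suc k)) *\<^sub>R ?e + x) + 1 / real (Suc k)"
        using norm_triangle_ineq4[of "(1 / real (Suc k)) *\<^sub>R ?e + x" "(1 / real (Suc k)) *\<^sub>R ?e"] by simp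
      moreover have "1 / real (Suc k) \<le> 1" by simp
      ultimately have "norm ((1 / real (Suc k)) *\<^sub>R ?e + x) > R" by linarith
      then show "F ((1 / real (Suc k)) *\<^sub>R ?e + x) = 0" by (rule supp)
    qed
    then show ?thesis
      using intF integral_translate_lborel(1)[of F "(1 / real (Suc k)) *\<^sub>R ?e"]
      by (simp add: s_def add.commute)
  qed
  ultimately have "(\<lambda>k. 0) \<longlonglongrightarrow> (LINT x|lborel. F' x)" by (simp only:)
  then show ?thesis using LIMSEQ_unique[OF tendsto_const] by metis
qed

text \<open>The difference of the two integrands is the derivative in direction i of
  \<open>\<psi>\<close> w1 - \<open>\<psi>1\<close> w, so both integrations by parts are one
  vanishing integral. The compact support of \<open>\<psi>\<close> makes up for the missing decay of
  w.\<close>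

lemma integration_by_parts_twice:
  fixes \<psi> w :: "real^'n::finite \<Rightarrow> real"
  assumes "\<And>x. has_partial i \<psi> (\<psi>1 x) x" "\<And>x. has_partial i \<psi>1 (\<psi>2 x) x"
    and "\<And>x. has_partial i w (w1 x) x" "\<And>x. has_partial i w1 (w2 x) x"
    and "continuous_on UNIV \<psi>" "continuous_on UNIV \<psi>1" "continuous_on UNIV \<psi>2"
    and "continuous_on UNIV w" "continuous_on UNIV w1" "continuous_on UNIV w2"
    and "\<And>x. norm x > R \<Longrightarrow> \<psi> x = 0" "\<And>x. norm x > R \<Longrightarrow> \<psi>1 x = 0" "\<And>x. norm x > R \<Longrightarrow> \<psi>2 x = 0"
    and "R \<ge> 0"
  shows "(LINT x|lborel. \<psi> x * w2 x) = (LINT x|lborel. \<psi>2 x * w x)"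
proof -
  have "(LINT x|lborel. (\<psi> x * w2 x - \<psi>2 x * w x)) = 0"
  proof (rule integral_partial_eq_0[where F="\<lambda>x. \<psi> x * w1 x - \<psi>1 x * w x" and R=R and i=i])
    fix x
    have "has_partial i (\<lambda>x. \<psi> x * w1 x - \<psi>1 x * w x)
        ((\<psi>1 x * w1 x + w2 x * \<psi> x) - (\<psi>2 x * w x + w1 x * \<psi>1 x)) x"
      using assms by (intro has_partial_diff has_partial_mult)
    then show "has_partial i (\<lambda>x. \<psi> x * w1 x - \<psi>1 x * w x) (\<psi> x * w2 x - \<psi>2 x * w x) x"
      by (simp add: algebra_simps)
  qed (use assms in \<open>auto intro!: continuous_intros\<close>)
  moreover have "integrable lborel (\<lambda>x. \<psi> x * w2 x)" "integrable lborel (\<lambda>x. \<psi>2 x * w x)"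
    using assms by (auto intro!: integrable_continuous_compact_support[where R=R] continuous_intros)
  ultimately show ?thesis by simp
qed

section \<open>A compactly supported cutoff of class C^2\<close>

lemma DERIV_max_0_power:
  "((\<lambda>y::real. max 0 y ^ (k + 2)) has_real_derivative real (k + 2) * max 0 y ^ (k + 1)) (at y)"
proof -
  consider "y > 0" | "y < 0" | "y = 0" by linarith
  then show ?thesis
  proof cases
    case 1
    have "((\<lambda>y::real. y ^ (k + 2)) has_real_derivative real (k + 2) * y ^ (k + 1)) (at y)"
      using DERIV_pow[of "k + 2" y] by simp
    then show ?thesis
      using 1 by (subst DERIV_cong_ev[OF refl _ refl, where g="\<lambda>y. y ^ (k + 2)"])
        (auto simp: max_def intro!: eventually_nhds_in_open[of "{0<..}", THEN eventually_mono])
  next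
    case 2
    then show ?thesis
      by (subst DERIV_cong_ev[OF refl _ refl, where g="\<lambda>y. 0"])
        (auto simp: max_def intro!: eventually_nhds_in_open[of "{..<0}", THEN eventually_mono])
  next
    case 3
    have "((\<lambda>h::real. (max 0 h ^ (k + 2)) / h) \<longlongrightarrow> 0) (at 0)"
    proof (rule Lim_null_comparison)
      show "\<forall>\<^sub>F h::real in at 0. norm (max 0 h ^ (k + 2) / h) \<le> \<bar>h\<bar> ^ (k + 1)"
      proof (intro always_eventually allI)
        fix h :: real
        show "norm (max 0 h ^ (k + 2) / h) \<le> \<bar>h\<bar> ^ (k + 1)"
        proof (cases "h > 0")
          case False
          then have "max 0 h = 0" by simp
          then show ?thesis by (simp del: power_Suc add: zero_le_power[OF abs_ge_zero])
        qed simp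
      qed
      show "((\<lambda>h::real. \<bar>h\<bar> ^ (k + 1)) \<longlongrightarrow> 0) (at 0)"
        by (auto intro!: tendsto_eq_intros)
    qed
    then show ?thesis using 3 by (simp add: has_field_derivative_iff)
  qed
qed

text \<open>The exponent 3 is the smallest integer that leaves two continuous derivatives across the
  boundary of the ball; a polynomial profile keeps these derivatives explicit.\<close>

definition cutoff :: "real \<Rightarrow> real^'n::finite \<Rightarrow> real" where
  "cutoff R y = max 0 (1 - (norm y)\<^sup>2 / R\<^sup>2) ^ 3"

definition cutoff_d :: "'n \<Rightarrow> real \<Rightarrow> real^'n::finite \<Rightarrow> real" where
  "cutoff_d i R y = - 6 / R\<^sup>2 * (y $ i * max 0 (1 - (norm y)\<^sup>2 / R\<^sup>2) ^ 2)"

definition cutoff_dd :: "'n \<Rightarrow> real \<Rightarrow> real^'n::finite \<Rightarrow> real" where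
  "cutoff_dd i R y = - 6 / R\<^sup>2 * (max 0 (1 - (norm y)\<^sup>2 / R\<^sup>2) ^ 2 - 4 / R\<^sup>2 * ((y $ i)\<^sup>2 * max 0 (1 - (norm y)\<^sup>2 / R\<^sup>2)))"

lemma has_partial_cutoff_base: "has_partial i (\<lambda>y. 1 - (norm y)\<^sup>2 / R\<^sup>2) (- 2 * y $ i / R\<^sup>2) y"
proof -
  have "has_partial i (\<lambda>y. 1 - (1 / R\<^sup>2) * (norm y)\<^sup>2) (0 - (1 / R\<^sup>2) * (2 * y $ i)) y"
    by (intro has_partial_diff has_partial_const has_partial_cmult has_partial_norm_sq)
  then show ?thesis by simp
qed

lemma has_partial_cutoff: "has_partial i (cutoff R) (cutoff_d i R y) y"
  using has_partial_compose[OF has_partial_cutoff_base[of i R y] DERIV_max_0_power[of 1]]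
  unfolding cutoff_def[abs_def] by (simp add: cutoff_d_def mult_ac numeral_3_eq_3 power2_eq_square)

lemma has_partial_cutoff_d: "has_partial i (cutoff_d i R) (cutoff_dd i R y) y"
proof -
  have "has_partial i (\<lambda>y. - 6 / R\<^sup>2 * (y $ i * max 0 (1 - (norm y)\<^sup>2 / R\<^sup>2) ^ 2))
    (- 6 / R\<^sup>2 * (1 * max 0 (1 - (norm y)\<^sup>2 / R\<^sup>2) ^ 2 + (2 * max 0 (1 - (norm y)\<^sup>2 / R\<^sup>2) * (- 2 * y $ i / R\<^sup>2)) * y $ i)) y"
    using has_partial_compose[OF has_partial_cutoff_base[of i R y] DERIV_max_0_power[of 0]] has_partial_component[of i i y]
    by (intro has_partial_cmult has_partial_mult) (simp_all add: numeral_2_eq_2)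
  then show ?thesis unfolding cutoff_d_def[abs_def]
    by (simp add: cutoff_dd_def power2_eq_square mult_ac)
qed

lemma cutoff_continuous [continuous_intros]:
  assumes "continuous_on S f"
  shows "continuous_on S (\<lambda>x. cutoff R (f x))" "continuous_on S (\<lambda>x. cutoff_d i R (f x))" "continuous_on S (\<lambda>x. cutoff_dd i R (f x))"
  unfolding cutoff_def cutoff_d_def cutoff_dd_def divide_inverse
  by (intro continuous_intros assms)+

lemma cutoff_zero:
  assumes "norm y > R" "R > 0"
  shows "cutoff R y = 0" "cutoff_d i R y = 0" "cutoff_dd i R y = 0"
proof -
  have "R\<^sup>2 \<le> (norm y)\<^sup>2" using assms by (intro power_mono) auto
  then have "max 0 (1 - (norm y)\<^sup>2 / R\<^sup>2) = 0" using assms by (simp add: max_def)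
  then show "cutoff R y = 0" "cutoff_d i R y = 0" "cutoff_dd i R y = 0"
    by (simp_all add: cutoff_def cutoff_d_def cutoff_dd_def)
qed

lemma cutoff_bounds:
  assumes "R > 0"
  shows "0 \<le> cutoff R y" "cutoff R y \<le> 1" "\<bar>cutoff_d i R y\<bar> \<le> 6 / R" "\<bar>cutoff_dd i R y\<bar> \<le> 30 / R\<^sup>2"
proof -
  define m where "m = max 0 (1 - (norm y)\<^sup>2 / R\<^sup>2)"
  have m: "0 \<le> m" "m \<le> 1" by (auto simp: m_def)
  show "0 \<le> cutoff R y" "cutoff R y \<le> 1"
    using m by (auto simp: cutoff_def m_def[symmetric] power_le_one)
  show "\<bar>cutoff_d i R y\<bar> \<le> 6 / R"
  proof (cases "norm y > R")
    case False
    then have "\<bar>y $ i\<bar> \<le> R" using component_le_norm_cart[of y i] by linarith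
    then have "\<bar>y $ i\<bar> * m\<^sup>2 \<le> R * 1"
      using m by (intro mult_mono) (auto simp: power_le_one)
    then have "6 / R\<^sup>2 * (\<bar>y $ i\<bar> * m\<^sup>2) \<le> 6 / R\<^sup>2 * R"
      by (intro mult_left_mono) auto
    then show ?thesis using assms
      by (simp add: cutoff_d_def m_def[symmetric] abs_mult) (simp add: power2_eq_square)
  qed (use assms in \<open>simp add: cutoff_zero\<close>)
  show "\<bar>cutoff_dd i R y\<bar> \<le> 30 / R\<^sup>2"
  proof (cases "norm y > R")
    case False
    then have "\<bar>y $ i\<bar> \<le> R" using component_le_norm_cart[of y i] by linarith
    then have "(y $ i)\<^sup>2 \<le> R\<^sup>2" using power_mono[of "\<bar>y $ i\<bar>" R 2] by simp
    then have "(y $ i)\<^sup>2 * m \<le> R\<^sup>2 * 1"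
      using m by (intro mult_mono) auto
    then have "4 / R\<^sup>2 * ((y $ i)\<^sup>2 * m) \<le> 4 / R\<^sup>2 * R\<^sup>2"
      by (intro mult_left_mono) auto
    then have 1: "4 / R\<^sup>2 * ((y $ i)\<^sup>2 * m) \<le> 4" using assms by simp
    have 2: "0 \<le> 4 / R\<^sup>2 * ((y $ i)\<^sup>2 * m)" using m by simp
    have "0 \<le> m\<^sup>2" "m\<^sup>2 \<le> 1" using m by (auto simp: power_le_one)
    define z where "z = m\<^sup>2 - 4 / R\<^sup>2 * ((y $ i)\<^sup>2 * m)"
    \<comment> \<open>z lies between -4 and 1, so 5 is generous; the prefactor 6 then gives
      30.\<close>
    have "\<bar>z\<bar> \<le> 5" using 1 2 \<open>0 \<le> m\<^sup>2\<close> \<open>m\<^sup>2 \<le> 1\<close> unfolding z_def by linarith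
    moreover have "cutoff_dd i R y = - 6 / R\<^sup>2 * z" by (simp only: cutoff_dd_def m_def z_def)
    ultimately show ?thesis by (simp add: abs_mult divide_right_mono)
  qed (use assms in \<open>simp add: cutoff_zero\<close>)
qed

lemma cutoff_tendsto_1: "(\<lambda>k. cutoff (real (Suc k)) y) \<longlonglongrightarrow> 1"
proof -
  have "(\<lambda>k. max 0 (1 - (norm y)\<^sup>2 * (inverse (real (Suc k)))\<^sup>2) ^ 3) \<longlonglongrightarrow> max 0 (1 - (norm y)\<^sup>2 * 0\<^sup>2) ^ 3"
    by (intro tendsto_intros LIMSEQ_inverse_real_of_nat)
  then show ?thesis by (simp add: cutoff_def divide_inverse power_inverse)
qed

lemma integral_scale_lborel:
  fixes f :: "'a::euclidean_space \<Rightarrow> real"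
  assumes [measurable]: "f \<in> borel_measurable borel" and c: "c \<noteq> 0"
  shows "(LINT x|lborel. f x) = \<bar>c\<bar> ^ DIM('a) * (LINT x|lborel. f (c *\<^sub>R x))"
proof -
  have "(LINT x|lborel. f x) = (LINT x|(density (distr lborel borel (\<lambda>x. 0 + c *\<^sub>R x)) (\<lambda>_. \<bar>c\<bar> ^ DIM('a))). f x)"
    by (subst lborel_affine[OF c, of 0, symmetric]) simp
  also have "\<dots> = (LINT x|lborel. \<bar>c\<bar> ^ DIM('a) * f (c *\<^sub>R x))"
    by (subst integral_density, simp_all, subst integral_distr) auto
  finally show ?thesis by simp
qed

lemma heat_kernel_derivs_continuous:
  assumes "continuous_on S f" "continuous_on S g" "\<And>x. x \<in> S \<Longrightarrow> g x > 0"
  shows "continuous_on S (\<lambda>x. heat_kernel_d i (f x) (g x))"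
    and "continuous_on S (\<lambda>x. heat_kernel_dd i (f x) (g x))"
    and "continuous_on S (\<lambda>x. heat_kernel_t (f x) (g x))"
proof -
  have g: "g x \<noteq> 0" if "x \<in> S" for x using assms(3)[OF that] by simp
  show "continuous_on S (\<lambda>x. heat_kernel_d i (f x) (g x))"
    and "continuous_on S (\<lambda>x. heat_kernel_dd i (f x) (g x))"
    and "continuous_on S (\<lambda>x. heat_kernel_t (f x) (g x))"
    unfolding heat_kernel_d_def heat_kernel_dd_def heat_kernel_t_def
    by (intro continuous_intros heat_kernel_continuous assms; use g in auto)+
qed

section \<open>The inhomogeneous heat equation, localized by a cutoff\<close>

lemma continuous_on_slice:
  assumes "continuous_on (UNIV \<times> T) (\<lambda>(x, t). f x t)" "t \<in> T"
  shows "continuous_on UNIV (\<lambda>x. f x t)"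
proof -
  have "continuous_on UNIV (\<lambda>x. case (x, t) of (x, t) \<Rightarrow> f x t)"
    by (rule continuous_on_compose2[OF assms(1)]) (use assms(2) in \<open>auto intro!: continuous_intros\<close>)
  then show ?thesis by simp
qed

text \<open>The equation is w_t = Laplacian w + g with w and g bounded. Nothing is assumed about
  decay in space, whence the cutoff. Only the pure second derivatives occur, since the Laplacian
  sees no others.\<close>

locale inhom_heat =
  fixes w g :: "real^'n::finite \<Rightarrow> real \<Rightarrow> real" and w1 w2 :: "'n \<Rightarrow> real^'n \<Rightarrow> real \<Rightarrow> real"
    and B L :: real
  assumes w_cont: "continuous_on (UNIV \<times> {0..}) (\<lambda>(x, t). w x t)"
    and w_bound: "\<And>x t. t \<ge> 0 \<Longrightarrow> \<bar>w x t\<bar> \<le> B"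
    and g_bound: "\<And>x t. t > 0 \<Longrightarrow> \<bar>g x t\<bar> \<le> L"
    and g_meas: "case_prod g \<in> borel_measurable borel"
    and g_cont: "continuous_on (UNIV \<times> {0<..}) (\<lambda>(x, t). g x t)"
    and w1_cont: "\<And>i. continuous_on (UNIV \<times> {0<..}) (\<lambda>(x, t). w1 i x t)"
    and w2_cont: "\<And>i. continuous_on (UNIV \<times> {0<..}) (\<lambda>(x, t). w2 i x t)"
    and w_partial: "\<And>i x t. t > 0 \<Longrightarrow> has_partial i (\<lambda>y. w y t) (w1 i x t) x"
    and w1_partial: "\<And>i x t. t > 0 \<Longrightarrow> has_partial i (\<lambda>y. w1 i y t) (w2 i x t) x"
    and w_time: "\<And>x t. t > 0 \<Longrightarrow> (w x has_real_derivative (\<Sum>i\<in>UNIV. w2 i x t) + g x t) (at t)"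
begin

lemma B_nonneg: "B \<ge> 0" using w_bound[of 0 0] by simp

lemma L_nonneg: "L \<ge> 0" using g_bound[of 1 0] by simp

lemma g_measurable [measurable]:
  assumes "f \<in> borel_measurable M" "h \<in> borel_measurable M"
  shows "(\<lambda>x. g (f x) (h x)) \<in> borel_measurable M"
  using measurable_compose[OF borel_measurable_Pair[OF assms] g_meas] by simp

lemma slice_continuous:
  shows "t \<ge> 0 \<Longrightarrow> continuous_on UNIV (\<lambda>x. w x t)"
    and "t > 0 \<Longrightarrow> continuous_on UNIV (\<lambda>x. g x t)"
    and "t > 0 \<Longrightarrow> continuous_on UNIV (\<lambda>x. w1 i x t)"
    and "t > 0 \<Longrightarrow> continuous_on UNIV (\<lambda>x. w2 i x t)"
  using w_cont g_cont w1_cont[of i] w2_cont[of i] by (auto elim: continuous_on_slice)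

lemma slice_measurable [measurable]: "t \<ge> 0 \<Longrightarrow> (\<lambda>x. w x t) \<in> borel_measurable borel"
  using slice_continuous(1) by (rule borel_measurable_continuous_onI)

text \<open>What the cutoff chi leaves behind: 2 grad G . grad chi + G Laplacian chi, that is, the
  commutator of the Laplacian with multiplication by chi, applied to the kernel G.\<close>

definition err :: "real \<Rightarrow> real \<Rightarrow> real^'n \<Rightarrow> real" where
  "err R \<sigma> y = (\<Sum>i\<in>UNIV. 2 * (heat_kernel_d i y \<sigma> * cutoff_d i R y) + heat_kernel y \<sigma> * cutoff_dd i R y)"

text \<open>The time derivative of the kernel has the sign of the backward heat equation. After
  integration by parts it cancels the Laplacian of w, and only the source and the commutator
  survive. The kernel is centred at the origin; other centres follow by translation.\<close>

lemma localized_derivative: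
  assumes "0 < s" "s < t" "R > 0"
  shows "((\<lambda>s. LINT y|lborel. heat_kernel y (t - s) * cutoff R y * w y s) has_real_derivative
    ((LINT y|lborel. heat_kernel y (t - s) * cutoff R y * g y s) + (LINT y|lborel. err R (t - s) y * w y s))) (at s)"
proof -
  define \<Phi> where "\<Phi> s y = heat_kernel y (t - s) * cutoff R y * w y s" for s y
  define \<Phi>' where "\<Phi>' s y = (- heat_kernel_t y (t - s)) * cutoff R y * w y s
    + heat_kernel y (t - s) * cutoff R y * ((\<Sum>i\<in>UNIV. w2 i y s) + g y s)" for s y
  let ?a = "(- R) *\<^sub>R One :: real^'n" and ?b = "R *\<^sub>R One :: real^'n"
  have out: "norm y > R" if "y \<notin> cbox ?a ?b" for y :: "real^'n"
  proof -
    have "\<not> (\<forall>b\<in>Basis. - R \<le> y \<bullet> b \<and> y \<bullet> b \<le> R)"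
      using that by (simp add: mem_box)
    then obtain b where b: "b \<in> Basis" "\<not> (- R \<le> y \<bullet> b \<and> y \<bullet> b \<le> R)" by blast
    then show ?thesis using Basis_le_norm[OF b(1), of y] by linarith
  qed
  \<comment> \<open>The open interval keeps s > 0, where w is differentiable, and t - s > 0, where
    the kernel is.\<close>
  let ?U = "{0<..<t}"
  have cont\<Phi>: "continuous_on UNIV (\<Phi> s)" if "s \<in> ?U" for s
    unfolding \<Phi>_def using that by (intro continuous_intros heat_kernel_continuous slice_continuous) auto
  have cont\<Phi>': "continuous_on (?U \<times> UNIV) (\<lambda>(s, y). \<Phi>' s y)"
  proof -
    have "continuous_on (?U \<times> UNIV) (\<lambda>p. w (snd p) (fst p))"
      by (rule continuous_on_compose2[OF w_cont, of _ "\<lambda>p. (snd p, fst p)", simplified]) (auto intro!: continuous_intros)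
    moreover have "continuous_on (?U \<times> UNIV) (\<lambda>p. g (snd p) (fst p))"
      by (rule continuous_on_compose2[OF g_cont, of _ "\<lambda>p. (snd p, fst p)", simplified]) (auto intro!: continuous_intros)
    moreover have "continuous_on (?U \<times> UNIV) (\<lambda>p. w2 i (snd p) (fst p))" for i
      by (rule continuous_on_compose2[OF w2_cont, of _ "\<lambda>p. (snd p, fst p)", simplified]) (auto intro!: continuous_intros)
    ultimately show ?thesis
      unfolding \<Phi>'_def case_prod_beta
      by (intro continuous_intros heat_kernel_continuous heat_kernel_derivs_continuous) auto
  qed
  have cont\<Phi>'_slice: "continuous_on UNIV (\<Phi>' s)" if "s \<in> ?U" for s
  proof -
    have "continuous_on UNIV (\<lambda>y. case (s, y) of (s, y) \<Rightarrow> \<Phi>' s y)"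
      by (rule continuous_on_compose2[OF cont\<Phi>']) (use that in \<open>auto intro!: continuous_intros\<close>)
    then show ?thesis by simp
  qed
  have "((\<lambda>s. integral (cbox ?a ?b) (\<Phi> s)) has_field_derivative integral (cbox ?a ?b) (\<Phi>' s)) (at s within ?U)"
  proof (rule leibniz_rule_field_derivative)
    fix r and y :: "real^'n" assume "r \<in> ?U"
    then have "((\<lambda>s. heat_kernel y (t - s)) has_real_derivative (- heat_kernel_t y (t - r))) (at r within ?U)"
    proof -
      have "((\<lambda>s. t - s) has_real_derivative - 1) (at r within ?U)" by (auto intro!: derivative_eq_intros)
      moreover have "((\<lambda>t. heat_kernel y t) has_real_derivative heat_kernel_t y (t - r)) (at (t - r))"
        using \<open>r \<in> ?U\<close> by (intro heat_kernel_deriv_time) auto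
      ultimately show ?thesis using DERIV_chain2 by fastforce
    qed
    moreover have "(w y has_real_derivative (\<Sum>i\<in>UNIV. w2 i y r) + g y r) (at r within ?U)"
      using w_time \<open>r \<in> ?U\<close> by (auto intro: has_field_derivative_at_within)
    ultimately show "((\<lambda>s. \<Phi> s y) has_real_derivative \<Phi>' r y) (at r within ?U)"
      unfolding \<Phi>_def \<Phi>'_def by (auto intro!: derivative_eq_intros simp: algebra_simps)
  next
    show "\<Phi> s integrable_on cbox ?a ?b" if "s \<in> ?U" for s
      by (intro integrable_continuous continuous_on_subset[OF cont\<Phi>[OF that]]) auto
    show "continuous_on (?U \<times> cbox ?a ?b) (\<lambda>(s, y). \<Phi>' s y)"
      by (rule continuous_on_subset[OF cont\<Phi>']) auto
  qed (use assms in auto)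
  then have "((\<lambda>s. integral (cbox ?a ?b) (\<Phi> s)) has_real_derivative integral (cbox ?a ?b) (\<Phi>' s)) (at s)"
    using assms by (subst (asm) at_within_open) auto
  moreover have eq: "integral (cbox ?a ?b) (\<Phi> s) = (LINT y|lborel. \<Phi> s y)" if "s \<in> ?U" for s
    using out assms(3) by (intro integral_eq_cbox[symmetric] cont\<Phi>[OF that]) (auto simp: \<Phi>_def cutoff_zero)
  moreover have "integral (cbox ?a ?b) (\<Phi>' s) = (LINT y|lborel. \<Phi>' s y)"
    using out assms by (intro integral_eq_cbox[symmetric] cont\<Phi>'_slice) (auto simp: \<Phi>'_def cutoff_zero)
  moreover have "\<forall>\<^sub>F s in nhds s. integral (cbox ?a ?b) (\<Phi> s) = (LINT y|lborel. \<Phi> s y)"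
  proof -
    have "\<forall>\<^sub>F r in nhds s. r \<in> ?U" using assms by (intro eventually_nhds_in_open) auto
    then show ?thesis by (rule eventually_mono) (rule eq)
  qed
  ultimately have main: "((\<lambda>s. LINT y|lborel. \<Phi> s y) has_real_derivative (LINT y|lborel. \<Phi>' s y)) (at s)"
    by (subst (asm) DERIV_cong_ev[OF refl _ refl]) auto
  define \<psi>2 where "\<psi>2 i y = heat_kernel_dd i y (t - s) * cutoff R y + 2 * (heat_kernel_d i y (t - s) * cutoff_d i R y) + heat_kernel y (t - s) * cutoff_dd i R y" for i and y :: "real^'n"
  have cs: "continuous_on UNIV (\<lambda>y. heat_kernel (y::real^'n) (t - s))" "continuous_on UNIV (\<lambda>y. heat_kernel_d i (y::real^'n) (t - s))"
    "continuous_on UNIV (\<lambda>y. heat_kernel_dd i (y::real^'n) (t - s))" "continuous_on UNIV (\<lambda>y. heat_kernel_t (y::real^'n) (t - s))" for i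
    using assms by (auto intro!: heat_kernel_continuous heat_kernel_derivs_continuous continuous_intros)
  have ws: "continuous_on UNIV (\<lambda>y. w y s)" "continuous_on UNIV (\<lambda>y. g y s)" "continuous_on UNIV (\<lambda>y. w1 i y s)" "continuous_on UNIV (\<lambda>y. w2 i y s)" for i
    using assms by (auto intro!: slice_continuous)
  \<comment> \<open>Both derivatives move onto kernel times cutoff, so that w enters only through
    its values, which are bounded.\<close>
  have ibp: "(LINT y|lborel. (heat_kernel y (t - s) * cutoff R y) * w2 i y s) = (LINT y|lborel. \<psi>2 i y * w y s)" for i
  proof (rule integration_by_parts_twice[where i=i and R=R and ?w1.0="\<lambda>y. w1 i y s" and ?\<psi>1.0="\<lambda>y. heat_kernel_d i y (t - s) * cutoff R y + cutoff_d i R y * heat_kernel y (t - s)"])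
    fix y :: "real^'n"
    show "has_partial i (\<lambda>y. heat_kernel y (t - s) * cutoff R y) (heat_kernel_d i y (t - s) * cutoff R y + cutoff_d i R y * heat_kernel y (t - s)) y"
      using assms by (intro has_partial_mult has_partial_heat_kernel has_partial_cutoff) auto
    have "has_partial i (\<lambda>y. heat_kernel_d i y (t - s) * cutoff R y + cutoff_d i R y * heat_kernel y (t - s))
      ((heat_kernel_dd i y (t - s) * cutoff R y + cutoff_d i R y * heat_kernel_d i y (t - s)) + (cutoff_dd i R y * heat_kernel y (t - s) + heat_kernel_d i y (t - s) * cutoff_d i R y)) y"
      using assms by (intro has_partial_add has_partial_mult has_partial_heat_kernel has_partial_heat_kernel_d has_partial_cutoff has_partial_cutoff_d) auto
    then show "has_partial i (\<lambda>y. heat_kernel_d i y (t - s) * cutoff R y + cutoff_d i R y * heat_kernel y (t - s)) (\<psi>2 i y) y"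
      by (simp add: \<psi>2_def algebra_simps)
    show "continuous_on UNIV (\<psi>2 i)" unfolding \<psi>2_def[abs_def] by (intro continuous_intros cs)
    show "has_partial i (\<lambda>y. w y s) (w1 i y s) y" "has_partial i (\<lambda>y. w1 i y s) (w2 i y s) y"
      using assms by (auto intro: w_partial w1_partial)
    show "continuous_on UNIV (\<lambda>y::real^'n. heat_kernel y (t - s) * cutoff R y)"
      "continuous_on UNIV (\<lambda>y. heat_kernel_d i y (t - s) * cutoff R y + cutoff_d i R y * heat_kernel y (t - s))"
      by (intro continuous_intros cs)+
    show "R \<ge> 0" using assms by simp
    show "continuous_on UNIV (\<lambda>y. w y s)" "continuous_on UNIV (\<lambda>y. w1 i y s)" "continuous_on UNIV (\<lambda>y. w2 i y s)"
      by (rule ws)+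
    assume "norm y > R"
    then show "heat_kernel y (t - s) * cutoff R y = 0" "\<psi>2 i y = 0"
      "heat_kernel_d i y (t - s) * cutoff R y + cutoff_d i R y * heat_kernel y (t - s) = 0"
      using assms by (auto simp: \<psi>2_def cutoff_zero)
  qed
  have int: "integrable lborel (\<lambda>y. heat_kernel_t y (t - s) * cutoff R y * w y s)" "integrable lborel (\<lambda>y. heat_kernel y (t - s) * cutoff R y * w2 i y s)"
    "integrable lborel (\<lambda>y. heat_kernel y (t - s) * cutoff R y * g y s)" "integrable lborel (\<lambda>y. \<psi>2 i y * w y s)" "integrable lborel (\<lambda>y. err R (t - s) y * w y s)" for i
    unfolding \<psi>2_def err_def using assms
    by (auto intro!: integrable_continuous_compact_support[where R=R] continuous_intros cs ws simp: cutoff_zero)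
  have "(LINT y|lborel. \<Phi>' s y) = (LINT y|lborel. (\<Sum>i\<in>UNIV. heat_kernel y (t - s) * cutoff R y * w2 i y s) + (heat_kernel y (t - s) * cutoff R y * g y s - heat_kernel_t y (t - s) * cutoff R y * w y s))"
    unfolding \<Phi>'_def by (intro Bochner_Integration.integral_cong refl) (simp add: algebra_simps sum_distrib_left)
  also have "\<dots> = (\<Sum>i\<in>UNIV. LINT y|lborel. heat_kernel y (t - s) * cutoff R y * w2 i y s) + ((LINT y|lborel. heat_kernel y (t - s) * cutoff R y * g y s) - (LINT y|lborel. heat_kernel_t y (t - s) * cutoff R y * w y s))"
    using int by (subst Bochner_Integration.integral_add) (auto simp: Bochner_Integration.integral_sum intro!: Bochner_Integration.integrable_sum)
  also have "(\<Sum>i\<in>UNIV. LINT y|lborel. heat_kernel y (t - s) * cutoff R y * w2 i y s) = (\<Sum>i\<in>UNIV. LINT y|lborel. \<psi>2 i y * w y s)"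
    by (simp add: ibp)
  also have "\<dots> = (LINT y|lborel. (\<Sum>i\<in>UNIV. \<psi>2 i y * w y s))"
    using int by (simp add: Bochner_Integration.integral_sum)
  also have "\<dots> = (LINT y|lborel. heat_kernel_t y (t - s) * cutoff R y * w y s + err R (t - s) y * w y s)"
  proof (intro Bochner_Integration.integral_cong refl)
    fix y
    have "(\<Sum>i\<in>UNIV. \<psi>2 i y) = heat_kernel_t y (t - s) * cutoff R y + err R (t - s) y"
      unfolding heat_equation_heat_kernel[symmetric] err_def \<psi>2_def
      by (simp add: sum.distrib sum_distrib_right)
    then show "(\<Sum>i\<in>UNIV. \<psi>2 i y * w y s) = heat_kernel_t y (t - s) * cutoff R y * w y s + err R (t - s) y * w y s"
      by (simp add: sum_distrib_right[symmetric] distrib_right)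
  qed
  also have "\<dots> = (LINT y|lborel. heat_kernel_t y (t - s) * cutoff R y * w y s) + (LINT y|lborel. err R (t - s) y * w y s)"
    using int by (intro Bochner_Integration.integral_add) auto
  finally show ?thesis using main by (simp add: \<Phi>_def add.commute)
qed

lemma err_integral_bound:
  assumes "\<sigma> > 0" "R \<ge> 1" "0 \<le> s"
  shows "\<bar>LINT y|lborel. err R \<sigma> y * w y s\<bar> \<le> B * real CARD('n) * (12 * 2 powr (real CARD('n) / 2) * \<sigma> powr (- (1/2)) + 30) / R"
proof -
  let ?c = "2 powr (real CARD('n) / 2) * \<sigma> powr (- (1/2))"
  \<comment> \<open>R >= 1 weakens the rate 1/R^2 of the second derivative of the cutoff to the rate
    1/R of the first.\<close>
  have RR: "30 / R\<^sup>2 \<le> 30 / R" using assms(2) by (simp add: divide_simps power2_eq_square)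
  have term_bd: "\<bar>2 * (heat_kernel_d i y \<sigma> * cutoff_d i R y) + heat_kernel y \<sigma> * cutoff_dd i R y\<bar>
      \<le> (12 * ?c / R) * heat_kernel y (2 * \<sigma>) + (30 / R) * heat_kernel y \<sigma>" for i and y :: "real^'n"
  proof -
    have "\<bar>heat_kernel_d i y \<sigma>\<bar> * \<bar>cutoff_d i R y\<bar> \<le> (?c * heat_kernel y (2 * \<sigma>)) * (6 / R)"
      using assms heat_kernel_d_bound[OF assms(1), of i y] by (intro mult_mono cutoff_bounds) auto
    moreover have "heat_kernel y \<sigma> * \<bar>cutoff_dd i R y\<bar> \<le> heat_kernel y \<sigma> * (30 / R)"
      using assms cutoff_bounds(4)[of R i y] RR by (intro mult_left_mono) auto
    ultimately show ?thesis
      using abs_triangle_ineq[of "2 * (heat_kernel_d i y \<sigma> * cutoff_d i R y)" "heat_kernel y \<sigma> * cutoff_dd i R y"]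
      by (simp add: abs_mult algebra_simps)
  qed
  have "\<bar>LINT y|lborel. err R \<sigma> y * w y s\<bar> \<le> (LINT y|lborel. \<bar>err R \<sigma> y * w y s\<bar>)"
    by (rule integral_abs_bound)
  also have "\<dots> \<le> (LINT y|lborel. (real CARD('n) * B * (12 * ?c / R)) * heat_kernel (y::real^'n) (2 * \<sigma>) + (real CARD('n) * B * (30 / R)) * heat_kernel y \<sigma>)"
  proof (rule integral_mono')
    show "integrable lborel (\<lambda>y. (real CARD('n) * B * (12 * ?c / R)) * heat_kernel (y::real^'n) (2 * \<sigma>) + (real CARD('n) * B * (30 / R)) * heat_kernel y \<sigma>)"
      using assms by (intro Bochner_Integration.integrable_add integrable_mult_right integrable_heat_kernel) auto
    fix y
    have "\<bar>err R \<sigma> y\<bar> \<le> (\<Sum>i\<in>(UNIV::'n set). (12 * ?c / R) * heat_kernel y (2 * \<sigma>) + (30 / R) * heat_kernel y \<sigma>)"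
      unfolding err_def by (intro order_trans[OF sum_abs] sum_mono term_bd)
    also have "\<dots> = real CARD('n) * ((12 * ?c / R) * heat_kernel y (2 * \<sigma>) + (30 / R) * heat_kernel y \<sigma>)" by simp
    finally have "\<bar>err R \<sigma> y\<bar> * \<bar>w y s\<bar> \<le> (real CARD('n) * ((12 * ?c / R) * heat_kernel y (2 * \<sigma>) + (30 / R) * heat_kernel y \<sigma>)) * B"
      using w_bound[OF assms(3), of y] by (intro mult_mono) auto
    then show "\<bar>err R \<sigma> y * w y s\<bar> \<le> (real CARD('n) * B * (12 * ?c / R)) * heat_kernel y (2 * \<sigma>) + (real CARD('n) * B * (30 / R)) * heat_kernel y \<sigma>"
      by (simp add: abs_mult algebra_simps)
  qed (use B_nonneg assms in simp)
  also have "\<dots> = (real CARD('n) * B * (12 * ?c / R)) + (real CARD('n) * B * (30 / R))"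
    using assms integrable_heat_kernel(1,3)[of "2 * \<sigma>", where 'n='n] integrable_heat_kernel(1,3)[of "\<sigma>", where 'n='n]
    by (subst Bochner_Integration.integral_add) auto
  finally show ?thesis by (simp add: algebra_simps add_divide_distrib)
qed

end

lemma integrable_heat_kernel_mult:
  fixes h :: "real^'n::finite \<Rightarrow> real"
  assumes "t > 0" and [measurable]: "h \<in> borel_measurable borel" and bd: "\<And>y. \<bar>h y\<bar> \<le> C"
  shows "integrable lborel (\<lambda>y. heat_kernel (a - y) t * h y)"
    and "integrable lborel (\<lambda>y. heat_kernel y t * h y)"
    and "\<bar>LINT y|lborel. heat_kernel (a - y) t * h y\<bar> \<le> C"
    and "\<bar>LINT y|lborel. heat_kernel y t * h y\<bar> \<le> C"
proof -
  have *: "integrable lborel (\<lambda>y. heat_kernel (a - y) t * h y)" "\<bar>LINT y|lborel. heat_kernel (a - y) t * h y\<bar> \<le> C" for a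
  proof -
    have "C \<ge> 0" using bd[of 0] by simp
    have i: "integrable lborel (\<lambda>y. heat_kernel (a - y) t * C)"
      using assms by (intro integrable_mult_left integrable_heat_kernel)
    have le: "\<bar>heat_kernel (a - y) t * h y\<bar> \<le> heat_kernel (a - y) t * C" for y
      using bd[of y] by (simp add: abs_mult mult_left_mono)
    show "integrable lborel (\<lambda>y. heat_kernel (a - y) t * h y)"
      by (rule Bochner_Integration.integrable_bound[OF i]) (auto intro!: AE_I2 order_trans[OF le])
    have "\<bar>LINT y|lborel. heat_kernel (a - y) t * h y\<bar> \<le> (LINT y|lborel. heat_kernel (a - y) t * C)"
      using integral_abs_bound integral_mono'[OF i le] by (rule order_trans) (simp add: \<open>C \<ge> 0\<close>)
    also have "\<dots> = C"
      using assms integral_translate_lborel(2)[of "\<lambda>y. heat_kernel y t" a] by (simp add: integrable_heat_kernel)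
    finally show "\<bar>LINT y|lborel. heat_kernel (a - y) t * h y\<bar> \<le> C" .
  qed
  show "integrable lborel (\<lambda>y. heat_kernel (a - y) t * h y)" "\<bar>LINT y|lborel. heat_kernel (a - y) t * h y\<bar> \<le> C"
    by (rule *)+
  show "integrable lborel (\<lambda>y. heat_kernel y t * h y)" "\<bar>LINT y|lborel. heat_kernel y t * h y\<bar> \<le> C"
    using *[of 0] by simp_all
qed

text \<open>Moves the time into the argument of h, whose continuity then takes care of the limit t
  -> 0 without an approximate identity argument.\<close>

lemma heat_kernel_integral_scaled:
  fixes h :: "real^'n::finite \<Rightarrow> real"
  assumes "t > 0" and [measurable]: "h \<in> borel_measurable borel"
  shows "(LINT y|lborel. heat_kernel y t * h y) = (LINT z|lborel. heat_kernel z 1 * h (sqrt t *\<^sub>R z))"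
proof -
  have "(LINT y|lborel. heat_kernel y t * h y)
      = sqrt t ^ CARD('n) * (LINT z|lborel. heat_kernel (sqrt t *\<^sub>R z) t * h (sqrt t *\<^sub>R z))"
    using assms(1) by (subst integral_scale_lborel[where c="sqrt t"]) auto
  also have "(LINT z|lborel. heat_kernel (sqrt t *\<^sub>R z) t * h (sqrt t *\<^sub>R z))
      = t powr (- (real CARD('n) / 2)) * (LINT z|lborel. heat_kernel z 1 * h (sqrt t *\<^sub>R z))"
    using assms(1) by (simp add: heat_kernel_scale mult.assoc)
  also have "sqrt t ^ CARD('n) * (t powr (- (real CARD('n) / 2)) * (LINT z|lborel. heat_kernel z 1 * h (sqrt t *\<^sub>R z)))
     = (LINT z|lborel. heat_kernel z 1 * h (sqrt t *\<^sub>R z))"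
    using assms(1) by (simp add: powr_half_sqrt[symmetric] powr_realpow[symmetric] powr_powr powr_add[symmetric] mult.assoc[symmetric])
  finally show ?thesis .
qed

lemma cutoff_integral_tendsto:
  fixes h :: "real^'n::finite \<Rightarrow> real"
  assumes "t > 0" and [measurable]: "h \<in> borel_measurable borel" and bd: "\<And>y. \<bar>h y\<bar> \<le> C"
  shows "(\<lambda>k. LINT y|lborel. heat_kernel y t * cutoff (real (Suc k)) y * h y) \<longlonglongrightarrow> (LINT y|lborel. heat_kernel y t * h y)"
proof (rule integral_dominated_convergence[where w="\<lambda>y. heat_kernel y t * C"])
  have [measurable]: "cutoff R \<in> borel_measurable borel" for R
    by (intro borel_measurable_continuous_onI continuous_intros)
  show "(\<lambda>y. heat_kernel y t * cutoff (real (Suc k)) y * h y) \<in> borel_measurable lborel" for k by measurable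
  show "(\<lambda>y. heat_kernel y t * h y) \<in> borel_measurable lborel" by measurable
  show "integrable lborel (\<lambda>y::real^'n. heat_kernel y t * C)"
    using assms by (intro integrable_mult_left integrable_heat_kernel)
  show "AE y in lborel. (\<lambda>k. heat_kernel y t * cutoff (real (Suc k)) y * h y) \<longlonglongrightarrow> heat_kernel y t * h y"
    using tendsto_mult[OF tendsto_mult[OF tendsto_const cutoff_tendsto_1] tendsto_const] by (intro AE_I2) fastforce
  show "AE y in lborel. norm (heat_kernel y t * cutoff (real (Suc k)) y * h y) \<le> heat_kernel y t * C" for k
  proof (rule AE_I2)
    fix y :: "real^'n"
    have "(heat_kernel y t * cutoff (real (Suc k)) y) * \<bar>h y\<bar> \<le> (heat_kernel y t * 1) * C"
      using bd[of y] cutoff_bounds(1,2)[of "real (Suc k)" y] by (intro mult_mono mult_left_mono) auto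
    then show "norm (heat_kernel y t * cutoff (real (Suc k)) y * h y) \<le> heat_kernel y t * C"
      using cutoff_bounds(1)[of "real (Suc k)" y] by (simp add: abs_mult)
  qed
qed

context inhom_heat begin

text \<open>For a fixed radius this is the fundamental theorem of calculus. The commutator is O(1/R)
  uniformly on [a, b], because t - s >= t - b > 0 there, and dominated convergence removes the
  cutoff.\<close>

lemma duhamel_interior:
  assumes "0 < a" "a \<le> b" "b < t"
  shows "((\<lambda>s. LINT y|lborel. heat_kernel y (t - s) * g y s) has_integral
    ((LINT y|lborel. heat_kernel y (t - b) * w y b) - (LINT y|lborel. heat_kernel y (t - a) * w y a))) {a..b}"
proof -
  define Jk where "Jk k s = (LINT y|lborel. heat_kernel y (t - s) * cutoff (real (Suc k)) y * w y s)" for k s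
  define ak where "ak k s = (LINT y|lborel. heat_kernel y (t - s) * cutoff (real (Suc k)) y * g y s)" for k s
  define ek where "ek k s = (LINT y|lborel. err (real (Suc k)) (t - s) y * w y s)" for k s
  define Ce where "Ce = B * real CARD('n) * (12 * 2 powr (real CARD('n) / 2) * (t - b) powr (- (1/2)) + 30)"
  have Ce: "Ce \<ge> 0" using B_nonneg by (simp add: Ce_def)
  have ek: "\<bar>ek k s\<bar> \<le> Ce / real (Suc k)" if "s \<in> {a..b}" for k s
  proof -
    have "\<bar>ek k s\<bar> \<le> B * real CARD('n) * (12 * 2 powr (real CARD('n) / 2) * (t - s) powr (- (1/2)) + 30) / real (Suc k)"
      unfolding ek_def using that assms by (intro err_integral_bound) auto
    also have "\<dots> \<le> Ce / real (Suc k)"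
      unfolding Ce_def using that assms B_nonneg by (intro divide_right_mono mult_left_mono add_right_mono powr_mono2') auto
    finally show ?thesis .
  qed
  have bdg: "\<bar>g y s\<bar> \<le> L" and bdw: "\<bar>w y s\<bar> \<le> B" if "s \<in> {a..b}" for s y
    using that assms by (auto intro: g_bound w_bound)
  have ak: "\<bar>ak k s\<bar> \<le> L" if s: "s \<in> {a..b}" for k s
  proof -
    have [measurable]: "cutoff R \<in> borel_measurable borel" for R
      by (intro borel_measurable_continuous_onI continuous_intros)
    have "\<bar>cutoff (real (Suc k)) y * g y s\<bar> \<le> L" for y
      using mult_mono[of "\<bar>cutoff (real (Suc k)) y\<bar>" 1 "\<bar>g y s\<bar>" L] cutoff_bounds(1,2)[of "real (Suc k)" y] bdg[OF s, of y] by (simp add: abs_mult)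
    then have "\<bar>LINT y|lborel. heat_kernel y (t - s) * (cutoff (real (Suc k)) y * g y s)\<bar> \<le> L"
      using s assms by (intro integrable_heat_kernel_mult) auto
    then show ?thesis by (simp add: ak_def mult.assoc)
  qed
  have lim: "(\<lambda>k. Jk k s) \<longlonglongrightarrow> (LINT y|lborel. heat_kernel y (t - s) * w y s)" "(\<lambda>k. ak k s) \<longlonglongrightarrow> (LINT y|lborel. heat_kernel y (t - s) * g y s)"
    "(\<lambda>k. ek k s) \<longlonglongrightarrow> 0" if s: "s \<in> {a..b}" for s
  proof -
    show "(\<lambda>k. Jk k s) \<longlonglongrightarrow> (LINT y|lborel. heat_kernel y (t - s) * w y s)"
      unfolding Jk_def using s assms bdw[OF s] by (intro cutoff_integral_tendsto) auto
    show "(\<lambda>k. ak k s) \<longlonglongrightarrow> (LINT y|lborel. heat_kernel y (t - s) * g y s)"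
      unfolding ak_def using s assms bdg[OF s] by (intro cutoff_integral_tendsto) auto
    have "(\<lambda>k. Ce * inverse (real (Suc k))) \<longlonglongrightarrow> Ce * 0"
      by (intro tendsto_intros LIMSEQ_inverse_real_of_nat)
    then have "(\<lambda>k. Ce / real (Suc k)) \<longlonglongrightarrow> 0" by (simp add: divide_inverse)
    then show "(\<lambda>k. ek k s) \<longlonglongrightarrow> 0"
      by (rule Lim_null_comparison[rotated]) (use ek[OF s] in auto)
  qed
  show ?thesis
  proof (rule has_integral_dominated_convergence[where f="\<lambda>k s. ak k s + ek k s" and y="\<lambda>k. Jk k b - Jk k a" and h="\<lambda>s. L + Ce"])
    show "((\<lambda>s. ak k s + ek k s) has_integral Jk k b - Jk k a) {a..b}" for k
    proof (rule fundamental_theorem_of_calculus)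
      fix s assume "s \<in> {a..b}"
      then have "(Jk k has_real_derivative (ak k s + ek k s)) (at s)"
        unfolding Jk_def[abs_def] ak_def ek_def using assms by (intro localized_derivative) auto
      then show "(Jk k has_vector_derivative (ak k s + ek k s)) (at s within {a..b})"
        by (auto simp: has_real_derivative_iff_has_vector_derivative intro: has_vector_derivative_at_within)
    qed (use assms in auto)
    show "(\<lambda>s. L + Ce) integrable_on {a..b}" by (rule integrable_const_ivl)
    show "\<forall>s\<in>{a..b}. norm (ak k s + ek k s) \<le> L + Ce" for k
    proof
      fix s assume s: "s \<in> {a..b}"
      have "Ce / real (Suc k) \<le> Ce" using Ce by (simp add: divide_le_eq mult_le_cancel_left1)
      then show "norm (ak k s + ek k s) \<le> L + Ce" using ak[OF s, of k] ek[OF s, of k] by simp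
    qed
    show "\<forall>s\<in>{a..b}. (\<lambda>k. ak k s + ek k s) \<longlonglongrightarrow> (LINT y|lborel. heat_kernel y (t - s) * g y s)"
      using tendsto_add[OF lim(2,3)] by simp
    show "(\<lambda>k. Jk k b - Jk k a) \<longlonglongrightarrow> (LINT y|lborel. heat_kernel y (t - b) * w y b) - (LINT y|lborel. heat_kernel y (t - a) * w y a)"
      using assms by (intro tendsto_diff lim) auto
  qed
qed

text \<open>One statement for both ends of the time interval: for r = t the scaled argument is 0 and
  the limit becomes w at the origin, for r = 0 it is the heat average of the initial value.\<close>

lemma heat_average_tendsto:
  assumes s: "\<And>k. 0 \<le> s k \<and> s k < t" "s \<longlonglongrightarrow> r" "0 \<le> r" "r \<le> t"
  shows "(\<lambda>k. LINT y|lborel. heat_kernel y (t - s k) * w y (s k)) \<longlonglongrightarrow> (LINT z|lborel. heat_kernel z 1 * w (sqrt (t - r) *\<^sub>R z) r)"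
proof -
  have eq: "(LINT y|lborel. heat_kernel y (t - s k) * w y (s k)) = (LINT z|lborel. heat_kernel z 1 * w (sqrt (t - s k) *\<^sub>R z) (s k))" for k
    using s(1)[of k] by (intro heat_kernel_integral_scaled) auto
  have m[measurable]: "(\<lambda>z. w (c *\<^sub>R z) q) \<in> borel_measurable borel" if "q \<ge> 0" for c q
    using measurable_compose[of "\<lambda>z. c *\<^sub>R z" borel borel "\<lambda>z. w z q"] slice_measurable[OF that] by simp
  show ?thesis unfolding eq
  proof (rule integral_dominated_convergence[where w="\<lambda>z. heat_kernel z 1 * B"])
    show "(\<lambda>z. heat_kernel z 1 * w (sqrt (t - r) *\<^sub>R z) r) \<in> borel_measurable lborel"
      "(\<lambda>z. heat_kernel z 1 * w (sqrt (t - s k) *\<^sub>R z) (s k)) \<in> borel_measurable lborel" for k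
      using m[OF s(3)] m[of "s k"] s(1)[of k] by (auto intro!: borel_measurable_times)
    show "integrable lborel (\<lambda>z::real^'n. heat_kernel z 1 * B)"
      by (intro integrable_mult_left integrable_heat_kernel) simp
    show "AE z in lborel. (\<lambda>k. heat_kernel z 1 * w (sqrt (t - s k) *\<^sub>R z) (s k)) \<longlonglongrightarrow> heat_kernel z 1 * w (sqrt (t - r) *\<^sub>R z) r"
    proof (rule AE_I2)
      fix z :: "real^'n"
      have "(\<lambda>k. (\<lambda>(x, t). w x t) (sqrt (t - s k) *\<^sub>R z, s k)) \<longlonglongrightarrow> (\<lambda>(x, t). w x t) (sqrt (t - r) *\<^sub>R z, r)"
        using s by (intro continuous_on_tendsto_compose[OF w_cont] tendsto_intros) (auto intro!: always_eventually)
      then show "(\<lambda>k. heat_kernel z 1 * w (sqrt (t - s k) *\<^sub>R z) (s k)) \<longlonglongrightarrow> heat_kernel z 1 * w (sqrt (t - r) *\<^sub>R z) r"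
        by (intro tendsto_mult tendsto_const) simp
    qed
    show "AE z in lborel. norm (heat_kernel z 1 * w (sqrt (t - s k) *\<^sub>R z) (s k)) \<le> heat_kernel z 1 * B" for k
      using w_bound[of "s k"] s(1)[of k] by (intro AE_I2) (simp add: abs_mult mult_left_mono)
  qed
qed

lemma duhamel_origin:
  assumes t: "t > 0"
  shows "((\<lambda>s. LINT y|lborel. heat_kernel y (t - s) * g y s) has_integral (w 0 t - (LINT y|lborel. heat_kernel y t * w y 0))) {0<..<t}"
proof -
  define a where "a s = (LINT y|lborel. heat_kernel y (t - s) * g y s)" for s
  define J where "J s = (LINT y|lborel. heat_kernel y (t - s) * w y s)" for s
  \<comment> \<open>t/(k+2) is at most t/2, so [p k, t - p k] is a genuine interval even for k =
    0.\<close>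
  define p where "p k = t * inverse (real (Suc (Suc k)))" for k
  have p: "0 < p k" "p k \<le> t - p k" "p k < t" for k
  proof -
    have "inverse (real (Suc (Suc k))) \<le> 1 / 2" by (simp add: divide_simps)
    then have "p k \<le> t * (1 / 2)" unfolding p_def using t by (intro mult_left_mono) auto
    moreover show "0 < p k" using t by (simp add: p_def)
    ultimately show "p k \<le> t - p k" "p k < t" using t by linarith+
  qed
  have p0: "p \<longlonglongrightarrow> 0"
    using tendsto_mult[OF tendsto_const LIMSEQ_Suc[OF LIMSEQ_inverse_real_of_nat], of t] by (simp add: p_def[abs_def])
  have absa: "\<bar>a s\<bar> \<le> L" if "s \<in> {0<..<t}" for s
    unfolding a_def using that g_bound[of s] by (intro integrable_heat_kernel_mult) auto
  have "((\<lambda>s. a s) has_integral (w 0 t - (LINT y|lborel. heat_kernel y t * w y 0))) {0<..<t}"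
  proof (rule has_integral_dominated_convergence[where f="\<lambda>k s. if s \<in> {p k..t - p k} then a s else 0" and y="\<lambda>k. J (t - p k) - J (p k)" and h="\<lambda>s. L"])
    show "((\<lambda>s. if s \<in> {p k..t - p k} then a s else 0) has_integral J (t - p k) - J (p k)) {0<..<t}" for k
    proof -
      have "(a has_integral J (t - p k) - J (p k)) {p k..t - p k}"
        unfolding a_def[abs_def] J_def using p[of k] by (intro duhamel_interior) auto
      then show ?thesis using p[of k] by (subst has_integral_restrict) auto
    qed
    show "(\<lambda>s. L) integrable_on {0<..<t}"
      using integrable_on_Icc_iff_Ioo integrable_const_ivl by blast
    show "\<forall>s\<in>{0<..<t}. norm (if s \<in> {p k..t - p k} then a s else 0) \<le> L" for k
      using absa L_nonneg by auto
    show "\<forall>s\<in>{0<..<t}. (\<lambda>k. if s \<in> {p k..t - p k} then a s else 0) \<longlonglongrightarrow> a s"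
    proof
      fix s assume s: "s \<in> {0<..<t}"
      have "\<forall>\<^sub>F k in sequentially. p k < min s (t - s)"
        using s by (intro order_tendstoD[OF p0]) auto
      then have "\<forall>\<^sub>F k in sequentially. (if s \<in> {p k..t - p k} then a s else 0) = a s"
        by eventually_elim auto
      then show "(\<lambda>k. if s \<in> {p k..t - p k} then a s else 0) \<longlonglongrightarrow> a s"
        by (rule tendsto_eventually)
    qed
    show "(\<lambda>k. J (t - p k) - J (p k)) \<longlonglongrightarrow> w 0 t - (LINT y|lborel. heat_kernel y t * w y 0)"
    proof (intro tendsto_diff)
      have "(\<lambda>k. t - p k) \<longlonglongrightarrow> t - 0" by (intro tendsto_intros p0)
      then have "(\<lambda>k. J (t - p k)) \<longlonglongrightarrow> (LINT z|lborel. heat_kernel z 1 * w (sqrt (t - t) *\<^sub>R z) t)"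
        unfolding J_def using p t by (intro heat_average_tendsto) (auto simp: less_imp_le)
      then show "(\<lambda>k. J (t - p k)) \<longlonglongrightarrow> w 0 t" by (simp add: integrable_heat_kernel)
      have "(\<lambda>k. J (p k)) \<longlonglongrightarrow> (LINT z|lborel. heat_kernel z 1 * w (sqrt (t - 0) *\<^sub>R z) 0)"
        unfolding J_def using p t p0 by (intro heat_average_tendsto) (auto simp: less_imp_le)
      then show "(\<lambda>k. J (p k)) \<longlonglongrightarrow> (LINT y|lborel. heat_kernel y t * w y 0)"
        using t by (subst heat_kernel_integral_scaled) auto
    qed
  qed
  then show ?thesis by (simp add: a_def)
qed

text \<open>Duhamel's formula is available at the origin; the hypotheses are translation invariant,
  which carries it to every point.\<close>

lemma translate: "inhom_heat (\<lambda>y. w (a + y)) (\<lambda>y. g (a + y)) (\<lambda>i y. w1 i (a + y)) (\<lambda>i y. w2 i (a + y)) B L"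
proof
  have tr: "continuous_on (UNIV \<times> T) (\<lambda>(x, t). f (a + x) t)" if "continuous_on (UNIV \<times> T) (\<lambda>(x, t). f x t)" for f :: "real^'n \<Rightarrow> real \<Rightarrow> real" and T
  proof -
    have "continuous_on (UNIV \<times> T) (\<lambda>p. case (a + fst p, snd p) of (x, t) \<Rightarrow> f x t)"
      by (rule continuous_on_compose2[OF that]) (auto intro!: continuous_intros)
    then show ?thesis by (simp add: case_prod_beta)
  qed
  show "continuous_on (UNIV \<times> {0..}) (\<lambda>(x, t). w (a + x) t)" "continuous_on (UNIV \<times> {0<..}) (\<lambda>(x, t). g (a + x) t)"
    "continuous_on (UNIV \<times> {0<..}) (\<lambda>(x, t). w1 i (a + x) t)" "continuous_on (UNIV \<times> {0<..}) (\<lambda>(x, t). w2 i (a + x) t)" for i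
    by (auto intro!: tr w_cont g_cont w1_cont w2_cont)
  show "(\<lambda>(x, t). g (a + x) t) \<in> borel_measurable borel"
    unfolding case_prod_beta borel_prod[symmetric] by measurable
  show "has_partial i (\<lambda>y. w (a + y) t) (w1 i (a + x) t) x" if "t > 0" for i x t
    using has_partial_translate[OF w_partial[OF that, of i "a + x"]] .
  show "has_partial i (\<lambda>y. w1 i (a + y) t) (w2 i (a + x) t) x" if "t > 0" for i x t
    using has_partial_translate[OF w1_partial[OF that, of i "a + x"]] .
  show "\<bar>w (a + x) t\<bar> \<le> B" if "t \<ge> 0" for x t by (rule w_bound[OF that])
  show "\<bar>g (a + x) t\<bar> \<le> L" if "t > 0" for x t by (rule g_bound[OF that])
  show "(w (a + x) has_real_derivative (\<Sum>i\<in>UNIV. w2 i (a + x) t) + g (a + x) t) (at t)" if "t > 0" for x t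
    by (rule w_time[OF that])
qed

theorem duhamel:
  assumes t: "t > 0"
  shows "integrable lborel (\<lambda>s. indicator {0<..<t} s * (LINT y|lborel. heat_kernel (x - y) (t - s) * g y s))"
    and "w x t = (LINT y|lborel. heat_kernel (x - y) t * w y 0)
      + (LINT s|lborel. indicator {0<..<t} s * (LINT y|lborel. heat_kernel (x - y) (t - s) * g y s))"
proof -
  interpret T: inhom_heat "\<lambda>y. w (x + y)" "\<lambda>y. g (x + y)" "\<lambda>i y. w1 i (x + y)" "\<lambda>i y. w2 i (x + y)" B L
    by (rule translate)
  define A where "A s = (LINT y|lborel. heat_kernel (x - y) (t - s) * g y s)" for s
  have tr: "(LINT y|lborel. heat_kernel y r * h (x + y)) = (LINT y|lborel. heat_kernel (x - y) r * h y)"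
    if [measurable]: "h \<in> borel_measurable borel" for h r
    using integral_translate_lborel(1)[of "\<lambda>y. heat_kernel (x - y) r * h y" x] by simp
  have "((\<lambda>s. LINT y|lborel. heat_kernel y (t - s) * g (x + y) s) has_integral (w (x + 0) t - (LINT y|lborel. heat_kernel y t * w (x + y) 0))) {0<..<t}"
    by (rule T.duhamel_origin[OF t])
  then have hi: "(A has_integral (w x t - (LINT y|lborel. heat_kernel (x - y) t * w y 0))) {0<..<t}"
    unfolding A_def[abs_def] by (subst (asm) (1 2) tr) simp_all
  have [measurable]: "A \<in> borel_measurable borel" unfolding A_def[abs_def] by measurable
  have bd: "\<bar>A s\<bar> \<le> L" if "s \<in> {0<..<t}" for s
    unfolding A_def using that g_bound[of s] by (intro integrable_heat_kernel_mult) auto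
  have int: "integrable lborel (\<lambda>s. indicator {0<..<t} s * A s)"
  proof (rule Bochner_Integration.integrable_bound[where f="\<lambda>s. L * indicator {0<..<t} s"])
    show "integrable lborel (\<lambda>s. L * indicator {0<..<t} s :: real)"
      using t by (intro integrable_mult_right integrable_real_indicator) auto
  qed (use bd L_nonneg in \<open>auto simp: indicator_def\<close>)
  then show "integrable lborel (\<lambda>s. indicator {0<..<t} s * (LINT y|lborel. heat_kernel (x - y) (t - s) * g y s))"
    by (simp add: A_def)
  have "((\<lambda>s. indicator {0<..<t} s * A s) has_integral (LINT s|lborel. indicator {0<..<t} s * A s)) UNIV"
    by (rule has_integral_integral_lborel[OF int])
  moreover have "(\<lambda>s. indicator {0<..<t} s * A s) = (\<lambda>s. if s \<in> {0<..<t} then A s else 0)"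
    by (auto simp: indicator_def)
  ultimately have "(A has_integral (LINT s|lborel. indicator {0<..<t} s * A s)) {0<..<t}"
    using has_integral_restrict_UNIV[of "{0<..<t}" A] by simp
  with hi have "w x t - (LINT y|lborel. heat_kernel (x - y) t * w y 0) = (LINT s|lborel. indicator {0<..<t} s * A s)"
    by (rule has_integral_unique)
  then show "w x t = (LINT y|lborel. heat_kernel (x - y) t * w y 0)
      + (LINT s|lborel. indicator {0<..<t} s * (LINT y|lborel. heat_kernel (x - y) (t - s) * g y s))"
    by (simp add: A_def)
qed

end

section \<open>The gradient form of Duhamel's formula\<close>

lemma ennreal_abs_integral_le:
  fixes f :: "'a \<Rightarrow> real"
  shows "ennreal \<bar>LINT x|M. f x\<bar> \<le> (\<integral>\<^sup>+x. ennreal \<bar>f x\<bar> \<partial>M)"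
proof (cases "integrable M f")
  case True
  then show ?thesis using integral_norm_bound_ennreal[OF True] by simp
qed (simp add: not_integrable_integral_eq)

lemma ennreal_abs_triangle: "ennreal \<bar>a + b\<bar> \<le> ennreal \<bar>a\<bar> + ennreal \<bar>b\<bar>"
  using ennreal_leI[OF abs_triangle_ineq[of a b]] by simp

text \<open>The mean value theorem turns the bound on \<open>k'\<close> into a majorant of the
  difference quotients, so dominated convergence applies along every sequence. Measurability of
  \<open>k' 0\<close> comes for free, as a limit of measurable quotients.\<close>

lemma DERIV_integral:
  fixes k k' :: "real \<Rightarrow> 'b \<Rightarrow> real"
  assumes int: "\<And>h. \<bar>h\<bar> < 1 \<Longrightarrow> integrable M (k h)"
    and der: "\<And>h y. \<bar>h\<bar> < 1 \<Longrightarrow> ((\<lambda>h. k h y) has_real_derivative k' h y) (at h)"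
    and bd: "\<And>h y. \<bar>h\<bar> < 1 \<Longrightarrow> \<bar>k' h y\<bar> \<le> D y"
    and D: "integrable M D"
  shows "((\<lambda>h. LINT y|M. k h y) has_real_derivative (LINT y|M. k' 0 y)) (at 0)"
proof -
  let ?S = "{-1<..<1::real}"
  have lim: "((\<lambda>h. ((LINT y|M. k h y) - (LINT y|M. k 0 y)) / h) \<longlongrightarrow> (LINT y|M. k' 0 y)) (at 0 within ?S)"
    unfolding tendsto_at_iff_sequentially
  proof (intro allI impI)
    fix X :: "nat \<Rightarrow> real" assume X: "\<forall>j. X j \<in> ?S - {0}" "X \<longlonglongrightarrow> 0"
    have X1: "\<bar>X j\<bar> < 1" "X j \<noteq> 0" for j using X(1) by (auto simp: abs_less_iff)
    have m: "(\<lambda>y. (k (X j) y - k 0 y) / X j) \<in> borel_measurable M" for j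
      using int[OF X1(1)[of j]] int[of 0] by (auto intro!: borel_measurable_divide borel_measurable_diff)
    have l: "(\<lambda>j. (k (X j) y - k 0 y) / X j) \<longlonglongrightarrow> k' 0 y" for y
    proof -
      have "((\<lambda>h. (k h y - k 0 y) / h) \<longlongrightarrow> k' 0 y) (at 0)"
        using der[of 0 y] by (simp add: has_field_derivative_iff)
      moreover have "filterlim X (at 0) sequentially"
        using X X1 by (auto simp: filterlim_at)
      ultimately show ?thesis by (rule filterlim_compose)
    qed
    have b: "\<bar>(k (X j) y - k 0 y) / X j\<bar> \<le> D y" for j y
    proof -
      have "\<exists>z. \<bar>z\<bar> < 1 \<and> k (X j) y - k 0 y = X j * k' z y"
      proof (cases "X j > 0")
        case True
        have "\<exists>z. 0 < z \<and> z < X j \<and> k (X j) y - k 0 y = (X j - 0) * k' z y"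
          using X1[of j] True by (intro MVT2 der) auto
        then obtain z where "0 < z" "z < X j" "k (X j) y - k 0 y = (X j - 0) * k' z y" by blast
        then show ?thesis using X1[of j] by (intro exI[of _ z]) auto
      next
        case False
        have "\<exists>z. X j < z \<and> z < 0 \<and> k 0 y - k (X j) y = (0 - X j) * k' z y"
          using X1[of j] False by (intro MVT2 der) auto
        then obtain z where "X j < z" "z < 0" "k 0 y - k (X j) y = (0 - X j) * k' z y" by blast
        then show ?thesis using X1[of j] by (intro exI[of _ z]) auto
      qed
      then obtain z where "\<bar>z\<bar> < 1" "k (X j) y - k 0 y = X j * k' z y" by blast
      then show ?thesis using bd[of z y] X1(2)[of j] by simp
    qed
    have "(\<lambda>j. LINT y|M. (k (X j) y - k 0 y) / X j) \<longlonglongrightarrow> (LINT y|M. k' 0 y)"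
    proof (rule integral_dominated_convergence[where w=D])
      show "k' 0 \<in> borel_measurable M"
        using l m by (rule borel_measurable_LIMSEQ_real)
    qed (use l m b D in auto)
    moreover have "(LINT y|M. (k (X j) y - k 0 y) / X j) = ((LINT y|M. k (X j) y) - (LINT y|M. k 0 y)) / X j" for j
      using int[OF X1(1)[of j]] int[of 0] by simp
    ultimately have "(\<lambda>j. ((LINT y|M. k (X j) y) - (LINT y|M. k 0 y)) / X j) \<longlonglongrightarrow> (LINT y|M. k' 0 y)"
      by (simp only:)
    then show "((\<lambda>h. ((LINT y|M. k h y) - (LINT y|M. k 0 y)) / h) \<circ> X) \<longlonglongrightarrow> (LINT y|M. k' 0 y)"
      by (simp add: comp_def)
  qed
  have "at (0::real) within ?S = at 0" by (rule at_within_open) auto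
  with lim show ?thesis by (simp add: has_field_derivative_iff)
qed

text \<open>Supplies one integrable majorant for all shifts of length at most 1, as needed for
  differentiating under the integral and for the continuity of translations in L^1.\<close>

lemma heat_kernel_shift:
  fixes z :: "real^'n::finite"
  assumes "t > 0" "norm v \<le> 1"
  shows "heat_kernel (z + v) t \<le> 2 powr (real CARD('n) / 2) * exp (1 / (4 * t)) * heat_kernel z (2 * t)"
proof -
  have "norm z \<le> norm (z + v) + norm v" using norm_triangle_ineq4[of "z + v" v] by simp
  then have "(norm z)\<^sup>2 \<le> (norm (z + v) + norm v)\<^sup>2" by (intro power_mono) auto
  also have "\<dots> \<le> 2 * (norm (z + v))\<^sup>2 + 2 * (norm v)\<^sup>2"
    using zero_le_power2[of "norm (z + v) - norm v"] by (simp add: power2_eq_square algebra_simps)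
  also have "(norm v)\<^sup>2 \<le> 1" using assms by (simp add: power_le_one)
  finally have "(norm z)\<^sup>2 / (8 * t) \<le> (2 * (norm (z + v))\<^sup>2 + 2) / (8 * t)"
    using assms by (intro divide_right_mono) auto
  then have "- ((norm (z + v))\<^sup>2 / (4 * t)) \<le> 1 / (4 * t) + - ((norm z)\<^sup>2 / (8 * t))"
    using assms by (simp add: add_divide_distrib)
  then have "exp (- ((norm (z + v))\<^sup>2 / (4 * t))) \<le> exp (1 / (4 * t)) * exp (- ((norm z)\<^sup>2 / (8 * t)))"
    by (simp add: exp_add[symmetric])
  then have "(4 * pi * t) powr (- (real CARD('n) / 2)) * exp (- ((norm (z + v))\<^sup>2 / (4 * t)))
     \<le> (4 * pi * t) powr (- (real CARD('n) / 2)) * (exp (1 / (4 * t)) * exp (- ((norm z)\<^sup>2 / (8 * t))))"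
    by (intro mult_left_mono) auto
  also have "\<dots> = exp (1 / (4 * t)) * (2 powr (real CARD('n) / 2) * heat_kernel z (2 * t))"
    unfolding heat_kernel_double[OF assms(1)] by simp
  finally show ?thesis by (simp add: heat_kernel_def mult_ac)
qed

text \<open>The constant of \<open>heat_kernel_d_bound\<close>; the type argument records the
  dimension, on which alone it depends.\<close>

definition kconst :: "'n::finite itself \<Rightarrow> real" where
  "kconst _ = 2 powr (real CARD('n) / 2)"

lemma kconst_ge_1: "kconst TYPE('n::finite) \<ge> 1"
  by (simp add: kconst_def ge_one_powr_ge_zero)

lemma nn_integral_heat_kernel_d_le:
  fixes h :: "real^'n::finite \<Rightarrow> real"
  assumes "t > 0" and [measurable]: "h \<in> borel_measurable borel"
  shows "(\<integral>\<^sup>+y. ennreal \<bar>heat_kernel_d i (x - y) t * h y\<bar> \<partial>lborel)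
    \<le> ennreal (kconst TYPE('n) * t powr (- (1/2))) * heat_nn (2 * t) (\<lambda>y. ennreal \<bar>h y\<bar>) x"
proof -
  have "(\<integral>\<^sup>+y. ennreal \<bar>heat_kernel_d i (x - y) t * h y\<bar> \<partial>lborel)
     \<le> (\<integral>\<^sup>+y. ennreal (kconst TYPE('n) * t powr (- (1/2))) * (ennreal (heat_kernel (x - y) (2 * t)) * ennreal \<bar>h y\<bar>) \<partial>lborel)"
  proof (rule nn_integral_mono)
    fix y
    have "\<bar>heat_kernel_d i (x - y) t * h y\<bar> \<le> kconst TYPE('n) * t powr (- (1/2)) * heat_kernel (x - y) (2 * t) * \<bar>h y\<bar>"
      unfolding abs_mult kconst_def using heat_kernel_d_bound[OF assms(1), of i "x - y"] by (intro mult_right_mono) auto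
    also have "ennreal \<dots> = ennreal (kconst TYPE('n) * t powr (- (1/2))) * (ennreal (heat_kernel (x - y) (2 * t)) * ennreal \<bar>h y\<bar>)"
      using kconst_ge_1[where 'n='n] by (simp add: ennreal_mult mult.assoc)
    finally show "ennreal \<bar>heat_kernel_d i (x - y) t * h y\<bar> \<le> \<dots>" by (simp add: ennreal_leI)
  qed
  also have "\<dots> = ennreal (kconst TYPE('n) * t powr (- (1/2))) * heat_nn (2 * t) (\<lambda>y. ennreal \<bar>h y\<bar>) x"
    unfolding heat_nn_def by (rule nn_integral_cmult) measurable
  finally show ?thesis .
qed

lemma heat_kernel_d_integral_bound:
  fixes h :: "real^'n::finite \<Rightarrow> real"
  assumes "t > 0" and [measurable]: "h \<in> borel_measurable borel" and bd: "\<And>y. \<bar>h y\<bar> \<le> C"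
  shows "\<bar>LINT y|lborel. heat_kernel_d i (x - y) t * h y\<bar> \<le> kconst TYPE('n) * C * t powr (- (1/2))"
proof -
  have C: "C \<ge> 0" using bd[of 0] by simp
  have "ennreal \<bar>LINT y|lborel. heat_kernel_d i (x - y) t * h y\<bar> \<le> (\<integral>\<^sup>+y. ennreal \<bar>heat_kernel_d i (x - y) t * h y\<bar> \<partial>lborel)"
    by (rule ennreal_abs_integral_le)
  also have "\<dots> \<le> ennreal (kconst TYPE('n) * t powr (- (1/2))) * heat_nn (2 * t) (\<lambda>y. ennreal \<bar>h y\<bar>) x"
    using assms by (intro nn_integral_heat_kernel_d_le) auto
  also have "\<dots> \<le> ennreal (kconst TYPE('n) * t powr (- (1/2))) * ennreal C"
    using assms bd by (intro mult_left_mono heat_nn_sup) (auto intro: ennreal_leI)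
  also have "\<dots> = ennreal (kconst TYPE('n) * C * t powr (- (1/2)))"
    using C kconst_ge_1[where 'n='n] by (simp add: ennreal_mult[symmetric] mult_ac)
  finally show ?thesis using C kconst_ge_1[where 'n='n] by (simp add: ennreal_le_iff)
qed

lemma has_partial_heat_average:
  fixes h :: "real^'n::finite \<Rightarrow> real"
  assumes "t > 0" and [measurable]: "h \<in> borel_measurable borel" and bd: "\<And>y. \<bar>h y\<bar> \<le> C"
  shows "has_partial i (\<lambda>x. LINT y|lborel. heat_kernel (x - y) t * h y) (LINT y|lborel. heat_kernel_d i (x - y) t * h y) x"
proof -
  let ?e = "axis i 1 :: real^'n"
  have C: "C \<ge> 0" using bd[of 0] by simp
  \<comment> \<open>The derivative bound doubles the time and the shift doubles it again, whence the
    majorant is a kernel at time 4 t.\<close>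
  let ?K = "kconst TYPE('n) * t powr (- (1/2)) * (kconst TYPE('n) * exp (1 / (4 * (2 * t))))"
  have "((\<lambda>r. LINT y|lborel. heat_kernel (x + r *\<^sub>R ?e - y) t * h y) has_real_derivative
      (LINT y|lborel. heat_kernel_d i (x + 0 *\<^sub>R ?e - y) t * h y)) (at 0)"
  proof (rule DERIV_integral[where D="\<lambda>y. ?K * C * heat_kernel (x - y) (2 * (2 * t))"])
    show "integrable lborel (\<lambda>y. heat_kernel (x + r *\<^sub>R ?e - y) t * h y)" for r
      by (rule integrable_heat_kernel_mult) (use assms in auto)
    show "integrable lborel (\<lambda>y. ?K * C * heat_kernel (x - y) (2 * (2 * t)))"
      using assms by (intro integrable_mult_right integrable_heat_kernel) auto
    fix r y
    have "((\<lambda>r. heat_kernel ((x - y) + r *\<^sub>R ?e) t) has_real_derivative heat_kernel_d i ((x - y) + r *\<^sub>R ?e) t) (at r)"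
      using assms by (intro has_partial_line has_partial_heat_kernel)
    then show "((\<lambda>r. heat_kernel (x + r *\<^sub>R ?e - y) t * h y) has_real_derivative heat_kernel_d i (x + r *\<^sub>R ?e - y) t * h y) (at r)"
      by (intro DERIV_cmult_right) (simp add: algebra_simps)
    assume r: "\<bar>r\<bar> < 1"
    have "\<bar>heat_kernel_d i ((x - y) + r *\<^sub>R ?e) t\<bar> \<le> kconst TYPE('n) * t powr (- (1/2)) * heat_kernel ((x - y) + r *\<^sub>R ?e) (2 * t)"
      unfolding kconst_def by (rule heat_kernel_d_bound) fact
    also have "\<dots> \<le> kconst TYPE('n) * t powr (- (1/2)) * (kconst TYPE('n) * exp (1 / (4 * (2 * t))) * heat_kernel (x - y) (2 * (2 * t)))"
      using assms r kconst_ge_1[where 'n='n] heat_kernel_shift[of "2 * t" "r *\<^sub>R ?e" "x - y"] by (intro mult_left_mono) (auto simp: kconst_def)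
    finally have "\<bar>heat_kernel_d i ((x - y) + r *\<^sub>R ?e) t\<bar> * \<bar>h y\<bar> \<le> (?K * heat_kernel (x - y) (2 * (2 * t))) * C"
      using bd[of y] kconst_ge_1[where 'n='n] by (intro mult_mono) (auto simp: mult_ac)
    then show "\<bar>heat_kernel_d i (x + r *\<^sub>R ?e - y) t * h y\<bar> \<le> ?K * C * heat_kernel (x - y) (2 * (2 * t))"
      by (simp add: abs_mult algebra_simps)
  qed
  then show ?thesis by (simp add: has_partial_def)
qed

lemma nn_integral_powr_half:
  fixes a t :: real
  assumes "a \<le> t"
  shows "(\<integral>\<^sup>+s. indicator {a<..<t} s * ennreal ((t - s) powr (- (1/2))) \<partial>lborel) = ennreal (2 * (t - a) powr (1/2))"
proof -
  let ?f = "\<lambda>s. if s \<in> {0..t - a} then s powr (- (1/2)) else (0::real)"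
  have "((\<lambda>s. s powr (- (1/2))) has_integral (t - a) powr (- (1/2) + 1) / (- (1/2) + 1)) {0..t - a}"
    using assms by (intro has_integral_powr_from_0) auto
  then have "(?f has_integral 2 * (t - a) powr (1/2)) UNIV"
    by (subst has_integral_restrict_UNIV) (simp add: mult.commute)
  then have "(\<integral>\<^sup>+s. ennreal (?f s) \<partial>lborel) = ennreal (2 * (t - a) powr (1/2))"
    by (rule nn_integral_has_integral_lborel[rotated 2]) auto
  moreover have "(\<integral>\<^sup>+s. ennreal (?f s) \<partial>lborel) = (\<integral>\<^sup>+s. ennreal (?f (t - s)) \<partial>lborel)"
    by (rule nn_integral_translate_lborel(2)[symmetric]) measurable
  \<comment> \<open>Only the end point a has to be discarded as a null set: at s = t both sides are
    0, because \<open>0 powr (- (1/2))\<close> is 0.\<close>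
  moreover have "(\<integral>\<^sup>+s. ennreal (?f (t - s)) \<partial>lborel) = (\<integral>\<^sup>+s. indicator {a<..<t} s * ennreal ((t - s) powr (- (1/2))) \<partial>lborel)"
    by (intro nn_integral_cong_AE AE_mp[OF AE_lborel_singleton[of a] AE_I2])
      (auto simp: indicator_def)
  ultimately show ?thesis by simp
qed

lemma integrable_powr_half:
  fixes t :: real
  assumes "t > 0"
  shows "integrable lborel (\<lambda>s. indicator {0<..<t} s * (t - s) powr (- (1/2)))"
proof (rule integrableI_nonneg)
  have "(\<integral>\<^sup>+s. ennreal (indicator {0<..<t} s * (t - s) powr (- (1/2))) \<partial>lborel) = (\<integral>\<^sup>+s. indicator {0<..<t} s * ennreal ((t - s) powr (- (1/2))) \<partial>lborel)"
    by (intro nn_integral_cong) (auto simp: indicator_def)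
  then show "(\<integral>\<^sup>+s. ennreal (indicator {0<..<t} s * (t - s) powr (- (1/2))) \<partial>lborel) < \<infinity>"
    using nn_integral_powr_half[of 0 t] assms by simp
qed auto

context inhom_heat begin

text \<open>The kernel derivative costs (t - s)^(-1/2), which is integrable up to s = t; this
  majorant allows both terms of Duhamel's formula to be differentiated. Uniqueness of derivatives
  identifies the result with \<open>w1\<close>.\<close>

theorem duhamel_gradient:
  assumes t: "t > 0"
  shows "w1 i x t = (LINT y|lborel. heat_kernel_d i (x - y) t * w y 0)
      + (LINT s|lborel. indicator {0<..<t} s * (LINT y|lborel. heat_kernel_d i (x - y) (t - s) * g y s))"
proof -
  let ?e = "axis i 1 :: real^'n"
  have gb: "\<bar>g y s\<bar> \<le> L" if "s \<in> {0<..<t}" for s y using that g_bound by auto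
  have "((\<lambda>r. LINT s|lborel. indicator {0<..<t} s * (LINT y|lborel. heat_kernel (x + r *\<^sub>R ?e - y) (t - s) * g y s)) has_real_derivative
      (LINT s|lborel. indicator {0<..<t} s * (LINT y|lborel. heat_kernel_d i (x + 0 *\<^sub>R ?e - y) (t - s) * g y s))) (at 0)"
  proof (rule DERIV_integral[where k'="\<lambda>r s. indicator {0<..<t} s * (LINT y|lborel. heat_kernel_d i (x + r *\<^sub>R ?e - y) (t - s) * g y s)" and D="\<lambda>s. kconst TYPE('n) * L * (indicator {0<..<t} s * (t - s) powr (- (1/2)))"])
    show "integrable lborel (\<lambda>s. indicator {0<..<t} s * (LINT y|lborel. heat_kernel (x + r *\<^sub>R ?e - y) (t - s) * g y s))" for r
      by (rule duhamel(1)[OF t])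
    show "integrable lborel (\<lambda>s. kconst TYPE('n) * L * (indicator {0<..<t} s * (t - s) powr (- (1/2))))"
      using t by (intro integrable_mult_right integrable_powr_half)
    fix r s :: real
    show "((\<lambda>r. indicator {0<..<t} s * (LINT y|lborel. heat_kernel (x + r *\<^sub>R ?e - y) (t - s) * g y s)) has_real_derivative
        indicator {0<..<t} s * (LINT y|lborel. heat_kernel_d i (x + r *\<^sub>R ?e - y) (t - s) * g y s)) (at r)"
    proof (cases "s \<in> {0<..<t}")
      case True
      then have "has_partial i (\<lambda>x. LINT y|lborel. heat_kernel (x - y) (t - s) * g y s) (LINT y|lborel. heat_kernel_d i (x + r *\<^sub>R ?e - y) (t - s) * g y s) (x + r *\<^sub>R ?e)"
        using gb[OF True] by (intro has_partial_heat_average) auto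
      from has_partial_line[OF this] True show ?thesis by simp
    qed simp
    show "\<bar>indicator {0<..<t} s * (LINT y|lborel. heat_kernel_d i (x + r *\<^sub>R ?e - y) (t - s) * g y s)\<bar>
      \<le> kconst TYPE('n) * L * (indicator {0<..<t} s * (t - s) powr (- (1/2)))"
    proof (cases "s \<in> {0<..<t}")
      case True
      then have "\<bar>LINT y|lborel. heat_kernel_d i (x + r *\<^sub>R ?e - y) (t - s) * g y s\<bar> \<le> kconst TYPE('n) * L * (t - s) powr (- (1/2))"
        using gb[OF True] by (intro heat_kernel_d_integral_bound) auto
      then show ?thesis using True by simp
    qed simp
  qed
  then have "has_partial i (\<lambda>x. LINT s|lborel. indicator {0<..<t} s * (LINT y|lborel. heat_kernel (x - y) (t - s) * g y s))
      (LINT s|lborel. indicator {0<..<t} s * (LINT y|lborel. heat_kernel_d i (x - y) (t - s) * g y s)) x"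
    by (simp add: has_partial_def)
  moreover have "has_partial i (\<lambda>x. LINT y|lborel. heat_kernel (x - y) t * w y 0) (LINT y|lborel. heat_kernel_d i (x - y) t * w y 0) x"
    using t w_bound[of 0] by (intro has_partial_heat_average) auto
  ultimately have "has_partial i (\<lambda>x. (LINT y|lborel. heat_kernel (x - y) t * w y 0) + (LINT s|lborel. indicator {0<..<t} s * (LINT y|lborel. heat_kernel (x - y) (t - s) * g y s)))
     ((LINT y|lborel. heat_kernel_d i (x - y) t * w y 0)
      + (LINT s|lborel. indicator {0<..<t} s * (LINT y|lborel. heat_kernel_d i (x - y) (t - s) * g y s))) x"
    by (intro has_partial_add)
  then have "has_partial i (\<lambda>x. w x t) ((LINT y|lborel. heat_kernel_d i (x - y) t * w y 0)
      + (LINT s|lborel. indicator {0<..<t} s * (LINT y|lborel. heat_kernel_d i (x - y) (t - s) * g y s))) x"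
    by (simp add: duhamel(2)[OF t, symmetric])
  then show ?thesis
    using has_partial_partial_deriv has_partial_partial_deriv[OF w_partial[OF t]] by fastforce
qed

text \<open>The absolute value stays outside the average of the initial data: for data with small
  integral this average becomes much smaller in L^1 than the heat flow of |w(0)|, a gain on which
  the L^1 asymptotics depends.\<close>

lemma abs_bound:
  assumes t: "t > 0"
  shows "ennreal \<bar>w x t\<bar> \<le> ennreal \<bar>LINT y|lborel. heat_kernel (x - y) t * w y 0\<bar>
    + (\<integral>\<^sup>+s. indicator {0<..<t} s * heat_nn (t - s) (\<lambda>y. ennreal \<bar>g y s\<bar>) x \<partial>lborel)"
    and "ennreal \<bar>LINT y|lborel. heat_kernel (x - y) t * w y 0\<bar> \<le> heat_nn t (\<lambda>y. ennreal \<bar>w y 0\<bar>) x"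
proof -
  have *: "ennreal \<bar>LINT y|lborel. heat_kernel (x - y) r * h y\<bar> \<le> heat_nn r (\<lambda>y. ennreal \<bar>h y\<bar>) x" for h r
    unfolding heat_nn_def
    by (rule order_trans[OF ennreal_abs_integral_le]) (simp add: abs_mult ennreal_mult)
  then show "ennreal \<bar>LINT y|lborel. heat_kernel (x - y) t * w y 0\<bar> \<le> heat_nn t (\<lambda>y. ennreal \<bar>w y 0\<bar>) x" .
  have "ennreal \<bar>w x t\<bar> \<le> ennreal \<bar>LINT y|lborel. heat_kernel (x - y) t * w y 0\<bar> + ennreal \<bar>LINT s|lborel. indicator {0<..<t} s * (LINT y|lborel. heat_kernel (x - y) (t - s) * g y s)\<bar>"
    unfolding duhamel(2)[OF t, of x] by (rule ennreal_abs_triangle)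
  also have "ennreal \<bar>LINT s|lborel. indicator {0<..<t} s * (LINT y|lborel. heat_kernel (x - y) (t - s) * g y s)\<bar>
     \<le> (\<integral>\<^sup>+s. ennreal \<bar>indicator {0<..<t} s * (LINT y|lborel. heat_kernel (x - y) (t - s) * g y s)\<bar> \<partial>lborel)"
    by (rule ennreal_abs_integral_le)
  also have "\<dots> \<le> (\<integral>\<^sup>+s. indicator {0<..<t} s * heat_nn (t - s) (\<lambda>y. ennreal \<bar>g y s\<bar>) x \<partial>lborel)"
    using * by (intro nn_integral_mono) (auto simp: indicator_def)
  finally show "ennreal \<bar>w x t\<bar> \<le> ennreal \<bar>LINT y|lborel. heat_kernel (x - y) t * w y 0\<bar>
    + (\<integral>\<^sup>+s. indicator {0<..<t} s * heat_nn (t - s) (\<lambda>y. ennreal \<bar>g y s\<bar>) x \<partial>lborel)"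
    by (simp add: add_left_mono)
qed

lemma abs_gradient_bound:
  assumes t: "t > 0"
  shows "ennreal \<bar>w1 i x t\<bar> \<le> ennreal (kconst TYPE('n) * t powr (- (1/2))) * heat_nn (2 * t) (\<lambda>y. ennreal \<bar>w y 0\<bar>) x
    + (\<integral>\<^sup>+s. indicator {0<..<t} s * (ennreal (kconst TYPE('n) * (t - s) powr (- (1/2))) * heat_nn (2 * (t - s)) (\<lambda>y. ennreal \<bar>g y s\<bar>) x) \<partial>lborel)"
proof -
  have *: "ennreal \<bar>LINT y|lborel. heat_kernel_d i (x - y) r * h y\<bar> \<le> ennreal (kconst TYPE('n) * r powr (- (1/2))) * heat_nn (2 * r) (\<lambda>y. ennreal \<bar>h y\<bar>) x"
    if "r > 0" "h \<in> borel_measurable borel" for h r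
    by (rule order_trans[OF ennreal_abs_integral_le nn_integral_heat_kernel_d_le]) fact+
  have main: "ennreal \<bar>w1 i x t\<bar> \<le> ennreal \<bar>LINT y|lborel. heat_kernel_d i (x - y) t * w y 0\<bar> + ennreal \<bar>LINT s|lborel. indicator {0<..<t} s * (LINT y|lborel. heat_kernel_d i (x - y) (t - s) * g y s)\<bar>"
    unfolding duhamel_gradient[OF t, of i x] by (rule ennreal_abs_triangle)
  have "ennreal \<bar>LINT s|lborel. indicator {0<..<t} s * (LINT y|lborel. heat_kernel_d i (x - y) (t - s) * g y s)\<bar>
     \<le> (\<integral>\<^sup>+s. ennreal \<bar>indicator {0<..<t} s * (LINT y|lborel. heat_kernel_d i (x - y) (t - s) * g y s)\<bar> \<partial>lborel)"
    by (rule ennreal_abs_integral_le)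
  also have "\<dots> \<le> (\<integral>\<^sup>+s. indicator {0<..<t} s * (ennreal (kconst TYPE('n) * (t - s) powr (- (1/2))) * heat_nn (2 * (t - s)) (\<lambda>y. ennreal \<bar>g y s\<bar>) x) \<partial>lborel)"
  proof (intro nn_integral_mono)
    fix s
    show "ennreal \<bar>indicator {0<..<t} s * (LINT y|lborel. heat_kernel_d i (x - y) (t - s) * g y s)\<bar>
      \<le> indicator {0<..<t} s * (ennreal (kconst TYPE('n) * (t - s) powr (- (1/2))) * heat_nn (2 * (t - s)) (\<lambda>y. ennreal \<bar>g y s\<bar>) x)"
      using *[of "t - s" "\<lambda>y. g y s"] by (auto simp: indicator_def)
  qed
  finally have 2: "ennreal \<bar>LINT s|lborel. indicator {0<..<t} s * (LINT y|lborel. heat_kernel_d i (x - y) (t - s) * g y s)\<bar>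
      \<le> (\<integral>\<^sup>+s. indicator {0<..<t} s * (ennreal (kconst TYPE('n) * (t - s) powr (- (1/2))) * heat_nn (2 * (t - s)) (\<lambda>y. ennreal \<bar>g y s\<bar>) x) \<partial>lborel)" .
  have 1: "ennreal \<bar>LINT y|lborel. heat_kernel_d i (x - y) t * w y 0\<bar> \<le> ennreal (kconst TYPE('n) * t powr (- (1/2))) * heat_nn (2 * t) (\<lambda>y. ennreal \<bar>w y 0\<bar>) x"
    by (rule *[OF t]) simp
  show ?thesis by (rule order_trans[OF main add_mono[OF 1 2]])
qed

lemma shift:
  assumes "\<tau> \<ge> 0"
  shows "inhom_heat (\<lambda>x t. w x (t + \<tau>)) (\<lambda>x t. g x (t + \<tau>)) (\<lambda>i x t. w1 i x (t + \<tau>)) (\<lambda>i x t. w2 i x (t + \<tau>)) B L"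
proof
  have tr: "continuous_on (UNIV \<times> T) (\<lambda>(x, t). f x (t + \<tau>))" if "continuous_on (UNIV \<times> T) (\<lambda>(x, t). f x t)" "\<And>t. t \<in> T \<Longrightarrow> t + \<tau> \<in> T" for f :: "real^'n \<Rightarrow> real \<Rightarrow> real" and T
  proof -
    have "continuous_on (UNIV \<times> T) (\<lambda>p. case (fst p, snd p + \<tau>) of (x, t) \<Rightarrow> f x t)"
      by (rule continuous_on_compose2[OF that(1)]) (use that(2) in \<open>auto intro!: continuous_intros\<close>)
    then show ?thesis by (simp add: case_prod_beta)
  qed
  show "continuous_on (UNIV \<times> {0..}) (\<lambda>(x, t). w x (t + \<tau>))" "continuous_on (UNIV \<times> {0<..}) (\<lambda>(x, t). g x (t + \<tau>))"
    "continuous_on (UNIV \<times> {0<..}) (\<lambda>(x, t). w1 i x (t + \<tau>))" "continuous_on (UNIV \<times> {0<..}) (\<lambda>(x, t). w2 i x (t + \<tau>))" for i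
    using assms by (auto intro!: tr w_cont g_cont w1_cont w2_cont)
  show "(\<lambda>(x, t). g x (t + \<tau>)) \<in> borel_measurable borel"
    unfolding case_prod_beta borel_prod[symmetric] by measurable
  fix i x t
  show "\<bar>w x (t + \<tau>)\<bar> \<le> B" if "t \<ge> 0" using that assms by (intro w_bound) auto
  show "\<bar>g x (t + \<tau>)\<bar> \<le> L" if "t > 0" using that assms by (intro g_bound) auto
  show "has_partial i (\<lambda>y. w y (t + \<tau>)) (w1 i x (t + \<tau>)) x" if "t > 0" using that assms by (intro w_partial) auto
  show "has_partial i (\<lambda>y. w1 i y (t + \<tau>)) (w2 i x (t + \<tau>)) x" if "t > 0" using that assms by (intro w1_partial) auto
  show "((\<lambda>t. w x (t + \<tau>)) has_real_derivative (\<Sum>i\<in>UNIV. w2 i x (t + \<tau>)) + g x (t + \<tau>)) (at t)" if "t > 0"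
    using that assms w_time[of "t + \<tau>" x] by (simp add: DERIV_shift)
qed

text \<open>The positive age \<open>\<tau>\<close> keeps the kernel bounded from the initial time
  on. As the kernel solves the homogeneous equation, the source is unchanged.\<close>

lemma sub_heat_kernel:
  assumes "\<tau> > 0"
  shows "inhom_heat (\<lambda>x t. w x t - c * heat_kernel x (t + \<tau>)) g (\<lambda>i x t. w1 i x t - c * heat_kernel_d i x (t + \<tau>))
    (\<lambda>i x t. w2 i x t - c * heat_kernel_dd i x (t + \<tau>)) (B + \<bar>c\<bar> * \<tau> powr (- (real CARD('n) / 2))) L"
proof
  have hk: "continuous_on (UNIV \<times> {0..}) (\<lambda>p. heat_kernel (fst p :: real^'n) (snd p + \<tau>))"
    "continuous_on (UNIV \<times> {0<..}) (\<lambda>p. heat_kernel_d i (fst p :: real^'n) (snd p + \<tau>))"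
    "continuous_on (UNIV \<times> {0<..}) (\<lambda>p. heat_kernel_dd i (fst p :: real^'n) (snd p + \<tau>))" for i
    using assms by (auto intro!: heat_kernel_continuous heat_kernel_derivs_continuous continuous_intros)
  show "continuous_on (UNIV \<times> {0..}) (\<lambda>(x, t). w x t - c * heat_kernel x (t + \<tau>))"
    "continuous_on (UNIV \<times> {0<..}) (\<lambda>(x, t). w1 i x t - c * heat_kernel_d i x (t + \<tau>))"
    "continuous_on (UNIV \<times> {0<..}) (\<lambda>(x, t). w2 i x t - c * heat_kernel_dd i x (t + \<tau>))" for i
    using w_cont w1_cont w2_cont by (auto simp: case_prod_beta intro!: continuous_on_diff continuous_on_mult_left hk)
  show "case_prod g \<in> borel_measurable borel" "continuous_on (UNIV \<times> {0<..}) (\<lambda>(x, t). g x t)" by (fact g_meas g_cont)+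
  fix i x t
  show "\<bar>g x t\<bar> \<le> L" if "t > 0" using that by (rule g_bound)
  show "\<bar>w x t - c * heat_kernel x (t + \<tau>)\<bar> \<le> B + \<bar>c\<bar> * \<tau> powr (- (real CARD('n) / 2))" if "t \<ge> 0"
  proof -
    have "heat_kernel x (t + \<tau>) \<le> (t + \<tau>) powr (- (real CARD('n) / 2))" using that assms by (intro heat_kernel_le) auto
    also have "\<dots> \<le> \<tau> powr (- (real CARD('n) / 2))" using that assms by (intro powr_mono2') auto
    finally have "\<bar>c\<bar> * heat_kernel x (t + \<tau>) \<le> \<bar>c\<bar> * \<tau> powr (- (real CARD('n) / 2))" by (intro mult_left_mono) auto
    then show ?thesis using w_bound[OF that, of x] abs_triangle_ineq4[of "w x t" "c * heat_kernel x (t + \<tau>)"] by (simp add: abs_mult)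
  qed
  assume t: "t > 0"
  show "has_partial i (\<lambda>y. w y t - c * heat_kernel y (t + \<tau>)) (w1 i x t - c * heat_kernel_d i x (t + \<tau>)) x"
    using t assms by (intro has_partial_diff has_partial_cmult w_partial has_partial_heat_kernel) auto
  show "has_partial i (\<lambda>y. w1 i y t - c * heat_kernel_d i y (t + \<tau>)) (w2 i x t - c * heat_kernel_dd i x (t + \<tau>)) x"
    using t assms by (intro has_partial_diff has_partial_cmult w1_partial has_partial_heat_kernel_d) auto
  have "((\<lambda>t. heat_kernel x (t + \<tau>)) has_real_derivative heat_kernel_t x (t + \<tau>)) (at t)"
    using t assms heat_kernel_deriv_time[of "t + \<tau>" x] by (simp add: DERIV_shift)
  then have "((\<lambda>t. w x t - c * heat_kernel x (t + \<tau>)) has_real_derivative ((\<Sum>i\<in>UNIV. w2 i x t) + g x t) - c * heat_kernel_t x (t + \<tau>)) (at t)"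
    by (intro DERIV_diff w_time t DERIV_cmult)
  then show "((\<lambda>t. w x t - c * heat_kernel x (t + \<tau>)) has_real_derivative (\<Sum>i\<in>UNIV. w2 i x t - c * heat_kernel_dd i x (t + \<tau>)) + g x t) (at t)"
    by (simp add: heat_equation_heat_kernel[symmetric] sum_subtractf sum_distrib_left algebra_simps)
qed

end

section \<open>Flattening of integrable data by the heat flow\<close>

lemma heat_kernel_L1_translation:
  fixes y :: "real^'n::finite"
  shows "((\<lambda>t. LINT x|lborel. \<bar>heat_kernel (x - y) t - heat_kernel x t\<bar>) \<longlongrightarrow> 0) at_top"
proof -
  have "((\<lambda>t. LINT z|lborel. \<bar>heat_kernel (z - (1 / sqrt t) *\<^sub>R y) 1 - heat_kernel z 1\<bar>) \<longlongrightarrow> (LINT z|(lborel::(real^'n) measure). (0::real))) at_top"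
  proof (rule integral_dominated_convergence_at_top[where w="\<lambda>z::real^'n. 2 powr (real CARD('n) / 2) * exp (1 / 4) * heat_kernel z 2 + heat_kernel z 1"])
    show "integrable lborel (\<lambda>z::real^'n. 2 powr (real CARD('n) / 2) * exp (1 / 4) * heat_kernel z 2 + heat_kernel z 1)"
      by (intro Bochner_Integration.integrable_add integrable_mult_right integrable_heat_kernel) auto
    show "\<forall>\<^sub>F t in at_top. AE z in lborel. norm \<bar>heat_kernel (z - (1 / sqrt t) *\<^sub>R y) 1 - heat_kernel z 1\<bar> \<le> 2 powr (real CARD('n) / 2) * exp (1 / 4) * heat_kernel z 2 + heat_kernel z 1"
    proof (rule eventually_mono[OF eventually_gt_at_top])
      \<comment> \<open>From this time on the rescaled shift y / sqrt t has length at most 1, as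
        \<open>heat_kernel_shift\<close> demands.\<close>
      fix t :: real assume t: "t > (norm y)\<^sup>2"
      then have "sqrt ((norm y)\<^sup>2) \<le> sqrt t" by (intro real_sqrt_le_mono) simp
      then have "norm y \<le> sqrt t" by simp
      moreover have "t > 0" using t zero_le_power2[of "norm y"] by linarith
      ultimately have "norm (- ((1 / sqrt t) *\<^sub>R y)) \<le> 1" by (simp add: divide_simps)
      from heat_kernel_shift[OF zero_less_one this]
      have "heat_kernel (z - (1 / sqrt t) *\<^sub>R y) 1 \<le> 2 powr (real CARD('n) / 2) * exp (1 / 4) * heat_kernel z 2" for z by simp
      then show "AE z in lborel. norm \<bar>heat_kernel (z - (1 / sqrt t) *\<^sub>R y) 1 - heat_kernel z 1\<bar> \<le> 2 powr (real CARD('n) / 2) * exp (1 / 4) * heat_kernel z 2 + heat_kernel z 1"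
        by (intro AE_I2) (smt (verit, ccfv_SIG) heat_kernel_nonneg real_norm_def)
    qed
    show "AE z in lborel. ((\<lambda>t. \<bar>heat_kernel (z - (1 / sqrt t) *\<^sub>R y) 1 - heat_kernel z 1\<bar>) \<longlongrightarrow> 0) at_top"
    proof (rule AE_I2)
      fix z :: "real^'n"
      have "((\<lambda>t. 1 / sqrt t) \<longlongrightarrow> 0) at_top"
        using tendsto_inverse_0_at_top[OF sqrt_at_top] by (simp add: divide_inverse)
      then have 1: "((\<lambda>t. z - (1 / sqrt t) *\<^sub>R y) \<longlongrightarrow> z - 0 *\<^sub>R y) at_top" by (intro tendsto_intros)
      have "continuous_on UNIV (\<lambda>z. heat_kernel (z::real^'n) 1)" by (intro heat_kernel_continuous continuous_intros) auto
      from continuous_on_tendsto_compose[OF this 1]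
      have "((\<lambda>t. heat_kernel (z - (1 / sqrt t) *\<^sub>R y) 1) \<longlongrightarrow> heat_kernel z 1) at_top" by simp
      from tendsto_rabs[OF tendsto_diff[OF this tendsto_const[of "heat_kernel z 1"]]]
      show "((\<lambda>t. \<bar>heat_kernel (z - (1 / sqrt t) *\<^sub>R y) 1 - heat_kernel z 1\<bar>) \<longlongrightarrow> 0) at_top" by simp
    qed
  qed measurable
  moreover have "\<forall>\<^sub>F t in at_top. (LINT z|lborel. \<bar>heat_kernel (z - (1 / sqrt t) *\<^sub>R y) 1 - heat_kernel z 1\<bar>) = (LINT x|lborel. \<bar>heat_kernel (x - y) t - heat_kernel x t\<bar>)"
  proof (rule eventually_mono[OF eventually_gt_at_top])
    fix t :: real assume t: "t > 0"
    \<comment> \<open>Under x = sqrt t z a shift by y at time t becomes a shift by y / sqrt t at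
      time 1, which tends to 0, while the scaling factors cancel.\<close>
    let ?c = "t powr (- (real CARD('n) / 2))"
    have eq: "\<bar>heat_kernel (sqrt t *\<^sub>R z - y) t - heat_kernel (sqrt t *\<^sub>R z) t\<bar> = ?c * \<bar>heat_kernel (z - (1 / sqrt t) *\<^sub>R y) 1 - heat_kernel z 1\<bar>" for z
    proof -
      have "sqrt t *\<^sub>R z - y = sqrt t *\<^sub>R (z - (1 / sqrt t) *\<^sub>R y)" using t by (simp add: scaleR_diff_right)
      then have "heat_kernel (sqrt t *\<^sub>R z - y) t - heat_kernel (sqrt t *\<^sub>R z) t = ?c * (heat_kernel (z - (1 / sqrt t) *\<^sub>R y) 1 - heat_kernel z 1)"
        using t by (simp only: heat_kernel_scale right_diff_distrib)
      then show ?thesis by (simp add: abs_mult)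
    qed
    have "(LINT x|lborel. \<bar>heat_kernel (x - y) t - heat_kernel x t\<bar>) = sqrt t ^ CARD('n) * (LINT z|lborel. \<bar>heat_kernel (sqrt t *\<^sub>R z - y) t - heat_kernel (sqrt t *\<^sub>R z) t\<bar>)"
      using t by (subst integral_scale_lborel[where c="sqrt t"]) auto
    also have "\<dots> = (sqrt t ^ CARD('n) * ?c) * (LINT z|lborel. \<bar>heat_kernel (z - (1 / sqrt t) *\<^sub>R y) 1 - heat_kernel z 1\<bar>)"
      by (simp only: eq integral_mult_right_zero mult.assoc)
    also have "sqrt t ^ CARD('n) * ?c = 1"
      using t by (simp add: powr_half_sqrt[symmetric] powr_realpow[symmetric] powr_powr powr_add[symmetric])
    finally show "(LINT z|lborel. \<bar>heat_kernel (z - (1 / sqrt t) *\<^sub>R y) 1 - heat_kernel z 1\<bar>) = (LINT x|lborel. \<bar>heat_kernel (x - y) t - heat_kernel x t\<bar>)" by simp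
  qed
  ultimately show ?thesis by (auto elim: Lim_transform_eventually)
qed

text \<open>Replacing G(x - y) by G(x) extracts the integral of h in front of a kernel of mass 1.
  The remainder averages, against |h|, the L^1 modulus of translation of the kernel, which is
  bounded by 2 and tends to 0 for each y.\<close>

lemma heat_average_L1_eventually_le:
  fixes h :: "real^'n::finite \<Rightarrow> real"
  assumes [measurable]: "h \<in> borel_measurable borel" and h: "integrable lborel h" and e: "e > 0"
  shows "\<forall>\<^sub>F t in at_top. (\<integral>\<^sup>+x. ennreal \<bar>LINT y|lborel. heat_kernel (x - y) t * h y\<bar> \<partial>lborel) \<le> ennreal (\<bar>LINT y|lborel. h y\<bar> + e)"
proof -
  define \<omega> where "\<omega> y t = (LINT x|lborel. \<bar>heat_kernel (x - y) t - heat_kernel x t\<bar>)" for y :: "real^'n" and t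
  have [measurable]: "(\<lambda>y. \<omega> y t) \<in> borel_measurable borel" for t
    unfolding \<omega>_def by measurable
  have hki: "integrable lborel (\<lambda>x. heat_kernel (x - y) t)" if "t > 0" for y :: "real^'n" and t
    using integrable_heat_kernel(2)[OF that, of y] heat_kernel_minus[of "y - _" t] by simp
  have \<omega>0: "0 \<le> \<omega> y t" for y t unfolding \<omega>_def by simp
  have \<omega>2: "\<omega> y t \<le> 2" if t: "t > 0" for y t
  proof -
    have "\<omega> y t \<le> (LINT x|lborel. heat_kernel (x - y) t + heat_kernel x t)"
      unfolding \<omega>_def using t hki[OF t, of y] integrable_heat_kernel(1)[OF t]
      by (intro integral_mono) (auto simp: abs_le_iff)
    also have "\<dots> = 2"
      using t hki[OF t, of y] integrable_heat_kernel(1,3)[OF t, where 'n='n] integral_translate_lborel(1)[of "\<lambda>x. heat_kernel x t" "-y"]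
      by (subst Bochner_Integration.integral_add) auto
    finally show ?thesis .
  qed
  have "((\<lambda>t. LINT y|lborel. \<bar>h y\<bar> * \<omega> y t) \<longlongrightarrow> (LINT y|(lborel::(real^'n) measure). (0::real))) at_top"
  proof (rule integral_dominated_convergence_at_top[where w="\<lambda>y. \<bar>h y\<bar> * 2"])
    show "integrable lborel (\<lambda>y. \<bar>h y\<bar> * 2)" using h by auto
    show "\<forall>\<^sub>F t in at_top. AE y in lborel. norm (\<bar>h y\<bar> * \<omega> y t) \<le> \<bar>h y\<bar> * 2"
    proof (rule eventually_mono[OF eventually_gt_at_top[of 0]])
      fix t :: real assume "t > 0"
      then show "AE y in lborel. norm (\<bar>h y\<bar> * \<omega> y t) \<le> \<bar>h y\<bar> * 2"
        using \<omega>2[of t] \<omega>0[of _ t] by (intro AE_I2) (simp add: abs_mult mult_left_mono)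
    qed
    show "AE y in lborel. ((\<lambda>t. \<bar>h y\<bar> * \<omega> y t) \<longlongrightarrow> 0) at_top"
      using tendsto_mult[OF tendsto_const heat_kernel_L1_translation] unfolding \<omega>_def by (intro AE_I2) fastforce
  qed measurable
  then have "\<forall>\<^sub>F t in at_top. (LINT y|lborel. \<bar>h y\<bar> * \<omega> y t) < e"
    using e by (auto dest: order_tendstoD(2))
  with eventually_gt_at_top[of "0::real"] show ?thesis
  proof eventually_elim
    fix t :: real assume t: "t > 0" and small: "(LINT y|lborel. \<bar>h y\<bar> * \<omega> y t) < e"
    let ?d = "\<lambda>x y. \<bar>heat_kernel (x - y) t - heat_kernel x t\<bar>"
    have 1: "ennreal \<bar>LINT y|lborel. heat_kernel (x - y) t * h y\<bar> \<le> ennreal \<bar>LINT y|lborel. h y\<bar> * ennreal (heat_kernel x t) + (\<integral>\<^sup>+y. ennreal (?d x y) * ennreal \<bar>h y\<bar> \<partial>lborel)" for x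
    proof -
      have i: "integrable lborel (\<lambda>y. heat_kernel (x - y) t * h y)"
      proof (rule Bochner_Integration.integrable_bound[where f="\<lambda>y. t powr (- (real CARD('n) / 2)) * h y"])
        show "AE y in lborel. norm (heat_kernel (x - y) t * h y) \<le> norm (t powr (- (real CARD('n) / 2)) * h y)"
          using heat_kernel_le[OF t, of "x - _"] by (intro AE_I2) (auto simp: abs_mult intro!: mult_right_mono)
      qed (use h in auto)
      have "(LINT y|lborel. heat_kernel (x - y) t * h y) = heat_kernel x t * (LINT y|lborel. h y) + (LINT y|lborel. heat_kernel (x - y) t * h y - heat_kernel x t * h y)"
        using i h by simp
      then have "ennreal \<bar>LINT y|lborel. heat_kernel (x - y) t * h y\<bar> \<le> ennreal \<bar>heat_kernel x t * (LINT y|lborel. h y)\<bar> + ennreal \<bar>LINT y|lborel. heat_kernel (x - y) t * h y - heat_kernel x t * h y\<bar>"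
        using ennreal_abs_triangle by simp
      also have "ennreal \<bar>heat_kernel x t * (LINT y|lborel. h y)\<bar> = ennreal \<bar>LINT y|lborel. h y\<bar> * ennreal (heat_kernel x t)"
        by (simp add: abs_mult ennreal_mult mult.commute)
      also have "ennreal \<bar>LINT y|lborel. heat_kernel (x - y) t * h y - heat_kernel x t * h y\<bar> \<le> (\<integral>\<^sup>+y. ennreal \<bar>heat_kernel (x - y) t * h y - heat_kernel x t * h y\<bar> \<partial>lborel)"
        by (rule ennreal_abs_integral_le)
      also have "\<dots> = (\<integral>\<^sup>+y. ennreal (?d x y) * ennreal \<bar>h y\<bar> \<partial>lborel)"
        by (intro nn_integral_cong) (simp add: ennreal_mult[symmetric] abs_mult[symmetric] left_diff_distrib)
      finally show ?thesis by (simp add: add_left_mono)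
    qed
    have "(\<integral>\<^sup>+x. ennreal \<bar>LINT y|lborel. heat_kernel (x - y) t * h y\<bar> \<partial>lborel)
        \<le> (\<integral>\<^sup>+x. ennreal \<bar>LINT y|lborel. h y\<bar> * ennreal (heat_kernel x t) + (\<integral>\<^sup>+y. ennreal (?d x y) * ennreal \<bar>h y\<bar> \<partial>lborel) \<partial>lborel)"
      by (intro nn_integral_mono 1)
    also have "\<dots> = (\<integral>\<^sup>+x. ennreal \<bar>LINT y|lborel. h y\<bar> * ennreal (heat_kernel (x::real^'n) t) \<partial>lborel) + (\<integral>\<^sup>+x. (\<integral>\<^sup>+y. ennreal (?d x y) * ennreal \<bar>h y\<bar> \<partial>lborel) \<partial>lborel)"
      by (rule nn_integral_add) measurable
    also have "(\<integral>\<^sup>+x. ennreal \<bar>LINT y|lborel. h y\<bar> * ennreal (heat_kernel (x::real^'n) t) \<partial>lborel) = ennreal \<bar>LINT y|lborel. h y\<bar>"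
      using t by (simp add: nn_integral_cmult nn_integral_heat_kernel)
    also have "(\<integral>\<^sup>+x. (\<integral>\<^sup>+y. ennreal (?d x y) * ennreal \<bar>h y\<bar> \<partial>lborel) \<partial>lborel) = (\<integral>\<^sup>+y. (\<integral>\<^sup>+x. ennreal (?d x y) * ennreal \<bar>h y\<bar> \<partial>lborel) \<partial>lborel)"
      by (rule lborel_pair.Fubini') measurable
    also have "\<dots> = (\<integral>\<^sup>+y. ennreal (\<bar>h y\<bar> * \<omega> y t) \<partial>lborel)"
    proof (intro nn_integral_cong)
      fix y
      have "(\<integral>\<^sup>+x. ennreal (?d x y) \<partial>lborel) = ennreal (\<omega> y t)"
        unfolding \<omega>_def using hki[OF t, of y] integrable_heat_kernel(1)[OF t] by (intro nn_integral_eq_integral) auto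
      then show "(\<integral>\<^sup>+x. ennreal (?d x y) * ennreal \<bar>h y\<bar> \<partial>lborel) = ennreal (\<bar>h y\<bar> * \<omega> y t)"
        using \<omega>0 by (subst nn_integral_multc) (simp_all add: ennreal_mult mult.commute)
    qed
    also have "\<dots> = ennreal (LINT y|lborel. \<bar>h y\<bar> * \<omega> y t)"
    proof (intro nn_integral_eq_integral)
      show "integrable lborel (\<lambda>y. \<bar>h y\<bar> * \<omega> y t)"
        by (rule Bochner_Integration.integrable_bound[where f="\<lambda>y. \<bar>h y\<bar> * 2"])
          (use h \<omega>2[OF t] \<omega>0 in \<open>auto simp: abs_mult mult_left_mono\<close>)
    qed (use \<omega>0 in auto)
    also have "ennreal \<bar>LINT y|lborel. h y\<bar> + ennreal (LINT y|lborel. \<bar>h y\<bar> * \<omega> y t) \<le> ennreal (\<bar>LINT y|lborel. h y\<bar> + e)"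
      using small e by (subst ennreal_plus) (auto intro!: add_left_mono ennreal_leI)
    finally show "(\<integral>\<^sup>+x. ennreal \<bar>LINT y|lborel. heat_kernel (x - y) t * h y\<bar> \<partial>lborel) \<le> ennreal (\<bar>LINT y|lborel. h y\<bar> + e)" .
  qed
qed

section \<open>The viscous Hamilton-Jacobi equation\<close>

text \<open>The gradient bound K is separate from B and L because a late restart improves K and
  keeps the other two; the smallness condition is expressed through K.\<close>

locale visc_HJ =
  fixes q :: real and u :: "real^'n::finite \<Rightarrow> real \<Rightarrow> real" and u1 u2 :: "'n \<Rightarrow> real^'n \<Rightarrow> real \<Rightarrow> real"
    and B L K :: real
  assumes q_gt_1: "q > 1"
    and heat: "inhom_heat u (\<lambda>x t. - (norm (\<chi> i. u1 i x t) powr q)) u1 u2 B L"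
    and gradient_bound: "\<And>x t. t > 0 \<Longrightarrow> norm (\<chi> i. u1 i x t) \<le> K"
    and initial_nonpos: "AE x in lborel. u x 0 \<le> 0"
begin

sublocale inhom_heat u "\<lambda>x t. - (norm (\<chi> i. u1 i x t) powr q)" u1 u2 B L
  by (rule heat)

definition gn :: "real^'n \<Rightarrow> real \<Rightarrow> real" where
  "gn x t = norm (\<chi> i. u1 i x t)"

definition f :: "real^'n \<Rightarrow> real \<Rightarrow> real" where
  "f x t = gn x t powr q"

lemma f_nonneg [simp]: "0 \<le> f x t" by (simp add: f_def)

lemma gn_nonneg [simp]: "0 \<le> gn x t" by (simp add: gn_def)

lemma g_eq_f: "- (norm (\<chi> i. u1 i x t) powr q) = - f x t"
  by (simp add: f_def gn_def)

lemma f_measurable [measurable]: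
  assumes "a \<in> borel_measurable M" "b \<in> borel_measurable M"
  shows "(\<lambda>x. f (a x) (b x)) \<in> borel_measurable M"
  using borel_measurable_uminus[OF g_measurable[OF assms]] by (simp add: g_eq_f)

lemma gn_le: "t > 0 \<Longrightarrow> gn x t \<le> K"
  using gradient_bound by (simp add: gn_def)

lemma f_le: "t > 0 \<Longrightarrow> f x t \<le> K powr q"
  unfolding f_def using gn_le q_gt_1 by (intro powr_mono2) auto

lemma gn_le_sum: "gn x t \<le> (\<Sum>i\<in>UNIV. \<bar>u1 i x t\<bar>)"
  unfolding gn_def using norm_le_l1_cart[of "\<chi> i. u1 i x t"] by simp

lemma gn_slice_measurable [measurable]: "t > 0 \<Longrightarrow> (\<lambda>x. gn x t) \<in> borel_measurable borel"
  unfolding gn_def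
  by (intro borel_measurable_continuous_onI continuous_intros) (simp add: slice_continuous)

lemma u_eq:
  assumes t: "t > 0"
  shows "- u x t = (LINT y|lborel. heat_kernel (x - y) t * (- u y 0))
    + (LINT s|lborel. indicator {0<..<t} s * (LINT y|lborel. heat_kernel (x - y) (t - s) * f y s))"
  using duhamel(2)[OF t, of x] by (simp add: g_eq_f)

text \<open>All terms of Duhamel's formula for -u are nonnegative. The identity therefore carries
  over to [0, oo], where integrals can be exchanged freely, and the sign of u holds at every point
  for t > 0.\<close>

lemma neg_u_eq_nn:
  assumes t: "t > 0"
  shows "ennreal (- u x t) = heat_nn t (\<lambda>y. ennreal (- u y 0)) x
    + (\<integral>\<^sup>+s. indicator {0<..<t} s * heat_nn (t - s) (\<lambda>y. ennreal (f y s)) x \<partial>lborel)"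
    and "u x t \<le> 0"
proof -
  let ?a = "LINT y|lborel. heat_kernel (x - y) t * (- u y 0)"
  let ?i = "\<lambda>s. LINT y|lborel. heat_kernel (x - y) (t - s) * f y s"
  let ?b = "LINT s|lborel. indicator {0<..<t} s * ?i s"
  have a0: "AE y in lborel. 0 \<le> heat_kernel (x - y) t * (- u y 0)"
    using initial_nonpos by eventually_elim (simp add: mult_nonneg_nonpos)
  have a: "0 \<le> ?a" using a0 by (rule integral_nonneg_AE)
  have i: "0 \<le> ?i s" for s by (rule integral_nonneg_AE) simp
  have b: "0 \<le> ?b" using i by (intro integral_nonneg_AE AE_I2) simp
  show "u x t \<le> 0" using u_eq[OF t, of x] a b by linarith
  have "ennreal (- u x t) = ennreal ?a + ennreal ?b"
    unfolding u_eq[OF t] using a b by (rule ennreal_plus)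
  also have "ennreal ?a = (\<integral>\<^sup>+y. ennreal (heat_kernel (x - y) t * (- u y 0)) \<partial>lborel)"
  proof (rule nn_integral_eq_integral[symmetric])
    show "integrable lborel (\<lambda>y. heat_kernel (x - y) t * (- u y 0))"
      using t w_bound[of 0] by (intro integrable_heat_kernel_mult(1)[where C=B]) auto
  qed (rule a0)
  also have "\<dots> = heat_nn t (\<lambda>y. ennreal (- u y 0)) x"
    unfolding heat_nn_def by (intro nn_integral_cong ennreal_mult' heat_kernel_nonneg)
  also have "ennreal ?b = (\<integral>\<^sup>+s. ennreal (indicator {0<..<t} s * ?i s) \<partial>lborel)"
    using duhamel(1)[OF t, of x] i by (intro nn_integral_eq_integral[symmetric]) (auto simp: g_eq_f)
  also have "\<dots> = (\<integral>\<^sup>+s. indicator {0<..<t} s * heat_nn (t - s) (\<lambda>y. ennreal (f y s)) x \<partial>lborel)"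
  proof (intro nn_integral_cong)
    fix s
    show "ennreal (indicator {0<..<t} s * ?i s) = indicator {0<..<t} s * heat_nn (t - s) (\<lambda>y. ennreal (f y s)) x"
    proof (cases "s \<in> {0<..<t}")
      case True
      have "integrable lborel (\<lambda>y. heat_kernel (x - y) (t - s) * f y s)"
        using True f_le[of s] by (intro integrable_heat_kernel_mult(1)[where C="K powr q"]) auto
      then have "ennreal (?i s) = (\<integral>\<^sup>+y. ennreal (heat_kernel (x - y) (t - s) * f y s) \<partial>lborel)"
        by (intro nn_integral_eq_integral[symmetric]) auto
      then show ?thesis using True by (simp add: heat_nn_def ennreal_mult)
    qed simp
  qed
  finally show "ennreal (- u x t) = heat_nn t (\<lambda>y. ennreal (- u y 0)) x
    + (\<integral>\<^sup>+s. indicator {0<..<t} s * heat_nn (t - s) (\<lambda>y. ennreal (f y s)) x \<partial>lborel)" .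
qed

definition mass :: "real \<Rightarrow> ennreal" where
  "mass t = (\<integral>\<^sup>+x. ennreal (- u x t) \<partial>lborel)"

definition F :: "real \<Rightarrow> ennreal" where
  "F s = (\<integral>\<^sup>+x. ennreal (f x s) \<partial>lborel)"

lemma F_measurable [measurable]: "F \<in> borel_measurable borel"
  unfolding F_def[abs_def] by measurable

lemma nn_integral_source:
  "(\<integral>\<^sup>+x. (\<integral>\<^sup>+s. indicator {0<..<t} s * heat_nn (t - s) (\<lambda>y. ennreal (f y s)) x \<partial>lborel) \<partial>lborel)
    = (\<integral>\<^sup>+s. indicator {0<..<t} s * F s \<partial>lborel)"
proof -
  have "(\<integral>\<^sup>+x. (\<integral>\<^sup>+s. indicator {0<..<t} s * heat_nn (t - s) (\<lambda>y. ennreal (f y s)) x \<partial>lborel) \<partial>lborel)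
     = (\<integral>\<^sup>+s. (\<integral>\<^sup>+x. indicator {0<..<t} s * heat_nn (t - s) (\<lambda>y. ennreal (f y s)) x \<partial>lborel) \<partial>lborel)"
    by (rule lborel_pair.Fubini') measurable
  also have "\<dots> = (\<integral>\<^sup>+s. indicator {0<..<t} s * F s \<partial>lborel)"
  proof (intro nn_integral_cong)
    fix s
    show "(\<integral>\<^sup>+x. indicator {0<..<t} s * heat_nn (t - s) (\<lambda>y. ennreal (f y s)) x \<partial>lborel) = indicator {0<..<t} s * F s"
      by (cases "s \<in> {0<..<t}") (auto simp: heat_nn_L1 F_def)
  qed
  finally show ?thesis .
qed

text \<open>Integrate \<open>neg_u_eq_nn\<close> over space: the heat flow preserves integrals. The
  identity also holds with infinite values, so integrability of the source may be deduced from
  it.\<close>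

lemma mass_eq:
  assumes t: "t \<ge> 0"
  shows "mass t = mass 0 + (\<integral>\<^sup>+s. indicator {0<..<t} s * F s \<partial>lborel)"
proof (cases "t = 0")
  case False
  then have t: "t > 0" using assms by simp
  have "mass t = (\<integral>\<^sup>+x. heat_nn t (\<lambda>y. ennreal (- u y 0)) x + (\<integral>\<^sup>+s. indicator {0<..<t} s * heat_nn (t - s) (\<lambda>y. ennreal (f y s)) x \<partial>lborel) \<partial>lborel)"
    unfolding mass_def neg_u_eq_nn(1)[OF t] by simp
  also have "\<dots> = (\<integral>\<^sup>+x. heat_nn t (\<lambda>y. ennreal (- u y 0)) x \<partial>lborel) + (\<integral>\<^sup>+x. (\<integral>\<^sup>+s. indicator {0<..<t} s * heat_nn (t - s) (\<lambda>y. ennreal (f y s)) x \<partial>lborel) \<partial>lborel)"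
    by (rule nn_integral_add) measurable
  also have "(\<integral>\<^sup>+x. heat_nn t (\<lambda>y. ennreal (- u y 0)) x \<partial>lborel) = mass 0"
    using t by (simp add: heat_nn_L1 mass_def)
  finally show ?thesis by (simp add: nn_integral_source)
qed simp

lemma u_nonpos: "t \<ge> 0 \<Longrightarrow> AE x in lborel. u x t \<le> 0"
  using initial_nonpos neg_u_eq_nn(2)[of t] by (cases "t = 0") auto

lemma nn_integral_abs_u: "t \<ge> 0 \<Longrightarrow> (\<integral>\<^sup>+x. ennreal \<bar>u x t\<bar> \<partial>lborel) = mass t"
  unfolding mass_def using u_nonpos[of t] by (intro nn_integral_cong_AE) auto

lemma shift_HJ:
  assumes "\<tau> \<ge> 0" "\<And>x t. t > \<tau> \<Longrightarrow> gn x t \<le> K'"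
  shows "visc_HJ q (\<lambda>x t. u x (t + \<tau>)) (\<lambda>i x t. u1 i x (t + \<tau>)) (\<lambda>i x t. u2 i x (t + \<tau>)) B L K'"
  unfolding visc_HJ_def
proof (intro conjI allI impI)
  show "inhom_heat (\<lambda>x t. u x (t + \<tau>)) (\<lambda>x t. - (norm (\<chi> i. u1 i x (t + \<tau>)) powr q)) (\<lambda>i x t. u1 i x (t + \<tau>)) (\<lambda>i x t. u2 i x (t + \<tau>)) B L"
    by (rule shift[OF assms(1)])
  show "norm (\<chi> i. u1 i x (t + \<tau>)) \<le> K'" if "t > 0" for x t
    using assms(2)[of "t + \<tau>" x] that by (simp add: gn_def)
qed (use q_gt_1 u_nonpos assms in auto)

end

text \<open>\<open>s0\<close> is the time at which the two branches of the minimum cross. Times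
  s^(1/2), the power q - 1 of the minimum increases before \<open>s0\<close> and, since
  \<open>\<kappa>\<close> (q - 1) > 1/2, decreases afterwards; \<open>\<eta>\<close> is its maximum,
  attained at \<open>s0\<close>. The integral is at most 2 \<open>\<eta>\<close> before
  \<open>s0\<close> and \<open>\<eta>\<close> divided by the surplus exponent after it.\<close>

lemma profile_bound:
  fixes K A \<kappa> q :: real
  assumes pos: "K > 0" "A > 0" "\<kappa> > 0" "q > 1" and crit: "\<kappa> * (q - 1) > 1 / 2"
  defines "s0 \<equiv> (A / K) powr (1 / \<kappa>)"
  defines "\<eta> \<equiv> K powr (q - 1) * s0 powr (1/2)"
  shows "s > 0 \<Longrightarrow> min K (A * s powr (- \<kappa>)) powr (q - 1) \<le> \<eta> * s powr (- (1/2))"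
    and "(\<integral>\<^sup>+s. indicator {0<..} s * ennreal (min K (A * s powr (- \<kappa>)) powr (q - 1) * s powr (- (1/2))) \<partial>lborel)
      \<le> ennreal ((2 + 1 / (\<kappa> * (q - 1) - 1/2)) * \<eta>)"
proof -
  let ?m = "\<lambda>s. min K (A * s powr (- \<kappa>))"
  let ?r = "\<kappa> * (q - 1) - 1/2"
  have s0: "s0 > 0" using pos by (simp add: s0_def)
  have eqK: "A * s0 powr (- \<kappa>) = K" using pos by (simp add: s0_def powr_powr powr_minus)
  have m1: "?m s powr (q - 1) \<le> K powr (q - 1)" if "s > 0" for s
    using pos that by (intro powr_mono2) auto
  have m2: "?m s powr (q - 1) \<le> A powr (q - 1) * s powr (- (\<kappa> * (q - 1)))" if "s > 0" for s
  proof -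
    have "?m s powr (q - 1) \<le> (A * s powr (- \<kappa>)) powr (q - 1)"
      using pos that by (intro powr_mono2) auto
    then show ?thesis using pos that by (simp add: powr_mult powr_powr)
  qed
  \<comment> \<open>The branches agree at \<open>s0\<close>, so \<open>\<eta>\<close> can also be
    written in terms of A, as the part after \<open>s0\<close> requires.\<close>
  have eq\<eta>: "A powr (q - 1) * s0 powr (- ?r) = \<eta>"
  proof -
    have "A powr (q - 1) * s0 powr (- (\<kappa> * (q - 1))) = (A * s0 powr (- \<kappa>)) powr (q - 1)"
      using pos s0 by (simp add: powr_mult powr_powr)
    then have "A powr (q - 1) * s0 powr (- (\<kappa> * (q - 1))) * s0 powr (1/2) = \<eta>" unfolding eqK \<eta>_def by simp
    then show ?thesis by (simp add: mult.assoc powr_add[symmetric])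
  qed
  show "?m s powr (q - 1) \<le> \<eta> * s powr (- (1/2))" if s: "s > 0" for s
  proof (cases "s \<le> s0")
    case True
    have "?m s powr (q - 1) * s powr (1/2) \<le> K powr (q - 1) * s0 powr (1/2)"
      using s True pos m1[OF s] by (intro mult_mono powr_mono2) auto
    then show ?thesis using s by (simp add: \<eta>_def powr_minus field_simps)
  next
    case False
    have "?m s powr (q - 1) * s powr (1/2) \<le> A powr (q - 1) * s powr (- (\<kappa> * (q - 1))) * s powr (1/2)"
      using m2[OF s] by (intro mult_right_mono) auto
    also have "\<dots> = A powr (q - 1) * s powr (- ?r)" by (simp add: mult.assoc powr_add[symmetric])
    also have "\<dots> \<le> A powr (q - 1) * s0 powr (- ?r)"
      using False s0 crit by (intro mult_left_mono powr_mono2') auto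
    finally have "?m s powr (q - 1) * s powr (1/2) \<le> \<eta>" by (simp only: eq\<eta>)
    then show ?thesis using s by (simp add: powr_minus field_simps)
  qed
  have "((\<lambda>s. K powr (q - 1) * s powr (- (1/2))) has_integral K powr (q - 1) * (s0 powr (- (1/2) + 1) / (- (1/2) + 1))) {0..s0}"
    using s0 by (intro has_integral_mult_right has_integral_powr_from_0) auto
  then have h1: "((\<lambda>s. if s \<in> {0..s0} then K powr (q - 1) * s powr (- (1/2)) else 0) has_integral 2 * \<eta>) UNIV"
    by (subst has_integral_restrict_UNIV) (simp add: \<eta>_def mult_ac)
  have "((\<lambda>s. A powr (q - 1) * s powr (- ?r - 1)) has_integral A powr (q - 1) * (- (s0 powr (- ?r - 1 + 1)) / (- ?r - 1 + 1))) {s0..}"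
    using s0 crit by (intro has_integral_mult_right has_integral_powr_to_inf) auto
  also have "A powr (q - 1) * (- (s0 powr (- ?r - 1 + 1)) / (- ?r - 1 + 1)) = 1 / ?r * (A powr (q - 1) * s0 powr (- ?r))"
  proof -
    have e: "- ?r - 1 + 1 = - ?r" by simp
    have gen: "a * (- X / (- r)) = 1 / r * (a * X)" for a X r :: real by simp
    show ?thesis unfolding e by (rule gen)
  qed
  also have "\<dots> = 1 / ?r * \<eta>" by (simp only: eq\<eta>)
  finally have h2: "((\<lambda>s. if s \<in> {s0..} then A powr (q - 1) * s powr (- ?r - 1) else 0) has_integral 1 / ?r * \<eta>) UNIV"
    by (subst has_integral_restrict_UNIV)
  have "(\<integral>\<^sup>+s. indicator {0<..} s * ennreal (?m s powr (q - 1) * s powr (- (1/2))) \<partial>lborel)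
     \<le> (\<integral>\<^sup>+s. ennreal (if s \<in> {0..s0} then K powr (q - 1) * s powr (- (1/2)) else 0) + ennreal (if s \<in> {s0..} then A powr (q - 1) * s powr (- ?r - 1) else 0) \<partial>lborel)"
  proof (intro nn_integral_mono)
    fix s
    consider "s \<le> 0" | "0 < s" "s \<le> s0" | "s > s0" "0 < s" using s0 by linarith
    then show "indicator {0<..} s * ennreal (?m s powr (q - 1) * s powr (- (1/2)))
      \<le> ennreal (if s \<in> {0..s0} then K powr (q - 1) * s powr (- (1/2)) else 0) + ennreal (if s \<in> {s0..} then A powr (q - 1) * s powr (- ?r - 1) else 0)"
    proof cases
      case 2
      then have "ennreal (?m s powr (q - 1) * s powr (- (1/2))) \<le> ennreal (K powr (q - 1) * s powr (- (1/2)))"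
        using m1[of s] by (intro ennreal_leI mult_right_mono) auto
      then show ?thesis using 2 by (simp add: add_increasing2)
    next
      case 3
      have "?m s powr (q - 1) * s powr (- (1/2)) \<le> A powr (q - 1) * s powr (- (\<kappa> * (q - 1))) * s powr (- (1/2))"
        using m2[of s] 3 by (intro mult_right_mono) auto
      also have "\<dots> = A powr (q - 1) * s powr (- ?r - 1)"
      proof -
        have e: "- (\<kappa> * (q - 1)) + - (1/2) = - ?r - 1" by simp
        show ?thesis unfolding mult.assoc powr_add[symmetric] e ..
      qed
      finally have "ennreal (?m s powr (q - 1) * s powr (- (1/2))) \<le> ennreal (A powr (q - 1) * s powr (- ?r - 1))"
        by (rule ennreal_leI)
      then show ?thesis using 3 by (simp add: add_increasing)
    qed simp
  qed
  also have "\<dots> = (\<integral>\<^sup>+s. ennreal (if s \<in> {0..s0} then K powr (q - 1) * s powr (- (1/2)) else 0) \<partial>lborel) + (\<integral>\<^sup>+s. ennreal (if s \<in> {s0..} then A powr (q - 1) * s powr (- ?r - 1) else 0) \<partial>lborel)"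
    by (rule nn_integral_add) measurable
  also have "(\<integral>\<^sup>+s. ennreal (if s \<in> {0..s0} then K powr (q - 1) * s powr (- (1/2)) else 0) \<partial>lborel) = ennreal (2 * \<eta>)"
    by (rule nn_integral_has_integral_lborel[OF _ _ h1]) auto
  also have "(\<integral>\<^sup>+s. ennreal (if s \<in> {s0..} then A powr (q - 1) * s powr (- ?r - 1) else 0) \<partial>lborel) = ennreal (1 / ?r * \<eta>)"
    by (rule nn_integral_has_integral_lborel[OF _ _ h2]) auto
  also have "ennreal (2 * \<eta>) + ennreal (1 / ?r * \<eta>) = ennreal ((2 + 1 / ?r) * \<eta>)"
    using crit by (subst ennreal_plus[symmetric]) (auto simp: \<eta>_def distrib_right)
  finally show "(\<integral>\<^sup>+s. indicator {0<..} s * ennreal (?m s powr (q - 1) * s powr (- (1/2))) \<partial>lborel) \<le> ennreal ((2 + 1 / ?r) * \<eta>)" .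
qed

section \<open>Integrals of the weights in space and of the singular factors in time\<close>

lemma nn_integral_exp_weight_finite:
  fixes a :: "real^'n::finite"
  assumes d: "\<delta> > 0"
  obtains D where "D \<ge> 0" "\<And>a::real^'n. (\<integral>\<^sup>+x. ennreal (exp (- \<delta> * norm (x - a))) \<partial>lborel) \<le> ennreal D"
proof -
  \<comment> \<open>With c = \<open>\<delta>\<close> / n the sum of c |x . b| over the n basis
    vectors is at most \<open>\<delta>\<close> |x|, so the weight is dominated by a product of
    one-dimensional exponentials.\<close>
  define c where "c = \<delta> / real CARD('n)"
  have c: "c > 0" "c * real CARD('n) = \<delta>" using d by (auto simp: c_def)
  have half: "(\<integral>\<^sup>+x. ennreal (exp (- c * x)) * indicator {0..} x \<partial>lborel) = ennreal (0 - (- exp (- c * 0) / c))"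
  proof (rule nn_integral_FTC_atLeast)
    show "((\<lambda>x. - exp (- c * x) / c) has_real_derivative exp (- c * x)) (at x)" for x
      using c by (auto intro!: derivative_eq_intros)
    have "((\<lambda>x. exp (- (c * x))) \<longlongrightarrow> 0) at_top"
      by (rule filterlim_compose[OF exp_at_bot])
        (use c in \<open>auto intro!: filterlim_tendsto_pos_mult_at_top[OF tendsto_const] filterlim_ident simp: filterlim_uminus_at_bot\<close>)
    from tendsto_divide[OF tendsto_minus[OF this] tendsto_const[of c]] show "((\<lambda>x. - exp (- c * x) / c) \<longlongrightarrow> 0) at_top" using c by simp
  qed auto
  have line: "(\<integral>\<^sup>+x. ennreal (exp (- c * \<bar>x\<bar>)) \<partial>lborel) \<le> ennreal (2 / c)"
  proof -
    have "(\<integral>\<^sup>+x. ennreal (exp (- c * \<bar>x\<bar>)) \<partial>lborel)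
       \<le> (\<integral>\<^sup>+x. ennreal (exp (- c * x)) * indicator {0..} x + ennreal (exp (- c * (0 - x))) * indicator {0..} (0 - x) \<partial>lborel)"
      by (intro nn_integral_mono) (auto simp: indicator_def abs_if)
    also have "\<dots> = (\<integral>\<^sup>+x. ennreal (exp (- c * x)) * indicator {0..} x \<partial>lborel) + (\<integral>\<^sup>+x. ennreal (exp (- c * (0 - x))) * indicator {0..} (0 - x) \<partial>lborel)"
      by (rule nn_integral_add) measurable
    also have "(\<integral>\<^sup>+x. ennreal (exp (- c * (0 - x))) * indicator {0..} (0 - x) \<partial>lborel) = (\<integral>\<^sup>+x. ennreal (exp (- c * x)) * indicator {0..} x \<partial>lborel)"
      by (rule nn_integral_translate_lborel(2)) measurable
    also have "(\<integral>\<^sup>+x. ennreal (exp (- c * x)) * indicator {0..} x \<partial>lborel) + (\<integral>\<^sup>+x. ennreal (exp (- c * x)) * indicator {0..} x \<partial>lborel) = ennreal (2 / c)"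
      unfolding half using c(1) by (simp add: ennreal_plus[symmetric] field_simps del: ennreal_plus)
    finally show ?thesis .
  qed
  have "(\<integral>\<^sup>+x. ennreal (exp (- \<delta> * norm (x - a))) \<partial>lborel) \<le> ennreal ((2 / c) ^ CARD('n))" for a :: "real^'n"
  proof -
    have "(\<integral>\<^sup>+x. ennreal (exp (- \<delta> * norm (x - a))) \<partial>lborel) = (\<integral>\<^sup>+x. ennreal (exp (- \<delta> * norm (x::real^'n))) \<partial>lborel)"
      by (rule nn_integral_translate_lborel(3)) measurable
    also have "\<dots> \<le> (\<integral>\<^sup>+x. (\<Prod>b\<in>(Basis::(real^'n) set). ennreal (exp (- c * \<bar>x \<bullet> b\<bar>))) \<partial>lborel)"
    proof (intro nn_integral_mono)
      fix x :: "real^'n"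
      have "(\<Sum>b\<in>Basis. \<bar>x \<bullet> b\<bar>) \<le> (\<Sum>b\<in>(Basis::(real^'n) set). norm x)"
        by (intro sum_mono Basis_le_norm)
      then have "c * (\<Sum>b\<in>Basis. \<bar>x \<bullet> b\<bar>) \<le> c * (real CARD('n) * norm x)"
        using c by (intro mult_left_mono) auto
      then have "c * (\<Sum>b\<in>Basis. \<bar>x \<bullet> b\<bar>) \<le> \<delta> * norm x" using c(2) by (simp add: mult.assoc[symmetric])
      then have "exp (- \<delta> * norm x) \<le> exp (\<Sum>b\<in>Basis. - c * \<bar>x \<bullet> b\<bar>)"
        unfolding sum_distrib_left[symmetric] by simp
      then show "ennreal (exp (- \<delta> * norm x)) \<le> (\<Prod>b\<in>Basis. ennreal (exp (- c * \<bar>x \<bullet> b\<bar>)))"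
        by (subst prod_ennreal) (auto simp: exp_sum[symmetric] intro!: ennreal_leI)
    qed
    also have "\<dots> = (\<Prod>b\<in>(Basis::(real^'n) set). \<integral>\<^sup>+x. ennreal (exp (- c * \<bar>x\<bar>)) \<partial>lborel)"
      by (rule nn_integral_lborel_prod) auto
    also have "\<dots> \<le> (\<Prod>b\<in>(Basis::(real^'n) set). ennreal (2 / c))"
      by (intro prod_mono_ennreal line) 
    also have "\<dots> = ennreal ((2 / c) ^ CARD('n))" using c by (simp add: ennreal_power)
    finally show ?thesis .
  qed
  then show thesis using c by (intro that[of "(2 / c) ^ CARD('n)"]) auto
qed

lemma half_powr_minus_half: "(t::real) > 0 \<Longrightarrow> t / 2 \<le> r \<Longrightarrow> r powr (- (1/2)) \<le> 2 * t powr (- (1/2))"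
proof -
  assume t: "t > 0" "t / 2 \<le> r"
  \<comment> \<open>Passing to t/4 rather than t/2 gives the rational constant 2 in place of sqrt
    2.\<close>
  have "r powr (- (1/2)) \<le> (t / 4) powr (- (1/2))" using t by (intro powr_mono2') auto
  also have "\<dots> = 2 * t powr (- (1/2))" 
  proof -
    have "sqrt (t / 4) = sqrt t / 2" by (simp add: real_sqrt_divide)
    then have "(t / 4) powr (1/2) = t powr (1/2) / 2" using t by (simp add: powr_half_sqrt)
    then have "inverse ((t / 4) powr (1/2)) = inverse (t powr (1/2) / 2)" by (simp only:)
    moreover have "inverse (p / 2) = 2 * inverse p" for p :: real by (cases "p = 0") (simp_all add: field_simps)
    ultimately show ?thesis unfolding powr_minus by presburger
  qed
  finally show ?thesis .
qed

text \<open>Split at t/2. On the first half (t - s)^(-1/2) is at most 2 t^(-1/2) and b is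
  integrable; on the second half b is at most 2 \<open>\<eta>\<close> / t and the singularity
  integrates to at most 2 t^(1/2).\<close>

lemma nn_integral_time_convolution:
  fixes b :: "real \<Rightarrow> real"
  assumes [measurable]: "b \<in> borel_measurable borel" and t: "t > 0" and \<eta>: "\<eta> \<ge> 0" "I \<ge> 0"
    and I: "(\<integral>\<^sup>+s. indicator {0<..} s * ennreal (b s) \<partial>lborel) \<le> ennreal I"
    and b: "\<And>s. s > 0 \<Longrightarrow> b s \<le> \<eta> / s"
  shows "(\<integral>\<^sup>+s. indicator {0<..<t} s * (ennreal ((t - s) powr (- (1/2))) * ennreal (b s)) \<partial>lborel) \<le> ennreal ((2 * I + 4 * \<eta>) * t powr (- (1/2)))"
proof -
  have "(\<integral>\<^sup>+s. indicator {0<..<t} s * (ennreal ((t - s) powr (- (1/2))) * ennreal (b s)) \<partial>lborel)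
     \<le> (\<integral>\<^sup>+s. ennreal (2 * t powr (- (1/2))) * (indicator {0<..} s * ennreal (b s))
          + ennreal (2 * \<eta> / t) * (indicator {t/2<..<t} s * ennreal ((t - s) powr (- (1/2)))) \<partial>lborel)"
  proof (intro nn_integral_mono)
    fix s
    consider "s \<notin> {0<..<t}" | "0 < s" "s \<le> t / 2" | "t / 2 < s" "s < t" "0 < s" using t by fastforce
    then show "indicator {0<..<t} s * (ennreal ((t - s) powr (- (1/2))) * ennreal (b s))
      \<le> ennreal (2 * t powr (- (1/2))) * (indicator {0<..} s * ennreal (b s))
          + ennreal (2 * \<eta> / t) * (indicator {t/2<..<t} s * ennreal ((t - s) powr (- (1/2))))"
    proof cases
      case 2
      then have "ennreal ((t - s) powr (- (1/2))) * ennreal (b s) \<le> ennreal (2 * t powr (- (1/2))) * ennreal (b s)"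
        using t half_powr_minus_half[of t "t - s"] by (intro mult_right_mono ennreal_leI) auto
      then show ?thesis using 2 t by (simp add: add_increasing2)
    next
      case 3
      have "b s \<le> \<eta> / s" using b 3 by simp
      also have "\<dots> \<le> \<eta> / (t / 2)" using 3 t \<eta> by (intro divide_left_mono) auto
      finally have "ennreal ((t - s) powr (- (1/2))) * ennreal (b s) \<le> ennreal ((t - s) powr (- (1/2))) * ennreal (2 * \<eta> / t)"
        by (intro mult_left_mono ennreal_leI) (auto simp: mult.commute)
      then show ?thesis using 3 by (simp add: add_increasing mult.commute)
    qed simp
  qed
  also have "\<dots> = ennreal (2 * t powr (- (1/2))) * (\<integral>\<^sup>+s. indicator {0<..} s * ennreal (b s) \<partial>lborel)
      + ennreal (2 * \<eta> / t) * (\<integral>\<^sup>+s. indicator {t/2<..<t} s * ennreal ((t - s) powr (- (1/2))) \<partial>lborel)"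
    by (simp add: nn_integral_add nn_integral_cmult)
  also have "\<dots> \<le> ennreal (2 * t powr (- (1/2))) * ennreal I + ennreal (2 * \<eta> / t) * ennreal (2 * (t - t / 2) powr (1/2))"
    using t I by (intro add_mono mult_left_mono) (auto simp: nn_integral_powr_half)
  also have "\<dots> = ennreal (2 * t powr (- (1/2)) * I + 2 * \<eta> / t * (2 * (t / 2) powr (1/2)))"
    using t \<eta> by (simp add: ennreal_mult[symmetric] ennreal_plus[symmetric] del: ennreal_plus)
  also have "\<dots> \<le> ennreal ((2 * I + 4 * \<eta>) * t powr (- (1/2)))"
  proof (rule ennreal_leI)
    have "(t / 2) powr (1/2) \<le> t powr (1/2)" using t by (intro powr_mono2) auto
    then have "2 * \<eta> / t * (2 * (t / 2) powr (1/2)) \<le> 2 * \<eta> / t * (2 * t powr (1/2))"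
      using t \<eta> by (intro mult_left_mono) auto
    also have "\<dots> = 4 * \<eta> * t powr (- (1/2))"
      using t by (simp add: powr_minus powr_half_sqrt divide_simps)
    finally show "2 * t powr (- (1/2)) * I + 2 * \<eta> / t * (2 * (t / 2) powr (1/2)) \<le> (2 * I + 4 * \<eta>) * t powr (- (1/2))"
      by (simp add: algebra_simps)
  qed
  finally show ?thesis .
qed

text \<open>For the last continuation step: the part of (0, t) beyond T has length at most h, so its
  contribution is small with h.\<close>

lemma nn_integral_powr_half_late:
  fixes t T h :: real
  assumes "t \<le> T + h" "h \<ge> 0"
  shows "(\<integral>\<^sup>+s. indicator {0<..<t} s * (ennreal ((t - s) powr (- (1/2))) * indicator {T<..} s) \<partial>lborel) \<le> ennreal (2 * h powr (1/2))"
proof (cases "T \<le> t")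
  case True
  have "(\<integral>\<^sup>+s. indicator {0<..<t} s * (ennreal ((t - s) powr (- (1/2))) * indicator {T<..} s) \<partial>lborel)
     \<le> (\<integral>\<^sup>+s. indicator {T<..<t} s * ennreal ((t - s) powr (- (1/2))) \<partial>lborel)"
    by (intro nn_integral_mono) (auto simp: indicator_def)
  also have "\<dots> = ennreal (2 * (t - T) powr (1/2))" by (rule nn_integral_powr_half) fact
  also have "\<dots> \<le> ennreal (2 * h powr (1/2))"
    using True assms by (intro ennreal_leI mult_left_mono powr_mono2) auto
  finally show ?thesis .
next
  case False
  then have "(\<integral>\<^sup>+s. indicator {0<..<t} s * (ennreal ((t - s) powr (- (1/2))) * indicator {T<..} s) \<partial>lborel) = nn_integral lborel (\<lambda>s::real. 0)"
    by (intro nn_integral_cong) (auto simp: indicator_def)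
  then show ?thesis by simp
qed

definition kexp :: "'n::finite itself \<Rightarrow> real" where
  "kexp _ = 2 powr (real CARD('n) / 2) * exp 2"

lemma kexp_ge_0 [simp]: "kexp TYPE('n::finite) \<ge> 0" by (simp add: kexp_def)

lemma kconst_ge_0 [simp]: "kconst TYPE('n::finite) \<ge> 0" by (simp add: kconst_def)

text \<open>The exponent k = (N+1)/2: N/2 from the smoothing of L^1 into L^oo and 1/2 from the
  gradient.\<close>

definition kdecay :: "'n::finite itself \<Rightarrow> real" where
  "kdecay _ = (real CARD('n) + 1) / 2"

context visc_HJ begin

text \<open>The gradient formula integrated against the weight. The weight is dropped on the initial
  term, where the mass is available, and kept on the source. The factor 2 in the condition on
  \<open>\<delta>\<close> comes from the kernel time 2 (t - s).\<close>

lemma weighted_gradient_bound: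
  assumes t: "t > 0" and d: "\<delta> \<ge> 0" "2 * \<delta>\<^sup>2 * t \<le> 1"
    and \<phi>: "\<And>s. 0 < s \<Longrightarrow> s < t \<Longrightarrow> (\<integral>\<^sup>+x. ennreal (exp (- \<delta> * norm (x - a))) * ennreal (f x s) \<partial>lborel) \<le> \<phi> s"
  shows "(\<integral>\<^sup>+x. ennreal (exp (- \<delta> * norm (x - a))) * ennreal \<bar>u1 i x t\<bar> \<partial>lborel)
    \<le> ennreal (kconst TYPE('n) * t powr (- (1/2))) * mass 0
     + (\<integral>\<^sup>+s. indicator {0<..<t} s * (ennreal (kconst TYPE('n) * kexp TYPE('n)) * (ennreal ((t - s) powr (- (1/2))) * \<phi> s)) \<partial>lborel)"
proof -
  let ?\<rho> = "\<lambda>x. ennreal (exp (- \<delta> * norm (x - a)))"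
  let ?c = "kconst TYPE('n)"
  let ?H = "\<lambda>s. heat_nn (2 * (t - s)) (\<lambda>y. ennreal (f y s))"
  have \<rho>: "?\<rho> x \<le> 1" for x
  proof -
    have "exp (- \<delta> * norm (x - a)) \<le> 1" using d by simp
    then show ?thesis using ennreal_leI by fastforce
  qed
  have "(\<integral>\<^sup>+x. ?\<rho> x * ennreal \<bar>u1 i x t\<bar> \<partial>lborel)
     \<le> (\<integral>\<^sup>+x. ennreal (?c * t powr (- (1/2))) * heat_nn (2 * t) (\<lambda>y. ennreal \<bar>u y 0\<bar>) x
        + (\<integral>\<^sup>+s. indicator {0<..<t} s * (ennreal (?c * (t - s) powr (- (1/2))) * (?\<rho> x * ?H s x)) \<partial>lborel) \<partial>lborel)"
  proof (intro nn_integral_mono)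
    fix x
    let ?X = "ennreal (?c * t powr (- (1/2))) * heat_nn (2 * t) (\<lambda>y. ennreal \<bar>u y 0\<bar>) x"
    let ?Y = "\<integral>\<^sup>+s. indicator {0<..<t} s * (ennreal (?c * (t - s) powr (- (1/2))) * ?H s x) \<partial>lborel"
    have "?\<rho> x * ennreal \<bar>u1 i x t\<bar> \<le> ?\<rho> x * (?X + ?Y)"
      using abs_gradient_bound[OF t, of i x] by (intro mult_left_mono) (auto simp: g_eq_f)
    also have "\<dots> = ?\<rho> x * ?X + ?\<rho> x * ?Y" by (rule distrib_left)
    also have "?\<rho> x * ?X \<le> 1 * ?X" by (intro mult_right_mono \<rho>) auto
    also have "?\<rho> x * ?Y = (\<integral>\<^sup>+s. indicator {0<..<t} s * (ennreal (?c * (t - s) powr (- (1/2))) * (?\<rho> x * ?H s x)) \<partial>lborel)"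
      by (subst nn_integral_cmult[symmetric]) (auto simp: mult_ac)
    finally show "?\<rho> x * ennreal \<bar>u1 i x t\<bar> \<le> ?X + (\<integral>\<^sup>+s. indicator {0<..<t} s * (ennreal (?c * (t - s) powr (- (1/2))) * (?\<rho> x * ?H s x)) \<partial>lborel)"
      by simp
  qed
  also have "\<dots> = (\<integral>\<^sup>+x. ennreal (?c * t powr (- (1/2))) * heat_nn (2 * t) (\<lambda>y. ennreal \<bar>u y 0\<bar>) x \<partial>lborel)
        + (\<integral>\<^sup>+x. (\<integral>\<^sup>+s. indicator {0<..<t} s * (ennreal (?c * (t - s) powr (- (1/2))) * (?\<rho> x * ?H s x)) \<partial>lborel) \<partial>lborel)"
    by (rule nn_integral_add) measurable
  also have "(\<integral>\<^sup>+x. ennreal (?c * t powr (- (1/2))) * heat_nn (2 * t) (\<lambda>y. ennreal \<bar>u y 0\<bar>) x \<partial>lborel) = ennreal (?c * t powr (- (1/2))) * mass 0"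
    using t by (simp add: nn_integral_cmult heat_nn_L1 nn_integral_abs_u)
  also have "(\<integral>\<^sup>+x. (\<integral>\<^sup>+s. indicator {0<..<t} s * (ennreal (?c * (t - s) powr (- (1/2))) * (?\<rho> x * ?H s x)) \<partial>lborel) \<partial>lborel)
     = (\<integral>\<^sup>+s. (\<integral>\<^sup>+x. indicator {0<..<t} s * (ennreal (?c * (t - s) powr (- (1/2))) * (?\<rho> x * ?H s x)) \<partial>lborel) \<partial>lborel)"
    by (rule lborel_pair.Fubini') measurable
  also have "\<dots> \<le> (\<integral>\<^sup>+s. indicator {0<..<t} s * (ennreal (?c * kexp TYPE('n)) * (ennreal ((t - s) powr (- (1/2))) * \<phi> s)) \<partial>lborel)"
  proof (intro nn_integral_mono)
    fix s
    show "(\<integral>\<^sup>+x. indicator {0<..<t} s * (ennreal (?c * (t - s) powr (- (1/2))) * (?\<rho> x * ?H s x)) \<partial>lborel)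
      \<le> indicator {0<..<t} s * (ennreal (?c * kexp TYPE('n)) * (ennreal ((t - s) powr (- (1/2))) * \<phi> s))"
    proof (cases "s \<in> {0<..<t}")
      case True
      have "\<delta>\<^sup>2 * (2 * (t - s)) \<le> \<delta>\<^sup>2 * (2 * t)" using True by (intro mult_left_mono) auto
      then have "\<delta>\<^sup>2 * (2 * (t - s)) \<le> 1" using d(2) by (simp add: mult_ac)
      then have "(\<integral>\<^sup>+x. ?\<rho> x * ?H s x \<partial>lborel) \<le> ennreal (kexp TYPE('n)) * (\<integral>\<^sup>+y. ?\<rho> y * ennreal (f y s) \<partial>lborel)"
        unfolding kexp_def using True d by (intro heat_nn_weighted_L1) auto
      also have "\<dots> \<le> ennreal (kexp TYPE('n)) * \<phi> s"
        using True by (intro mult_left_mono \<phi>) auto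
      finally have "ennreal (?c * (t - s) powr (- (1/2))) * (\<integral>\<^sup>+x. ?\<rho> x * ?H s x \<partial>lborel) \<le> ennreal (?c * (t - s) powr (- (1/2))) * (ennreal (kexp TYPE('n)) * \<phi> s)"
        by (intro mult_left_mono) auto
      also have "\<dots> = ennreal (?c * kexp TYPE('n)) * (ennreal ((t - s) powr (- (1/2))) * \<phi> s)"
        by (simp add: ennreal_mult mult_ac)
      finally show ?thesis using True by (simp add: nn_integral_cmult)
    qed simp
  qed
  finally show ?thesis by (simp add: add_left_mono)
qed

text \<open>On the first half of (0, t) the kernel turns a weighted L^1 bound into a bound at the
  centre a of the weight. On the second half, where smoothing would cost a non-integrable power of t
  - s, the sup bound \<open>\<psi>\<close> is used and only (t - s)^(-1/2) remains.\<close>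

lemma sup_gradient_bound:
  assumes t: "t > 0" and d: "\<delta> \<ge> 0" "2 * \<delta>\<^sup>2 * t \<le> 1"
    and \<phi>: "\<And>s. 0 < s \<Longrightarrow> s < t \<Longrightarrow> (\<integral>\<^sup>+x. ennreal (exp (- \<delta> * norm (x - a))) * ennreal (f x s) \<partial>lborel) \<le> \<phi> s"
    and \<psi>: "\<And>s x. 0 < s \<Longrightarrow> s < t \<Longrightarrow> ennreal (f x s) \<le> \<psi> s"
    and [measurable]: "\<phi> \<in> borel_measurable borel" "\<psi> \<in> borel_measurable borel"
  shows "ennreal \<bar>u1 i a t\<bar>
    \<le> ennreal (kconst TYPE('n) * t powr (- kdecay TYPE('n))) * mass 0
     + (ennreal (2 * kconst TYPE('n) * kexp TYPE('n) * t powr (- kdecay TYPE('n))) * (\<integral>\<^sup>+s. indicator {0<..<t} s * \<phi> s \<partial>lborel)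
     + ennreal (kconst TYPE('n)) * (\<integral>\<^sup>+s. indicator {t/2<..<t} s * (ennreal ((t - s) powr (- (1/2))) * \<psi> s) \<partial>lborel))"
proof -
  let ?\<rho> = "\<lambda>x. ennreal (exp (- \<delta> * norm (x - a)))"
  let ?c = "kconst TYPE('n)" and ?E = "kexp TYPE('n)" and ?\<kappa> = "kdecay TYPE('n)"
  let ?H = "\<lambda>s. heat_nn (2 * (t - s)) (\<lambda>y. ennreal (f y s))"
  have tk: "t powr (- (1/2)) * t powr (- (real CARD('n) / 2)) = t powr (- ?\<kappa>)"
  proof -
    have "- (1/2) + - (real CARD('n) / 2) = - ?\<kappa>" by (simp add: kdecay_def add_divide_distrib)
    then show ?thesis by (simp only: powr_add[symmetric])
  qed
  have 1: "ennreal (?c * t powr (- (1/2))) * heat_nn (2 * t) (\<lambda>y. ennreal \<bar>u y 0\<bar>) a \<le> ennreal (?c * t powr (- ?\<kappa>)) * mass 0"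
  proof -
    have "heat_nn (2 * t) (\<lambda>y. ennreal \<bar>u y 0\<bar>) a \<le> ennreal ((2 * t) powr (- (real CARD('n) / 2))) * (\<integral>\<^sup>+x. ennreal \<bar>u x 0\<bar> \<partial>lborel)"
      using t by (intro heat_nn_le_L1) auto
    also have "\<dots> \<le> ennreal (t powr (- (real CARD('n) / 2))) * mass 0"
      using t by (intro mult_mono ennreal_leI powr_mono2') (auto simp: nn_integral_abs_u)
    finally have "ennreal (?c * t powr (- (1/2))) * heat_nn (2 * t) (\<lambda>y. ennreal \<bar>u y 0\<bar>) a
       \<le> ennreal (?c * t powr (- (1/2))) * (ennreal (t powr (- (real CARD('n) / 2))) * mass 0)"
      by (intro mult_left_mono) auto
    also have "\<dots> = ennreal (?c * (t powr (- (1/2)) * t powr (- (real CARD('n) / 2)))) * mass 0"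
      by (simp add: ennreal_mult mult.assoc)
    finally show ?thesis unfolding tk .
  qed
  have 2: "(\<integral>\<^sup>+s. indicator {0<..<t} s * (ennreal (?c * (t - s) powr (- (1/2))) * ?H s a) \<partial>lborel)
     \<le> (\<integral>\<^sup>+s. ennreal (2 * ?c * ?E * t powr (- ?\<kappa>)) * (indicator {0<..<t} s * \<phi> s)
        + ennreal ?c * (indicator {t/2<..<t} s * (ennreal ((t - s) powr (- (1/2))) * \<psi> s)) \<partial>lborel)"
  proof (intro nn_integral_mono)
    fix s
    consider "s \<notin> {0<..<t}" | "0 < s" "s \<le> t / 2" | "t / 2 < s" "s < t" "0 < s" using t by fastforce
    then show "indicator {0<..<t} s * (ennreal (?c * (t - s) powr (- (1/2))) * ?H s a)
      \<le> ennreal (2 * ?c * ?E * t powr (- ?\<kappa>)) * (indicator {0<..<t} s * \<phi> s)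
        + ennreal ?c * (indicator {t/2<..<t} s * (ennreal ((t - s) powr (- (1/2))) * \<psi> s))"
    proof cases
      case 2
      have "\<delta>\<^sup>2 * (2 * (t - s)) \<le> \<delta>\<^sup>2 * (2 * t)" using 2 by (intro mult_left_mono) auto
      then have "\<delta>\<^sup>2 * (2 * (t - s)) \<le> 1" using d(2) by (simp add: mult_ac)
      then have "?H s a \<le> ennreal (?E * (2 * (t - s)) powr (- (real CARD('n) / 2))) * (\<integral>\<^sup>+y. ?\<rho> y * ennreal (f y s) \<partial>lborel)"
        unfolding kexp_def using 2 t d by (intro heat_nn_le_weighted) auto
      also have "\<dots> \<le> ennreal (?E * t powr (- (real CARD('n) / 2))) * \<phi> s"
        using 2 t by (intro mult_mono ennreal_leI mult_left_mono powr_mono2' \<phi>) auto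
      finally have "ennreal (?c * (t - s) powr (- (1/2))) * ?H s a \<le> ennreal (?c * (2 * t powr (- (1/2)))) * (ennreal (?E * t powr (- (real CARD('n) / 2))) * \<phi> s)"
        using half_powr_minus_half[of t "t - s"] 2 t by (intro mult_mono ennreal_leI mult_left_mono) auto
      also have "\<dots> = ennreal (2 * ?c * ?E * (t powr (- (1/2)) * t powr (- (real CARD('n) / 2)))) * \<phi> s"
        by (simp add: ennreal_mult mult_ac)
      finally show ?thesis using 2 t unfolding tk by (simp add: add_increasing2)
    next
      case 3
      have "?H s a \<le> \<psi> s" using 3 \<psi> by (intro heat_nn_sup) auto
      then have "ennreal (?c * (t - s) powr (- (1/2))) * ?H s a \<le> ennreal (?c * (t - s) powr (- (1/2))) * \<psi> s"
        by (intro mult_left_mono) auto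
      then show ?thesis using 3 by (simp add: add_increasing ennreal_mult mult.assoc)
    qed simp
  qed
  also have "\<dots> = ennreal (2 * ?c * ?E * t powr (- ?\<kappa>)) * (\<integral>\<^sup>+s. indicator {0<..<t} s * \<phi> s \<partial>lborel)
     + ennreal ?c * (\<integral>\<^sup>+s. indicator {t/2<..<t} s * (ennreal ((t - s) powr (- (1/2))) * \<psi> s) \<partial>lborel)"
    by (simp add: nn_integral_add nn_integral_cmult)
  finally have 3: "(\<integral>\<^sup>+s. indicator {0<..<t} s * (ennreal (?c * (t - s) powr (- (1/2))) * ?H s a) \<partial>lborel) \<le> \<dots>" .
  have "ennreal \<bar>u1 i a t\<bar> \<le> ennreal (?c * t powr (- (1/2))) * heat_nn (2 * t) (\<lambda>y. ennreal \<bar>u y 0\<bar>) a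
    + (\<integral>\<^sup>+s. indicator {0<..<t} s * (ennreal (?c * (t - s) powr (- (1/2))) * ?H s a) \<partial>lborel)"
    using abs_gradient_bound[OF t, of i a] by (simp add: g_eq_f)
  also have "\<dots> \<le> ennreal (?c * t powr (- ?\<kappa>)) * mass 0 + (ennreal (2 * ?c * ?E * t powr (- ?\<kappa>)) * (\<integral>\<^sup>+s. indicator {0<..<t} s * \<phi> s \<partial>lborel)
     + ennreal ?c * (\<integral>\<^sup>+s. indicator {t/2<..<t} s * (ennreal ((t - s) powr (- (1/2))) * \<psi> s) \<partial>lborel))"
    by (rule add_mono[OF 1 3])
  finally show ?thesis .
qed

end

section \<open>Small data: decay of the gradient by continuation in time\<close>

definition profile_const :: "real \<Rightarrow> 'n::finite itself \<Rightarrow> real" where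
  "profile_const q _ = 2 + 1 / (kdecay TYPE('n) * (q - 1) - 1 / 2)"

text \<open>Collects the coefficients of the mass bound M and of A \<open>\<eta>\<close> in
  \<open>weighted_step\<close> and \<open>sup_step\<close>; the factor n appears because
  \<open>gn\<close> is estimated by the sum of n partial derivatives.\<close>

definition step_const :: "real \<Rightarrow> 'n::finite itself \<Rightarrow> real" where
  "step_const q _ = real CARD('n) * (kconst TYPE('n) + kconst TYPE('n) * kexp TYPE('n) * (2 * profile_const q TYPE('n) + 4)
    + 2 * kconst TYPE('n) * kexp TYPE('n) * profile_const q TYPE('n) + 2 * kconst TYPE('n) * 2 powr kdecay TYPE('n))"

text \<open>K and M are upper bounds, not the norms themselves, and can thus be taken positive for
  any data; positivity makes the crossing time in \<open>profile_bound\<close> meaningful.\<close>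

locale visc_HJ_small = visc_HJ q u u1 u2 B L K
  for q :: real and u :: "real^'n::finite \<Rightarrow> real \<Rightarrow> real" and u1 u2 B L K +
  fixes M :: real
  assumes supercritical: "kdecay TYPE('n) * (q - 1) > 1 / 2"
    and K_pos: "K > 0" and M_pos: "M > 0" and mass_le_M: "mass 0 \<le> ennreal M"
begin

lemma profile_const_pos: "profile_const q TYPE('n) > 0" using supercritical by (simp add: profile_const_def add_pos_pos)

lemma kdecay_pos: "kdecay TYPE('n) > 0" by (simp add: kdecay_def)

definition \<eta> :: "real \<Rightarrow> real" where
  "\<eta> A = K powr (q - 1) * ((A / K) powr (1 / kdecay TYPE('n))) powr (1/2)"

text \<open>Under the decay with constant A, the weighted L^1 norm of the source at time s is at
  most A times this: q - 1 powers of the gradient are measured in the sup norm and one in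
  L^1.\<close>

definition b :: "real \<Rightarrow> real \<Rightarrow> real" where
  "b A s = min K (A * s powr (- kdecay TYPE('n))) powr (q - 1) * s powr (- (1/2))"

text \<open>The exponential weight makes the \<open>L\<^sup>1\<close> quantity finite a priori, since \<open>gn\<close> is bounded; the constants
  do not depend on \<open>\<delta>\<close>, which tends to 0 in the end.\<close>

definition decays :: "real \<Rightarrow> real \<Rightarrow> real \<Rightarrow> bool" where
  "decays A \<delta> s \<longleftrightarrow> (\<forall>x. gn x s \<le> A * s powr (- kdecay TYPE('n))) \<and>
    (\<forall>a. (\<integral>\<^sup>+x. ennreal (exp (- \<delta> * norm (x - a))) * ennreal (gn x s) \<partial>lborel) \<le> ennreal (A * s powr (- (1/2))))"

lemma eta_nonneg: "\<eta> A \<ge> 0" by (simp add: \<eta>_def)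

lemma b_nonneg: "b A s \<ge> 0" by (simp add: b_def)

lemma b_measurable [measurable]: "b A \<in> borel_measurable borel"
  unfolding b_def[abs_def] by measurable

lemma b_integral:
  assumes "A > 0"
  shows "(\<integral>\<^sup>+s. indicator {0<..} s * ennreal (b A s) \<partial>lborel) \<le> ennreal (profile_const q TYPE('n) * \<eta> A)"
  using profile_bound(2)[OF K_pos assms kdecay_pos q_gt_1 supercritical]
  by (simp add: b_def \<eta>_def profile_const_def)

lemma min_powr_le: "A > 0 \<Longrightarrow> s > 0 \<Longrightarrow> min K (A * s powr (- kdecay TYPE('n))) powr (q - 1) \<le> \<eta> A * s powr (- (1/2))"
  using profile_bound(1)[OF K_pos _ kdecay_pos q_gt_1 supercritical] by (simp add: \<eta>_def)

lemma b_le: "A > 0 \<Longrightarrow> s > 0 \<Longrightarrow> b A s \<le> \<eta> A / s"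
proof -
  assume A: "A > 0" "s > 0"
  have "b A s \<le> \<eta> A * s powr (- (1/2)) * s powr (- (1/2))"
    unfolding b_def using min_powr_le[OF A] by (intro mult_right_mono) auto
  also have "\<dots> = \<eta> A * (s powr (- (1/2)) * s powr (- (1/2)))" by simp
  also have "s powr (- (1/2)) * s powr (- (1/2)) = s powr (-1)" unfolding powr_add[symmetric] by simp
  also have "\<eta> A * s powr (-1) = \<eta> A / s" using A by (simp add: powr_minus_divide)
  finally show ?thesis .
qed

text \<open>One power of the gradient is set aside for the L^1 norm; the other q - 1 are bounded
  pointwise by the better of K and the decay.\<close>

lemma f_le_gn:
  assumes "A > 0" "s > 0" "decays A \<delta> s"
  shows "f x s \<le> min K (A * s powr (- kdecay TYPE('n))) powr (q - 1) * gn x s"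
proof -
  have "gn x s \<le> min K (A * s powr (- kdecay TYPE('n)))" using assms gn_le by (auto simp: decays_def)
  then have "gn x s powr (q - 1) * gn x s \<le> min K (A * s powr (- kdecay TYPE('n))) powr (q - 1) * gn x s"
    using q_gt_1 by (intro mult_right_mono powr_mono2) auto
  moreover have "f x s = gn x s powr (q - 1) * gn x s"
    using q_gt_1 powr_add[of "gn x s" "q - 1" 1] by (cases "gn x s = 0") (auto simp: f_def)
  ultimately show ?thesis by simp
qed

lemma decays_f_weighted:
  assumes "A > 0" "s > 0" "decays A \<delta> s"
  shows "(\<integral>\<^sup>+x. ennreal (exp (- \<delta> * norm (x - a))) * ennreal (f x s) \<partial>lborel) \<le> ennreal (A * b A s)"
proof -
  let ?m = "min K (A * s powr (- kdecay TYPE('n))) powr (q - 1)"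
  have "(\<integral>\<^sup>+x. ennreal (exp (- \<delta> * norm (x - a))) * ennreal (f x s) \<partial>lborel)
      \<le> (\<integral>\<^sup>+x. ennreal ?m * (ennreal (exp (- \<delta> * norm (x - a))) * ennreal (gn x s)) \<partial>lborel)"
  proof (intro nn_integral_mono)
    fix x
    have "ennreal (f x s) \<le> ennreal ?m * ennreal (gn x s)"
      using f_le_gn[OF assms, of x] by (simp add: ennreal_mult[symmetric] ennreal_leI)
    then have "ennreal (exp (- \<delta> * norm (x - a))) * ennreal (f x s) \<le> ennreal (exp (- \<delta> * norm (x - a))) * (ennreal ?m * ennreal (gn x s))"
      by (intro mult_left_mono) auto
    then show "ennreal (exp (- \<delta> * norm (x - a))) * ennreal (f x s) \<le> ennreal ?m * (ennreal (exp (- \<delta> * norm (x - a))) * ennreal (gn x s))"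
      by (simp add: mult_ac)
  qed
  also have "\<dots> = ennreal ?m * (\<integral>\<^sup>+x. ennreal (exp (- \<delta> * norm (x - a))) * ennreal (gn x s) \<partial>lborel)"
    using assms by (intro nn_integral_cmult) measurable
  also have "\<dots> \<le> ennreal ?m * ennreal (A * s powr (- (1/2)))"
    using assms by (intro mult_left_mono) (auto simp: decays_def)
  also have "\<dots> = ennreal (A * b A s)"
    using assms by (simp add: ennreal_mult[symmetric] b_def mult_ac)
  finally show ?thesis .
qed

lemma decays_f_sup:
  assumes "A > 0" "s > 0" "decays A \<delta> s"
  shows "f x s \<le> A * \<eta> A * s powr (- (1/2) - kdecay TYPE('n))"
proof -
  have "f x s \<le> min K (A * s powr (- kdecay TYPE('n))) powr (q - 1) * gn x s" by (rule f_le_gn) fact+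
  also have "\<dots> \<le> (\<eta> A * s powr (- (1/2))) * (A * s powr (- kdecay TYPE('n)))"
    using assms min_powr_le eta_nonneg by (intro mult_mono) (auto simp: decays_def)
  also have "\<dots> = A * \<eta> A * (s powr (- (1/2)) * s powr (- kdecay TYPE('n)))" by simp
  also have "s powr (- (1/2)) * s powr (- kdecay TYPE('n)) = s powr (- (1/2) - kdecay TYPE('n))"
    by (simp add: powr_add[symmetric])
  finally show ?thesis .
qed

text \<open>Continuation in steps of length \<open>h\<close>: on the last step only the bound \<open>K\<close> on the gradient is
  available, and its contribution \<open>crude\<close> is absorbed by choosing \<open>h\<close> small.\<close>

definition crude :: "real \<Rightarrow> real \<Rightarrow> real \<Rightarrow> real" where
  "crude D Tm h = kconst TYPE('n) * kexp TYPE('n) * (K powr q * D) * (2 * h powr (1/2)) * Tm powr (1/2)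
    + 2 * kconst TYPE('n) * kexp TYPE('n) * (K powr q * D) * h
    + 2 * kconst TYPE('n) * K powr q * h powr (1/2) * Tm powr kdecay TYPE('n)"

context
  fixes A \<delta> D Tm h T t :: real
  assumes A: "A > 0" and \<delta>: "\<delta> > 0" "2 * \<delta>\<^sup>2 * Tm \<le> 1"
    and D: "D \<ge> 0" "\<And>a::real^'n. (\<integral>\<^sup>+x. ennreal (exp (- \<delta> * norm (x - a))) \<partial>lborel) \<le> ennreal D"
    and h: "h > 0" and T: "T \<ge> 0" and t: "0 < t" "t \<le> Tm" "t \<le> T + h"
    and dec: "\<And>s. 0 < s \<Longrightarrow> s \<le> T \<Longrightarrow> s \<le> Tm \<Longrightarrow> decays A \<delta> s"
begin

lemma dt: "\<delta> \<ge> 0" "2 * \<delta>\<^sup>2 * t \<le> 1"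
proof -
  have "2 * \<delta>\<^sup>2 * t \<le> 2 * \<delta>\<^sup>2 * Tm" using t by (intro mult_left_mono) auto
  then show "2 * \<delta>\<^sup>2 * t \<le> 1" using \<delta> by linarith
qed (use \<delta> in auto)

definition \<phi> :: "real \<Rightarrow> ennreal" where
  "\<phi> s = ennreal A * ennreal (b A s) + ennreal (K powr q * D) * indicator {T<..} s"

definition \<psi> :: "real \<Rightarrow> ennreal" where
  "\<psi> s = ennreal (A * \<eta> A * s powr (- (1/2) - kdecay TYPE('n))) + ennreal (K powr q) * indicator {T<..} s"

lemma phi_psi_measurable [measurable]: "\<phi> \<in> borel_measurable borel" "\<psi> \<in> borel_measurable borel"
  unfolding \<phi>_def[abs_def] \<psi>_def[abs_def] by measurable

text \<open>Up to T the assumed decay applies. After T only the sup bound of the source is left, and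
  the integral D of the weight makes a weighted L^1 bound of it; this second term of
  \<open>\<phi>\<close> ends up in \<open>crude\<close>.\<close>

lemma phi_bound:
  assumes "0 < s" "s < t"
  shows "(\<integral>\<^sup>+x. ennreal (exp (- \<delta> * norm (x - a))) * ennreal (f x s) \<partial>lborel) \<le> \<phi> s"
proof (cases "s \<le> T")
  case True
  then have "(\<integral>\<^sup>+x. ennreal (exp (- \<delta> * norm (x - a))) * ennreal (f x s) \<partial>lborel) \<le> ennreal (A * b A s)"
    using assms t A by (intro decays_f_weighted dec) auto
  then show ?thesis using True A b_nonneg by (simp add: \<phi>_def ennreal_mult)
next
  case False
  have "(\<integral>\<^sup>+x. ennreal (exp (- \<delta> * norm (x - a))) * ennreal (f x s) \<partial>lborel)
     \<le> (\<integral>\<^sup>+x. ennreal (exp (- \<delta> * norm (x - a))) * ennreal (K powr q) \<partial>lborel)"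
    using f_le[OF assms(1)] by (intro nn_integral_mono mult_left_mono ennreal_leI) auto
  also have "\<dots> = (\<integral>\<^sup>+x. ennreal (exp (- \<delta> * norm (x - a))) \<partial>lborel) * ennreal (K powr q)"
    by (rule nn_integral_multc) measurable
  also have "\<dots> \<le> ennreal D * ennreal (K powr q)" by (intro mult_right_mono D) auto
  finally show ?thesis using False D by (simp add: \<phi>_def ennreal_mult mult.commute add_increasing)
qed

lemma psi_bound:
  assumes "0 < s" "s < t"
  shows "ennreal (f x s) \<le> \<psi> s"
proof (cases "s \<le> T")
  case True
  then have "f x s \<le> A * \<eta> A * s powr (- (1/2) - kdecay TYPE('n))"
    using assms t A by (intro decays_f_sup[where \<delta>=\<delta>] dec) auto
  then show ?thesis by (simp add: \<psi>_def ennreal_leI add_increasing2)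
next
  case False
  then show ?thesis using f_le[OF assms(1), of x] by (simp add: \<psi>_def ennreal_leI add_increasing)
qed

lemma weighted_step:
  "(\<integral>\<^sup>+x. ennreal (exp (- \<delta> * norm (x - a))) * ennreal \<bar>u1 i x t\<bar> \<partial>lborel)
    \<le> ennreal ((kconst TYPE('n) * M + kconst TYPE('n) * kexp TYPE('n) * (2 * profile_const q TYPE('n) + 4) * (A * \<eta> A) + crude D Tm h) * t powr (- (1/2)))"
proof -
  have "(\<integral>\<^sup>+x. ennreal (exp (- \<delta> * norm (x - a))) * ennreal \<bar>u1 i x t\<bar> \<partial>lborel)
    \<le> ennreal (kconst TYPE('n) * t powr (- (1/2))) * mass 0
     + (\<integral>\<^sup>+s. indicator {0<..<t} s * (ennreal (kconst TYPE('n) * kexp TYPE('n)) * (ennreal ((t - s) powr (- (1/2))) * \<phi> s)) \<partial>lborel)"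
    by (rule weighted_gradient_bound[OF t(1) dt]) (rule phi_bound)
  also have "(\<integral>\<^sup>+s. indicator {0<..<t} s * (ennreal (kconst TYPE('n) * kexp TYPE('n)) * (ennreal ((t - s) powr (- (1/2))) * \<phi> s)) \<partial>lborel)
     = (\<integral>\<^sup>+s. ennreal (kconst TYPE('n) * kexp TYPE('n)) * (ennreal A * (indicator {0<..<t} s * (ennreal ((t - s) powr (- (1/2))) * ennreal (b A s)))
        + ennreal (K powr q * D) * (indicator {0<..<t} s * (ennreal ((t - s) powr (- (1/2))) * indicator {T<..} s))) \<partial>lborel)"
    by (intro nn_integral_cong) (simp add: \<phi>_def algebra_simps)
  also have "\<dots> = ennreal (kconst TYPE('n) * kexp TYPE('n)) * (ennreal A * (\<integral>\<^sup>+s. indicator {0<..<t} s * (ennreal ((t - s) powr (- (1/2))) * ennreal (b A s)) \<partial>lborel)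
        + ennreal (K powr q * D) * (\<integral>\<^sup>+s. indicator {0<..<t} s * (ennreal ((t - s) powr (- (1/2))) * indicator {T<..} s) \<partial>lborel))"
    by (simp add: nn_integral_cmult nn_integral_add)
  also have "\<dots> \<le> ennreal (kconst TYPE('n) * kexp TYPE('n)) * (ennreal A * ennreal ((2 * (profile_const q TYPE('n) * \<eta> A) + 4 * \<eta> A) * t powr (- (1/2))) + ennreal (K powr q * D) * ennreal (2 * h powr (1/2)))"
  proof (intro mult_left_mono add_mono)
    show "(\<integral>\<^sup>+s. indicator {0<..<t} s * (ennreal ((t - s) powr (- (1/2))) * ennreal (b A s)) \<partial>lborel) \<le> ennreal ((2 * (profile_const q TYPE('n) * \<eta> A) + 4 * \<eta> A) * t powr (- (1/2)))"
      using t A b_integral[OF A] b_le[OF A] profile_const_pos eta_nonneg by (intro nn_integral_time_convolution) auto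
    show "(\<integral>\<^sup>+s. indicator {0<..<t} s * (ennreal ((t - s) powr (- (1/2))) * indicator {T<..} s) \<partial>lborel) \<le> ennreal (2 * h powr (1/2))"
      using t h by (intro nn_integral_powr_half_late) auto
  qed auto
  also have "ennreal (kconst TYPE('n) * t powr (- (1/2))) * mass 0 \<le> ennreal (kconst TYPE('n) * t powr (- (1/2))) * ennreal M"
    by (intro mult_left_mono mass_le_M) auto
  also have "ennreal (kconst TYPE('n) * t powr (- (1/2))) * ennreal M + ennreal (kconst TYPE('n) * kexp TYPE('n)) * (ennreal A * ennreal ((2 * (profile_const q TYPE('n) * \<eta> A) + 4 * \<eta> A) * t powr (- (1/2))) + ennreal (K powr q * D) * ennreal (2 * h powr (1/2)))
     = ennreal (kconst TYPE('n) * t powr (- (1/2)) * M + kconst TYPE('n) * kexp TYPE('n) * (A * ((2 * (profile_const q TYPE('n) * \<eta> A) + 4 * \<eta> A) * t powr (- (1/2))) + K powr q * D * (2 * h powr (1/2))))"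
  proof -
    have "0 \<le> (2 * (profile_const q TYPE('n) * \<eta> A) + 4 * \<eta> A) * t powr (- (1/2))" using profile_const_pos eta_nonneg[of A] by simp
    then show ?thesis using A M_pos D by (simp add: ennreal_mult ennreal_plus)
  qed
  also have "\<dots> \<le> ennreal ((kconst TYPE('n) * M + kconst TYPE('n) * kexp TYPE('n) * (2 * profile_const q TYPE('n) + 4) * (A * \<eta> A) + crude D Tm h) * t powr (- (1/2)))"
  proof (rule ennreal_leI)
    \<comment> \<open>The crude contribution has no decay of its own; as t <= Tm, the factor
      (Tm/t)^(1/2) >= 1 supplies the power of t. This is why \<open>crude\<close> depends on the
      horizon \<open>Tm\<close>.\<close>
    have "1 \<le> Tm powr (1/2) * t powr (- (1/2))"
      using t powr_mono2[of "1/2" t Tm] by (simp add: powr_minus divide_simps)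
    then have "kconst TYPE('n) * kexp TYPE('n) * (K powr q * D * (2 * h powr (1/2))) * 1 \<le> kconst TYPE('n) * kexp TYPE('n) * (K powr q * D * (2 * h powr (1/2))) * (Tm powr (1/2) * t powr (- (1/2)))"
      using D by (intro mult_left_mono) auto
    moreover have "0 \<le> (2 * kconst TYPE('n) * kexp TYPE('n) * (K powr q * D) * h + 2 * kconst TYPE('n) * K powr q * h powr (1/2) * Tm powr kdecay TYPE('n)) * t powr (- (1/2))"
      using D h by simp
    ultimately show "kconst TYPE('n) * t powr (- (1/2)) * M + kconst TYPE('n) * kexp TYPE('n) * (A * ((2 * (profile_const q TYPE('n) * \<eta> A) + 4 * \<eta> A) * t powr (- (1/2))) + K powr q * D * (2 * h powr (1/2)))
      \<le> (kconst TYPE('n) * M + kconst TYPE('n) * kexp TYPE('n) * (2 * profile_const q TYPE('n) + 4) * (A * \<eta> A) + crude D Tm h) * t powr (- (1/2))"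
      unfolding crude_def by (simp add: algebra_simps)
  qed
  finally show ?thesis by (simp add: add_mono)
qed

lemma sup_step:
  "\<bar>u1 i a t\<bar> \<le> (kconst TYPE('n) * M + 2 * kconst TYPE('n) * kexp TYPE('n) * profile_const q TYPE('n) * (A * \<eta> A) + 2 * kconst TYPE('n) * 2 powr kdecay TYPE('n) * (A * \<eta> A) + crude D Tm h) * t powr (- kdecay TYPE('n))"
proof -
  have I1: "(\<integral>\<^sup>+s. indicator {0<..<t} s * \<phi> s \<partial>lborel) \<le> ennreal (A * (profile_const q TYPE('n) * \<eta> A) + K powr q * D * h)"
  proof -
    have "(\<integral>\<^sup>+s. indicator {0<..<t} s * \<phi> s \<partial>lborel)
       \<le> (\<integral>\<^sup>+s. ennreal A * (indicator {0<..} s * ennreal (b A s)) + ennreal (K powr q * D) * indicator {T<..T+h} s \<partial>lborel)"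
    proof (intro nn_integral_mono)
      fix s
      show "indicator {0<..<t} s * \<phi> s \<le> ennreal A * (indicator {0<..} s * ennreal (b A s)) + ennreal (K powr q * D) * indicator {T<..T+h} s"
        using t by (auto simp: \<phi>_def indicator_def)
    qed
    also have "\<dots> = ennreal A * (\<integral>\<^sup>+s. indicator {0<..} s * ennreal (b A s) \<partial>lborel) + ennreal (K powr q * D) * ennreal h"
      using h by (simp add: nn_integral_add nn_integral_cmult nn_integral_cmult_indicator)
    also have "\<dots> \<le> ennreal A * ennreal (profile_const q TYPE('n) * \<eta> A) + ennreal (K powr q * D) * ennreal h"
      using b_integral[OF A] by (intro add_right_mono mult_left_mono) auto
    also have "\<dots> = ennreal (A * (profile_const q TYPE('n) * \<eta> A) + K powr q * D * h)"
      using A profile_const_pos eta_nonneg[of A] D h by (simp add: ennreal_mult ennreal_plus)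
    finally show ?thesis .
  qed
  have I2: "(\<integral>\<^sup>+s. indicator {t/2<..<t} s * (ennreal ((t - s) powr (- (1/2))) * \<psi> s) \<partial>lborel)
     \<le> ennreal (2 * 2 powr kdecay TYPE('n) * (A * \<eta> A) * t powr (- kdecay TYPE('n)) + K powr q * (2 * h powr (1/2)))"
  proof -
    have "(\<integral>\<^sup>+s. indicator {t/2<..<t} s * (ennreal ((t - s) powr (- (1/2))) * \<psi> s) \<partial>lborel)
       \<le> (\<integral>\<^sup>+s. ennreal (A * \<eta> A * (t/2) powr (- (1/2) - kdecay TYPE('n))) * (indicator {t/2<..<t} s * ennreal ((t - s) powr (- (1/2))))
          + ennreal (K powr q) * (indicator {0<..<t} s * (ennreal ((t - s) powr (- (1/2))) * indicator {T<..} s)) \<partial>lborel)"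
    proof (intro nn_integral_mono)
      fix s
      show "indicator {t/2<..<t} s * (ennreal ((t - s) powr (- (1/2))) * \<psi> s)
         \<le> ennreal (A * \<eta> A * (t/2) powr (- (1/2) - kdecay TYPE('n))) * (indicator {t/2<..<t} s * ennreal ((t - s) powr (- (1/2))))
          + ennreal (K powr q) * (indicator {0<..<t} s * (ennreal ((t - s) powr (- (1/2))) * indicator {T<..} s))"
      proof (cases "s \<in> {t/2<..<t}")
        case True
        \<comment> \<open>On (t/2, t) the negative power of s is largest at t/2, which is the origin
          of the factor 2^k in \<open>step_const\<close>.\<close>
        have "\<psi> s \<le> ennreal (A * \<eta> A * (t/2) powr (- (1/2) - kdecay TYPE('n))) + ennreal (K powr q) * indicator {T<..} s"
          unfolding \<psi>_def using True t A eta_nonneg[of A] kdecay_pos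
          by (intro add_right_mono ennreal_leI mult_left_mono powr_mono2') auto
        then have "ennreal ((t - s) powr (- (1/2))) * \<psi> s \<le> ennreal ((t - s) powr (- (1/2))) * (ennreal (A * \<eta> A * (t/2) powr (- (1/2) - kdecay TYPE('n))) + ennreal (K powr q) * indicator {T<..} s)"
          by (intro mult_left_mono) auto
        then show ?thesis using True t by (simp add: distrib_left mult_ac)
      qed simp
    qed
    also have "\<dots> = ennreal (A * \<eta> A * (t/2) powr (- (1/2) - kdecay TYPE('n))) * (\<integral>\<^sup>+s. indicator {t/2<..<t} s * ennreal ((t - s) powr (- (1/2))) \<partial>lborel)
          + ennreal (K powr q) * (\<integral>\<^sup>+s. indicator {0<..<t} s * (ennreal ((t - s) powr (- (1/2))) * indicator {T<..} s) \<partial>lborel)"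
      by (simp add: nn_integral_add nn_integral_cmult)
    also have "\<dots> \<le> ennreal (A * \<eta> A * (t/2) powr (- (1/2) - kdecay TYPE('n))) * ennreal (2 * (t - t/2) powr (1/2)) + ennreal (K powr q) * ennreal (2 * h powr (1/2))"
      using t h by (intro add_mono mult_left_mono nn_integral_powr_half_late) (auto simp: nn_integral_powr_half)
    also have "\<dots> = ennreal (A * \<eta> A * (t/2) powr (- (1/2) - kdecay TYPE('n)) * (2 * (t - t/2) powr (1/2)) + K powr q * (2 * h powr (1/2)))"
      using A eta_nonneg[of A] by (simp add: ennreal_mult ennreal_plus)
    also have "A * \<eta> A * (t/2) powr (- (1/2) - kdecay TYPE('n)) * (2 * (t - t/2) powr (1/2)) = 2 * (A * \<eta> A) * ((t/2) powr (- (1/2) - kdecay TYPE('n)) * (t/2) powr (1/2))"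
      by simp
    also have "(t/2) powr (- (1/2) - kdecay TYPE('n)) * (t/2) powr (1/2) = 2 powr kdecay TYPE('n) * t powr (- kdecay TYPE('n))"
      using t by (simp add: powr_add[symmetric] powr_divide powr_minus divide_simps)
    finally show ?thesis by (simp add: mult_ac)
  qed
  have "ennreal \<bar>u1 i a t\<bar> \<le> ennreal (kconst TYPE('n) * t powr (- kdecay TYPE('n))) * mass 0
     + (ennreal (2 * kconst TYPE('n) * kexp TYPE('n) * t powr (- kdecay TYPE('n))) * (\<integral>\<^sup>+s. indicator {0<..<t} s * \<phi> s \<partial>lborel)
     + ennreal (kconst TYPE('n)) * (\<integral>\<^sup>+s. indicator {t/2<..<t} s * (ennreal ((t - s) powr (- (1/2))) * \<psi> s) \<partial>lborel))"
    by (rule sup_gradient_bound[OF t(1) dt phi_bound psi_bound phi_psi_measurable])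
  also have "\<dots> \<le> ennreal (kconst TYPE('n) * t powr (- kdecay TYPE('n))) * ennreal M
     + (ennreal (2 * kconst TYPE('n) * kexp TYPE('n) * t powr (- kdecay TYPE('n))) * ennreal (A * (profile_const q TYPE('n) * \<eta> A) + K powr q * D * h)
     + ennreal (kconst TYPE('n)) * ennreal (2 * 2 powr kdecay TYPE('n) * (A * \<eta> A) * t powr (- kdecay TYPE('n)) + K powr q * (2 * h powr (1/2))))"
    by (intro add_mono mult_left_mono mass_le_M I1 I2) auto
  also have "\<dots> = ennreal (kconst TYPE('n) * t powr (- kdecay TYPE('n)) * M + (2 * kconst TYPE('n) * kexp TYPE('n) * t powr (- kdecay TYPE('n)) * (A * (profile_const q TYPE('n) * \<eta> A) + K powr q * D * h)
     + kconst TYPE('n) * (2 * 2 powr kdecay TYPE('n) * (A * \<eta> A) * t powr (- kdecay TYPE('n)) + K powr q * (2 * h powr (1/2)))))"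
  proof -
    have "0 \<le> A * (profile_const q TYPE('n) * \<eta> A) + K powr q * D * h" "0 \<le> 2 * 2 powr kdecay TYPE('n) * (A * \<eta> A) * t powr (- kdecay TYPE('n)) + K powr q * (2 * h powr (1/2))"
      using A profile_const_pos eta_nonneg[of A] D h by simp_all
    then show ?thesis using M_pos by (simp add: ennreal_mult[symmetric] ennreal_plus[symmetric] del: ennreal_plus)
  qed
  also have "\<dots> \<le> ennreal ((kconst TYPE('n) * M + 2 * kconst TYPE('n) * kexp TYPE('n) * profile_const q TYPE('n) * (A * \<eta> A) + 2 * kconst TYPE('n) * 2 powr kdecay TYPE('n) * (A * \<eta> A) + crude D Tm h) * t powr (- kdecay TYPE('n)))"
  proof (rule ennreal_leI)
    have "1 \<le> Tm powr kdecay TYPE('n) * t powr (- kdecay TYPE('n))"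
      using t kdecay_pos powr_mono2[of "kdecay TYPE('n)" t Tm] by (simp add: powr_minus divide_simps)
    then have "2 * kconst TYPE('n) * K powr q * h powr (1/2) * 1 \<le> 2 * kconst TYPE('n) * K powr q * h powr (1/2) * (Tm powr kdecay TYPE('n) * t powr (- kdecay TYPE('n)))"
      by (intro mult_left_mono) auto
    moreover have "0 \<le> kconst TYPE('n) * kexp TYPE('n) * (K powr q * D) * (2 * h powr (1/2)) * Tm powr (1/2) * t powr (- kdecay TYPE('n))"
      using D h by simp
    ultimately show "kconst TYPE('n) * t powr (- kdecay TYPE('n)) * M + (2 * kconst TYPE('n) * kexp TYPE('n) * t powr (- kdecay TYPE('n)) * (A * (profile_const q TYPE('n) * \<eta> A) + K powr q * D * h)
     + kconst TYPE('n) * (2 * 2 powr kdecay TYPE('n) * (A * \<eta> A) * t powr (- kdecay TYPE('n)) + K powr q * (2 * h powr (1/2))))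
      \<le> (kconst TYPE('n) * M + 2 * kconst TYPE('n) * kexp TYPE('n) * profile_const q TYPE('n) * (A * \<eta> A) + 2 * kconst TYPE('n) * 2 powr kdecay TYPE('n) * (A * \<eta> A) + crude D Tm h) * t powr (- kdecay TYPE('n))"
      unfolding crude_def by (simp add: algebra_simps)
  qed
  finally have "ennreal \<bar>u1 i a t\<bar> \<le> ennreal ((kconst TYPE('n) * M + 2 * kconst TYPE('n) * kexp TYPE('n) * profile_const q TYPE('n) * (A * \<eta> A) + 2 * kconst TYPE('n) * 2 powr kdecay TYPE('n) * (A * \<eta> A) + crude D Tm h) * t powr (- kdecay TYPE('n)))" .
  moreover have "0 \<le> (kconst TYPE('n) * M + 2 * kconst TYPE('n) * kexp TYPE('n) * profile_const q TYPE('n) * (A * \<eta> A) + 2 * kconst TYPE('n) * 2 powr kdecay TYPE('n) * (A * \<eta> A) + crude D Tm h) * t powr (- kdecay TYPE('n))"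
    using A M_pos profile_const_pos eta_nonneg[of A] D h by (simp add: crude_def)
  ultimately show ?thesis by (simp add: ennreal_le_iff)
qed

text \<open>Closing the bootstrap: after summing over the partial derivatives, the constants
  produced by both steps are at most the A with which the decay was assumed up to T.\<close>

lemma decays_step:
  assumes small: "step_const q TYPE('n) * (M + A * \<eta> A) + real CARD('n) * crude D Tm h \<le> A"
  shows "decays A \<delta> t"
  unfolding decays_def
proof (intro conjI allI)
  let ?n = "real CARD('n)"
  have cr: "crude D Tm h \<ge> 0" using D h by (simp add: crude_def)
  have AE: "A * \<eta> A \<ge> 0" using A eta_nonneg[of A] by simp
  define S where "S = kconst TYPE('n) + kconst TYPE('n) * kexp TYPE('n) * (2 * profile_const q TYPE('n) + 4) + 2 * kconst TYPE('n) * kexp TYPE('n) * profile_const q TYPE('n) + 2 * kconst TYPE('n) * 2 powr kdecay TYPE('n)"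
  have nn: "0 \<le> kconst TYPE('n) * kexp TYPE('n) * (2 * profile_const q TYPE('n) + 4)" "0 \<le> 2 * kconst TYPE('n) * kexp TYPE('n) * profile_const q TYPE('n)" "0 \<le> 2 * kconst TYPE('n) * 2 powr kdecay TYPE('n)"
    using profile_const_pos by auto
  have S: "kconst TYPE('n) \<le> S" "kconst TYPE('n) * kexp TYPE('n) * (2 * profile_const q TYPE('n) + 4) \<le> S" "2 * kconst TYPE('n) * kexp TYPE('n) * profile_const q TYPE('n) + 2 * kconst TYPE('n) * 2 powr kdecay TYPE('n) \<le> S"
    using nn kconst_ge_0[where 'n='n] unfolding S_def by linarith+
  have *: "?n * (S * M + S * (A * \<eta> A) + crude D Tm h) \<le> A"
  proof -
    have "step_const q TYPE('n) = ?n * S" by (simp only: step_const_def S_def)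
    then show ?thesis using small by (simp add: algebra_simps)
  qed
  have "kconst TYPE('n) * M + kconst TYPE('n) * kexp TYPE('n) * (2 * profile_const q TYPE('n) + 4) * (A * \<eta> A) + crude D Tm h \<le> S * M + S * (A * \<eta> A) + crude D Tm h"
    using S M_pos AE by (intro add_right_mono add_mono mult_right_mono) auto
  from order_trans[OF mult_left_mono[OF this, of ?n] *]
  have s1: "?n * (kconst TYPE('n) * M + kconst TYPE('n) * kexp TYPE('n) * (2 * profile_const q TYPE('n) + 4) * (A * \<eta> A) + crude D Tm h) \<le> A" by simp
  have "kconst TYPE('n) * M + (2 * kconst TYPE('n) * kexp TYPE('n) * profile_const q TYPE('n) + 2 * kconst TYPE('n) * 2 powr kdecay TYPE('n)) * (A * \<eta> A) + crude D Tm h \<le> S * M + S * (A * \<eta> A) + crude D Tm h"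
    using S M_pos AE by (intro add_right_mono add_mono mult_right_mono) auto
  from order_trans[OF mult_left_mono[OF this, of ?n] *]
  have s2: "?n * (kconst TYPE('n) * M + 2 * kconst TYPE('n) * kexp TYPE('n) * profile_const q TYPE('n) * (A * \<eta> A) + 2 * kconst TYPE('n) * 2 powr kdecay TYPE('n) * (A * \<eta> A) + crude D Tm h) \<le> A"
    by (simp add: distrib_right add.assoc)
  fix a :: "real^'n"
  have "gn a t \<le> (\<Sum>i\<in>(UNIV::'n set). (kconst TYPE('n) * M + 2 * kconst TYPE('n) * kexp TYPE('n) * profile_const q TYPE('n) * (A * \<eta> A) + 2 * kconst TYPE('n) * 2 powr kdecay TYPE('n) * (A * \<eta> A) + crude D Tm h) * t powr (- kdecay TYPE('n)))"
    by (intro order_trans[OF gn_le_sum] sum_mono sup_step)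
  also have "\<dots> = (?n * (kconst TYPE('n) * M + 2 * kconst TYPE('n) * kexp TYPE('n) * profile_const q TYPE('n) * (A * \<eta> A) + 2 * kconst TYPE('n) * 2 powr kdecay TYPE('n) * (A * \<eta> A) + crude D Tm h)) * t powr (- kdecay TYPE('n))"
    by simp
  also have "\<dots> \<le> A * t powr (- kdecay TYPE('n))" using s2 by (intro mult_right_mono) auto
  finally show "gn a t \<le> A * t powr (- kdecay TYPE('n))" .
  have u1m[measurable]: "(\<lambda>x. u1 i x t) \<in> borel_measurable borel" for i
    using slice_continuous(3)[OF t(1)] by (rule borel_measurable_continuous_onI)
  have "(\<integral>\<^sup>+x. ennreal (exp (- \<delta> * norm (x - a))) * ennreal (gn x t) \<partial>lborel)
     \<le> (\<integral>\<^sup>+x. (\<Sum>i\<in>(UNIV::'n set). ennreal (exp (- \<delta> * norm (x - a))) * ennreal \<bar>u1 i x t\<bar>) \<partial>lborel)"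
    unfolding sum_distrib_left[symmetric]
    by (intro nn_integral_mono mult_left_mono) (auto intro!: ennreal_leI gn_le_sum)
  also have "\<dots> = (\<Sum>i\<in>(UNIV::'n set). \<integral>\<^sup>+x. ennreal (exp (- \<delta> * norm (x - a))) * ennreal \<bar>u1 i x t\<bar> \<partial>lborel)"
    by (intro nn_integral_sum) measurable
  also have "\<dots> \<le> (\<Sum>i\<in>(UNIV::'n set). ennreal ((kconst TYPE('n) * M + kconst TYPE('n) * kexp TYPE('n) * (2 * profile_const q TYPE('n) + 4) * (A * \<eta> A) + crude D Tm h) * t powr (- (1/2))))"
    by (intro sum_mono weighted_step)
  also have "\<dots> = ennreal ((?n * (kconst TYPE('n) * M + kconst TYPE('n) * kexp TYPE('n) * (2 * profile_const q TYPE('n) + 4) * (A * \<eta> A) + crude D Tm h)) * t powr (- (1/2)))"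
    
  proof -
    have "0 \<le> kconst TYPE('n) * M + kconst TYPE('n) * kexp TYPE('n) * (2 * profile_const q TYPE('n) + 4) * (A * \<eta> A) + crude D Tm h"
      using cr nn(1) AE M_pos by (intro add_nonneg_nonneg mult_nonneg_nonneg[of "kconst TYPE('n) * kexp TYPE('n) * (2 * profile_const q TYPE('n) + 4)"]) auto
    then show ?thesis by (simp add: ennreal_mult[symmetric] ennreal_of_nat_eq_real_of_nat mult.assoc)
  qed
  also have "\<dots> \<le> ennreal (A * t powr (- (1/2)))"
    using s1 by (intro ennreal_leI mult_right_mono) auto
  finally show "(\<integral>\<^sup>+x. ennreal (exp (- \<delta> * norm (x - a))) * ennreal (gn x t) \<partial>lborel) \<le> ennreal (A * t powr (- (1/2)))" .
qed

end

lemma step_const_pos: "step_const q TYPE('n) > 0"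
  using profile_const_pos kconst_ge_1[where 'n='n] by (simp add: step_const_def add_pos_nonneg)

text \<open>The factor 4 balances the budget of \<open>decays_step\<close>: the mass term takes
  A0/4, the source term at most A0/2 by \<open>eta_A0\<close>, and the crude term at most
  A0/4.\<close>

definition A0 :: real where "A0 = 4 * step_const q TYPE('n) * M"

lemma A0_pos: "A0 > 0" using step_const_pos M_pos by (simp add: A0_def)

context
  assumes small: "M * K powr (2 * kdecay TYPE('n) * (q - 1) - 1)
    < (1 / (2 * step_const q TYPE('n))) powr (2 * kdecay TYPE('n)) / (4 * step_const q TYPE('n))"
begin

text \<open>The power 2k of \<open>\<eta>\<close> at A0 equals A0 K^(2k(q-1) - 1), a multiple of the
  quantity assumed small. The threshold is chosen so that taking the root leaves exactly 1/(2 S)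
  with S = \<open>step_const\<close>.\<close>

lemma eta_A0: "\<eta> A0 \<le> 1 / (2 * step_const q TYPE('n))"
proof -
  let ?S = "step_const q TYPE('n)" and ?k = "kdecay TYPE('n)"
  have "\<eta> A0 powr (2 * ?k) = K powr ((q - 1) * (2 * ?k)) * (A0 / K) powr 1"
    using A0_pos K_pos kdecay_pos by (simp add: \<eta>_def powr_mult powr_powr)
  also have "\<dots> = A0 * (K powr ((q - 1) * (2 * ?k)) * K powr (- 1))"
    using A0_pos K_pos by (simp add: powr_minus_divide)
  also have "K powr ((q - 1) * (2 * ?k)) * K powr (- 1) = K powr (2 * ?k * (q - 1) - 1)"
  proof -
    have "(q - 1) * (2 * ?k) + - 1 = 2 * ?k * (q - 1) - 1" by simp
    then show ?thesis by (simp only: powr_add[symmetric])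
  qed
  also have "A0 * K powr (2 * ?k * (q - 1) - 1) = (4 * ?S) * (M * K powr (2 * ?k * (q - 1) - 1))"
    by (simp add: A0_def)
  also have "\<dots> \<le> (4 * ?S) * ((1 / (2 * ?S)) powr (2 * ?k) / (4 * ?S))"
    using small step_const_pos by (intro mult_left_mono) auto
  also have "\<dots> = (1 / (2 * ?S)) powr (2 * ?k)" using step_const_pos by simp
  finally have *: "\<eta> A0 powr (2 * ?k) \<le> (1 / (2 * ?S)) powr (2 * ?k)" .
  show ?thesis
  proof (rule ccontr)
    assume "\<not> \<eta> A0 \<le> 1 / (2 * ?S)"
    then have "(1 / (2 * ?S)) powr (2 * ?k) < \<eta> A0 powr (2 * ?k)"
      using kdecay_pos step_const_pos by (intro powr_less_mono2) auto
    with * show False by simp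
  qed
qed

text \<open>\<open>crude\<close> depends on the weight, the horizon and h, but not on how far the
  decay has been propagated. One step length h therefore serves for all steps, and finitely many of
  them reach \<open>Tm\<close>.\<close>

lemma decays_A0:
  assumes d: "\<delta> > 0" "2 * \<delta>\<^sup>2 * Tm \<le> 1" and t: "0 < t" "t \<le> Tm"
  shows "decays A0 \<delta> t"
proof -
  let ?S = "step_const q TYPE('n)"
  obtain D where D: "D \<ge> 0" "\<And>a::real^'n. (\<integral>\<^sup>+x. ennreal (exp (- \<delta> * norm (x - a))) \<partial>lborel) \<le> ennreal D"
    using nn_integral_exp_weight_finite[OF d(1), where 'n='n] by blast
  define X where "X = kconst TYPE('n) * kexp TYPE('n) * (K powr q * D) * 2 * Tm powr (1/2) + 2 * kconst TYPE('n) * kexp TYPE('n) * (K powr q * D)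
    + 2 * kconst TYPE('n) * K powr q * Tm powr kdecay TYPE('n)"
  have X: "X \<ge> 0" using D by (simp add: X_def)
  \<comment> \<open>\<open>X\<close> collects the coefficients of \<open>crude\<close>; with h = r^2
    both h^(1/2) and h are at most r. The added 1 guards against X = 0.\<close>
  define r where "r = min 1 ((A0 / 4) / (real CARD('n) * X + 1))"
  have nX: "real CARD('n) * X + 1 > 0" using X by (simp add: add_nonneg_pos)
  have r: "0 < r" "r \<le> 1" "real CARD('n) * X * r \<le> A0 / 4"
  proof -
    show "0 < r" using A0_pos nX by (simp add: r_def)
    show "r \<le> 1" by (simp add: r_def)
    have "real CARD('n) * X * r \<le> (real CARD('n) * X + 1) * ((A0 / 4) / (real CARD('n) * X + 1))"
      using X nX A0_pos by (intro mult_mono) (auto simp: r_def)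
    moreover have "Y * ((A0 / 4) / Y) = A0 / 4" if "Y > 0" for Y :: real using that by simp
    ultimately show "real CARD('n) * X * r \<le> A0 / 4" using nX by metis
  qed
  define h where "h = r\<^sup>2"
  have h: "h > 0" "h powr (1/2) = r" "h \<le> r"
    using r by (auto simp: h_def powr_half_sqrt power2_eq_square mult_left_le)
  have "crude D Tm h = kconst TYPE('n) * kexp TYPE('n) * (K powr q * D) * 2 * Tm powr (1/2) * r + 2 * kconst TYPE('n) * kexp TYPE('n) * (K powr q * D) * h
    + 2 * kconst TYPE('n) * K powr q * Tm powr kdecay TYPE('n) * r"
    unfolding crude_def h(2) by simp
  also have "\<dots> \<le> X * r"
  proof -
    have "2 * kconst TYPE('n) * kexp TYPE('n) * (K powr q * D) * h \<le> 2 * kconst TYPE('n) * kexp TYPE('n) * (K powr q * D) * r"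
      using D h by (intro mult_left_mono) auto
    then show ?thesis by (simp add: X_def distrib_right)
  qed
  finally have "crude D Tm h \<le> X * r" .
  then have "real CARD('n) * crude D Tm h \<le> real CARD('n) * (X * r)" by (rule mult_left_mono) simp
  also have "\<dots> = real CARD('n) * X * r" by simp
  also note r(3)
  finally have "real CARD('n) * crude D Tm h \<le> A0 / 4" .
  moreover have "?S * (M + A0 * \<eta> A0) \<le> A0 / 4 + A0 / 2"
  proof -
    have "?S * (A0 * \<eta> A0) \<le> ?S * (A0 * (1 / (2 * ?S)))"
      using step_const_pos A0_pos eta_A0 by (intro mult_left_mono) auto
    then show ?thesis using step_const_pos by (simp add: distrib_left A0_def)
  qed
  ultimately have crude: "?S * (M + A0 * \<eta> A0) + real CARD('n) * crude D Tm h \<le> A0"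
    by linarith
  \<comment> \<open>The case k = 0 is vacuous because t > 0; the very first step thus rests on the
    crude bound alone.\<close>
  have "\<forall>t. 0 < t \<longrightarrow> t \<le> Tm \<longrightarrow> t \<le> real k * h \<longrightarrow> decays A0 \<delta> t" for k
  proof (induction k)
    case (Suc k)
    show ?case
    proof (intro allI impI)
      fix t assume t: "0 < t" "t \<le> Tm" "t \<le> real (Suc k) * h"
      show "decays A0 \<delta> t"
        by (rule decays_step[where T="real k * h", OF A0_pos d D h(1) _ _ _ _ _ crude])
          (use Suc h t in \<open>auto simp: distrib_right\<close>)
    qed
  qed auto
  moreover obtain k where "t \<le> real k * h" using reals_Archimedean3[OF h(1)] less_imp_le by blast
  ultimately show ?thesis using t by blast
qed

text \<open>The estimates hold with the same A0 for every admissible weight, and the weights tend to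
  1 as \<open>\<delta>\<close> tends to 0, so Fatou's lemma removes them.\<close>

theorem small_data_decay:
  assumes t: "t > 0"
  shows "gn x t \<le> A0 * t powr (- kdecay TYPE('n))"
    and "(\<integral>\<^sup>+x. ennreal (gn x t) \<partial>lborel) \<le> ennreal (A0 * t powr (- (1/2)))"
    and "F t \<le> ennreal (A0 * b A0 t)"
proof -
  \<comment> \<open>With horizon Tm = t the condition on the weight reads 2 d^2 t <= 1; it holds
    with equality for j = 0.\<close>
  define d where "d j = 1 / (sqrt (2 * t) * real (Suc j))" for j
  have d: "d j > 0" "2 * (d j)\<^sup>2 * t \<le> 1" for j
  proof -
    show "d j > 0" using t by (simp add: d_def)
    have "2 * (d j)\<^sup>2 * t = 1 / (real (Suc j))\<^sup>2" using t by (simp add: d_def power_divide power_mult_distrib)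
    also have "\<dots> \<le> 1" using one_le_power[of "real (Suc j)" 2] by (simp add: divide_le_eq_1)
    finally show "2 * (d j)\<^sup>2 * t \<le> 1" .
  qed
  have dec: "decays A0 (d j) t" for j by (rule decays_A0[OF d]) (use t in auto)
  then show "gn x t \<le> A0 * t powr (- kdecay TYPE('n))" by (auto simp: decays_def)
  have d0: "d \<longlonglongrightarrow> 0"
  proof -
    have "(\<lambda>j. (1 / sqrt (2 * t)) * inverse (real (Suc j))) \<longlonglongrightarrow> (1 / sqrt (2 * t)) * 0"
      by (intro tendsto_intros LIMSEQ_inverse_real_of_nat)
    then show ?thesis by (simp add: d_def[abs_def] inverse_eq_divide)
  qed
  have lim: "(\<integral>\<^sup>+x. ennreal (g x) \<partial>lborel) \<le> ennreal C"
    if [measurable]: "g \<in> borel_measurable borel"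
      and le: "\<And>j. (\<integral>\<^sup>+x. ennreal (exp (- d j * norm x)) * ennreal (g x) \<partial>lborel) \<le> ennreal C" for g :: "real^'n \<Rightarrow> real" and C
  proof -
    have "(\<integral>\<^sup>+x. ennreal (g x) \<partial>lborel) = (\<integral>\<^sup>+x. liminf (\<lambda>j. ennreal (exp (- d j * norm x)) * ennreal (g x)) \<partial>lborel)"
    proof (intro nn_integral_cong)
      fix x :: "real^'n"
      have "(\<lambda>j. exp (- d j * norm x)) \<longlonglongrightarrow> exp (- 0 * norm x)" by (intro tendsto_intros d0)
      then have "(\<lambda>j. ennreal (exp (- d j * norm x)) * ennreal (g x)) \<longlonglongrightarrow> ennreal (exp (- 0 * norm x)) * ennreal (g x)"
        by (intro tendsto_mult_ennreal tendsto_ennrealI tendsto_const) auto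
      then show "ennreal (g x) = liminf (\<lambda>j. ennreal (exp (- d j * norm x)) * ennreal (g x))"
        by (simp add: lim_imp_Liminf)
    qed
    also have "\<dots> \<le> liminf (\<lambda>j. \<integral>\<^sup>+x. ennreal (exp (- d j * norm x)) * ennreal (g x) \<partial>lborel)"
      by (rule nn_integral_liminf) measurable
    also have "\<dots> \<le> liminf (\<lambda>j. ennreal C)" using le by (intro Liminf_mono) auto
    finally show ?thesis by (simp add: Liminf_const)
  qed
  show "(\<integral>\<^sup>+x. ennreal (gn x t) \<partial>lborel) \<le> ennreal (A0 * t powr (- (1/2)))"
  proof (rule lim)
    show "(\<integral>\<^sup>+x. ennreal (exp (- d j * norm x)) * ennreal (gn x t) \<partial>lborel) \<le> ennreal (A0 * t powr (- (1/2)))" for j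
    proof -
      have "(\<integral>\<^sup>+x. ennreal (exp (- d j * norm (x - 0))) * ennreal (gn x t) \<partial>lborel) \<le> ennreal (A0 * t powr (- (1/2)))"
        using dec[of j] unfolding decays_def by blast
      then show ?thesis by simp
    qed
  qed (use t in measurable)
  show "F t \<le> ennreal (A0 * b A0 t)"
    unfolding F_def
  proof (rule lim)
    show "(\<integral>\<^sup>+x. ennreal (exp (- d j * norm x)) * ennreal (f x t) \<partial>lborel) \<le> ennreal (A0 * b A0 t)" for j
      using decays_f_weighted[OF A0_pos t dec[of j], of 0] by simp
  qed measurable
qed

corollary small_data_source:
  "(\<integral>\<^sup>+s. indicator {0<..} s * F s \<partial>lborel) \<le> ennreal (A0 * (profile_const q TYPE('n) * \<eta> A0))"
proof -
  have "(\<integral>\<^sup>+s. indicator {0<..} s * F s \<partial>lborel) \<le> (\<integral>\<^sup>+s. ennreal A0 * (indicator {0<..} s * ennreal (b A0 s)) \<partial>lborel)"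
  proof (intro nn_integral_mono)
    fix s
    show "indicator {0<..} s * F s \<le> ennreal A0 * (indicator {0<..} s * ennreal (b A0 s))"
      using small_data_decay(3)[of s] A0_pos b_nonneg by (cases "s > 0") (auto simp: ennreal_mult)
  qed
  also have "\<dots> = ennreal A0 * (\<integral>\<^sup>+s. indicator {0<..} s * ennreal (b A0 s) \<partial>lborel)"
    by (rule nn_integral_cmult) measurable
  also have "\<dots> \<le> ennreal A0 * ennreal (profile_const q TYPE('n) * \<eta> A0)"
    by (intro mult_left_mono b_integral A0_pos) auto
  finally show ?thesis using A0_pos profile_const_pos eta_nonneg by (simp add: ennreal_mult)
qed

end

end

section \<open>Bounded mass for q >= 2 and vanishing of the gradient\<close>

lemma tail_integral_small:
  fixes F :: "real \<Rightarrow> ennreal"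
  assumes [measurable]: "F \<in> borel_measurable borel"
    and fin: "(\<integral>\<^sup>+s. indicator {0<..} s * F s \<partial>lborel) < \<infinity>" and e: "e > 0"
  obtains T where "T > 0" "(\<integral>\<^sup>+s. indicator {T<..} s * F s \<partial>lborel) \<le> ennreal e"
proof -
  have "(\<lambda>k. \<integral>\<^sup>+s. indicator {real (Suc k)<..} s * F s \<partial>lborel) \<longlonglongrightarrow> (\<integral>\<^sup>+s. 0 \<partial>(lborel::real measure))"
  proof (rule nn_integral_dominated_convergence[where w="\<lambda>s. indicator {0<..} s * F s"])
    show "AE s in lborel. indicator {real (Suc k)<..} s * F s \<le> indicator {0<..} s * F s" for k
      by (intro AE_I2) (auto simp: indicator_def)
    show "AE s in lborel. (\<lambda>k. indicator {real (Suc k)<..} s * F s) \<longlonglongrightarrow> 0"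
    proof (rule AE_I2)
      fix s :: real
      obtain N :: nat where N: "s \<le> real N" using real_arch_simple by blast
      have "\<forall>\<^sub>F k in sequentially. indicator {real (Suc k)<..} s * F s = 0"
        using eventually_ge_at_top[of N] by eventually_elim (use N in \<open>auto simp: indicator_def\<close>)
      then show "(\<lambda>k. indicator {real (Suc k)<..} s * F s) \<longlonglongrightarrow> 0"
        by (rule tendsto_eventually)
    qed
  qed (use fin in auto)
  then have "\<forall>\<^sub>F k in sequentially. (\<integral>\<^sup>+s. indicator {real (Suc k)<..} s * F s \<partial>lborel) < ennreal e"
    using e by (intro order_tendstoD(2)) auto
  then obtain k where "(\<integral>\<^sup>+s. indicator {real (Suc k)<..} s * F s \<partial>lborel) < ennreal e"
    unfolding eventually_sequentially by blast
  then show thesis by (intro that[of "real (Suc k)"]) auto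
qed

lemma tail_integral_mono:
  "T \<le> T' \<Longrightarrow> (\<integral>\<^sup>+s. indicator {T'<..} s * F s \<partial>lborel) \<le> (\<integral>\<^sup>+s. indicator {T<..} s * F s \<partial>lborel)"
  for T T' :: real and F :: "real \<Rightarrow> ennreal"
  by (intro nn_integral_mono) (auto simp: indicator_def)

lemma integral_nonpos:
  fixes f :: "'a \<Rightarrow> real"
  assumes "\<And>x. f x \<le> 0"
  shows "(LINT x|M. f x) \<le> 0"
  using Bochner_Integration.integral_nonneg[of M "\<lambda>x. - f x"] assms by simp

lemma abs_exp_minus_1_le: "\<bar>exp y - 1\<bar> \<le> exp \<bar>y\<bar> * \<bar>y\<bar>" for y :: real
proof (cases "y \<ge> 0")
  case True
  have "1 - y \<le> exp (- y)" using exp_ge_add_one_self[of "- y"] by simp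
  then have "exp y * (1 - y) \<le> exp y * exp (- y)" by (intro mult_left_mono) auto
  then have "exp y * (1 - y) \<le> 1" by (simp add: exp_minus)
  then show ?thesis using True by (simp add: algebra_simps)
next
  case False
  have "1 - exp y \<le> - y" using exp_ge_add_one_self[of y] by linarith
  also have "\<dots> \<le> exp \<bar>y\<bar> * \<bar>y\<bar>" using False mult_right_mono[of 1 "exp \<bar>y\<bar>" "\<bar>y\<bar>"] by simp
  finally show ?thesis using False by simp
qed

context visc_HJ begin

text \<open>\<open>mass_eq\<close> bounds the source integral over (0, t) by the mass at time t, and
  Fatou's lemma lets t tend to infinity along the integers.\<close>

lemma integral_source_le:
  assumes "\<And>t. t > 0 \<Longrightarrow> mass t \<le> C"
  shows "(\<integral>\<^sup>+s. indicator {0<..} s * F s \<partial>lborel) \<le> C"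
proof -
  have "(\<integral>\<^sup>+s. indicator {0<..} s * F s \<partial>lborel) = (\<integral>\<^sup>+s. liminf (\<lambda>k. indicator {0<..<real (Suc k)} s * F s) \<partial>lborel)"
  proof (intro nn_integral_cong)
    fix s :: real
    obtain N :: nat where N: "s \<le> real N" using real_arch_simple by blast
    have "\<forall>\<^sub>F k in sequentially. indicator {0<..<real (Suc k)} s * F s = indicator {0<..} s * F s"
      using eventually_ge_at_top[of N] by eventually_elim (use N in \<open>auto simp: indicator_def\<close>)
    then have "(\<lambda>k. indicator {0<..<real (Suc k)} s * F s) \<longlonglongrightarrow> indicator {0<..} s * F s"
      by (rule tendsto_eventually)
    then show "indicator {0<..} s * F s = liminf (\<lambda>k. indicator {0<..<real (Suc k)} s * F s)"
      by (simp add: lim_imp_Liminf)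
  qed
  also have "\<dots> \<le> liminf (\<lambda>k. \<integral>\<^sup>+s. indicator {0<..<real (Suc k)} s * F s \<partial>lborel)"
    by (rule nn_integral_liminf) measurable
  also have "\<dots> \<le> liminf (\<lambda>k. C)"
  proof (intro Liminf_mono always_eventually allI)
    fix k
    have "(\<integral>\<^sup>+s. indicator {0<..<real (Suc k)} s * F s \<partial>lborel) \<le> mass (real (Suc k))"
      by (subst mass_eq) auto
    also have "\<dots> \<le> C" by (rule assms) simp
    finally show "(\<integral>\<^sup>+s. indicator {0<..<real (Suc k)} s * F s \<partial>lborel) \<le> C" .
  qed
  finally show ?thesis by (simp add: Liminf_const)
qed

text \<open>For \<open>q \<ge> 2\<close> the exponential \<open>exp (- l * u)\<close> is a subsolution of the heat equation as soon as
  \<open>l \<ge> K powr (q - 2)\<close>; this is the Hopf--Cole transformation if \<open>q = 2\<close>.\<close>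

lemma mass_bounded_quadratic:
  assumes q2: "q \<ge> 2"
  obtains C where "C \<ge> 0" "\<And>t. t > 0 \<Longrightarrow> mass t \<le> ennreal C * mass 0"
proof -
  \<comment> \<open>l >= K^(q-2) makes the source g of the transformed equation nonpositive, and l
    >= 1 makes W dominate -u.\<close>
  define l where "l = max 1 (K powr (q - 2))"
  have l: "l \<ge> 1" "K powr (q - 2) \<le> l" by (auto simp: l_def)
  define W where "W x t = exp (- l * u x t) - 1" for x t
  define W1 where "W1 i x t = exp (- l * u x t) * (- l * u1 i x t)" for i x t
  define W2 where "W2 i x t = exp (- l * u x t) * (l\<^sup>2 * (u1 i x t)\<^sup>2 - l * u2 i x t)" for i x t
  \<comment> \<open>Set to 0 for t <= 0, where nothing is known about u: \<open>inhom_heat\<close>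
    asks for Borel measurability on all of space-time.\<close>
  define g where "g x t = (if t > 0 then l * exp (- l * u x t) * (f x t - l * (gn x t)\<^sup>2) else 0)" for x t
  have gn2: "(gn x t)\<^sup>2 = (\<Sum>i\<in>UNIV. (u1 i x t)\<^sup>2)" for x t
    by (simp add: gn_def sum_component_sq[symmetric])
  have f2: "f x t \<le> l * (gn x t)\<^sup>2" if t: "t > 0" for x t
  proof -
    have "f x t = gn x t powr (q - 2) * (gn x t)\<^sup>2"
      using q_gt_1 powr_add[of "gn x t" "q - 2" 2] by (cases "gn x t = 0") (auto simp: f_def)
    also have "\<dots> \<le> K powr (q - 2) * (gn x t)\<^sup>2"
      using gn_le[OF t] q2 by (intro mult_right_mono powr_mono2) auto
    also have "\<dots> \<le> l * (gn x t)\<^sup>2" using l by (intro mult_right_mono) auto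
    finally show ?thesis .
  qed
  have eb: "exp (- l * u x t) \<le> exp (l * B)" if "t \<ge> 0" for x t
  proof -
    have "- u x t \<le> B" using w_bound[OF that, of x] by simp
    then have "l * (- u x t) \<le> l * B" using l by (intro mult_left_mono) auto
    then show ?thesis by simp
  qed
  interpret W: inhom_heat W g W1 W2 "exp (l * B) + 1" "l * exp (l * B) * (L + l * K\<^sup>2)"
  proof
    have cu: "continuous_on (UNIV \<times> {0<..}) (\<lambda>p. u (fst p) (snd p))" "continuous_on (UNIV \<times> {0..}) (\<lambda>p. u (fst p) (snd p))"
      "continuous_on (UNIV \<times> {0<..}) (\<lambda>p. u1 i (fst p) (snd p))" "continuous_on (UNIV \<times> {0<..}) (\<lambda>p. u2 i (fst p) (snd p))" for i
      using w_cont w1_cont[of i] w2_cont[of i] by (auto simp: case_prod_beta elim: continuous_on_subset)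
    have cg: "continuous_on (UNIV \<times> {0<..}) (\<lambda>p. gn (fst p) (snd p))"
      unfolding gn_def by (intro continuous_intros cu)
    have cf: "continuous_on (UNIV \<times> {0<..}) (\<lambda>p. f (fst p) (snd p))"
      using continuous_on_minus[OF g_cont] by (simp add: g_eq_f case_prod_beta)
    show "continuous_on (UNIV \<times> {0..}) (\<lambda>(x, t). W x t)"
      unfolding W_def case_prod_beta by (intro continuous_intros cu)
    show "continuous_on (UNIV \<times> {0<..}) (\<lambda>(x, t). W1 i x t)" "continuous_on (UNIV \<times> {0<..}) (\<lambda>(x, t). W2 i x t)" for i
      unfolding W1_def W2_def case_prod_beta by (intro continuous_intros cu)+
    have cgg: "continuous_on (UNIV \<times> {0<..}) (\<lambda>p. l * exp (- l * u (fst p) (snd p)) * (f (fst p) (snd p) - l * (gn (fst p) (snd p))\<^sup>2))"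
      by (intro continuous_intros cu cf cg)
    then show "continuous_on (UNIV \<times> {0<..}) (\<lambda>(x, t). g x t)"
      by (rule continuous_on_eq) (auto simp: g_def)
    have "(\<lambda>p. indicator (UNIV \<times> {0<..}) p *\<^sub>R (l * exp (- l * u (fst p) (snd p)) * (f (fst p) (snd p) - l * (gn (fst p) (snd p))\<^sup>2))) \<in> borel_measurable borel"
      by (intro borel_measurable_continuous_on_indicator cgg borel_open open_Times) auto
    also have "(\<lambda>p. indicator (UNIV \<times> {0<..}) p *\<^sub>R (l * exp (- l * u (fst p) (snd p)) * (f (fst p) (snd p) - l * (gn (fst p) (snd p))\<^sup>2))) = case_prod g"
      by (auto simp: g_def indicator_def fun_eq_iff)
    finally show "case_prod g \<in> borel_measurable borel" .
    fix x t
    show "\<bar>W x t\<bar> \<le> exp (l * B) + 1" if "t \<ge> 0"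
    proof -
      have "0 \<le> exp (- l * u x t)" "0 \<le> exp (l * B)" by simp_all
      then show ?thesis using eb[OF that, of x] unfolding W_def abs_le_iff by linarith
    qed
    assume t: "t > 0"
    show "\<bar>g x t\<bar> \<le> l * exp (l * B) * (L + l * K\<^sup>2)"
    proof -
      have "f x t \<le> L" using g_bound[OF t, of x] by (simp add: g_eq_f)
      moreover have "(gn x t)\<^sup>2 \<le> K\<^sup>2" using gn_le[OF t, of x] by (intro power_mono) auto
      then have "l * (gn x t)\<^sup>2 \<le> l * K\<^sup>2" using l by (intro mult_left_mono) auto
      ultimately have "\<bar>f x t - l * (gn x t)\<^sup>2\<bar> \<le> L + l * K\<^sup>2"
        using l f_nonneg[of x t] by (smt (verit) zero_le_power2 mult_nonneg_nonneg)
      then have "l * exp (- l * u x t) * \<bar>f x t - l * (gn x t)\<^sup>2\<bar> \<le> l * exp (l * B) * (L + l * K\<^sup>2)"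
        using l eb[of t x] t by (intro mult_mono) auto
      then show ?thesis using t l by (simp add: g_def abs_mult)
    qed
    fix i
    have dE: "((\<lambda>y. exp (- l * y)) has_real_derivative - l * exp (- l * y)) (at y)" for y
      by (auto intro!: derivative_eq_intros)
    have pE: "has_partial i (\<lambda>y. exp (- l * u y t)) (- l * exp (- l * u x t) * u1 i x t) x"
      by (rule has_partial_compose[OF w_partial[OF t] dE])
    have "has_partial i (\<lambda>y. exp (- l * u y t) - 1) (- l * exp (- l * u x t) * u1 i x t - 0) x"
      by (intro has_partial_diff pE has_partial_const)
    then show "has_partial i (\<lambda>y. W y t) (W1 i x t) x"
      by (simp add: W_def W1_def mult_ac)
    have "has_partial i (\<lambda>y. exp (- l * u y t) * (- l * u1 i y t))
      ((- l * exp (- l * u x t) * u1 i x t) * (- l * u1 i x t) + (- l * u2 i x t) * exp (- l * u x t)) x"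
      by (intro has_partial_mult pE has_partial_cmult w1_partial t)
    then show "has_partial i (\<lambda>y. W1 i y t) (W2 i x t) x"
      by (simp add: W1_def W2_def power2_eq_square algebra_simps)
    have "((\<lambda>t. exp (- l * u x t)) has_real_derivative (- l * exp (- l * u x t)) * ((\<Sum>i\<in>UNIV. u2 i x t) + - (norm (\<chi> i. u1 i x t) powr q))) (at t)"
      by (rule DERIV_chain2[OF dE w_time[OF t]])
    from DERIV_diff[OF this DERIV_const[of 1]]
    have "(W x has_real_derivative (- l * exp (- l * u x t)) * ((\<Sum>i\<in>UNIV. u2 i x t) - f x t)) (at t)"
      unfolding W_def[abs_def] g_eq_f by simp
    moreover have "(- l * exp (- l * u x t)) * ((\<Sum>i\<in>UNIV. u2 i x t) - f x t) = (\<Sum>i\<in>UNIV. W2 i x t) + g x t"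
    proof -
      have "(\<Sum>i\<in>UNIV. W2 i x t) = exp (- l * u x t) * (l\<^sup>2 * (gn x t)\<^sup>2 - l * (\<Sum>i\<in>UNIV. u2 i x t))"
        unfolding W2_def gn2 by (simp only: sum_distrib_left[symmetric] sum_subtractf)
      then show ?thesis using t by (simp add: g_def power2_eq_square algebra_simps)
    qed
    ultimately show "(W x has_real_derivative (\<Sum>i\<in>UNIV. W2 i x t) + g x t) (at t)" by simp
  qed
  \<comment> \<open>By \<open>f2\<close> the source is nonpositive; dropping it in Duhamel's formula
    is the comparison principle for a subsolution.\<close>
  have W_le: "ennreal (W x t) \<le> heat_nn t (\<lambda>y. ennreal \<bar>W y 0\<bar>) x" if t: "t > 0" for x t
  proof -
    have "(LINT s|lborel. indicator {0<..<t} s * (LINT y|lborel. heat_kernel (x - y) (t - s) * g y s)) \<le> 0"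
    proof (rule integral_nonpos)
      fix s
      have "(LINT y|lborel. heat_kernel (x - y) (t - s) * g y s) \<le> 0"
        using f2[of s] l by (intro integral_nonpos) (auto simp: g_def mult_nonneg_nonpos)
      then show "indicator {0<..<t} s * (LINT y|lborel. heat_kernel (x - y) (t - s) * g y s) \<le> 0"
        by (simp add: mult_nonneg_nonpos)
    qed
    then have "W x t \<le> \<bar>LINT y|lborel. heat_kernel (x - y) t * W y 0\<bar>"
      using W.duhamel(2)[OF t, of x] by simp
    then show ?thesis using W.abs_bound(2)[OF t, of x] by (meson ennreal_leI order_trans)
  qed
  have W0: "\<bar>W x 0\<bar> \<le> (exp (l * B) * l) * \<bar>u x 0\<bar>" for x
  proof -
    have "l * \<bar>u x 0\<bar> \<le> l * B" using w_bound[of 0 x] l by (intro mult_left_mono) auto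
    then have "exp \<bar>- l * u x 0\<bar> * \<bar>- l * u x 0\<bar> \<le> exp (l * B) * \<bar>- l * u x 0\<bar>"
      using l by (intro mult_right_mono) (auto simp: abs_mult)
    with abs_exp_minus_1_le have "\<bar>W x 0\<bar> \<le> exp (l * B) * \<bar>- l * u x 0\<bar>"
      unfolding W_def by (rule order_trans)
    also have "\<dots> = (exp (l * B) * l) * \<bar>u x 0\<bar>" using l by (simp add: abs_mult)
    finally show ?thesis .
  qed
  have "mass t \<le> ennreal (exp (l * B) * l) * mass 0" if t: "t > 0" for t
  proof -
    have "mass t \<le> (\<integral>\<^sup>+x. heat_nn t (\<lambda>y. ennreal \<bar>W y 0\<bar>) x \<partial>lborel)"
      unfolding mass_def
    proof (intro nn_integral_mono)
      fix x
      have "- u x t \<le> l * (- u x t)" using neg_u_eq_nn(2)[OF t, of x] l mult_right_mono[of 1 l "- u x t"] by simp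
      also have "\<dots> \<le> W x t" using exp_ge_add_one_self[of "- l * u x t"] by (simp add: W_def)
      finally show "ennreal (- u x t) \<le> heat_nn t (\<lambda>y. ennreal \<bar>W y 0\<bar>) x"
        using W_le[OF t, of x] by (meson ennreal_leI order_trans)
    qed
    also have "\<dots> = (\<integral>\<^sup>+x. ennreal \<bar>W x 0\<bar> \<partial>lborel)" using t by (intro heat_nn_L1) auto
    also have "\<dots> \<le> (\<integral>\<^sup>+x. ennreal (exp (l * B) * l) * ennreal \<bar>u x 0\<bar> \<partial>lborel)"
      using W0 l by (intro nn_integral_mono) (auto simp: ennreal_mult[symmetric] intro!: ennreal_leI)
    also have "\<dots> = ennreal (exp (l * B) * l) * mass 0"
      by (simp add: nn_integral_cmult nn_integral_abs_u)
    finally show ?thesis .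
  qed
  then show thesis using l by (intro that[of "exp (l * B) * l"]) auto
qed

text \<open>Three zones of the source: for s <= t/2 the kernel decays like t^(-k); for s between t/2
  and t - h it is at most of order h^(-k), and the tail of the source integral is small; on the last
  stretch of length h the bound K^q costs only a multiple of h^(1/2).\<close>

lemma gradient_vanishes:
  assumes M: "mass 0 \<le> ennreal M" "M \<ge> 0"
    and fin: "(\<integral>\<^sup>+s. indicator {0<..} s * F s \<partial>lborel) < \<infinity>" and e: "e > 0"
  obtains T where "T > 0" "\<And>x t. t > T \<Longrightarrow> gn x t \<le> e"
proof -
  let ?c = "kconst TYPE('n)" and ?k = "kdecay TYPE('n)" and ?n = "real CARD('n)"
  have k0: "?k > 0" by (simp add: kdecay_def)
  have c1: "?c > 0" using kconst_ge_1[where 'n='n] by simp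
  obtain Q where Q: "(\<integral>\<^sup>+s. indicator {0<..} s * F s \<partial>lborel) = ennreal Q" "Q \<ge> 0"
    using fin by (cases "\<integral>\<^sup>+s. indicator {0<..} s * F s \<partial>lborel") auto
  \<comment> \<open>Each of the three zones, the initial term being counted with the first,
    contributes at most c r to a partial derivative; 4 r leaves room, and n partial derivatives are
    summed.\<close>
  define r where "r = e / (4 * ?n * ?c)"
  have r: "r > 0" "?c * (4 * r) = e / ?n" using e c1 by (auto simp: r_def)
  \<comment> \<open>p = h^(1/2) is such that the last stretch contributes at most r; the added 1
    avoids a zero denominator.\<close>
  define p where "p = r / (2 * (K powr q + 1))"
  have Kq: "K powr q + 1 > 0" using powr_ge_zero[of K q] by linarith
  have p: "p > 0" using r Kq by (simp add: p_def)
  define h where "h = p\<^sup>2"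
  have h: "h > 0" "h powr (1/2) = p" using p by (auto simp: h_def powr_half_sqrt)
  have hK: "K powr q * (2 * p) \<le> r"
  proof -
    have "a * (2 * (r / (2 * Y))) = (a / Y) * r" for a Y :: real by simp
    then have "K powr q * (2 * p) = (K powr q / (K powr q + 1)) * r" unfolding p_def .
    also have "\<dots> \<le> 1 * r" using r Kq by (intro mult_right_mono) (auto simp: divide_le_eq_1)
    finally show ?thesis by simp
  qed
  \<comment> \<open>The factor h^k compensates the kernel bound h^(-k) of the middle zone, so h has
    to be fixed before T1.\<close>
  obtain T1 where T1: "T1 > 0" "(\<integral>\<^sup>+s. indicator {T1<..} s * F s \<partial>lborel) \<le> ennreal (r * h powr ?k)"
    using tail_integral_small[OF F_measurable fin, of "r * h powr ?k"] r h by auto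
  have "((\<lambda>t. (M + Q) * (t / 2) powr (- ?k)) \<longlongrightarrow> (M + Q) * 0) at_top"
  proof (intro tendsto_mult tendsto_const tendsto_neg_powr)
    show "LIM t at_top. t / 2 :> (at_top :: real filter)"
      using filterlim_tendsto_pos_mult_at_top[OF tendsto_const _ filterlim_ident, of "1/2 :: real"] by simp
  qed (use k0 in auto)
  then have "\<forall>\<^sub>F t in at_top. (M + Q) * (t / 2) powr (- ?k) < r"
    using r by (auto dest: order_tendstoD(2))
  then obtain T2 where T2: "\<And>t. t \<ge> T2 \<Longrightarrow> (M + Q) * (t / 2) powr (- ?k) < r"
    unfolding eventually_at_top_linorder by blast
  define T where "T = max (2 * T1) (max T2 (2 * h))"
  have main: "gn x t \<le> e" if t: "t > T" for x t
  proof -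
    have t0: "t > 0" "t / 2 \<ge> T1" "t \<ge> T2" "h < t / 2" using t T1 by (auto simp: T_def)
    have rk: "a powr (- (1/2)) * a powr (- (?n / 2)) = a powr (- ?k)" for a :: real
    proof -
      have "- (1/2) + - (?n / 2) = - ?k" by (simp add: kdecay_def add_divide_distrib)
      then show ?thesis by (simp only: powr_add[symmetric])
    qed
    have hn: "ennreal (?c * a powr (- (1/2))) * heat_nn (2 * a) h' x \<le> ennreal (?c * a powr (- ?k)) * (\<integral>\<^sup>+y. h' y \<partial>lborel)"
      if a: "a > 0" and [measurable]: "h' \<in> borel_measurable borel" for a h'
    proof -
      have "heat_nn (2 * a) h' x \<le> ennreal ((2 * a) powr (- (?n / 2))) * (\<integral>\<^sup>+y. h' y \<partial>lborel)"
        using a by (intro heat_nn_le_L1) auto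
      also have "\<dots> \<le> ennreal (a powr (- (?n / 2))) * (\<integral>\<^sup>+y. h' y \<partial>lborel)"
        using a by (intro mult_right_mono ennreal_leI powr_mono2') auto
      finally have "ennreal (?c * a powr (- (1/2))) * heat_nn (2 * a) h' x \<le> ennreal (?c * a powr (- (1/2))) * (ennreal (a powr (- (?n / 2))) * (\<integral>\<^sup>+y. h' y \<partial>lborel))"
        by (intro mult_left_mono) auto
      also have "\<dots> = ennreal (?c * (a powr (- (1/2)) * a powr (- (?n / 2)))) * (\<integral>\<^sup>+y. h' y \<partial>lborel)"
        by (simp add: ennreal_mult mult.assoc)
      finally show ?thesis unfolding rk .
    qed
    have b: "ennreal \<bar>u1 i x t\<bar> \<le> ennreal (?c * (4 * r))" for i
    proof -
      have "ennreal \<bar>u1 i x t\<bar> \<le> ennreal (?c * t powr (- (1/2))) * heat_nn (2 * t) (\<lambda>y. ennreal \<bar>u y 0\<bar>) x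
        + (\<integral>\<^sup>+s. indicator {0<..<t} s * (ennreal (?c * (t - s) powr (- (1/2))) * heat_nn (2 * (t - s)) (\<lambda>y. ennreal (f y s)) x) \<partial>lborel)"
        using abs_gradient_bound[OF t0(1), of i x] by (simp add: g_eq_f)
      also have "\<dots> \<le> ennreal (?c * (t / 2) powr (- ?k)) * mass 0 +
        (\<integral>\<^sup>+s. ennreal ?c * (ennreal ((t / 2) powr (- ?k)) * (indicator {0<..} s * F s) + (ennreal (h powr (- ?k)) * (indicator {T1<..} s * F s)
           + ennreal (K powr q) * (indicator {t - h<..<t} s * ennreal ((t - s) powr (- (1/2)))))) \<partial>lborel)"
      proof (intro add_mono nn_integral_mono)
        have "ennreal (?c * t powr (- (1/2))) * heat_nn (2 * t) (\<lambda>y. ennreal \<bar>u y 0\<bar>) x \<le> ennreal (?c * t powr (- ?k)) * mass 0"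
          using hn[OF t0(1), of "\<lambda>y. ennreal \<bar>u y 0\<bar>"] by (simp add: nn_integral_abs_u)
        also have "\<dots> \<le> ennreal (?c * (t / 2) powr (- ?k)) * mass 0"
          using t0 k0 by (intro mult_right_mono ennreal_leI mult_left_mono powr_mono2') auto
        finally show "ennreal (?c * t powr (- (1/2))) * heat_nn (2 * t) (\<lambda>y. ennreal \<bar>u y 0\<bar>) x \<le> ennreal (?c * (t / 2) powr (- ?k)) * mass 0" .
        fix s
        consider "s \<notin> {0<..<t}" | "0 < s" "s \<le> t / 2" | "t / 2 < s" "s \<le> t - h" "0 < s" | "t - h < s" "s < t" "0 < s"
          using t0 by fastforce
        then show "indicator {0<..<t} s * (ennreal (?c * (t - s) powr (- (1/2))) * heat_nn (2 * (t - s)) (\<lambda>y. ennreal (f y s)) x)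
          \<le> ennreal ?c * (ennreal ((t / 2) powr (- ?k)) * (indicator {0<..} s * F s) + (ennreal (h powr (- ?k)) * (indicator {T1<..} s * F s)
           + ennreal (K powr q) * (indicator {t - h<..<t} s * ennreal ((t - s) powr (- (1/2))))))" (is "?l \<le> ennreal ?c * (?A1 + (?A2 + ?A3))")
        proof cases
          case 2
          have "?l \<le> ennreal (?c * (t - s) powr (- ?k)) * F s"
            using hn[of "t - s" "\<lambda>y. ennreal (f y s)"] 2 t0 by (simp add: F_def)
          also have "\<dots> \<le> ennreal (?c * (t / 2) powr (- ?k)) * F s"
            using 2 t0 k0 by (intro mult_right_mono ennreal_leI mult_left_mono powr_mono2') auto
          also have "\<dots> = ennreal ?c * ?A1" using 2 by (simp add: ennreal_mult mult.assoc)
          also have "\<dots> \<le> ennreal ?c * (?A1 + (?A2 + ?A3))" by (intro mult_left_mono) auto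
          finally show ?thesis .
        next
          case 3
          have "?l \<le> ennreal (?c * (t - s) powr (- ?k)) * F s"
            using hn[of "t - s" "\<lambda>y. ennreal (f y s)"] 3 t0 h by (simp add: F_def)
          also have "\<dots> \<le> ennreal (?c * h powr (- ?k)) * F s"
            using 3 t0 k0 h by (intro mult_right_mono ennreal_leI mult_left_mono powr_mono2') auto
          also have "\<dots> = ennreal ?c * ?A2" using 3 t0 by (simp add: ennreal_mult mult.assoc)
          also have "\<dots> \<le> ennreal ?c * (?A1 + (?A2 + ?A3))" by (intro mult_left_mono) (auto simp: add_increasing add_increasing2)
          finally show ?thesis .
        next
          case 4
          have "heat_nn (2 * (t - s)) (\<lambda>y. ennreal (f y s)) x \<le> ennreal (K powr q)"
            using 4 f_le[of s] by (intro heat_nn_sup) (auto intro: ennreal_leI)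
          then have "?l \<le> ennreal (?c * (t - s) powr (- (1/2))) * ennreal (K powr q)"
            using 4 by (simp add: mult_left_mono)
          also have "\<dots> = ennreal ?c * ?A3" using 4 by (simp add: ennreal_mult mult_ac)
          also have "\<dots> \<le> ennreal ?c * (?A1 + (?A2 + ?A3))" by (intro mult_left_mono) (auto simp: add_increasing)
          finally show ?thesis .
        qed simp
      qed
      also have "(\<integral>\<^sup>+s. ennreal ?c * (ennreal ((t / 2) powr (- ?k)) * (indicator {0<..} s * F s) + (ennreal (h powr (- ?k)) * (indicator {T1<..} s * F s)
           + ennreal (K powr q) * (indicator {t - h<..<t} s * ennreal ((t - s) powr (- (1/2)))))) \<partial>lborel)
         = ennreal ?c * (ennreal ((t / 2) powr (- ?k)) * (\<integral>\<^sup>+s. indicator {0<..} s * F s \<partial>lborel) + (ennreal (h powr (- ?k)) * (\<integral>\<^sup>+s. indicator {T1<..} s * F s \<partial>lborel)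
           + ennreal (K powr q) * (\<integral>\<^sup>+s. indicator {t - h<..<t} s * ennreal ((t - s) powr (- (1/2))) \<partial>lborel)))"
        by (simp add: nn_integral_cmult nn_integral_add)
      also have "ennreal (?c * (t / 2) powr (- ?k)) * mass 0 + \<dots> \<le> ennreal (?c * (t / 2) powr (- ?k)) * ennreal M
         + ennreal ?c * (ennreal ((t / 2) powr (- ?k)) * ennreal Q + (ennreal (h powr (- ?k)) * ennreal (r * h powr ?k) + ennreal (K powr q) * ennreal (2 * p)))"
        using h M(1) T1(2) Q(1) by (intro add_mono mult_left_mono) (auto simp: nn_integral_powr_half)
      also have "\<dots> = ennreal (?c * ((M + Q) * (t / 2) powr (- ?k) + (h powr (- ?k) * (r * h powr ?k) + K powr q * (2 * p))))"
        using M(2) Q(2) r p by (simp add: ennreal_mult[symmetric] ennreal_plus[symmetric] algebra_simps del: ennreal_plus)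
      also have "h powr (- ?k) * (r * h powr ?k) = r" using h by (simp add: powr_minus)
      also have "ennreal (?c * ((M + Q) * (t / 2) powr (- ?k) + (r + K powr q * (2 * p)))) \<le> ennreal (?c * (4 * r))"
        using T2[OF t0(3)] hK r c1 by (intro ennreal_leI mult_left_mono) auto
      finally show ?thesis .
    qed
    have "gn x t \<le> (\<Sum>i\<in>(UNIV::'n set). e / ?n)"
    proof (intro order_trans[OF gn_le_sum] sum_mono)
      fix i show "\<bar>u1 i x t\<bar> \<le> e / ?n"
        using b[of i] r e by (simp add: ennreal_le_iff)
    qed
    then show ?thesis by simp
  qed
  have "T > 0" using T1 by (simp add: T_def)
  then show thesis using main by (rule that)
qed

text \<open>The interface between the decay estimates and the asymptotics. Rates are required after
  some time T only, because for q >= 2 they set in once the gradient has become small.\<close>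

definition diffusive_decay :: bool where
  "diffusive_decay \<longleftrightarrow> (\<integral>\<^sup>+s. indicator {0<..} s * F s \<partial>lborel) < \<infinity> \<and>
    (\<exists>A>0. \<exists>T>0. \<forall>t>T. (\<forall>x. gn x t \<le> A * t powr (- kdecay TYPE('n))) \<and>
      (\<integral>\<^sup>+x. ennreal (gn x t) \<partial>lborel) \<le> ennreal (A * t powr (- (1/2))))"

lemma small_data_diffusive_decay:
  assumes crit: "kdecay TYPE('n) * (q - 1) > 1 / 2" and M: "mass 0 \<le> ennreal M" "M > 0" and K: "K > 0"
    and small: "M * K powr (2 * kdecay TYPE('n) * (q - 1) - 1)
      < (1 / (2 * step_const q TYPE('n))) powr (2 * kdecay TYPE('n)) / (4 * step_const q TYPE('n))"
  shows diffusive_decay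
proof -
  interpret visc_HJ_small q u u1 u2 B L K M
    by unfold_locales fact+
  have "(\<integral>\<^sup>+s. indicator {0<..} s * F s \<partial>lborel) < \<infinity>"
    using small_data_source[OF small] by (rule order.strict_trans1) simp
  then show ?thesis unfolding diffusive_decay_def
    using small_data_decay(1,2)[OF small] A0_pos
    by (intro conjI exI[of _ A0] exI[of _ 1]) auto
qed

lemma quadratic_diffusive_decay:
  assumes q2: "q \<ge> 2" and M: "mass 0 \<le> ennreal M" "M > 0"
  shows diffusive_decay
proof -
  let ?k = "kdecay TYPE('n)"
  have k: "?k \<ge> 1" by (simp add: kdecay_def Suc_leI[OF zero_less_card_finite])
  have crit: "?k * (q - 1) > 1 / 2" using mult_mono[of 1 ?k 1 "q - 1"] k q2 by simp
  obtain C where C: "C \<ge> 0" "\<And>t. t > 0 \<Longrightarrow> mass t \<le> ennreal C * mass 0"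
    using mass_bounded_quadratic[OF q2] by blast
  have CM: "mass t \<le> ennreal (C * M)" if "t > 0" for t
  proof -
    have "mass t \<le> ennreal C * ennreal M" using C(2)[OF that] M(1) by (meson mult_left_mono order_trans zero_le)
    then show ?thesis using C M by (simp add: ennreal_mult)
  qed
  have fin: "(\<integral>\<^sup>+s. indicator {0<..} s * F s \<partial>lborel) < \<infinity>"
    by (rule le_less_trans[OF integral_source_le[OF CM] ennreal_less_top[folded infinity_ennreal_def]])
  \<comment> \<open>The added 1 keeps the mass bound positive even if C M = 0.\<close>
  define M' where "M' = C * M + 1"
  have M': "M' > 0" "C * M \<le> M'" using C M by (auto simp: M'_def add_nonneg_pos)
  define b where "b = 2 * ?k * (q - 1) - 1"
  have b: "b > 0" using crit by (simp add: b_def)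
  define eps where "eps = (1 / (2 * step_const q TYPE('n))) powr (2 * ?k) / (4 * step_const q TYPE('n))"
  have sc: "step_const q TYPE('n) > 0"
    using crit kconst_ge_1[where 'n='n] by (simp add: step_const_def profile_const_def add_pos_nonneg)
  have eps: "eps > 0" using sc by (simp add: eps_def)
  \<comment> \<open>Solves M' K'^b = eps/2, half of the admissible threshold; the exponent b is
    positive above the critical value of q.\<close>
  define K' where "K' = (eps / (2 * M')) powr (1 / b)"
  have K': "K' > 0" "M' * K' powr b < eps"
    using eps M' b by (auto simp: K'_def powr_powr)
  obtain T where T: "T > 0" "\<And>x t. t > T \<Longrightarrow> gn x t \<le> K'"
    using gradient_vanishes[OF M(1) less_imp_le[OF M(2)] fin K'(1)] by blast
  interpret S: visc_HJ q "\<lambda>x t. u x (t + T)" "\<lambda>i x t. u1 i x (t + T)" "\<lambda>i x t. u2 i x (t + T)" B L K'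
    using T by (intro shift_HJ) auto
  have S: "S.mass 0 \<le> ennreal M'"
    using CM[OF T(1)] M' by (simp add: S.mass_def mass_def) (meson ennreal_leI order_trans)
  interpret S: visc_HJ_small q "\<lambda>x t. u x (t + T)" "\<lambda>i x t. u1 i x (t + T)" "\<lambda>i x t. u2 i x (t + T)" B L K' M'
    by unfold_locales fact+
  have small: "M' * K' powr (2 * kdecay TYPE('n) * (q - 1) - 1)
      < (1 / (2 * step_const q TYPE('n))) powr (2 * kdecay TYPE('n)) / (4 * step_const q TYPE('n))"
    using K'(2) by (simp add: b_def eps_def)
  \<comment> \<open>For t > 2 T one has t - T >= t/2, so returning from the restarted clock to t
    costs at most 2^k in either rate.\<close>
  define A where "A = S.A0 * 2 powr ?k"
  have A: "A > 0" "S.A0 * 2 powr (1/2) \<le> A"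
    using S.A0_pos k by (auto simp: A_def intro!: mult_left_mono powr_mono)
  have "(\<forall>x. gn x t \<le> A * t powr (- ?k)) \<and> (\<integral>\<^sup>+x. ennreal (gn x t) \<partial>lborel) \<le> ennreal (A * t powr (- (1/2)))"
    if t: "t > 2 * T" for t
  proof -
    have t': "t - T > 0" "t > 0" "t / 2 \<le> t - T" using t T by auto
    have pw: "(t - T) powr (- a) \<le> 2 powr a * t powr (- a)" if "a > 0" for a
    proof -
      have "(t - T) powr (- a) \<le> (t / 2) powr (- a)" using t' that by (intro powr_mono2') auto
      also have "\<dots> = 2 powr a * t powr (- a)" using t' by (simp add: powr_divide powr_minus divide_simps)
      finally show ?thesis .
    qed
    have eq: "S.gn x (t - T) = gn x t" for x by (simp add: S.gn_def gn_def)
    have "gn x t \<le> S.A0 * (t - T) powr (- ?k)" for x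
      using S.small_data_decay(1)[OF small t'(1), of x] by (simp add: eq)
    moreover have "S.A0 * (t - T) powr (- ?k) \<le> S.A0 * (2 powr ?k * t powr (- ?k))"
      using pw[of ?k] k S.A0_pos by (intro mult_left_mono) auto
    ultimately have 1: "gn x t \<le> A * t powr (- ?k)" for x
      unfolding A_def mult.assoc by (meson order_trans)
    have "(\<integral>\<^sup>+x. ennreal (gn x t) \<partial>lborel) \<le> ennreal (S.A0 * (t - T) powr (- (1/2)))"
      using S.small_data_decay(2)[OF small t'(1)] by (simp add: eq)
    also have "\<dots> \<le> ennreal (A * t powr (- (1/2)))"
    proof (rule ennreal_leI)
      have "S.A0 * (t - T) powr (- (1/2)) \<le> S.A0 * (2 powr (1/2) * t powr (- (1/2)))"
        using pw[of "1/2"] S.A0_pos by (intro mult_left_mono) auto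
      also have "\<dots> \<le> A * t powr (- (1/2))"
        using A(2) by (simp add: mult.assoc[symmetric] mult_right_mono)
      finally show "S.A0 * (t - T) powr (- (1/2)) \<le> A * t powr (- (1/2))" .
    qed
    finally show ?thesis using 1 by blast
  qed
  then show ?thesis unfolding diffusive_decay_def using fin A(1) T(1)
    by (intro conjI exI[of _ A] exI[of _ "2 * T"]) auto
qed

end

section \<open>Large time asymptotics\<close>

context visc_HJ begin

definition mass_inf :: ennreal where
  "mass_inf = mass 0 + (\<integral>\<^sup>+s. indicator {0<..} s * F s \<partial>lborel)"

text \<open>A real number, so that V can be formed. It agrees with \<open>I_infty u\<close> once
  \<open>mass_inf\<close> is finite; otherwise \<open>enn2real\<close> makes it 0.\<close>

definition I where "I = - enn2real mass_inf"

definition V :: "real^'n \<Rightarrow> real \<Rightarrow> real" where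
  "V x t = u x t - I * heat_kernel x t"

definition V1 :: "'n \<Rightarrow> real^'n \<Rightarrow> real \<Rightarrow> real" where
  "V1 i x t = u1 i x t - I * heat_kernel_d i x t"

abbreviation tail :: "real \<Rightarrow> ennreal" where
  "tail t \<equiv> \<integral>\<^sup>+s. indicator {t<..} s * F s \<partial>lborel"

lemma mass_inf_split:
  assumes "t \<ge> 0"
  shows "mass_inf = mass t + tail t"
proof -
  \<comment> \<open>The point s = t belongs to neither of the two intervals, hence equality only
    almost everywhere.\<close>
  have "(\<integral>\<^sup>+s. indicator {0<..} s * F s \<partial>lborel) = (\<integral>\<^sup>+s. indicator {0<..<t} s * F s + indicator {t<..} s * F s \<partial>lborel)"
    using assms by (intro nn_integral_cong_AE AE_mp[OF AE_lborel_singleton[of t] AE_I2]) (auto simp: indicator_def)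
  also have "\<dots> = (\<integral>\<^sup>+s. indicator {0<..<t} s * F s \<partial>lborel) + tail t"
    by (rule nn_integral_add) measurable
  finally show ?thesis unfolding mass_inf_def mass_eq[OF assms] by (simp add: add.assoc)
qed

text \<open>V compares u and the kernel at the same absolute time, so a restart at
  \<open>\<tau>\<close> subtracts the kernel of age t + \<open>\<tau>\<close> and the initial
  singularity of the kernel is avoided.\<close>

lemma V_inhom_heat:
  assumes "\<tau> > 0"
  shows "inhom_heat (\<lambda>x t. V x (t + \<tau>)) (\<lambda>x t. - f x (t + \<tau>)) (\<lambda>i x t. V1 i x (t + \<tau>))
    (\<lambda>i x t. u2 i x (t + \<tau>) - I * heat_kernel_dd i x (t + \<tau>)) (B + \<bar>I\<bar> * \<tau> powr (- (real CARD('n) / 2))) L"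
proof -
  interpret S: inhom_heat "\<lambda>x t. u x (t + \<tau>)" "\<lambda>x t. - (norm (\<chi> i. u1 i x (t + \<tau>)) powr q)" "\<lambda>i x t. u1 i x (t + \<tau>)" "\<lambda>i x t. u2 i x (t + \<tau>)" B L
    using assms by (intro shift) simp
  show ?thesis
    using S.sub_heat_kernel[OF assms, of I] unfolding V_def V1_def g_eq_f .
qed

lemma F_tail_shift:
  "(\<integral>\<^sup>+s. indicator {0<..} s * F (s + \<tau>) \<partial>lborel) = tail \<tau>"
proof -
  have "tail \<tau> = (\<integral>\<^sup>+s. indicator {\<tau><..} (\<tau> + s) * F (\<tau> + s) \<partial>lborel)"
    by (rule nn_integral_translate_lborel(1)[symmetric]) measurable
  also have "\<dots> = (\<integral>\<^sup>+s. indicator {0<..} s * F (s + \<tau>) \<partial>lborel)"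
    by (intro nn_integral_cong) (auto simp: indicator_def add.commute)
  finally show ?thesis ..
qed

text \<open>Three errors of size e/4 each: the integral of V at the restart, which is exactly
  \<open>tail \<tau>\<close>; the deviation from it in the flattening by the heat flow; and the mass
  created by the source after \<open>\<tau>\<close>.\<close>

lemma V_L1_tendsto:
  assumes fin: "mass_inf < \<infinity>" and e: "e > 0"
  shows "\<forall>\<^sub>F t in at_top. (\<integral>\<^sup>+x. ennreal \<bar>V x t\<bar> \<partial>lborel) \<le> ennreal e"
proof -
  have Ffin: "(\<integral>\<^sup>+s. indicator {0<..} s * F s \<partial>lborel) < \<infinity>"
    using fin unfolding mass_inf_def by (simp add: ennreal_add_less_top)
  obtain \<tau> where \<tau>: "\<tau> > 0" "tail \<tau> \<le> ennreal (e / 4)"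
    using tail_integral_small[OF F_measurable Ffin, of "e / 4"] e by auto
  interpret H: inhom_heat "\<lambda>x t. V x (t + \<tau>)" "\<lambda>x t. - f x (t + \<tau>)" "\<lambda>i x t. V1 i x (t + \<tau>)"
    "\<lambda>i x t. u2 i x (t + \<tau>) - I * heat_kernel_dd i x (t + \<tau>)" "B + \<bar>I\<bar> * \<tau> powr (- (real CARD('n) / 2))" L
    by (rule V_inhom_heat) fact
  interpret S: visc_HJ q "\<lambda>x t. u x (t + \<tau>)" "\<lambda>i x t. u1 i x (t + \<tau>)" "\<lambda>i x t. u2 i x (t + \<tau>)" B L K
    using \<tau> gn_le by (intro shift_HJ) auto
  have mfin: "mass \<tau> < \<infinity>" "tail \<tau> < \<infinity>"
    using fin mass_inf_split[of \<tau>] \<tau> by (auto simp: ennreal_add_less_top)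
  have umeas[measurable]: "(\<lambda>x. u x \<tau>) \<in> borel_measurable borel" using \<tau> by (intro slice_measurable) simp
  have uint: "integrable lborel (\<lambda>x. u x \<tau>)"
    using nn_integral_abs_u[of \<tau>] \<tau> mfin by (intro integrableI_bounded) auto
  have "(LINT x|lborel. - u x \<tau>) = enn2real (\<integral>\<^sup>+x. ennreal (- u x \<tau>) \<partial>lborel)"
    using u_nonpos[of \<tau>] \<tau> by (intro integral_eq_nn_integral) auto
  then have uI: "(LINT x|lborel. u x \<tau>) = - enn2real (mass \<tau>)" by (simp add: mass_def)
  have VI: "integrable lborel (\<lambda>x. V x (0 + \<tau>))" "(LINT x|lborel. V x (0 + \<tau>)) = enn2real (tail \<tau>)"
  proof -
    show "integrable lborel (\<lambda>x. V x (0 + \<tau>))"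
      unfolding V_def using uint \<tau> integrable_heat_kernel(1)[of \<tau>, where 'n='n] by auto
    have "(LINT x|lborel. V x (0 + \<tau>)) = - enn2real (mass \<tau>) - I"
      unfolding V_def using uint uI \<tau> integrable_heat_kernel(1,3)[of \<tau>, where 'n='n] by simp
    also have "\<dots> = enn2real (tail \<tau>)"
      unfolding I_def mass_inf_split[OF less_imp_le[OF \<tau>(1)]] using mfin by (subst enn2real_plus) auto
    finally show "(LINT x|lborel. V x (0 + \<tau>)) = enn2real (tail \<tau>)" .
  qed
  have tr: "enn2real (tail \<tau>) \<le> e / 4" by (rule enn2real_leI) (use \<tau>(2) e in auto)
  have [measurable]: "(\<lambda>x. V x (0 + \<tau>)) \<in> borel_measurable borel"
    using borel_measurable_integrable[OF VI(1)] by simp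
  have "\<forall>\<^sub>F t in at_top. (\<integral>\<^sup>+x. ennreal \<bar>LINT y|lborel. heat_kernel (x - y) t * V y (0 + \<tau>)\<bar> \<partial>lborel) \<le> ennreal (\<bar>LINT y|lborel. V y (0 + \<tau>)\<bar> + e / 4)"
    using e VI(1) by (intro heat_average_L1_eventually_le) auto
  then obtain N where N: "\<And>t. t \<ge> N \<Longrightarrow> (\<integral>\<^sup>+x. ennreal \<bar>LINT y|lborel. heat_kernel (x - y) t * V y (0 + \<tau>)\<bar> \<partial>lborel) \<le> ennreal (\<bar>LINT y|lborel. V y (0 + \<tau>)\<bar> + e / 4)"
    unfolding eventually_at_top_linorder by blast
  have "(\<integral>\<^sup>+x. ennreal \<bar>V x r\<bar> \<partial>lborel) \<le> ennreal e" if r: "r > max N 0 + \<tau>" for r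
  proof -
    define t where "t = r - \<tau>"
    have t: "t > 0" "t \<ge> N" "r = t + \<tau>" using r by (auto simp: t_def)
    have sF: "S.F s = F (s + \<tau>)" for s by (simp add: S.F_def F_def S.f_def f_def S.gn_def gn_def)
    have sf: "S.f x s = f x (s + \<tau>)" for x s by (simp add: S.f_def f_def S.gn_def gn_def)
    have "(\<integral>\<^sup>+x. ennreal \<bar>V x r\<bar> \<partial>lborel) \<le> (\<integral>\<^sup>+x. ennreal \<bar>LINT y|lborel. heat_kernel (x - y) t * V y (0 + \<tau>)\<bar>
        + (\<integral>\<^sup>+s. indicator {0<..<t} s * heat_nn (t - s) (\<lambda>y. ennreal (S.f y s)) x \<partial>lborel) \<partial>lborel)"
      using H.abs_bound(1)[OF t(1)] unfolding t(3) by (intro nn_integral_mono) (simp add: sf)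
    also have "\<dots> = (\<integral>\<^sup>+x. ennreal \<bar>LINT y|lborel. heat_kernel (x - y) t * V y (0 + \<tau>)\<bar> \<partial>lborel)
        + (\<integral>\<^sup>+x. (\<integral>\<^sup>+s. indicator {0<..<t} s * heat_nn (t - s) (\<lambda>y. ennreal (S.f y s)) x \<partial>lborel) \<partial>lborel)"
      by (rule nn_integral_add) measurable
    also have "(\<integral>\<^sup>+x. (\<integral>\<^sup>+s. indicator {0<..<t} s * heat_nn (t - s) (\<lambda>y. ennreal (S.f y s)) x \<partial>lborel) \<partial>lborel) = (\<integral>\<^sup>+s. indicator {0<..<t} s * F (s + \<tau>) \<partial>lborel)"
      unfolding S.nn_integral_source by (simp add: sF)
    also have "\<dots> \<le> (\<integral>\<^sup>+s. indicator {0<..} s * F (s + \<tau>) \<partial>lborel)"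
      by (intro nn_integral_mono) (auto simp: indicator_def)
    also have "\<dots> \<le> ennreal (e / 4)" unfolding F_tail_shift by (rule \<tau>(2))
    also have "(\<integral>\<^sup>+x. ennreal \<bar>LINT y|lborel. heat_kernel (x - y) t * V y (0 + \<tau>)\<bar> \<partial>lborel) \<le> ennreal (e / 4 + e / 4)"
      using N[OF t(2)] unfolding VI(2) by (rule order_trans) (use tr in \<open>auto intro!: ennreal_leI\<close>)
    also have "ennreal (e / 4 + e / 4) + ennreal (e / 4) \<le> ennreal e"
      using e by (subst ennreal_plus[symmetric]) (auto intro!: ennreal_leI)
    finally show ?thesis by (simp add: add_mono)
  qed
  then show ?thesis
    unfolding eventually_at_top_dense by blast
qed

text \<open>Smallness of V in L^1 is known. Smoothing over an interval [t, 2t] upgrades it to the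
  sup norm and to the gradient with the diffusive rates, provided the source on (t, 2t) decays
  strictly faster.\<close>

theorem diffusive_asymptotics:
  assumes crit: "kdecay TYPE('n) * (q - 1) > 1 / 2" and m0: "mass 0 < \<infinity>" and dec: diffusive_decay and e: "e > 0"
  shows "\<forall>\<^sub>F t in at_top. (\<integral>\<^sup>+x. ennreal \<bar>V x t\<bar> \<partial>lborel) \<le> ennreal e
    \<and> (\<forall>x. \<bar>V x t\<bar> \<le> e * t powr (- (real CARD('n) / 2)))
    \<and> (\<forall>i. (\<integral>\<^sup>+x. ennreal \<bar>V1 i x t\<bar> \<partial>lborel) \<le> ennreal (e * t powr (- (1/2))))
    \<and> (\<forall>i x. \<bar>V1 i x t\<bar> \<le> e * t powr (- kdecay TYPE('n)))"
proof -
  let ?c = "kconst TYPE('n)" and ?k = "kdecay TYPE('n)" and ?n = "real CARD('n)"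
  have k0: "?k > 0" by (simp add: kdecay_def)
  have kn: "?k = ?n / 2 + 1 / 2" by (simp add: kdecay_def add_divide_distrib)
  have c1: "?c \<ge> 1" by (rule kconst_ge_1)
  \<comment> \<open>The surplus of decay above the critical exponent: every source term on (t, 2t)
    carries an extra factor t^(-\<open>\<rho>\<close>) relative to the diffusive rate.\<close>
  define \<rho> where "\<rho> = ?k * (q - 1) - 1 / 2"
  have \<rho>: "\<rho> > 0" using crit by (simp add: \<rho>_def)
  \<comment> \<open>c is the price of a kernel derivative, 2^k that of replacing t = r/2 by r in the
    rate, and 2 that of adding initial term and source.\<close>
  define e' where "e' = e / (?c * 2 powr ?k * 2)"
  have e': "e' > 0" "?c * 2 powr ?k * (2 * e') = e"
    using e c1 by (auto simp: e'_def)
  have fin: "mass_inf < \<infinity>"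
    using m0 dec by (simp add: mass_inf_def diffusive_decay_def ennreal_add_less_top)
  obtain A T where A: "A > 0" "T > 0" and d: "\<And>t x. t > T \<Longrightarrow> gn x t \<le> A * t powr (- ?k)"
    "\<And>t. t > T \<Longrightarrow> (\<integral>\<^sup>+x. ennreal (gn x t) \<partial>lborel) \<le> ennreal (A * t powr (- (1/2)))"
    using dec unfolding diffusive_decay_def by blast
  have fdec: "f x s \<le> A powr q * s powr (- (?k * q))" if s: "s > T" for x s
  proof -
    have "f x s \<le> (A * s powr (- ?k)) powr q"
      unfolding f_def using d(1)[OF s, of x] q_gt_1 by (intro powr_mono2) auto
    also have "\<dots> = A powr q * s powr (- (?k * q))" using A s by (simp add: powr_mult powr_powr)
    finally show ?thesis .
  qed
  \<comment> \<open>q - 1 powers of the gradient are estimated in the sup norm and one in L^1, so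
    the rates k (q - 1) and 1/2 add up.\<close>
  have Fdec: "F s \<le> ennreal (A powr q * s powr (- (?k * (q - 1)) - 1 / 2))" if s: "s > T" for s
  proof -
    have s0: "s > 0" using s A by simp
    let ?m = "(A * s powr (- ?k)) powr (q - 1)"
    have "F s \<le> (\<integral>\<^sup>+x. ennreal ?m * ennreal (gn x s) \<partial>lborel)"
      unfolding F_def
    proof (intro nn_integral_mono)
      fix x
      have "f x s = gn x s powr (q - 1) * gn x s"
        using q_gt_1 powr_add[of "gn x s" "q - 1" 1] by (cases "gn x s = 0") (auto simp: f_def)
      also have "\<dots> \<le> ?m * gn x s"
        using d(1)[OF s, of x] q_gt_1 by (intro mult_right_mono powr_mono2) auto
      finally show "ennreal (f x s) \<le> ennreal ?m * ennreal (gn x s)"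
        by (simp add: ennreal_mult[symmetric] ennreal_leI)
    qed
    also have "\<dots> = ennreal ?m * (\<integral>\<^sup>+x. ennreal (gn x s) \<partial>lborel)"
      using s0 by (intro nn_integral_cmult) measurable
    also have "\<dots> \<le> ennreal ?m * ennreal (A * s powr (- (1/2)))"
      by (intro mult_left_mono d(2) s) simp
    also have "\<dots> = ennreal ((A powr (q - 1) * A) * (s powr (- (?k * (q - 1))) * s powr (- (1/2))))"
      using A s0 by (simp add: ennreal_mult[symmetric] powr_mult powr_powr mult_ac)
    also have "A powr (q - 1) * A = A powr q" using A powr_add[of A "q - 1" 1] by simp
    also have "s powr (- (?k * (q - 1))) * s powr (- (1/2)) = s powr (- (?k * (q - 1)) - 1 / 2)"
      by (simp add: powr_add[symmetric])
    finally show ?thesis .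
  qed
  have "((\<lambda>t. A powr q * 2 * t powr (- \<rho>)) \<longlongrightarrow> A powr q * 2 * 0) at_top"
    using \<rho> by (intro tendsto_mult tendsto_const tendsto_neg_powr filterlim_ident) auto
  then have "\<forall>\<^sub>F t in at_top. A powr q * 2 * t powr (- \<rho>) < e'"
    using e' by (intro order_tendstoD(2)) auto
  moreover have "\<forall>\<^sub>F t in at_top. (\<integral>\<^sup>+x. ennreal \<bar>V x t\<bar> \<partial>lborel) \<le> ennreal e'"
    by (rule V_L1_tendsto[OF fin e'(1)])
  ultimately have "\<forall>\<^sub>F t in at_top. (\<integral>\<^sup>+x. ennreal \<bar>V x t\<bar> \<partial>lborel) \<le> ennreal e' \<and> A powr q * 2 * t powr (- \<rho>) < e' \<and> t > T"
    using eventually_gt_at_top[of T] by eventually_elim auto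
  then obtain N where N: "\<And>t. t \<ge> N \<Longrightarrow> (\<integral>\<^sup>+x. ennreal \<bar>V x t\<bar> \<partial>lborel) \<le> ennreal e'"
    "\<And>t. t \<ge> N \<Longrightarrow> A powr q * 2 * t powr (- \<rho>) < e'" "\<And>t. t \<ge> N \<Longrightarrow> t > T"
    unfolding eventually_at_top_linorder by blast
  have "(\<integral>\<^sup>+x. ennreal \<bar>V x r\<bar> \<partial>lborel) \<le> ennreal e
    \<and> (\<forall>x. \<bar>V x r\<bar> \<le> e * r powr (- (?n / 2)))
    \<and> (\<forall>i. (\<integral>\<^sup>+x. ennreal \<bar>V1 i x r\<bar> \<partial>lborel) \<le> ennreal (e * r powr (- (1/2))))
    \<and> (\<forall>i x. \<bar>V1 i x r\<bar> \<le> e * r powr (- ?k))" if r: "r \<ge> 2 * max N 0" for r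
  proof -
    \<comment> \<open>The first half of the time makes V small in L^1, the second half smooths
      it.\<close>
    define t where "t = r / 2"
    have tN: "t \<ge> N" and rt: "r = t + t" using r by (auto simp: t_def)
    have t: "t > 0" "t > T" using N(3)[OF tN] A by auto
    have small: "A powr q * 2 * t powr (- \<rho>) \<le> e'" using N(2)[OF tN] by simp
    note L1 = N(1)[OF tN]
    interpret H: inhom_heat "\<lambda>x s. V x (s + t)" "\<lambda>x s. - f x (s + t)" "\<lambda>i x s. V1 i x (s + t)"
      "\<lambda>i x s. u2 i x (s + t) - I * heat_kernel_dd i x (s + t)" "B + \<bar>I\<bar> * t powr (- (real CARD('n) / 2))" L
      by (rule V_inhom_heat) fact
    have Vm[measurable]: "(\<lambda>x. V x t) \<in> borel_measurable borel"
      using H.slice_measurable[of 0] by simp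
    have e'e: "e' \<le> e"
    proof -
      have "1 * 1 \<le> ?c * 2 powr ?k" using c1 k0 by (intro mult_mono) (auto intro: ge_one_powr_ge_zero)
      then have "1 * (2 * e') \<le> ?c * 2 powr ?k * (2 * e')" using e' by (intro mult_right_mono) auto
      then show ?thesis using e' by simp
    qed
    have 1: "(\<integral>\<^sup>+x. ennreal \<bar>V x r\<bar> \<partial>lborel) \<le> ennreal e"
    proof -
      have "r \<ge> N" using r rt tN t by linarith
      from order_trans[OF N(1)[OF this] ennreal_leI[OF e'e]] show ?thesis .
    qed
    have scale: "?c * (t powr (- a) * (2 * e')) \<le> e * r powr (- a)" if a: "a \<le> ?k" for a
    proof -
      have "t powr (- a) = 2 powr a * r powr (- a)" using t by (simp add: rt powr_mult powr_minus mult_2[symmetric] divide_simps)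
      also have "\<dots> \<le> 2 powr ?k * r powr (- a)" using a by (intro mult_right_mono powr_mono) auto
      finally have "?c * (t powr (- a) * (2 * e')) \<le> ?c * (2 powr ?k * r powr (- a) * (2 * e'))"
        using c1 e' by (intro mult_left_mono mult_right_mono) auto
      also have "\<dots> = (?c * 2 powr ?k * (2 * e')) * r powr (- a)" by (simp add: mult_ac)
      finally show ?thesis unfolding e'(2) .
    qed
    have hsup: "heat_nn a (\<lambda>y. ennreal (f y (s + t))) x \<le> ennreal (A powr q * t powr (- (?k * q)))" if "a > 0" "s > 0" for a s x
    proof (rule heat_nn_sup[OF that(1)])
      fix y
      have "f y (s + t) \<le> A powr q * (s + t) powr (- (?k * q))" using that t by (intro fdec) auto
      also have "\<dots> \<le> A powr q * t powr (- (?k * q))"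
        using that t k0 q_gt_1 by (intro mult_left_mono powr_mono2') auto
      finally show "ennreal (f y (s + t)) \<le> ennreal (A powr q * t powr (- (?k * q)))" by (rule ennreal_leI)
    qed
    have hL1: "heat_nn a (\<lambda>y. ennreal \<bar>V y (0 + t)\<bar>) x \<le> ennreal (t powr (- (?n / 2)) * e')" if "a \<ge> t" for a x
    proof -
      have "heat_nn a (\<lambda>y. ennreal \<bar>V y (0 + t)\<bar>) x \<le> ennreal (a powr (- (?n / 2))) * (\<integral>\<^sup>+y. ennreal \<bar>V y (0 + t)\<bar> \<partial>lborel)"
        using that t by (intro heat_nn_le_L1) auto
      also have "\<dots> \<le> ennreal (t powr (- (?n / 2))) * ennreal e'"
        using that t L1 by (intro mult_mono ennreal_leI powr_mono2') auto
      finally show ?thesis using e' by (simp add: ennreal_mult)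
    qed
    have pw: "t powr x * t powr y = t powr z" if "x + y = z" for x y z using that by (simp add: powr_add[symmetric])
    have 2: "\<bar>V x r\<bar> \<le> e * r powr (- (?n / 2))" for x
    proof -
      have "ennreal \<bar>V x r\<bar> \<le> heat_nn t (\<lambda>y. ennreal \<bar>V y (0 + t)\<bar>) x + (\<integral>\<^sup>+s. indicator {0<..<t} s * heat_nn (t - s) (\<lambda>y. ennreal (f y (s + t))) x \<partial>lborel)"
        using order_trans[OF H.abs_bound(1)[OF t(1)] add_right_mono[OF H.abs_bound(2)[OF t(1)]]] unfolding rt by simp
      also have "\<dots> \<le> ennreal (t powr (- (?n / 2)) * e') + (\<integral>\<^sup>+s. ennreal (A powr q * t powr (- (?k * q))) * indicator {0<..<t} s \<partial>lborel)"
        using hsup hL1 by (intro add_mono nn_integral_mono) (auto simp: indicator_def)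
      also have "(\<integral>\<^sup>+s. ennreal (A powr q * t powr (- (?k * q))) * indicator {0<..<t} s \<partial>lborel) = ennreal (A powr q * t powr (- (?k * q)) * t)"
        using t by (simp add: nn_integral_cmult_indicator ennreal_mult)
      also have "ennreal (t powr (- (?n / 2)) * e') + ennreal (A powr q * t powr (- (?k * q)) * t) = ennreal (t powr (- (?n / 2)) * e' + A powr q * t powr (- (?k * q)) * t)"
        using t e' by (intro ennreal_plus[symmetric]) auto
      finally have "\<bar>V x r\<bar> \<le> t powr (- (?n / 2)) * e' + A powr q * (t powr (- (?k * q)) * t powr 1)"
        using t e' by (simp add: ennreal_le_iff mult.assoc del: ennreal_plus)
      \<comment> \<open>Integrating over an interval of length t costs one power; since k q = n/2 +
        1 + \<open>\<rho>\<close>, the factor t^(-\<open>\<rho>\<close>) is left over.\<close>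
      also have "t powr (- (?k * q)) * t powr 1 = t powr (- (?n / 2)) * t powr (- \<rho>)"
      proof -
        have "?k * (q - 1) = ?k * q - ?k" by (simp add: algebra_simps)
        then have "- (?k * q) + 1 = - (?n / 2) + - \<rho>" using kn unfolding \<rho>_def by linarith
        then show ?thesis by (simp only: powr_add[symmetric])
      qed
      also have "t powr (- (?n / 2)) * e' + A powr q * (t powr (- (?n / 2)) * t powr (- \<rho>)) = t powr (- (?n / 2)) * (e' + A powr q * t powr (- \<rho>))"
        by (simp add: algebra_simps)
      also have "\<dots> \<le> t powr (- (?n / 2)) * (2 * e')"
        using small by (intro mult_left_mono) (auto intro: order_trans[OF _ small])
      also have "\<dots> \<le> ?c * (t powr (- (?n / 2)) * (2 * e'))"
        using c1 e' mult_right_mono[of 1 ?c "t powr (- (?n / 2)) * (2 * e')"] by simp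
      also have "\<dots> \<le> e * r powr (- (?n / 2))" by (rule scale) (simp add: kn)
      finally show ?thesis .
    qed
    have grad: "ennreal \<bar>V1 i x r\<bar> \<le> ennreal (?c * t powr (- (1/2))) * heat_nn (2 * t) (\<lambda>y. ennreal \<bar>V y (0 + t)\<bar>) x
      + (\<integral>\<^sup>+s. indicator {0<..<t} s * (ennreal (?c * (t - s) powr (- (1/2))) * heat_nn (2 * (t - s)) (\<lambda>y. ennreal (f y (s + t))) x) \<partial>lborel)" for i x
      using H.abs_gradient_bound[OF t(1), of i x] unfolding rt by simp
    have 3: "(\<integral>\<^sup>+x. ennreal \<bar>V1 i x r\<bar> \<partial>lborel) \<le> ennreal (e * r powr (- (1/2)))" for i
    proof -
      let ?b = "A powr q * t powr (- (?k * (q - 1)) - 1 / 2)"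
      have "(\<integral>\<^sup>+x. ennreal \<bar>V1 i x r\<bar> \<partial>lborel) \<le> (\<integral>\<^sup>+x. ennreal (?c * t powr (- (1/2))) * heat_nn (2 * t) (\<lambda>y. ennreal \<bar>V y (0 + t)\<bar>) x
        + (\<integral>\<^sup>+s. indicator {0<..<t} s * (ennreal (?c * (t - s) powr (- (1/2))) * heat_nn (2 * (t - s)) (\<lambda>y. ennreal (f y (s + t))) x) \<partial>lborel) \<partial>lborel)"
        by (intro nn_integral_mono grad)
      also have "\<dots> = (\<integral>\<^sup>+x. ennreal (?c * t powr (- (1/2))) * heat_nn (2 * t) (\<lambda>y. ennreal \<bar>V y (0 + t)\<bar>) x \<partial>lborel)
        + (\<integral>\<^sup>+x. (\<integral>\<^sup>+s. indicator {0<..<t} s * (ennreal (?c * (t - s) powr (- (1/2))) * heat_nn (2 * (t - s)) (\<lambda>y. ennreal (f y (s + t))) x) \<partial>lborel) \<partial>lborel)"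
        by (rule nn_integral_add) (simp_all, measurable)
      also have "(\<integral>\<^sup>+x. ennreal (?c * t powr (- (1/2))) * heat_nn (2 * t) (\<lambda>y. ennreal \<bar>V y (0 + t)\<bar>) x \<partial>lborel) = ennreal (?c * t powr (- (1/2))) * (\<integral>\<^sup>+x. ennreal \<bar>V x t\<bar> \<partial>lborel)"
        using t by (simp add: nn_integral_cmult heat_nn_L1)
      also have "\<dots> \<le> ennreal (?c * t powr (- (1/2))) * ennreal e'" by (intro mult_left_mono L1) auto
      also have "(\<integral>\<^sup>+x. (\<integral>\<^sup>+s. indicator {0<..<t} s * (ennreal (?c * (t - s) powr (- (1/2))) * heat_nn (2 * (t - s)) (\<lambda>y. ennreal (f y (s + t))) x) \<partial>lborel) \<partial>lborel)
         = (\<integral>\<^sup>+s. (\<integral>\<^sup>+x. indicator {0<..<t} s * (ennreal (?c * (t - s) powr (- (1/2))) * heat_nn (2 * (t - s)) (\<lambda>y. ennreal (f y (s + t))) x) \<partial>lborel) \<partial>lborel)"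
        by (rule lborel_pair.Fubini') measurable
      also have "\<dots> \<le> (\<integral>\<^sup>+s. ennreal (?c * ?b) * (indicator {0<..<t} s * ennreal ((t - s) powr (- (1/2)))) \<partial>lborel)"
      proof (intro nn_integral_mono)
        fix s
        show "(\<integral>\<^sup>+x. indicator {0<..<t} s * (ennreal (?c * (t - s) powr (- (1/2))) * heat_nn (2 * (t - s)) (\<lambda>y. ennreal (f y (s + t))) x) \<partial>lborel)
          \<le> ennreal (?c * ?b) * (indicator {0<..<t} s * ennreal ((t - s) powr (- (1/2))))"
        proof (cases "s \<in> {0<..<t}")
          case True
          have "(\<integral>\<^sup>+x. indicator {0<..<t} s * (ennreal (?c * (t - s) powr (- (1/2))) * heat_nn (2 * (t - s)) (\<lambda>y. ennreal (f y (s + t))) x) \<partial>lborel) = ennreal (?c * (t - s) powr (- (1/2))) * F (s + t)"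
            using True by (simp add: nn_integral_cmult heat_nn_L1 F_def)
          also have "F (s + t) \<le> ennreal (A powr q * (s + t) powr (- (?k * (q - 1)) - 1 / 2))" using True t by (intro Fdec) auto
          also have "\<dots> \<le> ennreal ?b"
          proof (intro ennreal_leI mult_left_mono powr_mono2')
            have "0 \<le> ?k * (q - 1)" using k0 q_gt_1 by simp
            then show "- (?k * (q - 1)) - 1 / 2 \<le> 0" by linarith
          qed (use True t in auto)
          finally have "(\<integral>\<^sup>+x. indicator {0<..<t} s * (ennreal (?c * (t - s) powr (- (1/2))) * heat_nn (2 * (t - s)) (\<lambda>y. ennreal (f y (s + t))) x) \<partial>lborel) \<le> ennreal (?c * (t - s) powr (- (1/2))) * ennreal ?b"
            by (simp add: mult_left_mono)
          then show ?thesis using True by (simp add: ennreal_mult mult_ac)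
        qed simp
      qed
      also have "\<dots> = ennreal (?c * ?b) * ennreal (2 * (t - 0) powr (1/2))"
        using t by (simp add: nn_integral_cmult nn_integral_powr_half)
      also have "ennreal (?c * t powr (- (1/2))) * ennreal e' + ennreal (?c * ?b) * ennreal (2 * (t - 0) powr (1/2)) = ennreal (?c * (t powr (- (1/2)) * e' + A powr q * 2 * (t powr (- (?k * (q - 1)) - 1 / 2) * t powr (1/2))))"
        using e' by (simp add: ennreal_mult[symmetric] ennreal_plus[symmetric] algebra_simps del: ennreal_plus)
      also have "t powr (- (?k * (q - 1)) - 1 / 2) * t powr (1/2) = t powr (- (1/2)) * t powr (- \<rho>)"
        unfolding powr_add[symmetric] by (simp add: \<rho>_def)
      also have "t powr (- (1/2)) * e' + A powr q * 2 * (t powr (- (1/2)) * t powr (- \<rho>)) = t powr (- (1/2)) * (e' + A powr q * 2 * t powr (- \<rho>))"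
        by (simp add: distrib_left mult_ac)
      also have "ennreal (?c * (t powr (- (1/2)) * (e' + A powr q * 2 * t powr (- \<rho>)))) \<le> ennreal (?c * (t powr (- (1/2)) * (2 * e')))"
        using small by (intro ennreal_leI mult_left_mono) auto
      also have "\<dots> \<le> ennreal (e * r powr (- (1/2)))" by (intro ennreal_leI scale) (simp add: kn)
      finally show ?thesis by (simp add: add_mono)
    qed
    have 4: "\<bar>V1 i x r\<bar> \<le> e * r powr (- ?k)" for i x
    proof -
      let ?b = "A powr q * t powr (- (?k * q))"
      have "ennreal \<bar>V1 i x r\<bar> \<le> ennreal (?c * t powr (- (1/2))) * ennreal (t powr (- (?n / 2)) * e')
        + (\<integral>\<^sup>+s. ennreal (?c * ?b) * (indicator {0<..<t} s * ennreal ((t - s) powr (- (1/2)))) \<partial>lborel)"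
      proof (rule order_trans[OF grad], intro add_mono mult_left_mono nn_integral_mono)
        show "heat_nn (2 * t) (\<lambda>y. ennreal \<bar>V y (0 + t)\<bar>) x \<le> ennreal (t powr (- (?n / 2)) * e')" using t by (intro hL1) auto
        fix s
        show "indicator {0<..<t} s * (ennreal (?c * (t - s) powr (- (1/2))) * heat_nn (2 * (t - s)) (\<lambda>y. ennreal (f y (s + t))) x)
          \<le> ennreal (?c * ?b) * (indicator {0<..<t} s * ennreal ((t - s) powr (- (1/2))))"
        proof (cases "s \<in> {0<..<t}")
          case True
          have "ennreal (?c * (t - s) powr (- (1/2))) * heat_nn (2 * (t - s)) (\<lambda>y. ennreal (f y (s + t))) x \<le> ennreal (?c * (t - s) powr (- (1/2))) * ennreal ?b"
            using True by (intro mult_left_mono hsup) auto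
          then show ?thesis using True by (simp add: ennreal_mult mult_ac)
        qed simp
      qed simp
      also have "(\<integral>\<^sup>+s. ennreal (?c * ?b) * (indicator {0<..<t} s * ennreal ((t - s) powr (- (1/2)))) \<partial>lborel) = ennreal (?c * ?b) * ennreal (2 * (t - 0) powr (1/2))"
        using t by (simp add: nn_integral_cmult nn_integral_powr_half)
      also have "ennreal (?c * t powr (- (1/2))) * ennreal (t powr (- (?n / 2)) * e') + ennreal (?c * ?b) * ennreal (2 * (t - 0) powr (1/2))
         = ennreal (?c * ((t powr (- (1/2)) * t powr (- (?n / 2))) * e' + A powr q * 2 * (t powr (- (?k * q)) * t powr (1/2))))"
        using e' by (simp add: ennreal_mult[symmetric] ennreal_plus[symmetric] algebra_simps del: ennreal_plus)
      also have "t powr (- (1/2)) * t powr (- (?n / 2)) = t powr (- ?k)"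
        by (rule pw) (simp add: kn)
      also have "t powr (- (?k * q)) * t powr (1/2) = t powr (- ?k) * t powr (- \<rho>)"
        unfolding powr_add[symmetric] by (simp add: \<rho>_def algebra_simps)
      also have "t powr (- ?k) * e' + A powr q * 2 * (t powr (- ?k) * t powr (- \<rho>)) = t powr (- ?k) * (e' + A powr q * 2 * t powr (- \<rho>))"
        by (simp add: distrib_left mult_ac)
      also have "ennreal (?c * (t powr (- ?k) * (e' + A powr q * 2 * t powr (- \<rho>)))) \<le> ennreal (?c * (t powr (- ?k) * (2 * e')))"
        using small by (intro ennreal_leI mult_left_mono) auto
      also have "\<dots> \<le> ennreal (e * r powr (- ?k))" by (intro ennreal_leI scale) simp
      finally show ?thesis using e by (simp add: ennreal_le_iff)
    qed
    show ?thesis using 1 2 3 4 by blast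
  qed
  then show ?thesis
    unfolding eventually_at_top_linorder by blast
qed

end

section \<open>Uniqueness of weak gradients\<close>

text \<open>The standard smooth function vanishing on a half-line, with a polynomial factor in 1/y.
  This factor closes the family under differentiation: p is replaced by X^2 (p - p').\<close>

definition flat :: "real poly \<Rightarrow> real \<Rightarrow> real" where
  "flat p y = (if y > 0 then poly p (1 / y) * exp (- (1 / y)) else 0)"

lemma poly_times_exp_tendsto_0: "((\<lambda>x. poly p x * exp (- x)) \<longlongrightarrow> (0::real)) at_top"
proof -
  have "((\<lambda>x. \<Sum>i\<le>degree p. coeff p i * (x ^ i / exp x)) \<longlongrightarrow> (\<Sum>i\<le>degree p. coeff p i * 0)) at_top"
    by (intro tendsto_sum tendsto_mult tendsto_const tendsto_power_div_exp_0)
  then show ?thesis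
    by (simp add: poly_altdef sum_distrib_right exp_minus divide_inverse mult.assoc)
qed

lemma flat_at_right_0: "((\<lambda>h. flat p h) \<longlongrightarrow> 0) (at_right 0)"
proof -
  have "((\<lambda>h. poly p (inverse h) * exp (- inverse h)) \<longlongrightarrow> 0) (at_right (0::real))"
    by (rule filterlim_compose[OF poly_times_exp_tendsto_0 filterlim_inverse_at_top_right])
  then show ?thesis
    by (rule Lim_transform_eventually)
      (auto simp: flat_def eventually_at_right_less divide_inverse intro!: eventually_at_rightI[of 0 1])
qed

lemma flat_deriv:
  "(flat p has_real_derivative flat ([:0, 0, 1:] * (p - pderiv p)) y) (at y)"
proof -
  consider "y > 0" | "y < 0" | "y = 0" by linarith
  then show ?thesis
  proof cases
    case 1
    have "((\<lambda>y. poly p (1 / y) * exp (- (1 / y))) has_real_derivative flat ([:0, 0, 1:] * (p - pderiv p)) y) (at y)"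
      using 1 by (auto intro!: derivative_eq_intros simp: flat_def power2_eq_square algebra_simps)
    then show ?thesis
      using 1 by (subst DERIV_cong_ev[OF refl _ refl, where g="\<lambda>y. poly p (1 / y) * exp (- (1 / y))"])
        (auto simp: flat_def intro!: eventually_nhds_in_open[of "{0<..}", THEN eventually_mono])
  next
    case 2
    then show ?thesis
      by (subst DERIV_cong_ev[OF refl _ refl, where g="\<lambda>y. 0"])
        (auto simp: flat_def intro!: eventually_nhds_in_open[of "{..<0}", THEN eventually_mono])
  next
    case 3
    \<comment> \<open>Dividing by h multiplies the polynomial by X, so the limit is again that of a
      member of the family.\<close>
    have "((\<lambda>h. flat p h / h) \<longlongrightarrow> 0) (at_right 0)"
      using flat_at_right_0[of "[:0, 1:] * p"]
      by (rule Lim_transform_eventually) (auto simp: flat_def intro!: eventually_at_rightI[of 0 1])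
    moreover have "((\<lambda>h. flat p h / h) \<longlongrightarrow> 0) (at_left 0)"
      by (rule tendsto_eventually) (auto simp: flat_def intro!: eventually_at_leftI[of "-1" 0])
    ultimately have "((\<lambda>h. flat p h / h) \<longlongrightarrow> 0) (at 0)"
      by (simp add: filterlim_split_at)
    then show ?thesis using 3 by (simp add: has_field_derivative_iff flat_def)
  qed
qed

text \<open>A class of functions that is closed under partial derivatives and contains bump functions.\<close>

inductive_set smooth_class :: "(real^'n::finite \<Rightarrow> real) set" where
  flat: "(\<lambda>x. flat p (s * x $ j + c)) \<in> smooth_class"
| const: "(\<lambda>x. r) \<in> smooth_class"
| add: "f \<in> smooth_class \<Longrightarrow> g \<in> smooth_class \<Longrightarrow> (\<lambda>x. f x + g x) \<in> smooth_class"
| mult: "f \<in> smooth_class \<Longrightarrow> g \<in> smooth_class \<Longrightarrow> (\<lambda>x. f x * g x) \<in> smooth_class"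

lemma smooth_class_continuous: "f \<in> smooth_class \<Longrightarrow> continuous_on UNIV f"
proof (induction rule: smooth_class.induct)
  case (flat p s j c)
  have "continuous_on UNIV (flat p)"
    using DERIV_isCont[OF flat_deriv] by (simp add: continuous_on_eq_continuous_at)
  then show ?case by (rule continuous_on_compose2) (auto intro!: continuous_intros)
qed (auto intro!: continuous_intros)

lemma smooth_class_partial:
  "f \<in> smooth_class \<Longrightarrow> \<exists>f'\<in>smooth_class. \<forall>x. has_partial i f (f' x) x"
proof (induction rule: smooth_class.induct)
  case (flat p s j c)
  let ?p = "[:0, 0, 1:] * (p - pderiv p)"
  have "has_partial i (\<lambda>x. flat p (s * x $ j + c)) (flat ?p (s * x $ j + c) * (s * (if i = j then 1 else 0) + 0)) x" for x
    by (rule has_partial_compose[OF _ flat_deriv])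
      (intro has_partial_add has_partial_cmult has_partial_component has_partial_const)
  then show ?case
    by (intro bexI[of _ "\<lambda>x. flat ?p (s * x $ j + c) * (s * (if i = j then 1 else 0) + 0)"] smooth_class.mult smooth_class.flat smooth_class.const) auto
next
  case (const r)
  show ?case by (intro bexI[of _ "\<lambda>x. 0"] smooth_class.const) auto
next
  case (add f g)
  then obtain f' g' where *: "f' \<in> smooth_class" "g' \<in> smooth_class" "\<And>x. has_partial i f (f' x) x" "\<And>x. has_partial i g (g' x) x"
    by blast
  then show ?case by (intro bexI[of _ "\<lambda>x. f' x + g' x"] smooth_class.add) auto
next
  case (mult f g)
  then obtain f' g' where *: "f' \<in> smooth_class" "g' \<in> smooth_class" "\<And>x. has_partial i f (f' x) x" "\<And>x. has_partial i g (g' x) x"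
    by blast
  then show ?case
    using mult by (intro bexI[of _ "\<lambda>x. f' x * g x + g' x * f x"] smooth_class.add smooth_class.mult) auto
qed

lemma smooth_class_partial_deriv: "f \<in> smooth_class \<Longrightarrow> partial_deriv i f \<in> smooth_class"
proof -
  assume "f \<in> smooth_class"
  then obtain f' where "f' \<in> smooth_class" "\<And>x. has_partial i f (f' x) x"
    using smooth_class_partial by blast
  moreover from this have "partial_deriv i f = f'" by (auto intro: has_partial_partial_deriv)
  ultimately show ?thesis by simp
qed

lemma smooth_class_smooth: "f \<in> smooth_class \<Longrightarrow> smooth_function f"
proof -
  assume f: "f \<in> smooth_class"
  have *: "foldr partial_deriv is f \<in> smooth_class" for "is"
    using f by (induction "is") (auto intro: smooth_class_partial_deriv)
  show ?thesis unfolding smooth_function_def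
    using smooth_class_continuous[OF *] smooth_class_partial[OF *] has_partial_partially_differentiable by blast
qed

lemma smooth_class_prod:
  assumes "finite S" "\<And>j. j \<in> S \<Longrightarrow> f j \<in> smooth_class"
  shows "(\<lambda>x. \<Prod>j\<in>S. f j x) \<in> smooth_class"
  using assms by (induction rule: finite_induct) (auto intro: smooth_class.const smooth_class.mult)

text \<open>Supported in the box and increasing to its indicator, because \<open>flat 1\<close> at k
  d is exp(-1/(k d)) for d > 0. The arguments are written in the shape of the generators of
  \<open>smooth_class\<close>.\<close>

definition bump :: "real^'n::finite \<Rightarrow> real^'n \<Rightarrow> real \<Rightarrow> real^'n \<Rightarrow> real" where
  "bump a b k x = (\<Prod>j\<in>UNIV. flat 1 (k * x $ j + - k * a $ j) * flat 1 (- k * x $ j + k * b $ j))"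

lemma flat_1_bounds: "0 \<le> flat 1 y" "flat 1 y \<le> 1"
  by (auto simp: flat_def)

lemma bump_zero: "k > 0 \<Longrightarrow> x \<notin> box a b \<Longrightarrow> bump a b k x = 0"
proof -
  assume k: "k > 0" and "x \<notin> box a b"
  then obtain j where j: "x $ j \<le> a $ j \<or> b $ j \<le> x $ j" by (auto simp: mem_box_cart not_less)
  have "flat 1 (k * x $ j + - k * a $ j) * flat 1 (- k * x $ j + k * b $ j) = 0"
    using j k by (auto simp: flat_def)
  then show ?thesis unfolding bump_def by (intro prod_zero) auto
qed

lemma bump_bounds: "0 \<le> bump a b k x" "bump a b k x \<le> 1"
  unfolding bump_def by (auto intro!: prod_nonneg prod_le_1 mult_nonneg_nonneg mult_le_one flat_1_bounds)

lemma bump_tendsto: "(\<lambda>k. bump a b (real (Suc k)) x) \<longlonglongrightarrow> indicator (box a b) x"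
proof (cases "x \<in> box a b")
  case True
  have fl: "(\<lambda>k. flat 1 (real (Suc k) * d)) \<longlonglongrightarrow> 1" if d: "d > 0" for d
  proof -
    have "(\<lambda>k. exp (- (inverse (real (Suc k)) * (1 / d)))) \<longlonglongrightarrow> exp (- (0 * (1 / d)))"
      by (intro tendsto_intros LIMSEQ_inverse_real_of_nat)
    moreover have "flat 1 (real (Suc k) * d) = exp (- (inverse (real (Suc k)) * (1 / d)))" for k
      using d by (simp add: flat_def divide_simps)
    ultimately show ?thesis by simp
  qed
  have "(\<lambda>k. bump a b (real (Suc k)) x) \<longlonglongrightarrow> (\<Prod>j\<in>(UNIV::'a set). 1 * 1)"
    unfolding bump_def
  proof (intro tendsto_prod tendsto_mult)
    fix j
    have j: "x $ j - a $ j > 0" "b $ j - x $ j > 0" using True by (auto simp: mem_box_cart)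
    show "(\<lambda>k. flat 1 (real (Suc k) * x $ j + - real (Suc k) * a $ j)) \<longlonglongrightarrow> 1"
      using fl[OF j(1)] by (simp add: algebra_simps)
    show "(\<lambda>k. flat 1 (- real (Suc k) * x $ j + real (Suc k) * b $ j)) \<longlonglongrightarrow> 1"
      using fl[OF j(2)] by (simp add: algebra_simps)
  qed
  then show ?thesis using True by simp
next
  case False
  then show ?thesis by (simp add: bump_zero)
qed

lemma bump_smooth_class: "bump a b k \<in> smooth_class"
  unfolding bump_def[abs_def]
  by (intro smooth_class_prod smooth_class.mult smooth_class.flat) auto

lemma bump_continuous: "continuous_on UNIV (bump a b k)"
  by (rule smooth_class_continuous[OF bump_smooth_class])

lemma bump_test_function:
  assumes "k > 0"
  shows "test_function (bump a b k)"
proof -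
  have "{x. bump a b k x \<noteq> 0} \<subseteq> cbox a b"
    using bump_zero[OF assms] box_subset_cbox[of a b] by blast
  then have "bounded {x. bump a b k x \<noteq> 0}" using bounded_cbox bounded_subset by blast
  then show ?thesis
    by (simp add: test_function_def smooth_class_smooth[OF bump_smooth_class] compact_closure)
qed

text \<open>The positive and the negative part of h define finite measures that agree on boxes.
  Boxes are stable under intersection and generate the Borel sets, so the measures coincide, and
  with them their densities.\<close>

lemma AE_zero_if_box_integrals_zero:
  fixes h :: "real^'n::finite \<Rightarrow> real"
  assumes h: "integrable lebesgue h" and box: "\<And>a b. (LINT x|lebesgue. indicator (box a b) x * h x) = 0"
  shows "AE x in lebesgue. h x = 0"
proof -
  \<comment> \<open>Measures are compared on Borel sets, so the Lebesgue measurable h is replaced by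
    a Borel representative.\<close>
  obtain h' where h': "h' \<in> borel_measurable lborel" "AE x in lborel. h x = h' x"
    using completion_ex_borel_measurable_real[of h lborel] borel_measurable_integrable[OF h] by auto
  have [measurable]: "h' \<in> borel_measurable borel" using h'(1) by simp
  have AE': "AE x in lebesgue. h x = h' x" using h'(2) by (rule AE_completion)
  have "integrable lebesgue h'"
    by (rule integrable_cong_AE_imp[OF h]) (use AE' h'(1) in \<open>auto intro: measurable_completion\<close>)
  then have int: "integrable lborel h'" by (simp add: integrable_completion h'(1))
  have box': "(LINT x|lborel. indicator (box a b) x * h' x) = 0" for a b
  proof -
    have "(LINT x|lborel. indicator (box a b) x * h' x) = (LINT x|lebesgue. indicator (box a b) x * h' x)"
      by (rule integral_completion[symmetric]) measurable
    also have "\<dots> = (LINT x|lebesgue. indicator (box a b) x * h x)"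
    proof (rule integral_cong_AE)
      show "(\<lambda>x. indicator (box a b) x * h' x) \<in> borel_measurable lebesgue"
        by (rule measurable_completion) measurable
      show "(\<lambda>x. indicator (box a b) x * h x) \<in> borel_measurable lebesgue"
        using borel_measurable_integrable[OF h] by (intro borel_measurable_times) (auto intro!: measurable_completion)
    qed (use AE' in auto)
    finally show ?thesis by (simp add: box)
  qed
  have fin: "(\<integral>\<^sup>+x. ennreal (h' x) \<partial>lborel) < \<infinity>" "(\<integral>\<^sup>+x. ennreal (- h' x) \<partial>lborel) < \<infinity>"
    using int by (auto simp: real_integrable_def less_top)
  have eq: "(\<integral>\<^sup>+x. ennreal (h' x) * indicator (box a b) x \<partial>lborel) = (\<integral>\<^sup>+x. ennreal (- h' x) * indicator (box a b) x \<partial>lborel)" for a b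
  proof -
    let ?g = "\<lambda>x. indicator (box a b) x * h' x"
    have ig: "integrable lborel ?g" using integrable_mult_indicator[OF _ int, of "box a b"] by simp
    have e1: "(\<integral>\<^sup>+x. ennreal (?g x) \<partial>lborel) = (\<integral>\<^sup>+x. ennreal (h' x) * indicator (box a b) x \<partial>lborel)"
      "(\<integral>\<^sup>+x. ennreal (- ?g x) \<partial>lborel) = (\<integral>\<^sup>+x. ennreal (- h' x) * indicator (box a b) x \<partial>lborel)"
      by (intro nn_integral_cong; simp add: indicator_def)+
    have f1: "(\<integral>\<^sup>+x. ennreal (?g x) \<partial>lborel) \<noteq> \<infinity>" "(\<integral>\<^sup>+x. ennreal (- ?g x) \<partial>lborel) \<noteq> \<infinity>"
      using ig by (auto simp: real_integrable_def)
    have "enn2real (\<integral>\<^sup>+x. ennreal (?g x) \<partial>lborel) = enn2real (\<integral>\<^sup>+x. ennreal (- ?g x) \<partial>lborel)"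
      using box'[of a b] real_lebesgue_integral_def[OF ig] by simp
    then have "(\<integral>\<^sup>+x. ennreal (?g x) \<partial>lborel) = (\<integral>\<^sup>+x. ennreal (- ?g x) \<partial>lborel)"
      using f1 by (cases "\<integral>\<^sup>+x. ennreal (?g x) \<partial>lborel"; cases "\<integral>\<^sup>+x. ennreal (- ?g x) \<partial>lborel") auto
    then show ?thesis unfolding e1 .
  qed
  have "density lborel (\<lambda>x. ennreal (h' x)) = density lborel (\<lambda>x. ennreal (- h' x))"
  proof (rule measure_eqI_generator_eq[where E="range (\<lambda>(a, b). box a b)" and \<Omega>=UNIV and A="\<lambda>k::nat. box (- (real k *\<^sub>R One)) (real k *\<^sub>R One)"])
    show "Int_stable (range (\<lambda>(a, b). box a b :: (real^'n) set))"
      unfolding Int_stable_def by (auto simp: box_Int_box)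
    show "sets (density lborel (\<lambda>x. ennreal (h' x))) = sigma_sets UNIV (range (\<lambda>(a, b). box a b))"
      "sets (density lborel (\<lambda>x. ennreal (- h' x))) = sigma_sets UNIV (range (\<lambda>(a, b). box a b))"
      by (simp_all add: borel_eq_box sets_measure_of)
    show "range (\<lambda>k::nat. box (- (real k *\<^sub>R One)) (real k *\<^sub>R One)) \<subseteq> range (\<lambda>(a, b). box a b :: (real^'n) set)"
      by auto
    show "(\<Union>k::nat. box (- (real k *\<^sub>R One)) (real k *\<^sub>R One)) = (UNIV :: (real^'n) set)"
      by (rule UN_box_eq_UNIV)
    show "emeasure (density lborel (\<lambda>x. ennreal (h' x))) (box (- (real k *\<^sub>R One)) (real k *\<^sub>R One)) \<noteq> \<infinity>" for k
    proof -
      have "emeasure (density lborel (\<lambda>x. ennreal (h' x))) (box (- (real k *\<^sub>R One)) (real k *\<^sub>R One)) \<le> (\<integral>\<^sup>+x. ennreal (h' x) \<partial>lborel)"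
        by (auto simp: emeasure_density intro!: nn_integral_mono simp: indicator_def)
      then show ?thesis using fin(1) by (auto simp: top_unique)
    qed
  next
    fix X :: "(real^'n) set" assume "X \<in> range (\<lambda>(a, b). box a b)"
    then show "emeasure (density lborel (\<lambda>x. ennreal (h' x))) X = emeasure (density lborel (\<lambda>x. ennreal (- h' x))) X"
      using eq by (auto simp: emeasure_density)
  qed auto
  then have "AE x in lborel. ennreal (h' x) = ennreal (- h' x)"
    by (rule iffD1[OF finite_density_unique, rotated 5]) (use fin in auto)
  \<comment> \<open>One of the two sides is always 0, since \<open>ennreal\<close> truncates
    negative values; equality leaves only h' = 0.\<close>
  then have "AE x in lborel. h' x = 0"
    by eventually_elim (metis ennreal_eq_0_iff ennreal_neg le_cases neg_le_0_iff_le order_antisym_conv)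
  then have "AE x in lebesgue. h' x = 0" by (rule AE_completion)
  with AE' show ?thesis by eventually_elim simp
qed

text \<open>\<open>weak_grad\<close> is an arbitrary choice, and boundedness of one weak gradient
  passes to it only through this uniqueness. Truncation to growing boxes makes the merely locally
  integrable difference integrable.\<close>

theorem weak_grad_unique:
  fixes f :: "real^'n::finite \<Rightarrow> real"
  assumes "is_weak_grad f g" "is_weak_grad f g'"
  shows "AE x in lebesgue. g x = g' x"
proof -
  have comp: "AE x in lebesgue. indicator (box (- (real m *\<^sub>R One)) (real m *\<^sub>R One)) x * (g x $ i - g' x $ i) = 0" for i and m :: nat
  proof (rule AE_zero_if_box_integrals_zero)
    let ?Q = "box (- (real m *\<^sub>R One)) (real m *\<^sub>R One) :: (real^'n) set"
    let ?C = "cbox (- (real m *\<^sub>R One)) (real m *\<^sub>R One) :: (real^'n) set"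
    have loc: "integrable lebesgue (\<lambda>x. indicator S x * G x $ i)"
      if G: "is_weak_grad f G" and S: "S \<subseteq> cbox a b" "S \<in> sets borel" for G S a b
    proof -
      have "set_integrable lebesgue (cbox a b) G"
        using G by (auto simp: is_weak_grad_def locally_integrable_def)
      then have "set_integrable lebesgue S G"
        using S by (intro set_integrable_subset[of lebesgue "cbox a b" G S]) auto
      then have "integrable lebesgue (\<lambda>x. (indicator S x *\<^sub>R G x) \<bullet> axis i 1)"
        unfolding set_integrable_def by (rule integrable_inner_left)
      then show ?thesis by (simp add: cart_eq_inner_axis)
    qed
    have "integrable lebesgue (\<lambda>x. indicator ?Q x * G x $ i)" if "is_weak_grad f G" for G
      by (rule loc[OF that box_subset_cbox]) auto
    from Bochner_Integration.integrable_diff[OF this[OF assms(1)] this[OF assms(2)]]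
    show "integrable lebesgue (\<lambda>x. indicator ?Q x * (g x $ i - g' x $ i))"
      by (simp add: right_diff_distrib)
    fix a b :: "real^'n"
    \<comment> \<open>The intersection of the testing box with the truncation box is again a box,
      whose indicator is a pointwise limit of test functions.\<close>
    obtain c d where cd: "box a b \<inter> ?Q = box c d" unfolding box_Int_box by blast
    have blim: "(\<lambda>k. LINT x|lebesgue. bump c d (real (Suc k)) x * G x $ i) \<longlonglongrightarrow> (LINT x|lebesgue. indicator (box c d) x * G x $ i)"
      if G: "is_weak_grad f G" for G
    proof -
      have bm: "bump c d k \<in> borel_measurable lebesgue" if "k > 0" for k
        by (rule measurable_completion) (simp add: borel_measurable_continuous_onI bump_continuous)
      have i1: "integrable lebesgue (\<lambda>x. indicator (box c d) x * G x $ i)"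
        by (rule loc[OF G, of _ c d]) (auto simp: box_subset_cbox)
      have eqb: "bump c d k x * G x $ i = bump c d k x * (indicator (box c d) x * G x $ i)" if "k > 0" for k x
        using bump_zero[OF that, of x c d] by (auto simp: indicator_def)
      have le: "norm (bump c d k x * (indicator (box c d) x * G x $ i)) \<le> norm (indicator (box c d) x * G x $ i)" for k x
        using mult_right_mono[of "\<bar>bump c d k x\<bar>" 1 "\<bar>indicator (box c d) x * G x $ i\<bar>"] bump_bounds[of c d k x] by (simp add: abs_mult)
      have m1: "(\<lambda>x. bump c d k x * (indicator (box c d) x * G x $ i)) \<in> borel_measurable lebesgue" if "k > 0" for k
        using bm[OF that] borel_measurable_integrable[OF i1] by (rule borel_measurable_times)
      have "(\<lambda>k. LINT x|lebesgue. bump c d (real (Suc k)) x * (indicator (box c d) x * G x $ i)) \<longlonglongrightarrow> (LINT x|lebesgue. indicator (box c d) x * (indicator (box c d) x * G x $ i))"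
      proof (rule integral_dominated_convergence[where w="\<lambda>x. norm (indicator (box c d) x * G x $ i)"])
        show "(\<lambda>x. indicator (box c d) x * (indicator (box c d) x * G x $ i)) \<in> borel_measurable lebesgue"
          using borel_measurable_integrable[OF i1] by (auto simp: mult.assoc[symmetric] indicator_inter_arith[symmetric])
        show "integrable lebesgue (\<lambda>x. norm (indicator (box c d) x * G x $ i))" using i1 by (rule integrable_norm)
        show "AE x in lebesgue. (\<lambda>k. bump c d (real (Suc k)) x * (indicator (box c d) x * G x $ i)) \<longlonglongrightarrow> indicator (box c d) x * (indicator (box c d) x * G x $ i)"
          by (intro AE_I2 tendsto_mult bump_tendsto tendsto_const)
        show "AE x in lebesgue. norm (bump c d (real (Suc k)) x * (indicator (box c d) x * G x $ i)) \<le> norm (indicator (box c d) x * G x $ i)" for k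
          by (intro AE_I2 le)
      qed (simp add: m1)
      moreover have "bump c d (real (Suc k)) x * (indicator (box c d) x * G x $ i) = bump c d (real (Suc k)) x * G x $ i" for k x
        by (rule eqb[symmetric]) simp
      moreover have "indicator (box c d) x * (indicator (box c d) x * r) = indicator (box c d) x * r" for x and r :: real
        by (simp add: indicator_def)
      ultimately show "(\<lambda>k. LINT x|lebesgue. bump c d (real (Suc k)) x * G x $ i) \<longlonglongrightarrow> (LINT x|lebesgue. indicator (box c d) x * G x $ i)"
        by (simp only:)
    qed
    have "(LINT x|lebesgue. bump c d (real (Suc k)) x * g x $ i) = (LINT x|lebesgue. bump c d (real (Suc k)) x * g' x $ i)" for k
    proof -
      have "test_function (bump c d (real (Suc k)))" by (rule bump_test_function) simp
      then have "(LINT x|lebesgue. f x * partial_deriv i (bump c d (real (Suc k))) x) = - (LINT x|lebesgue. G x $ i * bump c d (real (Suc k)) x)"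
        if "is_weak_grad f G" for G
        using that unfolding is_weak_grad_def by blast
      from this[OF assms(1)] this[OF assms(2)] show ?thesis by (simp add: mult.commute)
    qed
    then have lim_eq: "(LINT x|lebesgue. indicator (box c d) x * g x $ i) = (LINT x|lebesgue. indicator (box c d) x * g' x $ i)"
      using blim[OF assms(1)] blim[OF assms(2)] by (auto intro: LIMSEQ_unique)
    have "(LINT x|lebesgue. indicator (box a b) x * (indicator ?Q x * (g x $ i - g' x $ i)))
       = (LINT x|lebesgue. indicator (box c d) x * g x $ i - indicator (box c d) x * g' x $ i)"
      by (intro Bochner_Integration.integral_cong) (auto simp: cd[symmetric] indicator_inter_arith right_diff_distrib)
    also have "\<dots> = 0"
      using lim_eq loc[OF assms(1), of "box c d" c d] loc[OF assms(2), of "box c d" c d] by (simp add: box_subset_cbox)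
    finally show "(LINT x|lebesgue. indicator (box a b) x * (indicator ?Q x * (g x $ i - g' x $ i))) = 0" .
  qed
  have "AE x in lebesgue. \<forall>i\<in>UNIV. \<forall>m::nat. indicator (box (- (real m *\<^sub>R One)) (real m *\<^sub>R One)) x * (g x $ i - g' x $ i) = 0"
    by (intro AE_finite_allI) (simp_all only: finite AE_all_countable comp simp_thms)
  then show ?thesis
  proof eventually_elim
    case (elim x)
    have "x \<in> (\<Union>k::nat. box (- (real k *\<^sub>R One)) (real k *\<^sub>R One))" using UN_box_eq_UNIV by auto
    then obtain m :: nat where "x \<in> box (- (real m *\<^sub>R One)) (real m *\<^sub>R One)" by blast
    then have "g x $ i = g' x $ i" for i using elim by (auto dest!: spec[of _ m] bspec[of UNIV _ i])
    then show ?case by (simp add: vec_eq_iff)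
  qed
qed

section \<open>Solutions in the sense of the Cauchy problem\<close>

text \<open>By continuity the exceptional set is open, and a nonempty open set is not
  negligible.\<close>

lemma continuous_AE_le:
  fixes h :: "real^'n::finite \<Rightarrow> real"
  assumes h: "continuous_on UNIV h" and ae: "AE x in lebesgue. h x \<le> c"
  shows "h x \<le> c"
proof (rule ccontr)
  assume "\<not> h x \<le> c"
  have "open {y. c < h y}"
    using open_Collect_less[OF continuous_on_const h] .
  moreover have "x \<in> {y. c < h y}" using \<open>\<not> h x \<le> c\<close> by simp
  ultimately have "\<not> negligible {y. c < h y}" using open_not_negligible by blast
  moreover have "{y. \<not> h y \<le> c} \<in> null_sets lebesgue"
    using ae AE_iff_null_sets[of "{y. \<not> h y \<le> c}" lebesgue] \<open>open {y. c < h y}\<close>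
    by (auto simp: not_le intro: lborelD)
  ultimately show False by (simp add: negligible_iff_null_sets not_le)
qed

lemma Lp_norm_infinity_le_imp:
  fixes h :: "real^'n::finite \<Rightarrow> 'b::real_normed_vector"
  assumes h: "continuous_on UNIV h" and le: "Lp_norm \<infinity> lebesgue h \<le> ennreal c" and c: "c \<ge> 0"
  shows "norm (h x) \<le> c"
proof (rule continuous_AE_le[where h="\<lambda>x. norm (h x)"])
  have "AE x in lebesgue. ennreal (norm (h x)) \<le> esssup lebesgue (\<lambda>x. ennreal (norm (h x)))" by (rule esssup_AE)
  then show "AE x in lebesgue. norm (h x) \<le> c"
  proof eventually_elim
    case (elim x)
    with le have "ennreal (norm (h x)) \<le> ennreal c" by (simp add: Lp_norm_def)
    then show ?case using c by (simp add: ennreal_le_iff)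
  qed
qed (intro continuous_intros h)

text \<open>Needed to compare essential suprema of two weak gradients that agree almost everywhere.
  The truncations to balls are integrable, hence measurable, and at each point they are eventually
  constant.\<close>

lemma locally_integrable_measurable:
  fixes g :: "real^'n::finite \<Rightarrow> 'b::euclidean_space"
  assumes "locally_integrable g"
  shows "g \<in> borel_measurable lebesgue"
proof (rule borel_measurable_LIMSEQ_metric)
  show "(\<lambda>x. indicator (cball 0 (real k)) x *\<^sub>R g x) \<in> borel_measurable lebesgue" for k :: nat
    using assms unfolding locally_integrable_def set_integrable_def
    by (intro borel_measurable_integrable) auto
  fix x :: "real^'n"
  obtain N :: nat where N: "norm x \<le> real N" using real_arch_simple by blast
  have "\<forall>\<^sub>F k in sequentially. indicator (cball 0 (real k)) x *\<^sub>R g x = g x"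
    using eventually_ge_at_top[of N] by eventually_elim (use N in auto)
  then show "(\<lambda>k. indicator (cball 0 (real k)) x *\<^sub>R g x) \<longlonglongrightarrow> g x" by (rule tendsto_eventually)
qed

lemma weak_grad_bounded:
  fixes u0 :: "real^'n::finite \<Rightarrow> real"
  assumes "in_W1_infty u0"
  shows "Lp_norm \<infinity> lebesgue (weak_grad u0) < \<infinity>"
proof -
  obtain g where g: "is_weak_grad u0 g" "in_Lp \<infinity> lebesgue g"
    using assms by (auto simp: in_W1_infty_def)
  have w: "is_weak_grad u0 (weak_grad u0)" unfolding weak_grad_def by (rule someI[of "is_weak_grad u0"]) (fact g(1))
  have m: "weak_grad u0 \<in> borel_measurable lebesgue" "g \<in> borel_measurable lebesgue"
    using w g(1) by (auto simp: is_weak_grad_def intro: locally_integrable_measurable)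
  have "esssup lebesgue (\<lambda>x. ennreal (norm (weak_grad u0 x))) = esssup lebesgue (\<lambda>x. ennreal (norm (g x)))"
    using m weak_grad_unique[OF w g(1)] by (intro esssup_AE_cong) auto
  then show ?thesis using g(2) by (simp add: in_Lp_def Lp_norm_def)
qed

text \<open>Set to 0 for t <= 0: derivatives are under control for positive times, while the source
  has to be Borel measurable on all of space-time.\<close>

definition HJ_d :: "(real^'n::finite \<Rightarrow> real \<Rightarrow> real) \<Rightarrow> 'n \<Rightarrow> real^'n \<Rightarrow> real \<Rightarrow> real" where
  "HJ_d u i x t = (if t > 0 then partial_deriv i (\<lambda>y. u y t) x else 0)"

definition HJ_dd :: "(real^'n::finite \<Rightarrow> real \<Rightarrow> real) \<Rightarrow> 'n \<Rightarrow> real^'n \<Rightarrow> real \<Rightarrow> real" where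
  "HJ_dd u i x t = (if t > 0 then partial_deriv i (partial_deriv i (\<lambda>y. u y t)) x else 0)"

lemma HJ_d_grad: "t > 0 \<Longrightarrow> (\<chi> i. HJ_d u i x t) = grad (\<lambda>y. u y t) x"
  by (simp add: HJ_d_def grad_def)

text \<open>K is an arbitrary bound for the norm of the weak gradient, because the small data case
  works with a slightly larger, positive value. Essential bounds hold at every point by
  continuity.\<close>

lemma HJ_solution_visc_HJ:
  fixes u0 :: "real^'n::finite \<Rightarrow> real"
  assumes q: "q > 1" and adm: "admissible_datum u0" and sol: "HJ_solution q u0 u"
    and K: "Lp_norm \<infinity> lebesgue (weak_grad u0) \<le> ennreal K" "K \<ge> 0"
  shows "visc_HJ q u (HJ_d u) (HJ_dd u) (enn2real (Lp_norm \<infinity> lebesgue u0)) (K powr q) K"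
proof -
  have C: "C21 u" and cont: "continuous_on (UNIV \<times> {0..}) (\<lambda>(x, t). u x t)"
    and init: "AE x in lebesgue. u x 0 = u0 x"
    and pde: "\<And>x t. t > 0 \<Longrightarrow> deriv (u x) t - laplacian (\<lambda>y. u y t) x + norm (grad (\<lambda>y. u y t) x) powr q = 0"
    and bu: "\<And>t. t > 0 \<Longrightarrow> Lp_norm \<infinity> lebesgue (\<lambda>x. u x t) \<le> Lp_norm \<infinity> lebesgue u0"
    and bg: "\<And>t. t > 0 \<Longrightarrow> Lp_norm \<infinity> lebesgue (grad (\<lambda>x. u x t)) \<le> Lp_norm \<infinity> lebesgue (weak_grad u0)"
    using sol by (auto simp: HJ_solution_def)
  define B where "B = enn2real (Lp_norm \<infinity> lebesgue u0)"
  have B: "Lp_norm \<infinity> lebesgue u0 = ennreal B" "B \<ge> 0"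
    using adm by (auto simp: B_def admissible_datum_def in_W1_infty_def in_Lp_def)
  have cd: "continuous_on (UNIV \<times> {0<..}) (\<lambda>p. HJ_d u i (fst p) (snd p))" for i
  proof -
    have "continuous_on (UNIV \<times> {0<..}) (\<lambda>(x, t). partial_deriv i (\<lambda>y. u y t) x)"
      using C by (simp add: C21_def)
    then show ?thesis by (rule continuous_on_eq) (auto simp: HJ_d_def)
  qed
  have cdd: "continuous_on (UNIV \<times> {0<..}) (\<lambda>p. HJ_dd u i (fst p) (snd p))" for i
  proof -
    have "continuous_on (UNIV \<times> {0<..}) (\<lambda>(x, t). partial_deriv i (partial_deriv i (\<lambda>y. u y t)) x)"
      using C by (simp add: C21_def)
    then show ?thesis by (rule continuous_on_eq) (auto simp: HJ_dd_def)
  qed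
  have cu: "continuous_on UNIV (\<lambda>x. u x t)" if "t \<ge> 0" for t
    by (rule continuous_on_slice[OF cont]) (use that in auto)
  have cgrad: "continuous_on UNIV (\<lambda>x. (\<chi> i. HJ_d u i x t))" if "t > 0" for t
    using cd that by (intro continuous_intros continuous_on_slice[where T="{0<..}"]) (auto simp: case_prod_beta)
  have ub: "\<bar>u x t\<bar> \<le> B" if "t > 0" for x t
    using Lp_norm_infinity_le_imp[OF cu[of t], of B x] bu[OF that] B that by simp
  have gb: "norm (\<chi> i. HJ_d u i x t) \<le> K" if "t > 0" for x t
  proof (rule Lp_norm_infinity_le_imp[OF cgrad[OF that]])
    have "(\<lambda>x. (\<chi> i. HJ_d u i x t)) = grad (\<lambda>x. u x t)"
      using HJ_d_grad[OF that] by auto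
    then show "Lp_norm \<infinity> lebesgue (\<lambda>x. (\<chi> i. HJ_d u i x t)) \<le> ennreal K"
      using order_trans[OF bg[OF that] K(1)] by simp
  qed fact
  \<comment> \<open>The maximum principle bound is part of the solution concept for t > 0;
    continuity of u extends it to t = 0.\<close>
  have ub0: "\<bar>u x t\<bar> \<le> B" if "t \<ge> 0" for x t
  proof (cases "t = 0")
    case True
    have "(\<lambda>k. (\<lambda>(x, t). u x t) (x, inverse (real (Suc k)))) \<longlonglongrightarrow> (\<lambda>(x, t). u x t) (x, 0)"
      by (rule continuous_on_tendsto_compose[OF cont])
        (intro tendsto_intros LIMSEQ_inverse_real_of_nat, auto)
    then have "(\<lambda>k. \<bar>u x (inverse (real (Suc k)))\<bar>) \<longlonglongrightarrow> \<bar>u x 0\<bar>" by (intro tendsto_rabs) simp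
    then show ?thesis unfolding True
      by (rule LIMSEQ_le_const2) (auto intro!: exI[of _ 0] ub)
  qed (use that ub in auto)
  have fle: "norm (\<chi> i. HJ_d u i x t) powr q \<le> K powr q" if "t > 0" for x t
    using gb[OF that] q by (intro powr_mono2) auto
  have cg: "continuous_on (UNIV \<times> {0<..}) (\<lambda>p. - (norm (\<chi> i. HJ_d u i (fst p) (snd p)) powr q))"
    using q by (intro continuous_intros continuous_on_powr' cd) auto
  show ?thesis
    unfolding visc_HJ_def B_def[symmetric]
  proof (intro conjI allI impI)
    show "inhom_heat u (\<lambda>x t. - (norm (\<chi> i. HJ_d u i x t) powr q)) (HJ_d u) (HJ_dd u) B (K powr q)"
    proof
      show "continuous_on (UNIV \<times> {0..}) (\<lambda>(x, t). u x t)" by (rule cont)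
      show "continuous_on (UNIV \<times> {0<..}) (\<lambda>(x, t). HJ_d u i x t)" "continuous_on (UNIV \<times> {0<..}) (\<lambda>(x, t). HJ_dd u i x t)"
        "continuous_on (UNIV \<times> {0<..}) (\<lambda>(x, t). - (norm (\<chi> i. HJ_d u i x t) powr q))" for i
        using cd cdd cg by (simp_all add: case_prod_beta)
      have "(\<lambda>p. indicator (UNIV \<times> {0<..}) p *\<^sub>R (- (norm (\<chi> i. HJ_d u i (fst p) (snd p)) powr q))) \<in> borel_measurable borel"
        by (intro borel_measurable_continuous_on_indicator cg borel_open open_Times) auto
      also have "(\<lambda>p. indicator (UNIV \<times> {0<..}) p *\<^sub>R (- (norm (\<chi> i. HJ_d u i (fst p) (snd p)) powr q))) = (\<lambda>(x, t). - (norm (\<chi> i. HJ_d u i x t) powr q))"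
        by (auto simp: fun_eq_iff indicator_def HJ_d_def zero_vec_def[symmetric])
      finally show "(\<lambda>(x, t). - (norm (\<chi> i. HJ_d u i x t) powr q)) \<in> borel_measurable borel" .
      fix x t
      show "\<bar>u x t\<bar> \<le> B" if "t \<ge> 0" by (rule ub0[OF that])
      show "\<bar>- (norm (\<chi> i. HJ_d u i x t) powr q)\<bar> \<le> K powr q" if "t > 0" using fle[OF that, of x] by simp
      fix i assume t: "t > 0"
      have "partially_differentiable i (\<lambda>y. u y t) x" using C t by (simp add: C21_def)
      from partially_differentiable_has_partial[OF this] show "has_partial i (\<lambda>y. u y t) (HJ_d u i x t) x"
        using t by (simp add: HJ_d_def)
      have "partially_differentiable i (partial_deriv i (\<lambda>y. u y t)) x" using C t by (simp add: C21_def)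
      from partially_differentiable_has_partial[OF this] show "has_partial i (\<lambda>y. HJ_d u i y t) (HJ_dd u i x t) x"
        using t by (simp add: HJ_d_def HJ_dd_def)
      have "u x differentiable (at t)" using C t by (simp add: C21_def)
      then have "(u x has_real_derivative deriv (u x) t) (at t)" by (simp add: DERIV_deriv_iff_real_differentiable)
      moreover have "deriv (u x) t = (\<Sum>i\<in>UNIV. HJ_dd u i x t) + - (norm (\<chi> i. HJ_d u i x t) powr q)"
        using pde[OF t, of x] t by (simp add: HJ_d_grad laplacian_def HJ_dd_def)
      ultimately show "(u x has_real_derivative (\<Sum>i\<in>UNIV. HJ_dd u i x t) + - (norm (\<chi> i. HJ_d u i x t) powr q)) (at t)" by simp
    qed
    have "AE x in lebesgue. u0 x \<le> 0" using adm by (simp add: admissible_datum_def)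
    with init have "AE x in lebesgue. u x 0 \<le> 0" by eventually_elim simp
    from continuous_AE_le[OF cu[of 0] this] show "AE x in lborel. u x 0 \<le> 0" by simp
  qed (use q gb in auto)
qed

text \<open>Follows from |h|^p <= b^(p-1) |h| for finite p. For p = oo the exponent of a is 0, and
  the bound is the supremum bound itself.\<close>

lemma Lp_norm_interpolation:
  fixes h :: "real^'n::finite \<Rightarrow> 'b::{real_normed_vector, second_countable_topology}"
  assumes [measurable]: "h \<in> borel_measurable borel"
    and L1: "(\<integral>\<^sup>+x. ennreal (norm (h x)) \<partial>lborel) \<le> ennreal a" and sup: "\<And>x. norm (h x) \<le> b"
    and pos: "a > 0" "b > 0" and p: "p \<ge> 1"
  shows "Lp_norm p lebesgue h \<le> ennreal (a powr inv_exponent p * b powr (1 - inv_exponent p))"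
proof (cases "p = \<infinity>")
  case True
  have "esssup lebesgue (\<lambda>x. ennreal (norm (h x))) \<le> ennreal b"
    by (intro esssup_I measurable_completion AE_I2 ennreal_leI sup) measurable
  then show ?thesis using True pos by (simp add: Lp_norm_def inv_exponent_def)
next
  case False
  define r where "r = enn2real p"
  have pr: "p = ennreal r" using False by (simp add: r_def less_top)
  have r: "r \<ge> 1" using p by (simp add: pr)
  have inv: "inv_exponent p = 1 / r"
    using r by (simp add: inv_exponent_def pr inverse_ennreal divide_inverse)
  define J where "J = (\<integral>\<^sup>+x. ennreal (norm (h x) powr r) \<partial>lborel)"
  have "J \<le> (\<integral>\<^sup>+x. ennreal (b powr (r - 1)) * ennreal (norm (h x)) \<partial>lborel)"
    unfolding J_def
  proof (intro nn_integral_mono)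
    fix x
    have "norm (h x) powr r = norm (h x) powr (r - 1) * norm (h x)"
      using r powr_add[of "norm (h x)" "r - 1" 1] by (cases "norm (h x) = 0") auto
    also have "\<dots> \<le> b powr (r - 1) * norm (h x)"
      using sup[of x] r by (intro mult_right_mono powr_mono2) auto
    finally show "ennreal (norm (h x) powr r) \<le> ennreal (b powr (r - 1)) * ennreal (norm (h x))"
      by (simp add: ennreal_mult[symmetric] ennreal_leI)
  qed
  also have "\<dots> = ennreal (b powr (r - 1)) * (\<integral>\<^sup>+x. ennreal (norm (h x)) \<partial>lborel)"
    by (rule nn_integral_cmult) measurable
  also have "\<dots> \<le> ennreal (b powr (r - 1)) * ennreal a" by (intro mult_left_mono L1) auto
  finally have J: "J \<le> ennreal (b powr (r - 1) * a)" using pos by (simp add: ennreal_mult)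
  have Jf: "J \<noteq> \<infinity>" using J by (auto simp: top_unique)
  have "enn2real J powr (1 / r) \<le> (b powr (r - 1) * a) powr (1 / r)"
    using r pos J by (intro powr_mono2 enn2real_leI) auto
  also have "\<dots> = a powr (1 / r) * b powr (1 - 1 / r)"
    using pos r by (simp add: powr_mult powr_powr diff_divide_distrib)
  finally have "ennreal (enn2real J powr (1 / r)) \<le> ennreal (a powr (1 / r) * b powr (1 - 1 / r))" by (rule ennreal_leI)
  moreover have "Lp_norm p lebesgue h = ennreal (enn2real J powr (1 / r))"
    using Jf False by (simp add: Lp_norm_def Let_def r_def[symmetric] nn_integral_completion J_def)
  ultimately show ?thesis unfolding inv by simp
qed

section \<open>From the estimates to the conclusions of the theorem\<close>

lemma ennreal_tendsto_0I:
  fixes g :: "real \<Rightarrow> ennreal"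
  assumes "\<And>e. e > 0 \<Longrightarrow> \<forall>\<^sub>F t in F. g t \<le> ennreal e"
  shows "(g \<longlongrightarrow> 0) F"
proof (rule order_tendstoI)
  fix a :: ennreal assume "0 < a"
  then obtain r where r: "0 < r" "r < a" using dense by blast
  then have "r < top" using top_greatest less_le_trans by blast
  then have re: "r = ennreal (enn2real r)" "enn2real r > 0"
    using r by (auto simp: enn2real_positive_iff)
  show "\<forall>\<^sub>F t in F. g t < a"
    using assms[OF re(2)] by eventually_elim (use r re(1) in \<open>auto intro: le_less_trans\<close>)
qed auto

lemma Lp_norm_1_eq:
  assumes "h \<in> borel_measurable lebesgue"
  shows "Lp_norm 1 lebesgue h = (\<integral>\<^sup>+x. ennreal (norm (h x)) \<partial>lebesgue)"
proof -
  have "ennreal (norm (h x) powr 1) = ennreal (norm (h x))" for x by simp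
  then show ?thesis by (auto simp: Lp_norm_def Let_def less_top)
qed

text \<open>The datum is attained almost everywhere only, which suffices to replace integrals of u0
  by those of u at time 0.\<close>

locale HJ_cauchy = visc_HJ q u "HJ_d u" "HJ_dd u" B L K
  for q :: real and u :: "real^'n::finite \<Rightarrow> real \<Rightarrow> real" and B L K +
  fixes u0 :: "real^'n \<Rightarrow> real"
  assumes initial: "AE x in lebesgue. u x 0 = u0 x"
begin

lemma ext_integral_u:
  assumes t: "t \<ge> 0"
  shows "ext_integral lebesgue (\<lambda>x. u x t) = - enn2ereal (mass t)"
proof -
  have "(\<integral>\<^sup>+x. ennreal (u x t) \<partial>lborel) = (\<integral>\<^sup>+x. 0 \<partial>(lborel::(real^'n) measure))"
    using u_nonpos[OF t] by (intro nn_integral_cong_AE) (auto simp: ennreal_neg)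
  then show ?thesis by (simp add: ext_integral_def nn_integral_completion mass_def zero_ennreal.rep_eq)
qed

lemma ext_integral_u0: "ext_integral lebesgue u0 = - enn2ereal (mass 0)"
proof -
  have "ext_integral lebesgue u0 = ext_integral lebesgue (\<lambda>x. u x 0)"
    unfolding ext_integral_def using initial
    by (intro arg_cong2[where f="(-)"] arg_cong[where f=enn2ereal] nn_integral_cong_AE) auto
  then show ?thesis by (simp add: ext_integral_u)
qed

lemma Lp_norm_1_u:
  assumes "t \<ge> 0"
  shows "Lp_norm 1 lebesgue (\<lambda>x. u x t) = mass t"
proof -
  have "(\<lambda>x. u x t) \<in> borel_measurable lebesgue"
    using slice_measurable[OF assms] by (intro measurable_completion) simp
  from Lp_norm_1_eq[OF this] show ?thesis using assms by (simp add: nn_integral_completion nn_integral_abs_u)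
qed

lemma Lp_norm_1_u0:
  assumes "u0 \<in> borel_measurable lebesgue"
  shows "Lp_norm 1 lebesgue u0 = mass 0"
proof -
  have "(\<integral>\<^sup>+x. ennreal (norm (u0 x)) \<partial>lebesgue) = (\<integral>\<^sup>+x. ennreal \<bar>u x 0\<bar> \<partial>lebesgue)"
    using initial by (intro nn_integral_cong_AE) auto
  then show ?thesis by (simp add: Lp_norm_1_eq[OF assms] nn_integral_completion nn_integral_abs_u)
qed

lemma I_infty_SUP: "I_infty u = - enn2ereal (SUP t\<in>{0..}. mass t)"
proof -
  have "enn2ereal (SUP t\<in>{0..}. mass t) = (SUP t\<in>{0..}. enn2ereal (mass t))"
  proof -
    have "0 \<le> (SUP t\<in>{0..}. enn2ereal (mass t))" by (rule SUP_upper2[of 0]) auto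
    then show ?thesis by (simp add: Sup_ennreal.rep_eq image_image max_absorb2)
  qed
  moreover have "I_infty u = (INF t\<in>{0..}. - enn2ereal (mass t))"
    unfolding I_infty_def by (intro INF_cong) (auto simp: ext_integral_u)
  ultimately show ?thesis by (simp add: ereal_INF_uminus_eq)
qed

lemma I_infty_claims:
  assumes "u0 \<in> borel_measurable lebesgue"
  shows "I_infty u = - enn2ereal (SUP t\<in>{0..}. Lp_norm 1 lebesgue (\<lambda>x. u x t))"
    and "I_infty u \<le> - enn2ereal (Lp_norm 1 lebesgue u0)"
proof -
  show "I_infty u = - enn2ereal (SUP t\<in>{0..}. Lp_norm 1 lebesgue (\<lambda>x. u x t))"
    unfolding I_infty_SUP by (simp add: Lp_norm_1_u)
  have "I_infty u \<le> ext_integral lebesgue (\<lambda>x. u x 0)" unfolding I_infty_def by (rule INF_lower) simp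
  then show "I_infty u \<le> - enn2ereal (Lp_norm 1 lebesgue u0)"
    by (simp add: ext_integral_u Lp_norm_1_u0[OF assms])
qed

lemma mass_tendsto:
  assumes fin: "mass_inf < \<infinity>"
  shows "((\<lambda>t. enn2real (mass t)) \<longlongrightarrow> enn2real mass_inf) at_top"
proof (rule tendstoI)
  fix e :: real assume e: "e > 0"
  have Ffin: "(\<integral>\<^sup>+s. indicator {0<..} s * F s \<partial>lborel) < \<infinity>"
    using fin unfolding mass_inf_def by (simp add: ennreal_add_less_top)
  obtain T where T: "T > 0" "tail T \<le> ennreal (e / 2)"
    using tail_integral_small[OF F_measurable Ffin, of "e / 2"] e by auto
  show "\<forall>\<^sub>F t in at_top. dist (enn2real (mass t)) (enn2real mass_inf) < e"
  proof (rule eventually_mono[OF eventually_ge_at_top[of T]])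
    fix t assume t: "T \<le> t"
    have tl: "tail t \<le> ennreal (e / 2)" using tail_integral_mono[OF t, of F] T(2) by (rule order_trans)
    have "mass t < \<infinity>" "tail t < \<infinity>" using fin mass_inf_split[of t] t T by (auto simp: ennreal_add_less_top)
    then have "enn2real mass_inf = enn2real (mass t) + enn2real (tail t)"
      using mass_inf_split[of t] t T by (simp add: enn2real_plus)
    moreover have "enn2real (tail t) \<le> e / 2" using tl by (rule enn2real_leI[rotated]) (use e in simp)
    ultimately show "dist (enn2real (mass t)) (enn2real mass_inf) < e" using e by (simp add: dist_real_def)
  qed
qed

text \<open>The masses never exceed \<open>mass_inf\<close> and converge to it, so the infimum of
  the integrals of u is their limit; finiteness lets the real number \<open>I\<close> stand for
  it.\<close>

lemma I_infty_eq:
  assumes fin: "mass_inf < \<infinity>"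
  shows "I_infty u = ereal I" "((\<lambda>t. ext_integral lebesgue (\<lambda>x. u x t)) \<longlongrightarrow> ereal I) at_top"
    and "ereal I = - enn2ereal mass_inf"
proof -
  have mf: "mass t \<noteq> \<infinity>" "mass t \<le> mass_inf" if "t \<ge> 0" for t
    using fin mass_inf_split[OF that] by (auto simp: ennreal_add_less_top)
  have er: "enn2ereal a = ereal (enn2real a)" if "a \<noteq> \<infinity>" for a
    using that by (cases a) auto
  show I: "ereal I = - enn2ereal mass_inf" using fin by (simp add: I_def er)
  have "((\<lambda>t. ereal (- enn2real (mass t))) \<longlongrightarrow> ereal I) at_top"
    unfolding I_def lim_ereal by (rule tendsto_minus[OF mass_tendsto[OF fin]])
  moreover have ev: "\<forall>\<^sub>F t in at_top. ereal (- enn2real (mass t)) = ext_integral lebesgue (\<lambda>x. u x t)"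
    using eventually_ge_at_top[of 0]
  proof eventually_elim
    case (elim t)
    have "- enn2ereal (mass t) = ereal (- enn2real (mass t))" unfolding er[OF mf(1)[OF elim]] by simp
    then show ?case by (simp add: ext_integral_u elim)
  qed
  ultimately show lim: "((\<lambda>t. ext_integral lebesgue (\<lambda>x. u x t)) \<longlongrightarrow> ereal I) at_top"
    by (rule Lim_transform_eventually)
  show "I_infty u = ereal I"
  proof (rule antisym)
    show "I_infty u \<le> ereal I"
    proof (rule tendsto_lowerbound[OF lim])
      show "\<forall>\<^sub>F t in at_top. I_infty u \<le> ext_integral lebesgue (\<lambda>x. u x t)"
        using eventually_ge_at_top[of 0] by eventually_elim (auto simp: I_infty_def intro: INF_lower)
    qed simp
    show "ereal I \<le> I_infty u"
      unfolding I_infty_def I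
      by (rule INF_greatest) (use mf(2) in \<open>auto simp: ext_integral_u ereal_minus_le_minus less_eq_ennreal.rep_eq\<close>)
  qed
qed

lemma f_eq_grad: "t > 0 \<Longrightarrow> f x t = norm (grad (\<lambda>y. u y t) x) powr q"
  by (simp add: f_def gn_def HJ_d_grad)

lemma f_nonpos_time: "t \<le> 0 \<Longrightarrow> f x t = 0"
  by (simp add: f_def gn_def HJ_d_def zero_vec_def[symmetric])

lemma F_eq_grad: "t > 0 \<Longrightarrow> (\<integral>\<^sup>+ x. ennreal (norm (grad (\<lambda>y. u y t) x) powr q) \<partial>lebesgue) = F t"
  by (simp add: F_def f_eq_grad nn_integral_completion)

lemma source_integral:
  "(\<integral>\<^sup>+ s\<in>{0<..}. (\<integral>\<^sup>+ x. ennreal (norm (grad (\<lambda>y. u y s) x) powr q) \<partial>lebesgue) \<partial>lebesgue)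
    = (\<integral>\<^sup>+s. indicator {0<..} s * F s \<partial>lborel)"
proof -
  have "(\<integral>\<^sup>+ x. ennreal (norm (grad (\<lambda>y. u y s) x) powr q) \<partial>lebesgue) * indicator {0<..} s = indicator {0<..} s * F s" for s
    by (cases "s > 0") (simp_all only: F_eq_grad indicator_simps greaterThan_iff mult_1_right mult_1_left mult_zero_left mult_zero_right not_False_eq_True)
  then show ?thesis by (simp only: nn_integral_completion[where M="lborel :: real measure"])
qed

text \<open>\<open>f\<close> vanishes for t <= 0, so the integral over the half space is one over
  all of space-time, where passing to \<open>lborel\<close> and Fubini reduce it to the time
  integral of \<open>F\<close>.\<close>

lemma gradient_in_Lq:
  assumes fin: "(\<integral>\<^sup>+s. indicator {0<..} s * F s \<partial>lborel) < \<infinity>"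
  shows "in_Lp (ennreal q) (lebesgue_on (UNIV \<times> {0<..})) (\<lambda>(x, t). norm (grad (\<lambda>y. u y t) x))"
proof -
  let ?S = "UNIV \<times> {0<..} :: ((real^'n) \<times> real) set"
  have S: "?S \<in> sets borel" by (intro borel_open open_Times) auto
  have "continuous_on ?S (\<lambda>p. norm (\<chi> i. HJ_d u i (fst p) (snd p)))"
    using w1_cont by (intro continuous_intros) (simp add: case_prod_beta)
  then have c: "continuous_on ?S (\<lambda>(x, t). norm (grad (\<lambda>y. u y t) x))"
    by (rule continuous_on_eq) (auto simp: HJ_d_grad)
  have m: "(\<lambda>(x, t). norm (grad (\<lambda>y. u y t) x)) \<in> borel_measurable (lebesgue_on ?S)"
    using c S by (intro continuous_imp_measurable_on_sets_lebesgue) auto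
  have qr: "enn2real (ennreal q) = q" using q_gt_1 by simp
  have "(\<integral>\<^sup>+p. ennreal (norm (case p of (x, t) \<Rightarrow> norm (grad (\<lambda>y. u y t) x)) powr q) \<partial>lebesgue_on ?S)
    = (\<integral>\<^sup>+p. ennreal (norm (case p of (x, t) \<Rightarrow> norm (grad (\<lambda>y. u y t) x)) powr q) * indicator ?S p \<partial>lebesgue)"
    using S by (subst nn_integral_restrict_space) auto
  also have "\<dots> = (\<integral>\<^sup>+p. ennreal (f (fst p) (snd p)) \<partial>lebesgue)"
  proof (intro nn_integral_cong)
    fix p :: "(real^'n) \<times> real"
    show "ennreal (norm (case p of (x, t) \<Rightarrow> norm (grad (\<lambda>y. u y t) x)) powr q) * indicator ?S p = ennreal (f (fst p) (snd p))"
      by (cases p; cases "snd p > 0") (auto simp: f_eq_grad f_nonpos_time)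
  qed
  also have "\<dots> = (\<integral>\<^sup>+p. ennreal (f (fst p) (snd p)) \<partial>lborel)"
    by (rule nn_integral_completion)
  also have "\<dots> = (\<integral>\<^sup>+p. ennreal (f (fst p) (snd p)) \<partial>(lborel \<Otimes>\<^sub>M lborel))"
    by (simp add: lborel_prod)
  also have "\<dots> = (\<integral>\<^sup>+s. (\<integral>\<^sup>+x. ennreal (f x s) \<partial>lborel) \<partial>lborel)"
    by (subst lborel_pair.nn_integral_snd[symmetric]) auto
  also have "\<dots> = (\<integral>\<^sup>+s. indicator {0<..} s * F s \<partial>lborel)"
    by (intro nn_integral_cong) (auto simp: indicator_def F_def f_nonpos_time)
  finally have J: "(\<integral>\<^sup>+p. ennreal (norm (case p of (x, t) \<Rightarrow> norm (grad (\<lambda>y. u y t) x)) powr q) \<partial>lebesgue_on ?S) < \<infinity>"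
    using fin by simp
  then have "Lp_norm (ennreal q) (lebesgue_on ?S) (\<lambda>(x, t). norm (grad (\<lambda>y. u y t) x)) < \<infinity>"
    unfolding Lp_norm_def qr Let_def by (auto simp: less_top)
  then show ?thesis using m by (simp add: in_Lp_def)
qed

theorem diffusive:
  assumes crit: "kdecay TYPE('n) * (q - 1) > 1 / 2" and m0: "mass 0 < \<infinity>" and dec: diffusive_decay
  shows "diffusive_large_time_behaviour q u0 u"
proof -
  let ?n = "real CARD('n)" and ?k = "kdecay TYPE('n)"
  have Ffin: "(\<integral>\<^sup>+s. indicator {0<..} s * F s \<partial>lborel) < \<infinity>" using dec by (simp add: diffusive_decay_def)
  have fin: "mass_inf < \<infinity>" using m0 Ffin by (simp add: mass_inf_def ennreal_add_less_top)
  note I = I_infty_eq[OF fin]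
  have rI: "real_of_ereal (I_infty u) = I" by (simp add: I(1))
  have source: "I_infty u = ext_integral lebesgue u0 - enn2ereal (\<integral>\<^sup>+s. indicator {0<..} s * F s \<partial>lborel)"
  proof -
    have "- (a + b) = - a - b" if "a \<noteq> \<infinity>" "b \<noteq> \<infinity>" "0 \<le> a" "0 \<le> b" for a b :: ereal
      using that by (cases a; cases b) auto
    moreover have "enn2ereal (mass 0) \<noteq> \<infinity>" "enn2ereal (\<integral>\<^sup>+s. indicator {0<..} s * F s \<partial>lborel) \<noteq> \<infinity>"
      using m0 Ffin by (auto simp: enn2ereal_eq_top_iff)
    ultimately show ?thesis
      unfolding I(1) I(3) ext_integral_u0 mass_inf_def plus_ennreal.rep_eq by simp
  qed
  have measV: "(\<lambda>x. V x t) \<in> borel_measurable borel" if t: "t > 0" for t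
    unfolding V_def using t by (intro borel_measurable_diff borel_measurable_times slice_measurable) auto
  have measg: "(\<lambda>x. \<chi> i. V1 i x t) \<in> borel_measurable borel" if t: "t > 0" for t
    unfolding V1_def using t slice_continuous(3)[OF t]
    by (intro borel_measurable_continuous_onI continuous_intros heat_kernel_derivs_continuous) auto
  have gradV: "grad (\<lambda>y. u y t) x - real_of_ereal (I_infty u) *\<^sub>R grad (\<lambda>y. heat_kernel y t) x = (\<chi> i. V1 i x t)" if t: "t > 0" for x t
  proof -
    have "partial_deriv i (\<lambda>y. heat_kernel y t) x = heat_kernel_d i x t" for i
      by (rule has_partial_partial_deriv[OF has_partial_heat_kernel[OF t]])
    then show ?thesis using t by (simp add: rI V1_def grad_def HJ_d_def vec_eq_iff)
  qed
  have asym: "((\<lambda>t. ennreal (t powr (?n / 2 * (1 - inv_exponent p))) * Lp_norm p lebesgue (\<lambda>x. u x t - real_of_ereal (I_infty u) * heat_kernel x t)) \<longlongrightarrow> 0) at_top"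
    "((\<lambda>t. ennreal (t powr (?n / 2 * (1 - inv_exponent p) + 1 / 2)) * Lp_norm p lebesgue (\<lambda>x. grad (\<lambda>y. u y t) x - real_of_ereal (I_infty u) *\<^sub>R grad (\<lambda>y. heat_kernel y t) x)) \<longlongrightarrow> 0) at_top"
    if p: "p \<ge> 1" for p
  proof -
    let ?i = "inv_exponent p"
    show "((\<lambda>t. ennreal (t powr (?n / 2 * (1 - ?i))) * Lp_norm p lebesgue (\<lambda>x. u x t - real_of_ereal (I_infty u) * heat_kernel x t)) \<longlongrightarrow> 0) at_top"
    proof (rule ennreal_tendsto_0I)
      fix e :: real assume e: "e > 0"
      show "\<forall>\<^sub>F t in at_top. ennreal (t powr (?n / 2 * (1 - ?i))) * Lp_norm p lebesgue (\<lambda>x. u x t - real_of_ereal (I_infty u) * heat_kernel x t) \<le> ennreal e"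
        using diffusive_asymptotics[OF crit m0 dec e] eventually_gt_at_top[of 0]
      proof eventually_elim
        case (elim t)
        then have "Lp_norm p lebesgue (\<lambda>x. V x t) \<le> ennreal (e powr ?i * (e * t powr (- (?n / 2))) powr (1 - ?i))"
          using e p by (intro Lp_norm_interpolation measV) auto
        also have "e powr ?i * (e * t powr (- (?n / 2))) powr (1 - ?i) = (e powr ?i * e powr (1 - ?i)) * t powr (- (?n / 2 * (1 - ?i)))"
          using e elim by (simp add: powr_mult powr_powr)
        also have "e powr ?i * e powr (1 - ?i) = e" using e by (simp add: powr_add[symmetric])
        finally have "ennreal (t powr (?n / 2 * (1 - ?i))) * Lp_norm p lebesgue (\<lambda>x. V x t) \<le> ennreal (t powr (?n / 2 * (1 - ?i))) * ennreal (e * t powr (- (?n / 2 * (1 - ?i))))"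
          by (intro mult_left_mono) auto
        also have "\<dots> = ennreal (e * (t powr (?n / 2 * (1 - ?i)) * t powr (- (?n / 2 * (1 - ?i)))))"
          using e by (simp add: ennreal_mult[symmetric] mult_ac)
        also have "t powr (?n / 2 * (1 - ?i)) * t powr (- (?n / 2 * (1 - ?i))) = 1"
          using elim by (simp add: powr_add[symmetric])
        finally show ?case by (simp add: rI V_def)
      qed
    qed
    show "((\<lambda>t. ennreal (t powr (?n / 2 * (1 - ?i) + 1 / 2)) * Lp_norm p lebesgue (\<lambda>x. grad (\<lambda>y. u y t) x - real_of_ereal (I_infty u) *\<^sub>R grad (\<lambda>y. heat_kernel y t) x)) \<longlongrightarrow> 0) at_top"
    proof (rule ennreal_tendsto_0I)
      fix e' :: real assume e': "e' > 0"
      \<comment> \<open>The Euclidean norm of the gradient is estimated by the sum over n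
        components, each of which gets a share e'/n.\<close>
      define e where "e = e' / ?n"
      have e: "e > 0" "?n * e = e'" using e' by (auto simp: e_def)
      show "\<forall>\<^sub>F t in at_top. ennreal (t powr (?n / 2 * (1 - ?i) + 1 / 2)) * Lp_norm p lebesgue (\<lambda>x. grad (\<lambda>y. u y t) x - real_of_ereal (I_infty u) *\<^sub>R grad (\<lambda>y. heat_kernel y t) x) \<le> ennreal e'"
        using diffusive_asymptotics[OF crit m0 dec e(1)] eventually_gt_at_top[of 0]
      proof eventually_elim
        case (elim t)
        have nle: "norm (\<chi> i. V1 i x t) \<le> (\<Sum>i\<in>UNIV. \<bar>V1 i x t\<bar>)" for x
          using norm_le_l1_cart[of "\<chi> i. V1 i x t"] by simp
        have mi: "(\<lambda>x. V1 i x t) \<in> borel_measurable borel" for i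
          using measg[OF elim(2)] borel_measurable_continuous_on[of "\<lambda>v. v $ i", OF _ measg[OF elim(2)]] by (simp add: continuous_intros)
        have sup: "norm (\<chi> i. V1 i x t) \<le> e' * t powr (- ?k)" for x
        proof -
          have "norm (\<chi> i. V1 i x t) \<le> (\<Sum>i\<in>(UNIV::'n set). e * t powr (- ?k))"
            using elim(1) by (intro order_trans[OF nle] sum_mono) auto
          then show ?thesis using e(2) by (simp add: mult.assoc[symmetric])
        qed
        have L1: "(\<integral>\<^sup>+x. ennreal (norm (\<chi> i. V1 i x t)) \<partial>lborel) \<le> ennreal (e' * t powr (- (1/2)))"
        proof -
          have "(\<integral>\<^sup>+x. ennreal (norm (\<chi> i. V1 i x t)) \<partial>lborel) \<le> (\<integral>\<^sup>+x. (\<Sum>i\<in>UNIV. ennreal \<bar>V1 i x t\<bar>) \<partial>lborel)"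
            using nle by (intro nn_integral_mono) (auto intro!: ennreal_leI)
          also have "\<dots> = (\<Sum>i\<in>UNIV. \<integral>\<^sup>+x. ennreal \<bar>V1 i x t\<bar> \<partial>lborel)"
            using mi by (intro nn_integral_sum) auto
          also have "\<dots> \<le> (\<Sum>i\<in>(UNIV::'n set). ennreal (e * t powr (- (1/2))))"
            using elim(1) by (intro sum_mono) auto
          also have "\<dots> = ennreal (?n * (e * t powr (- (1/2))))"
            using e by (simp add: ennreal_mult ennreal_of_nat_eq_real_of_nat)
          also have "?n * (e * t powr (- (1/2))) = e' * t powr (- (1/2))" by (simp only: e(2)[symmetric] mult.assoc)
          finally show ?thesis .
        qed
        have "Lp_norm p lebesgue (\<lambda>x. \<chi> i. V1 i x t) \<le> ennreal ((e' * t powr (- (1/2))) powr ?i * (e' * t powr (- ?k)) powr (1 - ?i))"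
          using e' p elim by (intro Lp_norm_interpolation measg L1 sup) auto
        also have "(e' * t powr (- (1/2))) powr ?i * (e' * t powr (- ?k)) powr (1 - ?i) = (e' powr ?i * e' powr (1 - ?i)) * (t powr (- (1/2) * ?i) * t powr (- ?k * (1 - ?i)))"
          using e' elim by (simp add: powr_mult powr_powr)
        also have "e' powr ?i * e' powr (1 - ?i) = e'" using e' by (simp add: powr_add[symmetric])
        also have "t powr (- (1/2) * ?i) * t powr (- ?k * (1 - ?i)) = t powr (- (?n / 2 * (1 - ?i) + 1 / 2))"
        proof -
          \<comment> \<open>The L^1 rate 1/2 and the sup rate (n+1)/2 interpolate linearly in
            1/p.\<close>
          have "- (1/2) * ?i + - ?k * (1 - ?i) = - (?n / 2 * (1 - ?i) + 1 / 2)"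
            by (simp add: kdecay_def field_simps)
          then show ?thesis by (simp only: powr_add[symmetric])
        qed
        finally have "ennreal (t powr (?n / 2 * (1 - ?i) + 1 / 2)) * Lp_norm p lebesgue (\<lambda>x. \<chi> i. V1 i x t)
           \<le> ennreal (t powr (?n / 2 * (1 - ?i) + 1 / 2)) * ennreal (e' * t powr (- (?n / 2 * (1 - ?i) + 1 / 2)))"
          by (intro mult_left_mono) auto
        also have "\<dots> = ennreal (e' * (t powr (?n / 2 * (1 - ?i) + 1 / 2) * t powr (- (?n / 2 * (1 - ?i) + 1 / 2))))"
          using e' by (simp add: ennreal_mult[symmetric] mult_ac)
        also have "t powr (?n / 2 * (1 - ?i) + 1 / 2) * t powr (- (?n / 2 * (1 - ?i) + 1 / 2)) = 1"
          unfolding powr_add[symmetric] using elim by simp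
        finally show ?case by (simp add: gradV[OF elim(2)])
      qed
    qed
  qed
  show ?thesis
    unfolding diffusive_large_time_behaviour_def source_integral
    using I gradient_in_Lq[OF Ffin] source asym by auto
qed

end

lemma admissible_HJ_cauchy:
  fixes u0 :: "real^'n::finite \<Rightarrow> real"
  assumes "q > 1" "admissible_datum u0" "HJ_solution q u0 u"
    and "Lp_norm \<infinity> lebesgue (weak_grad u0) \<le> ennreal K" "K \<ge> 0"
  shows "HJ_cauchy q u (enn2real (Lp_norm \<infinity> lebesgue u0)) (K powr q) K u0"
  unfolding HJ_cauchy_def HJ_cauchy_axioms_def
  using HJ_solution_visc_HJ[OF assms] assms(3) by (auto simp: HJ_solution_def)

theorem theorem2p3:
  fixes q :: real
  assumes "q > 1"
  shows
    "(\<forall>(u0 :: real^'n::finite \<Rightarrow> real) u. admissible_datum u0 \<and> HJ_solution q u0 u \<longrightarrow>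
        I_infty u = - enn2ereal (SUP t\<in>{0..}. Lp_norm 1 lebesgue (\<lambda>x. u x t)) \<and>
        I_infty u \<le> - enn2ereal (Lp_norm 1 lebesgue u0)) \<and>
     (q \<ge> 2 \<longrightarrow>
       (\<forall>(u0 :: real^'n \<Rightarrow> real) u. admissible_datum u0 \<and> HJ_solution q u0 u \<longrightarrow>
          diffusive_large_time_behaviour q u0 u)) \<and>
     (q_crit CARD('n) < q \<and> q < 2 \<longrightarrow>
       (\<exists>\<epsilon>>0. \<forall>(u0 :: real^'n \<Rightarrow> real) u.
          admissible_datum u0 \<and> HJ_solution q u0 u \<and>
          enn2real (Lp_norm 1 lebesgue u0)
            * enn2real (Lp_norm \<infinity> lebesgue (weak_grad u0))
                powr ((real CARD('n) + 1) * q - (real CARD('n) + 2)) < \<epsilon> \<longrightarrow>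
          diffusive_large_time_behaviour q u0 u))"
proof (intro conjI impI allI)
  let ?n = "real CARD('n)" and ?k = "kdecay TYPE('n)"
  have wg: "Lp_norm \<infinity> lebesgue (weak_grad u0) = ennreal (enn2real (Lp_norm \<infinity> lebesgue (weak_grad u0)))"
    and meas: "u0 \<in> borel_measurable lebesgue"
    and L1: "Lp_norm 1 lebesgue u0 < \<infinity>" if "admissible_datum u0" for u0 :: "real^'n \<Rightarrow> real"
    using that weak_grad_bounded[of u0] by (auto simp: admissible_datum_def in_Lp_def)
  {
    fix u0 :: "real^'n \<Rightarrow> real" and u
    assume a: "admissible_datum u0 \<and> HJ_solution q u0 u"
    then interpret HJ_cauchy q u "enn2real (Lp_norm \<infinity> lebesgue u0)" "enn2real (Lp_norm \<infinity> lebesgue (weak_grad u0)) powr q"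
      "enn2real (Lp_norm \<infinity> lebesgue (weak_grad u0))" u0
      using assms wg[of u0] by (intro admissible_HJ_cauchy) auto
    show "I_infty u = - enn2ereal (SUP t\<in>{0..}. Lp_norm 1 lebesgue (\<lambda>x. u x t))"
      "I_infty u \<le> - enn2ereal (Lp_norm 1 lebesgue u0)"
      using I_infty_claims meas a by auto
    assume q2: "q \<ge> 2"
    have m0: "mass 0 < \<infinity>" using L1[of u0] Lp_norm_1_u0 meas a by simp
    \<comment> \<open>For q >= 2 any finite bound for the mass will do; adding 1 makes it
      positive.\<close>
    have "mass 0 \<le> ennreal (enn2real (mass 0) + 1)" "enn2real (mass 0) + 1 > 0"
      using m0 by (auto simp: less_top add_nonneg_pos)
    then have diffusive_decay by (rule quadratic_diffusive_decay[OF q2])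
    moreover have "?k * (q - 1) > 1 / 2"
    proof -
      have "?k \<ge> 1" by (simp add: kdecay_def Suc_leI[OF zero_less_card_finite])
      then show ?thesis using mult_mono[of 1 ?k 1 "q - 1"] q2 by simp
    qed
    ultimately show "diffusive_large_time_behaviour q u0 u" using m0 by (intro diffusive)
  }
  \<comment> \<open>The threshold of \<open>small_data_diffusive_decay\<close>;
    \<open>step_const\<close> and k depend on q and the dimension only, hence so does
    \<open>\<epsilon>\<close>.\<close>
  define \<epsilon> where "\<epsilon> = (1 / (2 * step_const q TYPE('n))) powr (2 * ?k) / (4 * step_const q TYPE('n))"
  assume "q_crit CARD('n) < q \<and> q < 2"
  then have qc: "(?n + 2) / (?n + 1) < q" by (simp add: q_crit_def)
  define \<beta> where "\<beta> = (?n + 1) * q - (?n + 2)"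
  have \<beta>: "\<beta> > 0" using qc by (simp add: \<beta>_def divide_less_eq mult.commute)
  \<comment> \<open>Identifies the exponent of the gradient norm with the one produced by the
    bootstrap; its positivity is the condition q > q_c.\<close>
  have \<beta>k: "\<beta> = 2 * ?k * (q - 1) - 1" by (simp add: \<beta>_def kdecay_def algebra_simps)
  have crit: "?k * (q - 1) > 1 / 2" using \<beta> \<beta>k by simp
  have sc: "step_const q TYPE('n) > 0"
    using crit kconst_ge_1[where 'n='n] by (simp add: step_const_def profile_const_def add_pos_nonneg)
  show "\<exists>\<epsilon>>0. \<forall>(u0 :: real^'n \<Rightarrow> real) u.
          admissible_datum u0 \<and> HJ_solution q u0 u \<and>
          enn2real (Lp_norm 1 lebesgue u0)
            * enn2real (Lp_norm \<infinity> lebesgue (weak_grad u0))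
                powr ((?n + 1) * q - (?n + 2)) < \<epsilon> \<longrightarrow>
          diffusive_large_time_behaviour q u0 u"
  proof (intro exI[of _ \<epsilon>] conjI allI impI)
    show "\<epsilon> > 0" using sc by (simp add: \<epsilon>_def)
    fix u0 :: "real^'n \<Rightarrow> real" and u
    let ?K = "enn2real (Lp_norm \<infinity> lebesgue (weak_grad u0))" and ?M = "enn2real (Lp_norm 1 lebesgue u0)"
    assume a: "admissible_datum u0 \<and> HJ_solution q u0 u \<and> ?M * ?K powr ((?n + 1) * q - (?n + 2)) < \<epsilon>"
    \<comment> \<open>Raising both norms by a small d > 0 provides the positive bounds M and K asked
      for by \<open>visc_HJ_small\<close>; the strict inequality survives by continuity, as
      \<open>\<beta>\<close> > 0.\<close>
    have "((\<lambda>d. (?M + d) * (?K + d) powr \<beta>) \<longlongrightarrow> (?M + 0) * (?K + 0) powr \<beta>) (at_right 0)"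
      using \<beta> by (intro tendsto_mult tendsto_add tendsto_const tendsto_powr' tendsto_ident_at)
        (auto intro!: eventually_at_rightI[of 0 1])
    then have "\<forall>\<^sub>F d in at_right 0. (?M + d) * (?K + d) powr \<beta> < \<epsilon>"
      using a by (intro order_tendstoD(2)) (auto simp: \<beta>_def)
    then have "\<forall>\<^sub>F d in at_right 0. (?M + d) * (?K + d) powr \<beta> < \<epsilon> \<and> 0 < d"
      using eventually_at_right_less by eventually_elim auto
    then obtain d where d: "(?M + d) * (?K + d) powr \<beta> < \<epsilon>" "d > 0"
      using eventually_happens'[OF trivial_limit_at_right_real] by blast
    interpret HJ_cauchy q u "enn2real (Lp_norm \<infinity> lebesgue u0)" "(?K + d) powr q" "?K + d" u0
    proof (rule admissible_HJ_cauchy)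
      have "Lp_norm \<infinity> lebesgue (weak_grad u0) = ennreal ?K" using a by (intro wg) simp
      also have "\<dots> \<le> ennreal (?K + d)" using d by (intro ennreal_leI) simp
      finally show "Lp_norm \<infinity> lebesgue (weak_grad u0) \<le> ennreal (?K + d)" .
    qed (use assms a d in auto)
    have m: "mass 0 = Lp_norm 1 lebesgue u0" using Lp_norm_1_u0 meas a by simp
    have m0: "mass 0 < \<infinity>" using L1[of u0] a by (simp add: m)
    have "mass 0 = ennreal ?M" using m0 by (simp add: m less_top)
    also have "\<dots> \<le> ennreal (?M + d)" using d by (intro ennreal_leI) simp
    finally have "mass 0 \<le> ennreal (?M + d)" .
    moreover have "?M + d > 0" "?K + d > 0" using d by (auto intro: add_nonneg_pos)
    ultimately have diffusive_decay
      using d(1) by (intro small_data_diffusive_decay[OF crit]) (auto simp: \<epsilon>_def \<beta>k)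
    then show "diffusive_large_time_behaviour q u0 u" by (rule diffusive[OF crit m0])
  qed
qed

end
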